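(* In the setting and under the standing assumptions (R1), (S1), (S2), (E1) listed in the context, let $\rho$ be a prior density on $\Theta$, and put $$\Delta_{\lambda_n}(\theta)=n^{-1}\{\log pl_{\lambda_n}(\theta)-\log pl_{\lambda_n}(\hat\theta_{\lambda_n})\}.$$ Assume that for every random sequence $\{\tilde\theta_n\}\subset\Theta$, $\Delta_{\lambda_n}(\tilde\theta_n)=o_P(1)$ implies $\tilde\theta_n=\theta_0+o_P(1)$, that $\rho(\theta_0)>0$, and that $\rho(\cdot)$ has a continuous and finite first order derivative in some neighborhood of $\theta_0$. If $\theta$ has finite second absolute moment, then $$\hat\theta_{\lambda_n}=E^{\lambda_n}_{\theta|\tilde X}(\theta)+O_P(\lambda_n^2),$$ $$\tilde I_0=n^{-1}\left(Var^{\lambda_n}_{\theta|\tilde X}(\theta)\right)^{-1}+O_P(n^{1/2}\lambda_n^2),$$ where $E^{\lambda_n}_{\theta|\tilde X}(\theta)$ and $Var^{\lambda_n}_{\theta|\tilde X}(\theta)$ are the mean and the covariance matrix of $\theta$ under the penalized posterior profile distribution $\tilde P^{\lambda_n}_{\theta|\tilde X}$.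
   Context: Setting. $X_1,\dots,X_n$ are i.i.d. copies of $X$ with law $P=P_{\theta_0,\eta_0}$ from a semiparametric model indexed by $(\theta,\eta)$, where $\theta\in\Theta\subset\mathbb{R}^d$, $\Theta$ compact, and $\eta\in\mathcal H_k$. Here $k$ is a fixed positive integer and $\mathcal H_k$ is the Sobolev class of functions $\eta$ on a compact set $\mathcal Z\subset\mathbb{R}$ whose $k$-th derivative exists and is absolutely continuous with $J(\eta)<\infty$, where $J^2(\eta)=\int_{\mathcal Z}(\eta^{(k)}(z))^2dz$. $(\theta_0,\eta_0)$ is the true value. $\ell_{\theta,\eta}(x)$ is the log-likelihood of a single observation; $\mathbb{P}_n$ is the empirical distribution and $\mathbb{G}_n=\sqrt n(\mathbb{P}_n-P)$. $\|\cdot\|$ is the Euclidean norm; $d(\cdot,\cdot)$ is a metric on the set of possible values of $\eta$. Penalization. $\lambda_n$ is a (possibly data-dependent) smoothing parameter with $\lambda_n=o_P(n^{-1/4})$ and $\lambda_n^{-1}=O_P(n^{k/(2k+1)})$. For fixed $\theta$, $\hat\eta_{\theta,\lambda_n}$ maximizes $\mathbb{P}_n\ell_{\theta,\eta}-\lambda_n^2J^2(\eta)$ over $\eta\in\mathcal H_k$; $(\hat\theta_{\lambda_n},\hat\eta_{\lambda_n})$ maximizes it jointly over $\Theta\times\mathcal H_k$. The log-profile penalized likelihood is $\log pl_{\lambda_n}(\theta)=n\{\mathbb{P}_n\ell_{\theta,\hat\eta_{\theta,\lambda_n}}-\lambda_n^2J^2(\hat\eta_{\theta,\lambda_n})\}$.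 It is assumed that $\hat\theta_{\lambda_n}=\theta_0+o_P(1)$. Penalized posterior profile distribution with prior $\rho$: $\tilde P^{\lambda_n}_{\theta|\tilde X}(A)=\int_A\rho(\theta)pl_{\lambda_n}(\theta)d\theta\big/\int_\Theta\rho(\theta)pl_{\lambda_n}(\theta)d\theta$. Least favorable submodel. $t\mapsto\eta_t(\theta,\eta)$ is a map from a neighborhood of $\theta$ into the parameter set for $\eta$ with $\eta_\theta(\theta,\eta)=\eta$, and $\ell(t,\theta,\eta)(x)=\ell_{t,\eta_t(\theta,\eta)}(x)$. Dots and $^{(3)}$ denote derivatives in $t$ ($\dot\ell,\ddot\ell,\ell^{(3)}$); $\ell_{t,\theta}$ is the derivative of $\dot\ell$ with respect to $\theta$. A subscript $0$ means evaluation at $(\theta_0,\theta_0,\eta_0)$. The submodel is least favorable: $\dot\ell_0=\tilde\ell_0$, the efficient score function for $\theta$ at $(\theta_0,\eta_0)$ (projection of the score for $\theta$ onto the orthocomplement of the tangent space of $\eta$). $\tilde I_0$ is the efficient information matrix, i.e. the variance matrix of $\tilde\ell_0(X)$ under $P$, assumed positive definite. Standing assumptions. (R1) For random sequences $\tilde\theta_n=\theta_0+o_P(1)$: $d(\hat\eta_{\tilde\theta_n,\lambda_n},\eta_0)=O_P(\lambda_n+\|\tilde\theta_n-\theta_0\|)$ and $\lambda_nJ(\hat\eta_{\tilde\theta_n,\lambda_n})=O_P(\lambda_n+\|\tilde\theta_n-\theta_0\|)$. (S1) The maps $(t,\theta,\eta)\mapsto\frac{\partial^{l+m}}{\partial t^l\partial\theta^m}\ell(t,\theta,\eta)$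 have integrable envelope functions in $L_1(P)$ in some neighborhood of $(\theta_0,\theta_0,\eta_0)$ for $(l,m)=(0,0),(1,0),(2,0),(3,0),(1,1),(1,2),(2,1)$. (S2) For all $\eta$ in some neighborhood of $\eta_0$: $P\ddot\ell(\theta_0,\theta_0,\eta)-P\ddot\ell(\theta_0,\theta_0,\eta_0)=O(d(\eta,\eta_0))$, $P\ell_{t,\theta}(\theta_0,\theta_0,\eta)-P\ell_{t,\theta}(\theta_0,\theta_0,\eta_0)=O(d(\eta,\eta_0))$, $P\dot\ell(\theta_0,\theta_0,\eta)=O(d^2(\eta,\eta_0))$. (E1) For all random sequences $\tilde\theta_n=\hat\theta_{\lambda_n}+o_P(1)$ and $\bar\theta_n=\theta_0+o_P(1)$: $\mathbb{G}_n(\dot\ell(\theta_0,\theta_0,\hat\eta_{\tilde\theta_n,\lambda_n})-\dot\ell_0)=O_P(n^{1/(4k+2)}(\lambda_n+\|\tilde\theta_n-\theta_0\|))$; $\mathbb{G}_n(\ddot\ell(\theta_0,\tilde\theta_n,\hat\eta_{\tilde\theta_n,\lambda_n}))=O_P(1)$; $\mathbb{G}_n(\ell_{t,\theta}(\theta_0,\bar\theta_n,\hat\eta_{\tilde\theta_n,\lambda_n}))=O_P(1)$; $(\mathbb{P}_n-P)\ell^{(3)}(\bar\theta_n,\tilde\theta_n,\hat\eta_{\tilde\theta_n,\lambda_n})=o_P(1)$.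
   Formalization: Added about the least favorable submodel: (t,θ)↦P_{t,η_t(θ,η_0)} is differentiable in quadratic mean at (θ_0,θ_0), and |J(η_t(θ,η))−J(η)| ≤ C(1+J(η))‖t−θ‖ near (θ_0,θ_0,η_0); random sequences are arbitrary maps, with orders in outer probability. *)

theory Defs
  imports "HOL-Probability.Probability"
begin

section \<open>Stochastic order symbols\<close>

text \<open>
  As usual in empirical process theory, the order symbols refer to outer probability and a random
  sequence is an arbitrary sequence of maps on the sample space: the exceptional event is only
  required to be contained in a measurable set of small probability. This is the ordinary notion
  when \<^term>\<open>Y\<close> and \<^term>\<open>R\<close> are measurable.
\<close>

definition bigO_P :: "'w measure \<Rightarrow> (nat \<Rightarrow> 'w \<Rightarrow> 'b::real_normed_vector) \<Rightarrow> (nat \<Rightarrow> 'w \<Rightarrow> real) \<Rightarrow> bool"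
  where "bigO_P M Y R \<longleftrightarrow>
    (\<forall>\<epsilon>>0. \<exists>C. \<forall>\<^sub>F n in sequentially. \<exists>A\<in>sets M.
       measure M A \<ge> 1 - \<epsilon> \<and> (\<forall>\<omega>\<in>A. norm (Y n \<omega>) \<le> C * \<bar>R n \<omega>\<bar>))"

definition smallo_P :: "'w measure \<Rightarrow> (nat \<Rightarrow> 'w \<Rightarrow> 'b::real_normed_vector) \<Rightarrow> (nat \<Rightarrow> 'w \<Rightarrow> real) \<Rightarrow> bool"
  where "smallo_P M Y R \<longleftrightarrow>
    (\<forall>c>0. \<forall>\<epsilon>>0. \<forall>\<^sub>F n in sequentially. \<exists>A\<in>sets M.
       measure M A \<ge> 1 - \<epsilon> \<and> (\<forall>\<omega>\<in>A. norm (Y n \<omega>) \<le> c * \<bar>R n \<omega>\<bar>))"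

definition random_seq_near ::
    "'w measure \<Rightarrow> 'v::real_normed_vector set \<Rightarrow> (nat \<Rightarrow> 'w \<Rightarrow> 'v) \<Rightarrow> (nat \<Rightarrow> 'w \<Rightarrow> 'v) \<Rightarrow> bool"
  where "random_seq_near M \<Theta> T \<tau> \<longleftrightarrow>
    (\<forall>n. \<forall>\<omega>\<in>space M. T n \<omega> \<in> \<Theta>) \<and> smallo_P M (\<lambda>n \<omega>. T n \<omega> - \<tau> n \<omega>) (\<lambda>n \<omega>. 1)"


section \<open>Empirical measure and empirical process\<close>

text \<open>The sample of size \<^term>\<open>n\<close> is \<open>X 0, \<dots>, X (n - 1)\<close>.\<close>

definition emp :: "(nat \<Rightarrow> 'w \<Rightarrow> 'x) \<Rightarrow> nat \<Rightarrow> 'w \<Rightarrow> ('x \<Rightarrow> 'b::real_vector) \<Rightarrow> 'b"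
  where "emp X n \<omega> f = (1 / real n) *\<^sub>R (\<Sum>i<n. f (X i \<omega>))"

definition emp_process ::
    "'x measure \<Rightarrow> (nat \<Rightarrow> 'w \<Rightarrow> 'x) \<Rightarrow> nat \<Rightarrow> 'w \<Rightarrow> ('x \<Rightarrow> 'b::{banach, second_countable_topology}) \<Rightarrow> 'b"
  where "emp_process P X n \<omega> f = sqrt (real n) *\<^sub>R (emp X n \<omega> f - (\<integral>x. f x \<partial>P))"

definition cov_matrix :: "'x measure \<Rightarrow> ('x \<Rightarrow> real^'d) \<Rightarrow> real^'d^'d"
  where "cov_matrix P f = (\<chi> i j. (\<integral>x. (f x $ i - (\<integral>y. f y $ i \<partial>P)) * (f x $ j - (\<integral>y. f y $ j \<partial>P)) \<partial>P))"


section \<open>The Sobolev class and the roughness penalty\<close>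

primrec deriv_within :: "real set \<Rightarrow> nat \<Rightarrow> (real \<Rightarrow> real) \<Rightarrow> real \<Rightarrow> real"
  where
    "deriv_within Z 0 f = f"
  | "deriv_within Z (Suc j) f = (\<lambda>z. vector_derivative (deriv_within Z j f) (at z within Z))"

definition abs_continuous_on :: "real set \<Rightarrow> (real \<Rightarrow> real) \<Rightarrow> bool"
  where "abs_continuous_on Z f \<longleftrightarrow>
    (\<forall>\<epsilon>>0. \<exists>\<delta>>0. \<forall>S. finite S \<and> S \<subseteq> Z \<times> Z \<and> (\<forall>(a, b)\<in>S. a \<le> b) \<and>
       pairwise (\<lambda>p q. {fst p<..<snd p} \<inter> {fst q<..<snd q} = {}) S \<and> (\<Sum>(a, b)\<in>S. b - a) < \<delta>
       \<longrightarrow> (\<Sum>(a, b)\<in>S. \<bar>f b - f a\<bar>) < \<epsilon>)"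

text \<open>
  Functions on \<^term>\<open>Z\<close> are represented by their \<^const>\<open>extensional\<close> extensions, so that equality
  in the class is equality on \<^term>\<open>Z\<close>, as the metric on the class requires.
\<close>

definition sobolev_class :: "nat \<Rightarrow> real set \<Rightarrow> (real \<Rightarrow> real) set"
  where "sobolev_class k Z = {\<eta> \<in> extensional Z.
    (\<forall>j<k. \<forall>z\<in>Z. deriv_within Z j \<eta> differentiable (at z within Z)) \<and>
    abs_continuous_on Z (deriv_within Z k \<eta>) \<and>
    set_integrable lborel Z (\<lambda>z. (deriv_within Z k \<eta> z)\<^sup>2)}"

definition roughness :: "nat \<Rightarrow> real set \<Rightarrow> (real \<Rightarrow> real) \<Rightarrow> real"
  where "roughness k Z \<eta> = sqrt (LINT z:Z|lborel. (deriv_within Z k \<eta> z)\<^sup>2)"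


section \<open>The semiparametric model and its efficient score\<close>

definition model_law ::
    "'x measure \<Rightarrow> ('p \<Rightarrow> 'h \<Rightarrow> 'x \<Rightarrow> real) \<Rightarrow> 'p \<Rightarrow> 'h \<Rightarrow> 'x measure"
  where "model_law \<mu> ll \<theta> \<eta> = density \<mu> (\<lambda>x. ennreal (exp (ll \<theta> \<eta> x)))"

definition semiparametric_model ::
    "'x measure \<Rightarrow> 'p set \<Rightarrow> 'h set \<Rightarrow> ('p \<Rightarrow> 'h \<Rightarrow> 'x \<Rightarrow> real) \<Rightarrow> bool"
  where "semiparametric_model \<mu> \<Theta> H ll \<longleftrightarrow> sigma_finite_measure \<mu> \<and>
    (\<forall>\<theta>\<in>\<Theta>. \<forall>\<eta>\<in>H. ll \<theta> \<eta> \<in> borel_measurable \<mu> \<and> prob_space (model_law \<mu> ll \<theta> \<eta>))"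

text \<open>
  Differentiability in quadratic mean at \<^term>\<open>v0\<close>, along \<^term>\<open>S\<close>, of a family of densities
  \<^term>\<open>q\<close>, with score \<^term>\<open>g\<close>.
\<close>

definition qmd ::
    "'x measure \<Rightarrow> ('v::euclidean_space \<Rightarrow> 'x \<Rightarrow> real) \<Rightarrow> 'v \<Rightarrow> 'v set \<Rightarrow> ('x \<Rightarrow> 'v) \<Rightarrow> bool"
  where "qmd \<mu> q v0 S g \<longleftrightarrow> g \<in> borel_measurable \<mu> \<and>
    ((\<lambda>v. (\<integral>\<^sup>+x. ennreal ((sqrt (q v x) - sqrt (q v0 x) - (g x \<bullet> (v - v0)) / 2 * sqrt (q v0 x))\<^sup>2) \<partial>\<mu>)
          / ennreal ((norm (v - v0))\<^sup>2)) \<longlongrightarrow> 0) (at v0 within S)"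

definition nuisance_scores ::
    "'x measure \<Rightarrow> 'h set \<Rightarrow> ('p \<Rightarrow> 'h \<Rightarrow> 'x \<Rightarrow> real) \<Rightarrow> 'p \<Rightarrow> 'h \<Rightarrow> ('x \<Rightarrow> real) set"
  where "nuisance_scores \<mu> H ll \<theta>0 \<eta>0 = {g. \<exists>path. path 0 = \<eta>0 \<and> (\<forall>s\<ge>0. path s \<in> H) \<and>
    qmd \<mu> (\<lambda>s x. exp (ll \<theta>0 (path s) x)) (0::real) {0..} g}"

text \<open>The tangent space is the closed linear span of the nuisance scores in \<open>L\<^sub>2(P)\<close>.\<close>

definition in_tangent_space :: "'x measure \<Rightarrow> ('x \<Rightarrow> real) set \<Rightarrow> ('x \<Rightarrow> real) \<Rightarrow> bool"
  where "in_tangent_space P T f \<longleftrightarrow> f \<in> borel_measurable P \<and> integrable P (\<lambda>x. (f x)\<^sup>2) \<and>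
    (\<forall>\<epsilon>>0. \<exists>A c. finite A \<and> A \<subseteq> T \<and> (\<integral>x. (f x - (\<Sum>g\<in>A. c g * g x))\<^sup>2 \<partial>P) < \<epsilon>)"

text \<open>
  \<^term>\<open>g\<close> is the score for \<open>\<theta>\<close> minus its projection on the tangent space of \<open>\<eta>\<close>: it is orthogonal
  to the tangent space and differs from the score by elements of that space.
\<close>

definition efficient_score ::
    "'x measure \<Rightarrow> (real^'d) set \<Rightarrow> 'h set \<Rightarrow> (real^'d \<Rightarrow> 'h \<Rightarrow> 'x \<Rightarrow> real) \<Rightarrow> real^'d \<Rightarrow> 'h \<Rightarrow>
     ('x \<Rightarrow> real^'d) \<Rightarrow> bool"
  where "efficient_score \<mu> \<Theta> H ll \<theta>0 \<eta>0 g \<longleftrightarrow>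
    (let P = model_law \<mu> ll \<theta>0 \<eta>0; T = nuisance_scores \<mu> H ll \<theta>0 \<eta>0 in
     g \<in> borel_measurable P \<and> integrable P (\<lambda>x. (norm (g x))\<^sup>2) \<and>
     (\<forall>i h. in_tangent_space P T h \<longrightarrow> (\<integral>x. g x $ i * h x \<partial>P) = 0) \<and>
     (\<exists>s. qmd \<mu> (\<lambda>\<theta> x. exp (ll \<theta> \<eta>0 x)) \<theta>0 \<Theta> s \<and>
          (\<forall>i. in_tangent_space P T (\<lambda>x. s x $ i - g x $ i))))"


section \<open>The least favorable submodel\<close>

definition submodel_loglik ::
    "('p \<Rightarrow> 'h \<Rightarrow> 'x \<Rightarrow> real) \<Rightarrow> ('p \<Rightarrow> 'p \<Rightarrow> 'h \<Rightarrow> 'h) \<Rightarrow> 'p \<Rightarrow> 'p \<Rightarrow> 'h \<Rightarrow> 'x \<Rightarrow> real"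
  where "submodel_loglik ll sub t \<theta> \<eta> = ll t (sub t \<theta> \<eta>)"

text \<open>
  \<open>sub t \<theta> \<eta>\<close> is the value at \<open>t\<close> of the submodel through \<open>(\<theta>, \<eta>)\<close>. Smoothness of the submodel as
  a curve in the penalized parameter set includes that the roughness is locally Lipschitz along it.
  This controls the penalty in \<open>log pl(t) \<ge> n (P\<^sub>n ll(t, sub t \<theta> \<eta>) - \<lambda>\<^sup>2 J\<^sup>2(sub t \<theta> \<eta>))\<close>;
  for \<open>sub t \<theta> \<eta> = \<eta> + (\<theta> - t) \<bullet> h\<close> it says that the components of \<open>h\<close> have finite roughness.
\<close>

definition smooth_submodel ::
    "'h set \<Rightarrow> ('h \<Rightarrow> 'h \<Rightarrow> real) \<Rightarrow> ('h \<Rightarrow> real) \<Rightarrow> real^'d \<Rightarrow> 'h \<Rightarrow>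
     (real^'d \<Rightarrow> real^'d \<Rightarrow> 'h \<Rightarrow> 'h) \<Rightarrow> bool"
  where "smooth_submodel H d J \<theta>0 \<eta>0 sub \<longleftrightarrow>
    (\<exists>\<delta>>0. \<exists>C. \<forall>t\<in>ball \<theta>0 \<delta>. \<forall>\<theta>\<in>ball \<theta>0 \<delta>. \<forall>\<eta>\<in>H. d \<eta> \<eta>0 < \<delta> \<longrightarrow>
       sub t \<theta> \<eta> \<in> H \<and> sub \<theta> \<theta> \<eta> = \<eta> \<and>
       \<bar>J (sub t \<theta> \<eta>) - J \<eta>\<bar> \<le> C * (1 + J \<eta>) * norm (t - \<theta>))"

text \<open>
  \<^term>\<open>D10\<close> is the derivative of the submodel log-likelihood in \<open>t\<close> and \<^term>\<open>ltilde\<close> the efficient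
  score. Quadratic mean differentiability makes \<^term>\<open>D10\<close> a score in the sense of the
  semiparametric model; with the integrability of the second derivatives it yields the information
  identities \<open>P D20 = - cov_matrix P ltilde\<close> and \<open>P D11 = 0\<close> at the true value.
\<close>

definition least_favorable ::
    "'x measure \<Rightarrow> (real^'d) set \<Rightarrow> 'h set \<Rightarrow> (real^'d \<Rightarrow> 'h \<Rightarrow> 'x \<Rightarrow> real) \<Rightarrow> real^'d \<Rightarrow> 'h \<Rightarrow>
     (real^'d \<Rightarrow> real^'d \<Rightarrow> 'h \<Rightarrow> 'h) \<Rightarrow> (real^'d \<Rightarrow> real^'d \<Rightarrow> 'h \<Rightarrow> 'x \<Rightarrow> real^'d) \<Rightarrow>
     ('x \<Rightarrow> real^'d) \<Rightarrow> bool"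
  where "least_favorable \<mu> \<Theta> H ll \<theta>0 \<eta>0 sub D10 ltilde \<longleftrightarrow>
    efficient_score \<mu> \<Theta> H ll \<theta>0 \<eta>0 ltilde \<and>
    (AE x in model_law \<mu> ll \<theta>0 \<eta>0. D10 \<theta>0 \<theta>0 \<eta>0 x = ltilde x) \<and>
    (\<exists>b. qmd \<mu> (\<lambda>(t, \<theta>) x. exp (submodel_loglik ll sub t \<theta> \<eta>0 x)) (\<theta>0, \<theta>0) UNIV
           (\<lambda>x. (D10 \<theta>0 \<theta>0 \<eta>0 x, b x)))"

text \<open>
  \<open>Dlm\<close> stands for \<open>\<partial>\<^sup>l\<^sup>+\<^sup>m f / \<partial>t\<^sup>l \<partial>\<theta>\<^sup>m\<close>, where \<open>f\<close> is the submodel log-likelihood; the \<open>t\<close>-indices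
  come first. \<open>D10\<close>, \<open>D20\<close>, \<open>D30\<close>, \<open>D11\<close> are the functions written with one dot, with two dots, with
  the superscript (3), and with the subscripts \<open>t, \<theta>\<close>.
\<close>

definition condition_S1 ::
    "'x measure \<Rightarrow> 'h set \<Rightarrow> ('h \<Rightarrow> 'h \<Rightarrow> real) \<Rightarrow> real^'d \<Rightarrow> 'h \<Rightarrow>
     (real^'d \<Rightarrow> real^'d \<Rightarrow> 'h \<Rightarrow> 'x \<Rightarrow> real) \<Rightarrow>
     (real^'d \<Rightarrow> real^'d \<Rightarrow> 'h \<Rightarrow> 'x \<Rightarrow> real^'d) \<Rightarrow>
     (real^'d \<Rightarrow> real^'d \<Rightarrow> 'h \<Rightarrow> 'x \<Rightarrow> real^'d^'d) \<Rightarrow>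
     (real^'d \<Rightarrow> real^'d \<Rightarrow> 'h \<Rightarrow> 'x \<Rightarrow> real^'d^'d^'d) \<Rightarrow>
     (real^'d \<Rightarrow> real^'d \<Rightarrow> 'h \<Rightarrow> 'x \<Rightarrow> real^'d^'d) \<Rightarrow>
     (real^'d \<Rightarrow> real^'d \<Rightarrow> 'h \<Rightarrow> 'x \<Rightarrow> real^'d^'d^'d) \<Rightarrow>
     (real^'d \<Rightarrow> real^'d \<Rightarrow> 'h \<Rightarrow> 'x \<Rightarrow> real^'d^'d^'d) \<Rightarrow> bool"
  where "condition_S1 P H d \<theta>0 \<eta>0 f D10 D20 D30 D11 D12 D21 \<longleftrightarrow>
    (\<exists>\<delta>>0. \<exists>F. integrable P F \<and>
      (\<forall>t\<in>ball \<theta>0 \<delta>. \<forall>\<theta>\<in>ball \<theta>0 \<delta>. \<forall>\<eta>\<in>H. d \<eta> \<eta>0 < \<delta> \<longrightarrow> (\<forall>x\<in>space P.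
        ((\<lambda>u. f u \<theta> \<eta> x) has_derivative (\<lambda>h. D10 t \<theta> \<eta> x \<bullet> h)) (at t) \<and>
        ((\<lambda>u. D10 u \<theta> \<eta> x) has_derivative (\<lambda>h. D20 t \<theta> \<eta> x *v h)) (at t) \<and>
        ((\<lambda>u. D20 u \<theta> \<eta> x) has_derivative (\<lambda>h. \<chi> i j. D30 t \<theta> \<eta> x $ i $ j \<bullet> h)) (at t) \<and>
        ((\<lambda>u. D10 t u \<eta> x) has_derivative (\<lambda>h. D11 t \<theta> \<eta> x *v h)) (at \<theta>) \<and>
        ((\<lambda>u. D11 t u \<eta> x) has_derivative (\<lambda>h. \<chi> i j. D12 t \<theta> \<eta> x $ i $ j \<bullet> h)) (at \<theta>) \<and>
        ((\<lambda>u. D20 t u \<eta> x) has_derivative (\<lambda>h. \<chi> i j. D21 t \<theta> \<eta> x $ i $ j \<bullet> h)) (at \<theta>) \<and>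
        \<bar>f t \<theta> \<eta> x\<bar> \<le> F x \<and> norm (D10 t \<theta> \<eta> x) \<le> F x \<and> norm (D20 t \<theta> \<eta> x) \<le> F x \<and>
        norm (D30 t \<theta> \<eta> x) \<le> F x \<and> norm (D11 t \<theta> \<eta> x) \<le> F x \<and>
        norm (D12 t \<theta> \<eta> x) \<le> F x \<and> norm (D21 t \<theta> \<eta> x) \<le> F x)))"

definition condition_S2 ::
    "'x measure \<Rightarrow> 'h set \<Rightarrow> ('h \<Rightarrow> 'h \<Rightarrow> real) \<Rightarrow> real^'d \<Rightarrow> 'h \<Rightarrow>
     (real^'d \<Rightarrow> real^'d \<Rightarrow> 'h \<Rightarrow> 'x \<Rightarrow> real^'d) \<Rightarrow>
     (real^'d \<Rightarrow> real^'d \<Rightarrow> 'h \<Rightarrow> 'x \<Rightarrow> real^'d^'d) \<Rightarrow>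
     (real^'d \<Rightarrow> real^'d \<Rightarrow> 'h \<Rightarrow> 'x \<Rightarrow> real^'d^'d) \<Rightarrow> bool"
  where "condition_S2 P H d \<theta>0 \<eta>0 D10 D20 D11 \<longleftrightarrow>
    (\<exists>\<delta>>0. \<exists>C. \<forall>\<eta>\<in>H. d \<eta> \<eta>0 < \<delta> \<longrightarrow>
       norm ((\<integral>x. D20 \<theta>0 \<theta>0 \<eta> x \<partial>P) - (\<integral>x. D20 \<theta>0 \<theta>0 \<eta>0 x \<partial>P)) \<le> C * d \<eta> \<eta>0 \<and>
       norm ((\<integral>x. D11 \<theta>0 \<theta>0 \<eta> x \<partial>P) - (\<integral>x. D11 \<theta>0 \<theta>0 \<eta>0 x \<partial>P)) \<le> C * d \<eta> \<eta>0 \<and>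
       norm (\<integral>x. D10 \<theta>0 \<theta>0 \<eta> x \<partial>P) \<le> C * (d \<eta> \<eta>0)\<^sup>2)"


section \<open>Penalized profile likelihood\<close>

definition pen_crit ::
    "('p \<Rightarrow> 'h \<Rightarrow> 'x \<Rightarrow> real) \<Rightarrow> ('h \<Rightarrow> real) \<Rightarrow> (nat \<Rightarrow> 'w \<Rightarrow> 'x) \<Rightarrow> (nat \<Rightarrow> 'w \<Rightarrow> real) \<Rightarrow>
     nat \<Rightarrow> 'w \<Rightarrow> 'p \<Rightarrow> 'h \<Rightarrow> real"
  where "pen_crit ll J X lam n \<omega> \<theta> \<eta> = emp X n \<omega> (ll \<theta> \<eta>) - (lam n \<omega>)\<^sup>2 * (J \<eta>)\<^sup>2"

definition log_pl ::
    "('p \<Rightarrow> 'h \<Rightarrow> 'x \<Rightarrow> real) \<Rightarrow> ('h \<Rightarrow> real) \<Rightarrow> (nat \<Rightarrow> 'w \<Rightarrow> 'x) \<Rightarrow> (nat \<Rightarrow> 'w \<Rightarrow> real) \<Rightarrow>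
     (nat \<Rightarrow> 'w \<Rightarrow> 'p \<Rightarrow> 'h) \<Rightarrow> nat \<Rightarrow> 'w \<Rightarrow> 'p \<Rightarrow> real"
  where "log_pl ll J X lam etahat n \<omega> \<theta> = real n * pen_crit ll J X lam n \<omega> \<theta> (etahat n \<omega> \<theta>)"

definition penalized_estimators ::
    "'w set \<Rightarrow> 'p set \<Rightarrow> 'h set \<Rightarrow> ('p \<Rightarrow> 'h \<Rightarrow> 'x \<Rightarrow> real) \<Rightarrow> ('h \<Rightarrow> real) \<Rightarrow> (nat \<Rightarrow> 'w \<Rightarrow> 'x) \<Rightarrow>
     (nat \<Rightarrow> 'w \<Rightarrow> real) \<Rightarrow> (nat \<Rightarrow> 'w \<Rightarrow> 'p \<Rightarrow> 'h) \<Rightarrow> (nat \<Rightarrow> 'w \<Rightarrow> 'p) \<Rightarrow> (nat \<Rightarrow> 'w \<Rightarrow> 'h) \<Rightarrow> bool"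
  where "penalized_estimators \<Omega> \<Theta> H ll J X lam etahat thetahat etajoint \<longleftrightarrow>
    (\<forall>n>0. \<forall>\<omega>\<in>\<Omega>.
       (\<forall>\<theta>\<in>\<Theta>. etahat n \<omega> \<theta> \<in> H \<and>
          (\<forall>\<eta>\<in>H. pen_crit ll J X lam n \<omega> \<theta> \<eta> \<le> pen_crit ll J X lam n \<omega> \<theta> (etahat n \<omega> \<theta>))) \<and>
       thetahat n \<omega> \<in> \<Theta> \<and> etajoint n \<omega> \<in> H \<and>
       (\<forall>\<theta>\<in>\<Theta>. \<forall>\<eta>\<in>H. pen_crit ll J X lam n \<omega> \<theta> \<eta>
          \<le> pen_crit ll J X lam n \<omega> (thetahat n \<omega>) (etajoint n \<omega>)))"

definition condition_R1 ::
    "'w measure \<Rightarrow> 'v::real_normed_vector set \<Rightarrow> ('h \<Rightarrow> 'h \<Rightarrow> real) \<Rightarrow> ('h \<Rightarrow> real) \<Rightarrow> (nat \<Rightarrow> 'w \<Rightarrow> real) \<Rightarrow>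
     (nat \<Rightarrow> 'w \<Rightarrow> 'v \<Rightarrow> 'h) \<Rightarrow> 'v \<Rightarrow> 'h \<Rightarrow> bool"
  where "condition_R1 M \<Theta> d J lam etahat \<theta>0 \<eta>0 \<longleftrightarrow>
    (\<forall>T. random_seq_near M \<Theta> T (\<lambda>n \<omega>. \<theta>0) \<longrightarrow>
       bigO_P M (\<lambda>n \<omega>. d (etahat n \<omega> (T n \<omega>)) \<eta>0) (\<lambda>n \<omega>. lam n \<omega> + norm (T n \<omega> - \<theta>0)) \<and>
       bigO_P M (\<lambda>n \<omega>. lam n \<omega> * J (etahat n \<omega> (T n \<omega>))) (\<lambda>n \<omega>. lam n \<omega> + norm (T n \<omega> - \<theta>0)))"

definition condition_E1 ::
    "'w measure \<Rightarrow> 'x measure \<Rightarrow> (nat \<Rightarrow> 'w \<Rightarrow> 'x) \<Rightarrow> nat \<Rightarrow> (real^'d) set \<Rightarrow> (nat \<Rightarrow> 'w \<Rightarrow> real) \<Rightarrow>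
     (nat \<Rightarrow> 'w \<Rightarrow> real^'d \<Rightarrow> 'h) \<Rightarrow> (nat \<Rightarrow> 'w \<Rightarrow> real^'d) \<Rightarrow> real^'d \<Rightarrow> 'h \<Rightarrow>
     (real^'d \<Rightarrow> real^'d \<Rightarrow> 'h \<Rightarrow> 'x \<Rightarrow> real^'d) \<Rightarrow>
     (real^'d \<Rightarrow> real^'d \<Rightarrow> 'h \<Rightarrow> 'x \<Rightarrow> real^'d^'d) \<Rightarrow>
     (real^'d \<Rightarrow> real^'d \<Rightarrow> 'h \<Rightarrow> 'x \<Rightarrow> real^'d^'d^'d) \<Rightarrow>
     (real^'d \<Rightarrow> real^'d \<Rightarrow> 'h \<Rightarrow> 'x \<Rightarrow> real^'d^'d) \<Rightarrow> bool"
  where "condition_E1 M P X k \<Theta> lam etahat thetahat \<theta>0 \<eta>0 D10 D20 D30 D11 \<longleftrightarrow>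
    (\<forall>T Tbar. random_seq_near M \<Theta> T thetahat \<and> random_seq_near M \<Theta> Tbar (\<lambda>n \<omega>. \<theta>0) \<longrightarrow>
       bigO_P M (\<lambda>n \<omega>. emp_process P X n \<omega>
            (\<lambda>x. D10 \<theta>0 \<theta>0 (etahat n \<omega> (T n \<omega>)) x - D10 \<theta>0 \<theta>0 \<eta>0 x))
         (\<lambda>n \<omega>. real n powr (1 / (4 * real k + 2)) * (lam n \<omega> + norm (T n \<omega> - \<theta>0))) \<and>
       bigO_P M (\<lambda>n \<omega>. emp_process P X n \<omega> (D20 \<theta>0 (T n \<omega>) (etahat n \<omega> (T n \<omega>)))) (\<lambda>n \<omega>. 1) \<and>
       bigO_P M (\<lambda>n \<omega>. emp_process P X n \<omega> (D11 \<theta>0 (Tbar n \<omega>) (etahat n \<omega> (T n \<omega>)))) (\<lambda>n \<omega>. 1) \<and>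
       smallo_P M (\<lambda>n \<omega>. emp X n \<omega> (D30 (Tbar n \<omega>) (T n \<omega>) (etahat n \<omega> (T n \<omega>)))
            - (\<integral>x. D30 (Tbar n \<omega>) (T n \<omega>) (etahat n \<omega> (T n \<omega>)) x \<partial>P)) (\<lambda>n \<omega>. 1))"


section \<open>Profile posterior\<close>

definition prior_density :: "(real^'d) set \<Rightarrow> (real^'d \<Rightarrow> real) \<Rightarrow> bool"
  where "prior_density \<Theta> \<rho> \<longleftrightarrow> (\<forall>\<theta>. \<rho> \<theta> \<ge> 0) \<and> (\<forall>\<theta>. \<theta> \<notin> \<Theta> \<longrightarrow> \<rho> \<theta> = 0) \<and> has_bochner_integral lebesgue \<rho> 1"

definition profile_posterior ::
    "(real^'d) set \<Rightarrow> (real^'d \<Rightarrow> real) \<Rightarrow> (real^'d \<Rightarrow> real) \<Rightarrow> (real^'d) measure"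
  where "profile_posterior \<Theta> \<rho> lpl = density (lebesgue_on \<Theta>)
    (\<lambda>\<theta>. ennreal (\<rho> \<theta> * exp (lpl \<theta>) / (\<integral>\<theta>'. \<rho> \<theta>' * exp (lpl \<theta>') \<partial>lebesgue_on \<Theta>)))"

end

theory Submission
  imports Defs
begin

text \<open>
  On an event of probability close to one the log profile likelihood is almost quadratic
  around its maximizer. With \<open>x = sqrt n * norm (\<theta> - \<theta>hat)\<close> and \<open>\<kappa> = sqrt n * \<lambda>\<^sup>2\<close>,

    \<open>log pl \<theta> - log pl \<theta>hat = - n / 2 * ((I0 *v (\<theta> - \<theta>hat)) \<bullet> (\<theta> - \<theta>hat)) + O(\<kappa> * (1 + x)\<^sup>3)\<close>.

  Relative to its value at \<open>\<theta>hat\<close>, the posterior density in the coordinate \<open>sqrt n *\<^sub>R (\<theta> -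
  \<theta>hat)\<close> is therefore a Gaussian density with precision \<open>I0\<close>, up to a relative error \<open>\<kappa>\<close> with
  polynomial growth. The rescaled posterior has mean \<open>O(\<kappa>)\<close> and covariance \<open>matrix_inv I0 +
  O(\<kappa>)\<close>. Scaling back, the posterior mean is at distance \<open>O(\<kappa> / sqrt n) = O(\<lambda>\<^sup>2)\<close> from \<open>\<theta>hat\<close>, and
  the inverse of \<open>n\<close> times the posterior covariance is at distance \<open>O(\<kappa>)\<close> from \<open>I0\<close>.

  The expansion has two ingredients. The first compares log profile likelihoods through the
  least favorable submodel. The submodel through \<open>(\<theta>, etahat \<theta>)\<close>, evaluated at \<open>\<theta>0\<close>, bounds
  \<open>log pl \<theta>0\<close> from below; the submodel through \<open>(\<theta>0, etahat \<theta>0)\<close>, evaluated at \<open>\<theta>\<close>, bounds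
  \<open>log pl \<theta>\<close> from below. Both bounds have the same quadratic approximation with the empirical
  score \<open>S\<close> at the truth, and \<open>h = \<theta> - \<theta>0\<close> enters the error as \<open>n * norm h * (\<lambda> + norm h)\<^sup>2\<close>
  (\<open>profile_expansion\<close>). Since \<open>1 / sqrt n\<close> is at most of order \<open>\<lambda>\<close>, this is \<open>O(\<kappa>)\<close> for \<open>norm h\<close>
  of order \<open>1 / sqrt n\<close>. The second ingredient is the stationarity of the submodel through the
  estimator at \<open>\<theta>hat\<close>: it gives the score equation \<open>S = I0 *v (\<theta>hat - \<theta>0) + O((\<lambda> + norm (\<theta>hat
  - \<theta>0))\<^sup>2)\<close> (\<open>score_equation\<close>). It localises \<open>\<theta>hat\<close> at the rate \<open>1 / sqrt n\<close> and removes the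
  linear term when the expansion is centred at \<open>\<theta>hat\<close>; maximality in the quadratic expansion
  alone would only locate \<open>\<theta>hat\<close> up to the square root of the remainder.

  The limit of the second derivatives of the submodel log-likelihood is \<open>- I0\<close>, and that of
  the mixed derivatives is \<open>0\<close> (\<open>information_identities\<close>). Both come from quadratic mean
  differentiability: the identity for a density ratio \<open>exp a\<close> with mean one, \<open>E (exp (a / 2) -
  1) = - E ((exp (a / 2) - 1)\<^sup>2) / 2\<close>, turns the score covariance into a second order term, and
  the derivative of the submodel in its base point is a nuisance score, hence orthogonal to
  the efficient score.

  The hypotheses on the estimators are stochastic orders along random sequences of parameters.
  A diagonal selection of bad parameters (\<open>bad_sequence_selection\<close>) shows that they hold
  uniformly on a small ball around \<open>\<theta>0\<close>, with a constant \<open>K\<close>, on an event of large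
  probability. Everything between that event and the conclusion is a deterministic estimate
  for one sample (\<open>profile_realization\<close>, \<open>laplace_setting\<close>).
\<close>


section \<open>Uniform stochastic bounds\<close>

text \<open>
  The common form of the order symbols. Measurability is asked of the inner set only, so that
  \<open>Q n\<close> may be any predicate, in particular one that quantifies over all parameters.
\<close>

definition eventually_wp :: "'w measure \<Rightarrow> real \<Rightarrow> (nat \<Rightarrow> 'w \<Rightarrow> bool) \<Rightarrow> bool"
  where "eventually_wp M \<epsilon> Q \<longleftrightarrow>
    (\<forall>\<^sub>F n in sequentially. \<exists>A\<in>sets M. measure M A \<ge> 1 - \<epsilon> \<and> (\<forall>\<omega>\<in>A. Q n \<omega>))"

text \<open>
  A bound that holds up to a constant \<open>K\<close>, with probability as close to one as desired for \<open>K\<close>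
  large. Monotonicity in \<open>K\<close> allows finitely many such bounds to share one constant.
\<close>

definition tight_event :: "'w measure \<Rightarrow> (real \<Rightarrow> nat \<Rightarrow> 'w \<Rightarrow> bool) \<Rightarrow> bool"
  where "tight_event M Q \<longleftrightarrow> (\<forall>K L n \<omega>. 1 \<le> K \<longrightarrow> K \<le> L \<longrightarrow> Q K n \<omega> \<longrightarrow> Q L n \<omega>) \<and>
    (\<forall>\<epsilon>>0. \<exists>K\<ge>1. eventually_wp M \<epsilon> (Q K))"

lemma eventually_wp_mono:
  assumes "eventually_wp M \<epsilon> Q"
    and "\<forall>\<^sub>F n in sequentially. \<forall>\<omega>\<in>space M. Q n \<omega> \<longrightarrow> R n \<omega>"
  shows "eventually_wp M \<epsilon> R"
  using assms unfolding eventually_wp_def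
proof eventually_elim
  case (elim n)
  then obtain A where "A \<in> sets M" "measure M A \<ge> 1 - \<epsilon>" "\<forall>\<omega>\<in>A. Q n \<omega>" by blast
  then show ?case using elim(2) sets.sets_into_space by (intro bexI[of _ A]) blast+
qed

lemma eventually_wp_mono_eps:
  assumes "eventually_wp M \<epsilon> Q" "\<epsilon> \<le> \<epsilon>'"
  shows "eventually_wp M \<epsilon>' Q"
  using assms(1) unfolding eventually_wp_def
  by eventually_elim (use assms(2) in force)

lemma (in prob_space) eventually_wp_conj:
  assumes "eventually_wp M \<epsilon>1 Q1" "eventually_wp M \<epsilon>2 Q2"
  shows "eventually_wp M (\<epsilon>1 + \<epsilon>2) (\<lambda>n \<omega>. Q1 n \<omega> \<and> Q2 n \<omega>)"
  using assms unfolding eventually_wp_def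
proof eventually_elim
  case (elim n)
  obtain A where A: "A \<in> sets M" "prob A \<ge> 1 - \<epsilon>1" "\<forall>\<omega>\<in>A. Q1 n \<omega>" using elim by blast
  obtain B where B: "B \<in> sets M" "prob B \<ge> 1 - \<epsilon>2" "\<forall>\<omega>\<in>B. Q2 n \<omega>" using elim by blast
  have "prob (A \<union> B) = prob A + prob B - prob (A \<inter> B)"
    using finite_measure_Union'[OF A(1) B(1)] finite_measure_Diff'[OF B(1) A(1)] by (simp add: Int_commute)
  then have "prob (A \<inter> B) \<ge> 1 - (\<epsilon>1 + \<epsilon>2)" using A B prob_le_1[of "A \<union> B"] by linarith
  then show ?case using A B by (intro bexI[of _ "A \<inter> B"]) auto
qed

lemma (in prob_space) eventually_wp_always:
  assumes "\<forall>\<^sub>F n in sequentially. \<forall>\<omega>\<in>space M. Q n \<omega>" "\<epsilon> \<ge> 0"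
  shows "eventually_wp M \<epsilon> Q"
  using assms(1) unfolding eventually_wp_def
  by eventually_elim (intro bexI[of _ "space M"], use assms(2) in \<open>auto simp: prob_space\<close>)

lemma (in prob_space) tight_event_conj:
  assumes "tight_event M Q1" "tight_event M Q2"
  shows "tight_event M (\<lambda>K n \<omega>. Q1 K n \<omega> \<and> Q2 K n \<omega>)"
  unfolding tight_event_def
proof (rule conjI; intro allI impI)
  have m1: "Q1 K n \<omega> \<Longrightarrow> Q1 L n \<omega>" and m2: "Q2 K n \<omega> \<Longrightarrow> Q2 L n \<omega>" if "1 \<le> K" "K \<le> L" for K L n \<omega>
    using assms that unfolding tight_event_def by blast+
  show "Q1 L n \<omega> \<and> Q2 L n \<omega>" if "1 \<le> K" "K \<le> L" "Q1 K n \<omega> \<and> Q2 K n \<omega>" for K L n \<omega>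
    using m1 m2 that by blast
  fix \<epsilon> :: real assume "\<epsilon> > 0"
  then obtain K1 K2 where K: "K1 \<ge> 1" "K2 \<ge> 1" "eventually_wp M (\<epsilon>/2) (Q1 K1)" "eventually_wp M (\<epsilon>/2) (Q2 K2)"
    using assms(1,2) unfolding tight_event_def by (meson half_gt_zero)
  have "eventually_wp M (\<epsilon>/2 + \<epsilon>/2) (\<lambda>n \<omega>. Q1 K1 n \<omega> \<and> Q2 K2 n \<omega>)"
    by (rule eventually_wp_conj[OF K(3,4)])
  then have "eventually_wp M \<epsilon> (\<lambda>n \<omega>. Q1 (max K1 K2) n \<omega> \<and> Q2 (max K1 K2) n \<omega>)"
    unfolding field_sum_of_halves
    by (rule eventually_wp_mono) (use K m1[of K1 "max K1 K2"] m2[of K2 "max K1 K2"] in \<open>auto intro!: always_eventually\<close>)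
  then show "\<exists>K\<ge>1. eventually_wp M \<epsilon> (\<lambda>n \<omega>. Q1 K n \<omega> \<and> Q2 K n \<omega>)"
    using K by (intro exI[of _ "max K1 K2"]) auto
qed

lemma smallo_P_imp_bigO_P: "smallo_P M Y R \<Longrightarrow> bigO_P M Y R"
  unfolding smallo_P_def bigO_P_def using zero_less_one by blast

lemma bigO_P_iff: "bigO_P M Y R \<longleftrightarrow> (\<forall>\<epsilon>>0. \<exists>C. eventually_wp M \<epsilon> (\<lambda>n \<omega>. norm (Y n \<omega>) \<le> C * \<bar>R n \<omega>\<bar>))"
  unfolding bigO_P_def eventually_wp_def ..

lemma smallo_P_iff: "smallo_P M Y R \<longleftrightarrow> (\<forall>c>0. \<forall>\<epsilon>>0. eventually_wp M \<epsilon> (\<lambda>n \<omega>. norm (Y n \<omega>) \<le> c * \<bar>R n \<omega>\<bar>))"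
  unfolding smallo_P_def eventually_wp_def ..

lemma bigO_P_tight:
  assumes "bigO_P M Y R"
  shows "tight_event M (\<lambda>K n \<omega>. norm (Y n \<omega>) \<le> K * \<bar>R n \<omega>\<bar>)"
  unfolding tight_event_def
proof (intro conjI allI impI)
  show "norm (Y n \<omega>) \<le> L * \<bar>R n \<omega>\<bar>" if "1 \<le> K" "K \<le> L" "norm (Y n \<omega>) \<le> K * \<bar>R n \<omega>\<bar>" for K L n \<omega>
    using that mult_right_mono[OF that(2), of "\<bar>R n \<omega>\<bar>"] by linarith
  fix \<epsilon> :: real assume "\<epsilon> > 0"
  then obtain C where C: "eventually_wp M \<epsilon> (\<lambda>n \<omega>. norm (Y n \<omega>) \<le> C * \<bar>R n \<omega>\<bar>)"
    using assms unfolding bigO_P_iff by blast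
  have "eventually_wp M \<epsilon> (\<lambda>n \<omega>. norm (Y n \<omega>) \<le> max 1 C * \<bar>R n \<omega>\<bar>)"
    by (rule eventually_wp_mono[OF C])
       (intro always_eventually allI ballI impI, erule order_trans, intro mult_right_mono, auto)
  then show "\<exists>K\<ge>1. eventually_wp M \<epsilon> (\<lambda>n \<omega>. norm (Y n \<omega>) \<le> K * \<bar>R n \<omega>\<bar>)"
    by (intro exI[of _ "max 1 C"]) auto
qed

text \<open>
  Bounds along all random sequences imply a uniform bound because counterexamples can be
  collected in one sequence. If for every \<open>m\<close> the property \<open>B m\<close> of bad parameters occurs with
  non-negligible probability for infinitely many sample sizes, choose increasing sample sizes
  \<open>N m\<close> at which it does, and let \<open>T (N m)\<close> pick a bad parameter at each sample point that has
  one. At all other places \<open>T\<close> takes the default value. No measurability of \<open>T\<close> is involved,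
  in line with the order symbols.
\<close>

lemma bad_sequence_selection:
  assumes fails: "\<And>m. \<not> eventually_wp M \<epsilon> (\<lambda>n \<omega>. \<forall>\<theta>\<in>\<Theta>. \<not> B m n \<omega> \<theta>)"
  obtains N T where "strict_mono (N :: nat \<Rightarrow> nat)"
    "\<And>n \<omega>. T n \<omega> = dflt n \<omega> \<or> (\<exists>m. n = N m \<and> T n \<omega> \<in> \<Theta> \<and> B m n \<omega> (T n \<omega>))"
    "\<And>m \<omega>. \<exists>\<theta>\<in>\<Theta>. B m (N m) \<omega> \<theta> \<Longrightarrow> T (N m) \<omega> \<in> \<Theta> \<and> B m (N m) \<omega> (T (N m) \<omega>)"
    "\<And>m A. A \<in> sets M \<Longrightarrow> measure M A \<ge> 1 - \<epsilon> \<Longrightarrow> \<exists>\<omega>\<in>A. \<exists>\<theta>\<in>\<Theta>. B m (N m) \<omega> \<theta>"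
proof -
  define bad where "bad m n \<longleftrightarrow> (\<forall>A\<in>sets M. measure M A \<ge> 1 - \<epsilon> \<longrightarrow> (\<exists>\<omega>\<in>A. \<exists>\<theta>\<in>\<Theta>. B m n \<omega> \<theta>))" for m n
  have ex: "\<exists>n'. n < n' \<and> bad m n'" for m n
  proof -
    have "\<exists>\<^sub>F n in sequentially. bad m n"
      using fails[of m] unfolding eventually_wp_def bad_def not_eventually
      by (rule frequently_elim1) blast
    then show ?thesis unfolding frequently_sequentially by (meson Suc_le_eq)
  qed
  define N where "N = rec_nat (SOME n. bad 0 n) (\<lambda>m p. SOME n. p < n \<and> bad (Suc m) n)"
  have N0: "bad 0 (N 0)" unfolding N_def by simp (metis ex someI)
  have NS: "N m < N (Suc m) \<and> bad (Suc m) (N (Suc m))" for m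
  proof -
    have "N (Suc m) = (SOME n. N m < n \<and> bad (Suc m) n)" by (simp add: N_def)
    then show ?thesis using someI_ex[OF ex[of "N m" "Suc m"]] by simp
  qed
  have bN: "bad m (N m)" for m by (cases m) (use N0 NS in auto)
  have sm: "strict_mono N" using NS by (simp add: strict_mono_Suc_iff)
  define T where "T n \<omega> = (if \<exists>m. n = N m \<and> (\<exists>\<theta>\<in>\<Theta>. B m n \<omega> \<theta>)
      then SOME \<theta>. \<theta> \<in> \<Theta> \<and> B (inv N n) n \<omega> \<theta> else dflt n \<omega>)" for n \<omega>
  have inv: "inv N (N m) = m" for m by (simp add: sm strict_mono_imp_inj_on)
  have 1: "T (N m) \<omega> \<in> \<Theta> \<and> B m (N m) \<omega> (T (N m) \<omega>)" if "\<exists>\<theta>\<in>\<Theta>. B m (N m) \<omega> \<theta>" for m \<omega>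
  proof -
    have "T (N m) \<omega> = (SOME \<theta>. \<theta> \<in> \<Theta> \<and> B m (N m) \<omega> \<theta>)"
      using that by (auto simp: T_def inv)
    moreover from that have "\<exists>\<theta>. \<theta> \<in> \<Theta> \<and> B m (N m) \<omega> \<theta>" by blast
    ultimately show ?thesis by (metis (mono_tags, lifting) someI_ex)
  qed
  show ?thesis
  proof (rule that[OF sm, of T])
    fix n \<omega>
    show "T n \<omega> = dflt n \<omega> \<or> (\<exists>m. n = N m \<and> T n \<omega> \<in> \<Theta> \<and> B m n \<omega> (T n \<omega>))"
    proof (cases "\<exists>m. n = N m \<and> (\<exists>\<theta>\<in>\<Theta>. B m n \<omega> \<theta>)")
      case True
      then show ?thesis using 1 by blast
    next
      case False
      then show ?thesis by (simp only: T_def if_False) blast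
    qed
  qed (use 1 bN in \<open>auto simp: bad_def\<close>)
qed

text \<open>
  If the uniform bound failed for every \<open>K\<close>, the parameters within \<open>1 / (m + 1)\<close> of \<open>\<theta>0\<close> that
  violate the bound with constant \<open>m + 1\<close> would assemble to a random sequence that converges
  to \<open>\<theta>0\<close> along which the ratio is not bounded in probability.
\<close>

lemma (in prob_space) uniform_bigO_P:
  fixes Y :: "nat \<Rightarrow> 'a \<Rightarrow> 'v::real_normed_vector \<Rightarrow> 'b::real_normed_vector"
  assumes centre: "\<theta>0 \<in> \<Theta>"
    and seq: "\<And>T. random_seq_near M \<Theta> T (\<lambda>n \<omega>. \<theta>0) \<Longrightarrow>
           bigO_P M (\<lambda>n \<omega>. Y n \<omega> (T n \<omega>)) (\<lambda>n \<omega>. R n \<omega> (T n \<omega>))"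
  shows "tight_event M (\<lambda>K n \<omega>. \<forall>\<theta>\<in>\<Theta>. norm (\<theta> - \<theta>0) \<le> 1 / K \<longrightarrow> norm (Y n \<omega> \<theta>) \<le> K * \<bar>R n \<omega> \<theta>\<bar>)"
  unfolding tight_event_def
proof (intro conjI allI impI)
  fix K L n \<omega> assume KL: "1 \<le> K" "K \<le> L"
    and b: "\<forall>\<theta>\<in>\<Theta>. norm (\<theta> - \<theta>0) \<le> 1 / K \<longrightarrow> norm (Y n \<omega> \<theta>) \<le> K * \<bar>R n \<omega> \<theta>\<bar>"
  show "\<forall>\<theta>\<in>\<Theta>. norm (\<theta> - \<theta>0) \<le> 1 / L \<longrightarrow> norm (Y n \<omega> \<theta>) \<le> L * \<bar>R n \<omega> \<theta>\<bar>"
  proof (intro ballI impI)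
    fix \<theta> assume "\<theta> \<in> \<Theta>" "norm (\<theta> - \<theta>0) \<le> 1 / L"
    moreover have "1 / L \<le> 1 / K" using KL by (simp add: frac_le)
    ultimately have "norm (Y n \<omega> \<theta>) \<le> K * \<bar>R n \<omega> \<theta>\<bar>" using b by auto
    also have "\<dots> \<le> L * \<bar>R n \<omega> \<theta>\<bar>" using KL by (intro mult_right_mono) auto
    finally show "norm (Y n \<omega> \<theta>) \<le> L * \<bar>R n \<omega> \<theta>\<bar>" .
  qed
next
  fix \<epsilon> :: real assume \<epsilon>: "\<epsilon> > 0"
  show "\<exists>K\<ge>1. eventually_wp M \<epsilon> (\<lambda>n \<omega>. \<forall>\<theta>\<in>\<Theta>. norm (\<theta> - \<theta>0) \<le> 1 / K \<longrightarrow> norm (Y n \<omega> \<theta>) \<le> K * \<bar>R n \<omega> \<theta>\<bar>)"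
  proof (rule ccontr)
    define B where "B m n \<omega> \<theta> \<longleftrightarrow> norm (\<theta> - \<theta>0) \<le> 1 / real (Suc m) \<and> \<not> norm (Y n \<omega> \<theta>) \<le> real (Suc m) * \<bar>R n \<omega> \<theta>\<bar>"
      for m n \<omega> and \<theta> :: 'v
    assume "\<not> (\<exists>K\<ge>1. eventually_wp M \<epsilon> (\<lambda>n \<omega>. \<forall>\<theta>\<in>\<Theta>. norm (\<theta> - \<theta>0) \<le> 1 / K \<longrightarrow> norm (Y n \<omega> \<theta>) \<le> K * \<bar>R n \<omega> \<theta>\<bar>))"
    then have no: "\<not> eventually_wp M \<epsilon> (\<lambda>n \<omega>. \<forall>\<theta>\<in>\<Theta>. norm (\<theta> - \<theta>0) \<le> 1 / K \<longrightarrow> norm (Y n \<omega> \<theta>) \<le> K * \<bar>R n \<omega> \<theta>\<bar>)"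
      if "K \<ge> 1" for K using that by blast
    have "\<not> eventually_wp M \<epsilon> (\<lambda>n \<omega>. \<forall>\<theta>\<in>\<Theta>. \<not> B m n \<omega> \<theta>)" for m
      using no[of "real (Suc m)"] by (simp add: B_def)
    from bad_sequence_selection[of M \<epsilon> \<Theta> B "\<lambda>n \<omega>. \<theta>0", OF this]
    obtain N T where sm: "strict_mono (N :: nat \<Rightarrow> nat)"
      and T: "\<And>n \<omega>. T n \<omega> = \<theta>0 \<or> (\<exists>m. n = N m \<and> T n \<omega> \<in> \<Theta> \<and> B m n \<omega> (T n \<omega>))"
      and TB: "\<And>m \<omega>. \<exists>\<theta>\<in>\<Theta>. B m (N m) \<omega> \<theta> \<Longrightarrow> T (N m) \<omega> \<in> \<Theta> \<and> B m (N m) \<omega> (T (N m) \<omega>)"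
      and bad: "\<And>m A. A \<in> sets M \<Longrightarrow> measure M A \<ge> 1 - \<epsilon> \<Longrightarrow> \<exists>\<omega>\<in>A. \<exists>\<theta>\<in>\<Theta>. B m (N m) \<omega> \<theta>"
      by metis
    have "random_seq_near M \<Theta> T (\<lambda>n \<omega>. \<theta>0)"
      unfolding random_seq_near_def smallo_P_iff
    proof (intro conjI allI impI ballI)
      show "T n \<omega> \<in> \<Theta>" for n \<omega> using T[of n \<omega>] centre by auto
      fix c \<epsilon>' :: real assume c: "c > 0" "\<epsilon>' > 0"
      obtain m0 where m0: "1 / real (Suc m0) < c" using c(1) by (metis nat_approx_posE)
      show "eventually_wp M \<epsilon>' (\<lambda>n \<omega>. norm (T n \<omega> - \<theta>0) \<le> c * \<bar>1\<bar>)"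
      proof (rule eventually_wp_always)
        have "norm (T n \<omega> - \<theta>0) \<le> c" if n: "n \<ge> N m0" for n \<omega>
          using T[of n \<omega>]
        proof (elim disjE exE conjE)
          fix m assume "n = N m" and b: "B m n \<omega> (T n \<omega>)"
          then have "m \<ge> m0" using n sm by (simp add: strict_mono_less_eq)
          then have "1 / real (Suc m) \<le> 1 / real (Suc m0)" by (simp add: frac_le)
          then show ?thesis using b m0 unfolding B_def by linarith
        qed (use c in simp)
        then show "\<forall>\<^sub>F n in sequentially. \<forall>\<omega>\<in>space M. norm (T n \<omega> - \<theta>0) \<le> c * \<bar>1\<bar>"
          unfolding eventually_sequentially by auto
      qed (use c in simp)
    qed
    from seq[OF this] obtain C where
      C: "eventually_wp M \<epsilon> (\<lambda>n \<omega>. norm (Y n \<omega> (T n \<omega>)) \<le> C * \<bar>R n \<omega> (T n \<omega>)\<bar>)"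
      unfolding bigO_P_iff using \<epsilon> by blast
    then obtain n0 where n0: "\<And>n. n \<ge> n0 \<Longrightarrow> \<exists>A\<in>sets M. measure M A \<ge> 1 - \<epsilon> \<and> (\<forall>\<omega>\<in>A. norm (Y n \<omega> (T n \<omega>)) \<le> C * \<bar>R n \<omega> (T n \<omega>)\<bar>)"
      unfolding eventually_wp_def eventually_sequentially by blast
    define m where "m = max n0 (nat \<lceil>C\<rceil>)"
    have "N m \<ge> n0" using seq_suble[OF sm, of m] by (simp add: m_def)
    then obtain A where A: "A \<in> sets M" "measure M A \<ge> 1 - \<epsilon>"
      "\<forall>\<omega>\<in>A. norm (Y (N m) \<omega> (T (N m) \<omega>)) \<le> C * \<bar>R (N m) \<omega> (T (N m) \<omega>)\<bar>" using n0 by blast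
    obtain \<omega> where w: "\<omega> \<in> A" "B m (N m) \<omega> (T (N m) \<omega>)" using bad[OF A(1,2)] TB by blast
    have "C \<le> real (Suc m)" unfolding m_def by linarith
    then have "C * \<bar>R (N m) \<omega> (T (N m) \<omega>)\<bar> \<le> real (Suc m) * \<bar>R (N m) \<omega> (T (N m) \<omega>)\<bar>"
      by (intro mult_right_mono) auto
    then show False using A(3) w unfolding B_def by (meson order_trans)
  qed
qed

text \<open>
  If no \<open>c\<close> worked, the selection with \<open>c = 1 / (m + 1)\<close> would produce a random sequence whose
  log profile likelihood falls short of the maximum by \<open>o(n)\<close> although it repeatedly stays
  away from \<open>\<theta>0\<close> with non-negligible probability.
\<close>

lemma (in prob_space) uniform_separation:
  fixes \<Theta> :: "'v::real_normed_vector set"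
  assumes sep: "\<And>T. (\<forall>n. \<forall>\<omega>\<in>space M. T n \<omega> \<in> \<Theta>) \<Longrightarrow>
          smallo_P M (\<lambda>n \<omega>. (1 / real n) * (L n \<omega> (T n \<omega>) - L n \<omega> (that n \<omega>))) (\<lambda>n \<omega>. 1) \<Longrightarrow>
          smallo_P M (\<lambda>n \<omega>. T n \<omega> - \<theta>0) (\<lambda>n \<omega>. 1)"
    and centre: "\<theta>0 \<in> \<Theta>"
    and max: "\<And>n \<omega> \<theta>. n > 0 \<Longrightarrow> \<omega> \<in> space M \<Longrightarrow> \<theta> \<in> \<Theta> \<Longrightarrow> L n \<omega> \<theta> \<le> L n \<omega> (that n \<omega>)"
    and max_in: "\<And>n \<omega>. n > 0 \<Longrightarrow> \<omega> \<in> space M \<Longrightarrow> that n \<omega> \<in> \<Theta>"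
    and \<epsilon>: "\<epsilon> > 0" and \<delta>: "\<delta> > 0"
  shows "\<exists>c>0. eventually_wp M \<epsilon> (\<lambda>n \<omega>. \<forall>\<theta>\<in>\<Theta>. norm (\<theta> - \<theta>0) \<ge> \<delta> \<longrightarrow>
            L n \<omega> \<theta> - L n \<omega> (that n \<omega>) \<le> - c * real n)"
proof (rule ccontr)
  define B where "B m n \<omega> \<theta> \<longleftrightarrow> n > 0 \<and> norm (\<theta> - \<theta>0) \<ge> \<delta> \<and> \<not> L n \<omega> \<theta> - L n \<omega> (that n \<omega>) \<le> - (1 / real (Suc m)) * real n"
    for m n \<omega> and \<theta> :: 'v
  \<comment> \<open>the estimator itself is the default value, because its deficit is zero\<close>
  define dflt where "dflt n \<omega> = (if n > 0 then that n \<omega> else \<theta>0)" for n \<omega>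
  assume no: "\<not> ?thesis"
  have "\<not> eventually_wp M \<epsilon> (\<lambda>n \<omega>. \<forall>\<theta>\<in>\<Theta>. \<not> B m n \<omega> \<theta>)" for m
  proof
    assume "eventually_wp M \<epsilon> (\<lambda>n \<omega>. \<forall>\<theta>\<in>\<Theta>. \<not> B m n \<omega> \<theta>)"
    then have "eventually_wp M \<epsilon> (\<lambda>n \<omega>. \<forall>\<theta>\<in>\<Theta>. norm (\<theta> - \<theta>0) \<ge> \<delta> \<longrightarrow>
            L n \<omega> \<theta> - L n \<omega> (that n \<omega>) \<le> - (1 / real (Suc m)) * real n)"
      by (rule eventually_wp_mono)
         (rule eventually_mono[OF eventually_gt_at_top[of 0]], unfold B_def, blast)
    moreover have "1 / real (Suc m) > 0" by simp
    ultimately show False using no by blast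
  qed
  from bad_sequence_selection[of M \<epsilon> \<Theta> B dflt, OF this]
  obtain N T where sm: "strict_mono (N :: nat \<Rightarrow> nat)"
    and T: "\<And>n \<omega>. T n \<omega> = dflt n \<omega> \<or> (\<exists>m. n = N m \<and> T n \<omega> \<in> \<Theta> \<and> B m n \<omega> (T n \<omega>))"
    and TB: "\<And>m \<omega>. \<exists>\<theta>\<in>\<Theta>. B m (N m) \<omega> \<theta> \<Longrightarrow> T (N m) \<omega> \<in> \<Theta> \<and> B m (N m) \<omega> (T (N m) \<omega>)"
    and bad: "\<And>m A. A \<in> sets M \<Longrightarrow> measure M A \<ge> 1 - \<epsilon> \<Longrightarrow> \<exists>\<omega>\<in>A. \<exists>\<theta>\<in>\<Theta>. B m (N m) \<omega> \<theta>"
    by metis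
  have TTh: "\<forall>n. \<forall>\<omega>\<in>space M. T n \<omega> \<in> \<Theta>" using T max_in centre by (metis dflt_def)
  have "smallo_P M (\<lambda>n \<omega>. (1 / real n) * (L n \<omega> (T n \<omega>) - L n \<omega> (that n \<omega>))) (\<lambda>n \<omega>. 1)"
    unfolding smallo_P_iff
  proof (intro allI impI)
    fix c \<epsilon>' :: real assume c: "c > 0" "\<epsilon>' > 0"
    obtain m0 where m0: "1 / real (Suc m0) < c" using c(1) by (metis nat_approx_posE)
    have "norm ((1 / real n) * (L n \<omega> (T n \<omega>) - L n \<omega> (that n \<omega>))) \<le> c"
      if n: "n \<ge> Suc (N m0)" and w: "\<omega> \<in> space M" for n \<omega>
      using T[of n \<omega>]
    proof (elim disjE exE conjE)
      fix m assume nm: "n = N m" and b: "B m n \<omega> (T n \<omega>)"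
      then have "m \<ge> m0" using n sm by (metis Suc_leD strict_mono_less_eq)
      then have "1 / real (Suc m) \<le> 1 / real (Suc m0)" by (simp add: frac_le)
      moreover have "L n \<omega> (T n \<omega>) - L n \<omega> (that n \<omega>) > - (1 / real (Suc m)) * real n"
        using b unfolding B_def by linarith
      then have "1 / real n * (L n \<omega> (T n \<omega>) - L n \<omega> (that n \<omega>)) > - (1 / real (Suc m))"
        using n by (simp add: field_simps)
      moreover have "L n \<omega> (T n \<omega>) - L n \<omega> (that n \<omega>) \<le> 0"
        using max[of n \<omega> "T n \<omega>"] TTh n w by auto
      then have "1 / real n * (L n \<omega> (T n \<omega>) - L n \<omega> (that n \<omega>)) \<le> 0"
        by (simp add: mult_nonneg_nonpos divide_nonpos_nonneg)
      ultimately show ?thesis using m0 unfolding real_norm_def by linarith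
    qed (use c n in \<open>simp add: dflt_def\<close>)
    then show "eventually_wp M \<epsilon>' (\<lambda>n \<omega>. norm ((1 / real n) * (L n \<omega> (T n \<omega>) - L n \<omega> (that n \<omega>))) \<le> c * \<bar>1\<bar>)"
      using c by (intro eventually_wp_always) (auto simp: eventually_sequentially simp del: real_norm_def)
  qed
  from sep[OF TTh this] have
    "eventually_wp M \<epsilon> (\<lambda>n \<omega>. norm (T n \<omega> - \<theta>0) \<le> \<delta>/2 * \<bar>1\<bar>)"
    unfolding smallo_P_iff using \<epsilon> \<delta> by (meson half_gt_zero)
  then obtain n0 where n0: "\<And>n. n \<ge> n0 \<Longrightarrow> \<exists>A\<in>sets M. measure M A \<ge> 1 - \<epsilon> \<and> (\<forall>\<omega>\<in>A. norm (T n \<omega> - \<theta>0) \<le> \<delta>/2 * \<bar>1\<bar>)"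
    unfolding eventually_wp_def eventually_sequentially by blast
  have "N n0 \<ge> n0" using seq_suble[OF sm] by simp
  then obtain A where A: "A \<in> sets M" "measure M A \<ge> 1 - \<epsilon>"
    "\<forall>\<omega>\<in>A. norm (T (N n0) \<omega> - \<theta>0) \<le> \<delta>/2 * \<bar>1\<bar>" using n0 by blast
  obtain \<omega> where w: "\<omega> \<in> A" "B n0 (N n0) \<omega> (T (N n0) \<omega>)" using bad[OF A(1,2)] TB by blast
  then show False using A(3) \<delta> unfolding B_def by fastforce
qed


section \<open>Taylor bounds and measurability of derivatives\<close>

text \<open>
  Vectors, matrices and third order tensors carry the Euclidean norm of all entries, so bounds
  pass from the rows to the whole array.
\<close>

lemma norm_vec_le_mult:
  fixes x :: "'a::real_normed_vector^'n" and y :: "'b::real_normed_vector^'n"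
  assumes "\<And>i. norm (y $ i) \<le> norm (x $ i) * c" "0 \<le> c"
  shows "norm y \<le> norm x * c"
  unfolding norm_vec_def L2_set_left_distrib[OF assms(2)]
  by (rule L2_set_mono) (use assms in auto)

lemma norm_matrix_vector_le:
  fixes A :: "real^'n^'m"
  shows "norm (A *v h) \<le> norm A * norm h"
proof (rule norm_vec_le_mult)
  fix i
  have "(A *v h) $ i = A $ i \<bullet> h" by (simp add: matrix_vector_mult_def inner_vec_def)
  then show "norm ((A *v h) $ i) \<le> norm (A $ i) * norm h" by (simp add: Cauchy_Schwarz_ineq2)
qed simp

lemma norm_tensor_inner_le:
  fixes D :: "real^'n^'m^'l"
  shows "norm (\<chi> i j. D $ i $ j \<bullet> h) \<le> norm D * norm h"
  by (intro norm_vec_le_mult) (auto simp: Cauchy_Schwarz_ineq2)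

lemma lipschitz_of_derivative_bound:
  fixes g :: "real^'d \<Rightarrow> 'b::real_normed_vector"
  assumes "convex S" "\<And>u. u \<in> S \<Longrightarrow> (g has_derivative G u) (at u)"
    and "\<And>u h. u \<in> S \<Longrightarrow> norm (G u h) \<le> B * norm h" "c \<in> S" "y \<in> S"
  shows "norm (g y - g c) \<le> B * norm (y - c)"
  using assms
  by (intro differentiable_bound[of S g G B]) (auto intro: has_derivative_at_withinI onorm_le)

text \<open>
  Two applications of the mean value inequality: \<open>D2\<close> is Lipschitz with constant \<open>B\<close>, and this
  bounds the derivative of \<open>D1\<close> minus its linearization on the segment from \<open>c\<close> to \<open>y\<close>.
\<close>

lemma taylor_second_order:
  fixes D1 :: "real^'d \<Rightarrow> real^'m"
  assumes S: "convex S" "c \<in> S" "y \<in> S"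
    and d1: "\<And>u. u \<in> S \<Longrightarrow> (D1 has_derivative (\<lambda>h. D2 u *v h)) (at u)"
    and d2: "\<And>u. u \<in> S \<Longrightarrow> (D2 has_derivative (\<lambda>h. \<chi> i j. D3 u $ i $ j \<bullet> h)) (at u)"
    and B: "\<And>u. u \<in> S \<Longrightarrow> norm (D3 u) \<le> B"
  shows "norm (D1 y - D1 c - D2 c *v (y - c)) \<le> B * (norm (y - c))\<^sup>2"
proof -
  let ?T = "closed_segment c y"
  have T: "?T \<subseteq> S" using S by (simp add: closed_segment_subset)
  have B0: "B \<ge> 0" using B[OF S(2)] norm_ge_zero order_trans by blast
  have L: "norm (D2 u - D2 c) \<le> B * norm (u - c)" if "u \<in> ?T" for u
    by (rule lipschitz_of_derivative_bound[OF S(1) d2])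
       (use that T S B in \<open>auto intro: order_trans[OF norm_tensor_inner_le mult_right_mono]\<close>)
  have "norm ((\<lambda>u. D1 u - D2 c *v u) y - (\<lambda>u. D1 u - D2 c *v u) c) \<le> (B * norm (y - c)) * norm (y - c)"
  proof (rule lipschitz_of_derivative_bound[of ?T _ "\<lambda>u h. D2 u *v h - D2 c *v h"])
    fix u assume u: "u \<in> ?T"
    then show "((\<lambda>u. D1 u - D2 c *v u) has_derivative (\<lambda>h. D2 u *v h - D2 c *v h)) (at u)"
      using T d1 by (intro has_derivative_diff bounded_linear.has_derivative[OF matrix_vector_mul_bounded_linear] has_derivative_ident) auto
    fix h
    have "norm (D2 u *v h - D2 c *v h) \<le> norm (D2 u - D2 c) * norm h"
      by (metis matrix_vector_mult_diff_rdistrib norm_matrix_vector_le)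
    also have "\<dots> \<le> (B * norm (y - c)) * norm h"
      using L[OF u] segment_bound1[OF u] B0
      by (intro mult_right_mono) (auto intro: order_trans[OF _ mult_left_mono])
    finally show "norm (D2 u *v h - D2 c *v h) \<le> (B * norm (y - c)) * norm h" .
  qed auto
  then show ?thesis by (simp add: matrix_vector_mult_diff_distrib power2_eq_square algebra_simps)
qed

text \<open>
  Along the segment, the difference between \<open>f\<close> and its quadratic Taylor polynomial has a
  derivative that is controlled by the second order bound for the gradient.
\<close>

lemma taylor_third_order:
  fixes f :: "real^'d \<Rightarrow> real"
  assumes S: "convex S" "c \<in> S" "y \<in> S"
    and d0: "\<And>u. u \<in> S \<Longrightarrow> (f has_derivative (\<lambda>h. D1 u \<bullet> h)) (at u)"
    and d1: "\<And>u. u \<in> S \<Longrightarrow> (D1 has_derivative (\<lambda>h. D2 u *v h)) (at u)"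
    and d2: "\<And>u. u \<in> S \<Longrightarrow> (D2 has_derivative (\<lambda>h. \<chi> i j. D3 u $ i $ j \<bullet> h)) (at u)"
    and B: "\<And>u. u \<in> S \<Longrightarrow> norm (D3 u) \<le> B"
  shows "\<bar>f y - f c - D1 c \<bullet> (y - c) - (D2 c *v (y - c)) \<bullet> (y - c) / 2\<bar> \<le> B * (norm (y - c))^3"
proof -
  define v where "v = y - c"
  define p where "p s = c + s *\<^sub>R v" for s
  define \<psi> where "\<psi> s = f (p s) - s * (D1 c \<bullet> v) - s\<^sup>2 * ((D2 c *v v) \<bullet> v) / 2" for s
  have B0: "B \<ge> 0" using B[OF S(2)] norm_ge_zero order_trans by blast
  have pS: "p s \<in> S" if "s \<in> {0..1}" for s
  proof -
    have "p s = (1 - s) *\<^sub>R c + s *\<^sub>R y" by (simp add: p_def v_def algebra_simps)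
    then show ?thesis using S that by (auto intro: convexD)
  qed
  have "norm (\<psi> 1 - \<psi> 0) \<le> (B * norm v ^ 3) * norm (1 - 0 :: real)"
  proof (rule differentiable_bound[of "{0..1}" \<psi> "\<lambda>s x. x * ((D1 (p s) - D1 c - s *\<^sub>R (D2 c *v v)) \<bullet> v)"])
    fix s :: real assume s: "s \<in> {0..1}"
    have "(p has_derivative (\<lambda>x. x *\<^sub>R v)) (at s within {0..1})"
      unfolding p_def by (auto intro!: derivative_eq_intros)
    from has_derivative_compose[OF this d0[OF pS[OF s]]]
    have "((\<lambda>s. f (p s)) has_derivative (\<lambda>x. D1 (p s) \<bullet> (x *\<^sub>R v))) (at s within {0..1})" .
    then show "(\<psi> has_derivative (\<lambda>x. x * ((D1 (p s) - D1 c - s *\<^sub>R (D2 c *v v)) \<bullet> v))) (at s within {0..1})"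
      unfolding \<psi>_def
      by (auto intro!: derivative_eq_intros simp: algebra_simps inner_diff_left)
    have "norm (D1 (p s) - D1 c - D2 c *v (p s - c)) \<le> B * (norm (p s - c))\<^sup>2"
      by (rule taylor_second_order[OF S(1,2) pS[OF s] d1 d2 B])
    moreover have "D2 c *v (p s - c) = s *\<^sub>R (D2 c *v v)" by (simp add: p_def matrix_vector_mult_scaleR)
    moreover have "B * (norm (p s - c))\<^sup>2 \<le> B * (norm v)\<^sup>2"
      using s B0 by (intro mult_left_mono power_mono) (auto simp: p_def mult_left_le_one_le)
    ultimately have "norm (D1 (p s) - D1 c - s *\<^sub>R (D2 c *v v)) \<le> B * (norm v)\<^sup>2" by simp
    then have "norm ((D1 (p s) - D1 c - s *\<^sub>R (D2 c *v v)) \<bullet> v) \<le> (B * (norm v)\<^sup>2) * norm v"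
      unfolding real_norm_def by (rule order_trans[OF Cauchy_Schwarz_ineq2 mult_right_mono]) simp
    also have "\<dots> = B * norm v ^ 3" by (simp add: power2_eq_square power3_eq_cube)
    finally have *: "norm ((D1 (p s) - D1 c - s *\<^sub>R (D2 c *v v)) \<bullet> v) \<le> B * norm v ^ 3" .
    show "onorm (\<lambda>x. x * ((D1 (p s) - D1 c - s *\<^sub>R (D2 c *v v)) \<bullet> v)) \<le> B * norm v ^ 3"
    proof (rule onorm_le)
      fix x :: real
      show "norm (x * ((D1 (p s) - D1 c - s *\<^sub>R (D2 c *v v)) \<bullet> v)) \<le> B * norm v ^ 3 * norm x"
        unfolding norm_mult mult.commute[of "norm x"] by (rule mult_right_mono[OF *]) simp
    qed
  qed auto
  then show ?thesis by (simp add: \<psi>_def p_def v_def)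
qed

text \<open>
  The increment of \<open>f\<close> from \<open>c\<close> to \<open>c + a + b\<close> is expanded in one step and in two steps
  through \<open>c + a\<close>. The terms up to second order differ by the antisymmetric part of \<open>D2 c\<close> in
  \<open>a\<close> and \<open>b\<close>, which is therefore cubic in the size of \<open>a\<close> and \<open>b\<close>. It is also quadratic under
  scaling, hence zero.
\<close>

lemma symmetric_second_derivative:
  fixes f :: "real^'d \<Rightarrow> real"
  assumes r: "r > 0"
    and d0: "\<And>u. u \<in> ball c r \<Longrightarrow> (f has_derivative (\<lambda>h. D1 u \<bullet> h)) (at u)"
    and d1: "\<And>u. u \<in> ball c r \<Longrightarrow> (D1 has_derivative (\<lambda>h. D2 u *v h)) (at u)"
    and d2: "\<And>u. u \<in> ball c r \<Longrightarrow> (D2 has_derivative (\<lambda>h. \<chi> i j. D3 u $ i $ j \<bullet> h)) (at u)"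
    and B: "\<And>u. u \<in> ball c r \<Longrightarrow> norm (D3 u) \<le> B"
  shows "(D2 c *v a) \<bullet> b = (D2 c *v b) \<bullet> a"
proof -
  have B0: "B \<ge> 0" using order_trans[OF norm_ge_zero B[of c]] r by simp
  \<comment> \<open>the remainders are 8 from the single step, 1 from each of the two steps, 1 from the gradient and 1 / 2 from the Hessian at the intermediate point, and the identity is doubled\<close>
  have small: "\<bar>(D2 c *v b) \<bullet> a - (D2 c *v a) \<bullet> b\<bar> \<le> 24 * B * m ^ 3"
    if m: "norm a \<le> m" "norm b \<le> m" "2 * m < r" for a b m
  proof -
    have m0: "m \<ge> 0" using m(1) norm_ge_zero order_trans by blast
    have ab: "norm (a + b) \<le> 2 * m" using m norm_triangle_ineq[of a b] by linarith
    have mem: "c \<in> ball c r" "c + a \<in> ball c r" "c + a + b \<in> ball c r"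
      using m m0 ab r by (auto simp: dist_norm norm_minus_commute add.assoc add.commute[of b])
    have p: "norm a ^ 3 \<le> m ^ 3" "norm b ^ 3 \<le> m ^ 3" "norm (a + b) ^ 3 \<le> (2 * m) ^ 3"
       "(norm a)\<^sup>2 \<le> m\<^sup>2" "(norm b)\<^sup>2 \<le> m\<^sup>2"
      using power_mono[OF m(1) norm_ge_zero] power_mono[OF m(2) norm_ge_zero] power_mono[OF ab norm_ge_zero, of 3]
      by (simp_all only:)
    note T3 = taylor_third_order[of "ball c r", OF convex_ball _ _ d0 d1 d2 B]
    have 1: "\<bar>f (c + a + b) - f c - D1 c \<bullet> (a + b) - (D2 c *v (a + b)) \<bullet> (a + b) / 2\<bar> \<le> B * (2 * m) ^ 3"
      using T3[OF mem(1,3)] mult_left_mono[OF p(3) B0] by (simp add: add.assoc)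
    have 2: "\<bar>f (c + a) - f c - D1 c \<bullet> a - (D2 c *v a) \<bullet> a / 2\<bar> \<le> B * m ^ 3"
      using T3[OF mem(1,2)] mult_left_mono[OF p(1) B0] by simp
    have 3: "\<bar>f (c + a + b) - f (c + a) - D1 (c + a) \<bullet> b - (D2 (c + a) *v b) \<bullet> b / 2\<bar> \<le> B * m ^ 3"
      using T3[OF mem(2,3)] mult_left_mono[OF p(2) B0] by simp
    have "norm (D1 (c + a) - D1 c - D2 c *v a) \<le> B * m\<^sup>2"
      using taylor_second_order[of "ball c r", OF convex_ball mem(1,2) d1 d2 B] mult_left_mono[OF p(4) B0] by simp
    then have "\<bar>(D1 (c + a) - D1 c - D2 c *v a) \<bullet> b\<bar> \<le> (B * m\<^sup>2) * m"
      using m m0 B0 by (intro order_trans[OF Cauchy_Schwarz_ineq2 mult_mono]) auto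
    then have 4: "\<bar>D1 (c + a) \<bullet> b - D1 c \<bullet> b - (D2 c *v a) \<bullet> b\<bar> \<le> B * m ^ 3"
      by (simp add: inner_diff_left power2_eq_square power3_eq_cube)
    have "norm (D2 (c + a) - D2 c) \<le> B * norm a"
      using lipschitz_of_derivative_bound[of "ball c r", OF convex_ball d2 _ mem(1,2), of B]
        order_trans[OF norm_tensor_inner_le mult_right_mono[OF B norm_ge_zero]] by simp
    also have "\<dots> \<le> B * m" using B0 m by (simp add: mult_left_mono)
    finally have "norm ((D2 (c + a) - D2 c) *v b) \<le> (B * m) * m"
      using m m0 B0 by (intro order_trans[OF norm_matrix_vector_le mult_mono]) auto
    then have "\<bar>((D2 (c + a) - D2 c) *v b) \<bullet> b\<bar> \<le> ((B * m) * m) * m"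
      using m m0 B0 by (intro order_trans[OF Cauchy_Schwarz_ineq2 mult_mono]) auto
    then have 5: "\<bar>(D2 (c + a) *v b) \<bullet> b - (D2 c *v b) \<bullet> b\<bar> \<le> B * m ^ 3"
      by (simp add: matrix_vector_mult_diff_rdistrib inner_diff_left power3_eq_cube mult.assoc)
    have "(D2 c *v (a + b)) \<bullet> (a + b) = (D2 c *v a) \<bullet> a + (D2 c *v a) \<bullet> b + (D2 c *v b) \<bullet> a + (D2 c *v b) \<bullet> b"
      by (simp add: matrix_vector_right_distrib inner_add_left inner_add_right)
    moreover have "D1 c \<bullet> (a + b) = D1 c \<bullet> a + D1 c \<bullet> b" by (simp add: inner_add_right)
    moreover have "B * (2 * m) ^ 3 = 8 * (B * m ^ 3)" by (simp add: power_mult_distrib)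
    ultimately show ?thesis using 1 2 3 4 5 unfolding mult.assoc[of 24] by linarith
  qed
  define X where "X = \<bar>(D2 c *v b) \<bullet> a - (D2 c *v a) \<bullet> b\<bar>"
  define m where "m = norm a + norm b"
  have "X \<le> 24 * B * m ^ 3 * s" if s: "s > 0" "2 * (s * m) < r" for s
  proof -
    have "\<bar>(D2 c *v (s *\<^sub>R b)) \<bullet> (s *\<^sub>R a) - (D2 c *v (s *\<^sub>R a)) \<bullet> (s *\<^sub>R b)\<bar> \<le> 24 * B * (s * m) ^ 3"
      by (rule small) (use s in \<open>auto simp: m_def\<close>)
    moreover have "(D2 c *v (s *\<^sub>R b)) \<bullet> (s *\<^sub>R a) - (D2 c *v (s *\<^sub>R a)) \<bullet> (s *\<^sub>R b)
        = s\<^sup>2 * ((D2 c *v b) \<bullet> a - (D2 c *v a) \<bullet> b)"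
      by (simp add: matrix_vector_mult_scaleR power2_eq_square algebra_simps)
    ultimately have "\<bar>s\<^sup>2 * ((D2 c *v b) \<bullet> a - (D2 c *v a) \<bullet> b)\<bar> \<le> 24 * B * (s * m) ^ 3" by simp
    moreover have "24 * B * (s * m) ^ 3 = s\<^sup>2 * (24 * B * m ^ 3 * s)"
      by (simp add: power_mult_distrib power3_eq_cube power2_eq_square)
    ultimately have "s\<^sup>2 * X \<le> s\<^sup>2 * (24 * B * m ^ 3 * s)"
      by (simp add: X_def abs_mult)
    then show ?thesis using s by simp
  qed
  note X = this
  have "\<forall>s>0. s < r / (2 * m + 1) \<longrightarrow> X \<le> 24 * B * m ^ 3 * s"
  proof (intro allI impI X)
    fix s :: real assume s: "s > 0" "s < r / (2 * m + 1)"
    have "m \<ge> 0" by (simp add: m_def)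
    then have "s * (2 * m + 1) < r" using s(2) by (subst (asm) pos_less_divide_eq) auto
    then show "2 * (s * m) < r" using s(1) by (simp add: algebra_simps)
  qed
  moreover have "r / (2 * m + 1) > 0" using r by (simp add: m_def add_nonneg_pos)
  ultimately have "eventually (\<lambda>s. X \<le> 24 * B * m ^ 3 * s) (at_right 0)"
    unfolding eventually_at_right_field by blast
  moreover have "((\<lambda>s. 24 * B * m ^ 3 * s) \<longlongrightarrow> 24 * B * m ^ 3 * 0) (at_right 0)"
    by (intro tendsto_intros)
  ultimately have "X \<le> 24 * B * m ^ 3 * 0"
    by (intro tendsto_lowerbound[of _ _ "at_right 0"]) auto
  then show ?thesis by (simp add: X_def)
qed

text \<open>
  A directional derivative is a pointwise limit of difference quotients, here along a sequence
  of step sizes for which \<open>t + s n *\<^sub>R h\<close> stays in the ball.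
\<close>

lemma measurable_directional_derivative:
  fixes g :: "real^'d \<Rightarrow> 'x \<Rightarrow> 'b::{real_normed_vector, second_countable_topology}"
  assumes r: "r > 0"
    and meas: "\<And>u. u \<in> ball t r \<Longrightarrow> g u \<in> borel_measurable P"
    and deriv: "\<And>x. x \<in> space P \<Longrightarrow> ((\<lambda>u. g u x) has_derivative G x) (at t)"
  shows "(\<lambda>x. G x h) \<in> borel_measurable P"
proof -
  define s where "s = (\<lambda>n. (r / (norm h + 1)) * inverse (real (Suc n)))"
  have s0: "s n > 0" for n using r by (simp add: s_def add_nonneg_pos)
  have sr: "s n * norm h < r" for n
  proof -
    have "s n \<le> r / (norm h + 1)" using r unfolding s_def
      by (intro mult_right_le_one_le) (auto simp: field_simps add_nonneg_pos)
    then have "s n * norm h \<le> r / (norm h + 1) * norm h" by (rule mult_right_mono) simp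
    also have "\<dots> = r * (norm h / (norm h + 1))" by simp
    also have "\<dots> < r * 1"
      by (rule mult_strict_left_mono[OF _ r]) (simp add: divide_less_eq add_nonneg_pos)
    finally have "s n * norm h < r * 1" .
    then have "s n * norm h < r" by simp
    then show ?thesis .
  qed
  have slim: "s \<longlonglongrightarrow> 0" unfolding s_def by (intro tendsto_mult_right_zero LIMSEQ_inverse_real_of_nat)
  have mem: "t + s n *\<^sub>R h \<in> ball t r" for n using sr[of n] s0[of n] by (simp add: dist_norm abs_of_pos)
  show ?thesis
  proof (rule borel_measurable_LIMSEQ_metric[where f = "\<lambda>n x. inverse (s n) *\<^sub>R (g (t + s n *\<^sub>R h) x - g t x)"])
    show "(\<lambda>x. inverse (s n) *\<^sub>R (g (t + s n *\<^sub>R h) x - g t x)) \<in> borel_measurable P" for n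
      using meas[OF mem[of n]] meas[of t] r by auto
    fix x assume x: "x \<in> space P"
    have "((\<lambda>u. t + u *\<^sub>R h) has_derivative (\<lambda>u. u *\<^sub>R h)) (at (0::real))"
      by (auto intro!: derivative_eq_intros)
    from has_derivative_compose[OF this, of "\<lambda>u. g u x" "G x"] deriv[OF x]
    have *: "((\<lambda>u. g (t + u *\<^sub>R h) x) has_derivative (\<lambda>u. G x (u *\<^sub>R h))) (at (0::real))" by simp
    have "bounded_linear (G x)" using deriv[OF x] by (rule has_derivative_bounded_linear)
    then have lin: "G x (u *\<^sub>R h) = u *\<^sub>R G x h" for u by (simp add: bounded_linear.linear linear_cmul)
    have "((\<lambda>u. (g (t + u *\<^sub>R h) x - g t x - u *\<^sub>R G x h) /\<^sub>R norm u) \<longlongrightarrow> 0) (at (0::real))"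
      using * unfolding has_derivative_at_within lin by simp
    moreover have "filterlim s (at 0) sequentially"
      using slim s0 by (auto simp: filterlim_at less_imp_neq[symmetric])
    ultimately have "(\<lambda>n. (g (t + s n *\<^sub>R h) x - g t x - s n *\<^sub>R G x h) /\<^sub>R norm (s n)) \<longlonglongrightarrow> 0"
      by (rule filterlim_compose)
    moreover have "(g (t + s n *\<^sub>R h) x - g t x - s n *\<^sub>R G x h) /\<^sub>R norm (s n) =
        inverse (s n) *\<^sub>R (g (t + s n *\<^sub>R h) x - g t x) - G x h" for n
      using s0[of n] by (simp add: scaleR_diff_right)
    ultimately show "(\<lambda>n. inverse (s n) *\<^sub>R (g (t + s n *\<^sub>R h) x - g t x)) \<longlonglongrightarrow> G x h"
      by (intro LIM_zero_cancel[of _ "G x h"]) simp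
  qed
qed

lemma borel_measurable_vecI:
  fixes f :: "'x \<Rightarrow> 'a::euclidean_space^'n"
  assumes "\<And>i. (\<lambda>x. f x $ i) \<in> borel_measurable P"
  shows "f \<in> borel_measurable P"
proof (subst borel_measurable_euclidean_space, intro ballI)
  fix b :: "'a^'n" assume "b \<in> Basis"
  then obtain i u where b: "b = axis i u" "u \<in> Basis" by (auto simp: Basis_vec_def)
  have "(\<lambda>x. f x \<bullet> b) = (\<lambda>x. f x $ i \<bullet> u)" by (simp add: b inner_axis)
  then show "(\<lambda>x. f x \<bullet> b) \<in> borel_measurable P" using assms[of i] by simp
qed

lemma borel_measurable_vec_nth [measurable (raw)]:
  fixes f :: "'x \<Rightarrow> 'a::euclidean_space^'n"
  assumes "f \<in> borel_measurable P"
  shows "(\<lambda>x. f x $ i) \<in> borel_measurable P"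
  using assms by (rule measurable_compose) (intro borel_measurable_continuous_onI continuous_intros)


section \<open>Second order expansion of density ratios\<close>

text \<open>
  Convergence of \<open>\<psi> n\<close> to zero is known in the mean only. Where \<open>G\<close> is at most \<open>k\<close>, the
  integral is at most \<open>k\<close> times that mean, and the rest is a tail of the integrable \<open>G\<close>.
\<close>

lemma (in finite_measure) integral_mult_vanishing:
  fixes G :: "'a \<Rightarrow> real" and \<psi> :: "nat \<Rightarrow> 'a \<Rightarrow> real"
  assumes G: "integrable M G" "\<And>x. x \<in> space M \<Longrightarrow> 0 \<le> G x"
    and \<psi>: "\<And>n. \<psi> n \<in> borel_measurable M" "\<And>n x. x \<in> space M \<Longrightarrow> 0 \<le> \<psi> n x" "\<And>n x. x \<in> space M \<Longrightarrow> \<psi> n x \<le> 1"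
    and lim: "(\<lambda>n. \<integral>x. \<psi> n x \<partial>M) \<longlonglongrightarrow> 0"
  shows "(\<lambda>n. \<integral>x. G x * \<psi> n x \<partial>M) \<longlonglongrightarrow> 0"
proof (rule LIMSEQ_I)
  fix e :: real assume e: "e > 0"
  have Gm[measurable]: "G \<in> borel_measurable M" using G(1) by simp
  note \<psi>(1)[measurable]
  have "(\<lambda>k. \<integral>x. (if G x \<le> real k then 0 else G x) \<partial>M) \<longlonglongrightarrow> (\<integral>x. 0 \<partial>M)"
  proof (rule integral_dominated_convergence[where w = G])
    show "AE x in M. (\<lambda>k. if G x \<le> real k then 0 else G x) \<longlonglongrightarrow> 0"
    proof (rule AE_I2)
      fix x
      have "\<forall>\<^sub>F k in sequentially. (if G x \<le> real k then 0 else G x) = 0"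
        using real_nat_ceiling_ge[of "G x"] by (auto simp: eventually_sequentially intro!: exI[of _ "nat \<lceil>G x\<rceil>"])
      then show "(\<lambda>k. if G x \<le> real k then 0 else G x) \<longlonglongrightarrow> 0" by (rule tendsto_eventually)
    qed
  qed (use G in \<open>auto intro!: AE_I2\<close>)
  then have "(\<lambda>k. \<integral>x. (if G x \<le> real k then 0 else G x) \<partial>M) \<longlonglongrightarrow> 0" by simp
  from order_tendstoD(2)[OF this, of "e/2"] e
  obtain k where k: "(\<integral>x. (if G x \<le> real k then 0 else G x) \<partial>M) < e / 2"
    by (auto simp: eventually_sequentially)
  have itail: "integrable M (\<lambda>x. (if G x \<le> real k then 0 else G x))"
    by (rule Bochner_Integration.integrable_bound[OF G(1)]) (use G in auto)
  have i\<psi>: "integrable M (\<psi> n)" for n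
    by (rule integrable_const_bound[where B = 1]) (use \<psi> in auto)
  have iG: "integrable M (\<lambda>x. G x * \<psi> n x)" for n
    by (rule Bochner_Integration.integrable_bound[OF G(1)])
       (use G \<psi> in \<open>auto simp: abs_mult mult_left_le\<close>)
  from order_tendstoD(2)[OF lim, of "e / (2 * (real k + 1))"] e
  obtain n0 where n0: "\<And>n. n \<ge> n0 \<Longrightarrow> (\<integral>x. \<psi> n x \<partial>M) < e / (2 * (real k + 1))"
    by (auto simp: eventually_sequentially)
  show "\<exists>n0. \<forall>n\<ge>n0. norm ((\<integral>x. G x * \<psi> n x \<partial>M) - 0) < e"
  proof (intro exI allI impI)
    fix n assume n: "n \<ge> n0"
    have "(\<integral>x. G x * \<psi> n x \<partial>M) \<le> (\<integral>x. (real k + 1) * \<psi> n x + (if G x \<le> real k then 0 else G x) \<partial>M)"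
    proof (rule integral_mono[OF iG])
      fix x assume x: "x \<in> space M"
      have "G x * \<psi> n x \<le> (real k + 1) * \<psi> n x" if "G x \<le> real k"
        using that \<psi>(2)[OF x] by (intro mult_right_mono) auto
      moreover have "G x * \<psi> n x \<le> G x" using G(2)[OF x] \<psi>(2,3)[OF x] by (simp add: mult_left_le)
      moreover have "0 \<le> (real k + 1) * \<psi> n x" using \<psi>(2)[OF x] by simp
      ultimately show "G x * \<psi> n x \<le> (real k + 1) * \<psi> n x + (if G x \<le> real k then 0 else G x)" by auto
    qed (use i\<psi> itail in auto)
    also have "\<dots> = (real k + 1) * (\<integral>x. \<psi> n x \<partial>M) + (\<integral>x. (if G x \<le> real k then 0 else G x) \<partial>M)"
      using i\<psi> itail by simp
    also have "\<dots> < e / 2 + e / 2"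
    proof (rule add_strict_mono[OF _ k])
      have "(real k + 1) * (\<integral>x. \<psi> n x \<partial>M) < (real k + 1) * (e / (2 * (real k + 1)))"
        by (rule mult_strict_left_mono[OF n0[OF n]]) simp
      also have "\<dots> = e / 2" by (simp add: field_simps)
      finally show "(real k + 1) * (\<integral>x. \<psi> n x \<partial>M) < e / 2" .
    qed
    finally have "(\<integral>x. G x * \<psi> n x \<partial>M) < e" by simp
    moreover have "(\<integral>x. G x * \<psi> n x \<partial>M) \<ge> 0" by (rule integral_nonneg_AE) (use G \<psi> in auto)
    ultimately show "norm ((\<integral>x. G x * \<psi> n x \<partial>M) - 0) < e" by simp
  qed
qed

text \<open>
  The function inside the absolute value has the derivative \<open>2 * w\<^sup>2 / (1 + w)\<close>. The factor
  \<open>min 1 \<bar>w\<bar>\<close> is small near zero and bounded for large \<open>w\<close>, so that the remainder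
  can be integrated when only \<open>w\<^sup>2\<close> is integrable.
\<close>

lemma ln_one_plus_third_order:
  fixes w :: real
  assumes "w \<ge> - 1 / 2"
  shows "\<bar>2 * ln (1 + w) - 2 * w + w\<^sup>2\<bar> \<le> 4 * w\<^sup>2 * min 1 \<bar>w\<bar>"
proof -
  define h where "h w = 2 * ln (1 + w) - 2 * w + w\<^sup>2" for w :: real
  have d: "DERIV h x :> 2 * x\<^sup>2 / (1 + x)" if "x \<ge> - 1 / 2" for x
  proof -
    have "DERIV h x :> 2 * (1 / (1 + x)) - 2 + 2 * x"
      unfolding h_def using that by (auto intro!: derivative_eq_intros)
    moreover have "2 * (1 / (1 + x)) - 2 + 2 * x = 2 * x\<^sup>2 / (1 + x)"
      using that by (simp add: field_simps power2_eq_square)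
    ultimately show ?thesis by simp
  qed
  have h0: "h 0 = 0" by (simp add: h_def)
  have main: "\<bar>h w\<bar> \<le> 4 * w\<^sup>2 * min 1 \<bar>w\<bar>" if w: "w \<ge> 0"
  proof (cases "w = 0")
    case False
    then have "w > 0" using w by simp
    from MVT2[OF this, of h "\<lambda>x. 2 * x\<^sup>2 / (1 + x)"] d
    obtain z where z: "0 < z" "z < w" "h w - h 0 = (w - 0) * (2 * z\<^sup>2 / (1 + z))" by force
    have 1: "2 * z\<^sup>2 / (1 + z) \<le> 2 * z" "2 * z\<^sup>2 / (1 + z) \<le> 2 * z\<^sup>2" "2 * z\<^sup>2 / (1 + z) \<ge> 0"
      using z by (auto simp: field_simps power2_eq_square)
    have "w * (2 * z\<^sup>2 / (1 + z)) \<le> w * (2 * w)"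
      using 1 z by (intro mult_left_mono) auto
    moreover have "z\<^sup>2 \<le> w\<^sup>2" using z by (intro power_mono) auto
    then have "2 * z\<^sup>2 / (1 + z) \<le> 2 * w\<^sup>2" using 1(2) by linarith
    then have "w * (2 * z\<^sup>2 / (1 + z)) \<le> w * (2 * w\<^sup>2)"
      using w by (intro mult_left_mono)
    moreover have "h w \<ge> 0" using z(3) mult_nonneg_nonneg[OF w 1(3)] h0 by simp
    ultimately have "h w \<le> 2 * w\<^sup>2 * 1 \<and> h w \<le> 2 * w\<^sup>2 * w \<and> h w \<ge> 0"
      using z(3) h0 by (simp add: power2_eq_square mult_ac)
    then have "\<bar>h w\<bar> \<le> 2 * w\<^sup>2 * min 1 \<bar>w\<bar>" using w by (auto simp: min_def)
    also have "\<dots> \<le> 4 * w\<^sup>2 * min 1 \<bar>w\<bar>" by (intro mult_right_mono) auto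
    finally show ?thesis .
  qed (simp add: h0)
  have neg: "\<bar>h w\<bar> \<le> 4 * w\<^sup>2 * min 1 \<bar>w\<bar>" if w: "w < 0"
  proof -
    have "\<exists>z>w. z < 0 \<and> h 0 - h w = (0 - w) * (2 * z\<^sup>2 / (1 + z))"
      by (rule MVT2[OF w]) (use d assms in auto)
    then obtain z where z: "w < z" "z < 0" "h 0 - h w = (0 - w) * (2 * z\<^sup>2 / (1 + z))" by blast
    have zz: "z\<^sup>2 \<le> w\<^sup>2" using z by (intro abs_le_square_iff[THEN iffD1]) simp
    have "2 * z\<^sup>2 / (1 + z) \<le> 2 * z\<^sup>2 / (1 / 2)"
      using z assms by (intro divide_left_mono) auto
    also have "\<dots> \<le> 4 * w\<^sup>2" using zz by simp
    finally have "(0 - w) * (2 * z\<^sup>2 / (1 + z)) \<le> (0 - w) * (4 * w\<^sup>2)"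
      using w by (intro mult_left_mono) auto
    moreover have "(0 - w) * (2 * z\<^sup>2 / (1 + z)) \<ge> 0"
      using w z assms by (intro mult_nonneg_nonneg divide_nonneg_nonneg) auto
    moreover have "h w = - ((0 - w) * (2 * z\<^sup>2 / (1 + z)))" using z(3) h0 by simp
    ultimately have "\<bar>h w\<bar> \<le> (0 - w) * (4 * w\<^sup>2)" by (simp only: abs_minus_cancel abs_of_nonneg)
    also have "\<dots> = 4 * w\<^sup>2 * min 1 \<bar>w\<bar>" using w assms by (simp add: min_def)
    finally show ?thesis .
  qed
  show ?thesis using main neg unfolding h_def by linarith
qed

text \<open>
  The logarithm of a single density ratio has no quadratic lower bound when the ratio is close
  to zero. The difference of two logarithms is assumed to be of order \<open>s\<close>, and this controls
  the lower tail as well: if \<open>w0\<close> or \<open>w1\<close> is below \<open>- 1 / 2\<close>, all terms are bounded by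
  multiples of \<open>w0\<^sup>2 + w1\<^sup>2\<close>, which is at least \<open>1 / 4\<close>, and of the bound on the difference.
\<close>

lemma log_difference_expansion:
  fixes w0 w1 s G F :: real
  assumes w: "w0 > - 1" "w1 > - 1" and nn: "G \<ge> 0" "F \<ge> 0"
    and diff: "\<bar>2 * ln (1 + w1) - 2 * ln (1 + w0)\<bar> \<le> s * G + s\<^sup>2 * F"
  shows "\<bar>(2 * ln (1 + w1) - 2 * ln (1 + w0)) - (2 * w1 - w1\<^sup>2) + (2 * w0 - w0\<^sup>2)\<bar>
      \<le> 24 * ((w0\<^sup>2 + w1\<^sup>2 + s\<^sup>2 * (G\<^sup>2 + F)) * min 1 (\<bar>w0\<bar> + \<bar>w1\<bar>))"
proof (cases "w0 \<ge> - 1 / 2 \<and> w1 \<ge> - 1 / 2")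
  case True
  let ?\<phi> = "min 1 (\<bar>w0\<bar> + \<bar>w1\<bar>)"
  have "\<bar>2 * ln (1 + w) - 2 * w + w\<^sup>2\<bar> \<le> 4 * (w\<^sup>2 * ?\<phi>)" if "w = w0 \<or> w = w1" for w
  proof -
    have "\<bar>2 * ln (1 + w) - 2 * w + w\<^sup>2\<bar> \<le> 4 * w\<^sup>2 * min 1 \<bar>w\<bar>"
      using that True by (intro ln_one_plus_third_order) auto
    also have "\<dots> \<le> 4 * w\<^sup>2 * ?\<phi>" using that by (intro mult_left_mono) auto
    finally show ?thesis by simp
  qed
  from this[of w0] this[of w1]
  have "\<bar>(2 * ln (1 + w1) - 2 * ln (1 + w0)) - (2 * w1 - w1\<^sup>2) + (2 * w0 - w0\<^sup>2)\<bar> \<le> 4 * ((w0\<^sup>2 + w1\<^sup>2) * ?\<phi>)"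
    unfolding distrib_right distrib_left abs_le_iff by linarith
  also have "\<dots> \<le> 24 * ((w0\<^sup>2 + w1\<^sup>2 + s\<^sup>2 * (G\<^sup>2 + F)) * ?\<phi>)"
    using nn by (intro mult_mono mult_right_mono) auto
  finally show ?thesis .
next
  case False
  define q where "q = w0\<^sup>2 + w1\<^sup>2"
  let ?\<phi> = "min 1 (\<bar>w0\<bar> + \<bar>w1\<bar>)"
  have \<phi>: "?\<phi> \<ge> 1 / 2" using False by auto
  have "(1/2)\<^sup>2 \<le> w0\<^sup>2 \<or> (1/2)\<^sup>2 \<le> w1\<^sup>2"
    using False power_mono[of "1/2" "- w0" 2] power_mono[of "1/2" "- w1" 2] by auto
  then have q: "1 \<le> 4 * q"
    unfolding q_def by (auto simp: power2_eq_square) (smt (verit) zero_le_square)+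
  have sG: "s * G \<le> (s\<^sup>2 * G\<^sup>2 + 1) / 2"
    using zero_le_power2[of "s * G - 1"] by (simp add: power2_diff power_mult_distrib)
  have 2: "\<bar>2 * w - w\<^sup>2\<bar> \<le> 1 + 2 * w\<^sup>2" for w :: real
    using zero_le_power2[of "w - 1"] zero_le_power2[of "w + 1"] zero_le_power2[of w]
    unfolding abs_le_iff power2_diff power2_sum by (simp, linarith)
  have arith: "\<bar>L - x1 + x0\<bar> \<le> 12 * (p0 + p1 + (g + f))"
    if "\<bar>L\<bar> \<le> t + f" "\<bar>x0\<bar> \<le> 1 + 2 * p0" "\<bar>x1\<bar> \<le> 1 + 2 * p1" "t \<le> (g + 1) / 2"
       "1 \<le> 4 * (p0 + p1)" "0 \<le> g" "0 \<le> f" for L x0 x1 p0 p1 g f t :: real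
  proof -
    have "\<bar>L - x1 + x0\<bar> \<le> \<bar>L\<bar> + \<bar>x1\<bar> + \<bar>x0\<bar>" by simp
    then show ?thesis using that by simp
  qed
  have nn2: "s\<^sup>2 * G\<^sup>2 \<ge> 0" "s\<^sup>2 * F \<ge> 0" "q \<ge> 0" using nn by (auto simp: q_def)
  have "\<bar>(2 * ln (1 + w1) - 2 * ln (1 + w0)) - (2 * w1 - w1\<^sup>2) + (2 * w0 - w0\<^sup>2)\<bar>
      \<le> 12 * (q + s\<^sup>2 * (G\<^sup>2 + F))"
    using arith[OF diff 2[of w0] 2[of w1] sG] q nn2 by (simp add: q_def distrib_left)
  also have "\<dots> = 24 * ((q + s\<^sup>2 * (G\<^sup>2 + F)) * (1 / 2))" by simp
  also have "\<dots> \<le> 24 * ((q + s\<^sup>2 * (G\<^sup>2 + F)) * ?\<phi>)"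
    using \<phi> nn2 by (intro mult_left_mono) (auto simp: distrib_left)
  finally show ?thesis by (simp add: q_def)
qed

lemma integrable_mult_of_squares:
  fixes f g :: "'a \<Rightarrow> real"
  assumes "integrable M (\<lambda>x. (f x)\<^sup>2)" "integrable M (\<lambda>x. (g x)\<^sup>2)"
    and [measurable]: "f \<in> borel_measurable M" "g \<in> borel_measurable M"
  shows "integrable M (\<lambda>x. f x * g x)"
proof (rule Bochner_Integration.integrable_bound[OF Bochner_Integration.integrable_add[OF assms(1,2)]])
  have "2 * \<bar>f x * g x\<bar> \<le> (f x)\<^sup>2 + (g x)\<^sup>2" for x
    using zero_le_power2[of "\<bar>f x\<bar> - \<bar>g x\<bar>"] by (simp add: power2_diff abs_mult)
  then show "AE x in M. norm (f x * g x) \<le> norm ((f x)\<^sup>2 + (g x)\<^sup>2)"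
    by (intro AE_I2) (simp, smt (verit) zero_le_power2)
qed simp

lemma (in prob_space) integrable_of_square:
  fixes f :: "'a \<Rightarrow> real"
  assumes "integrable M (\<lambda>x. (f x)\<^sup>2)" "f \<in> borel_measurable M"
  shows "integrable M f"
  using integrable_mult_of_squares[of M f "\<lambda>_. 1"] assms by simp

text \<open>
  Convergence in mean square implies convergence of the second moments, because \<open>\<bar>v\<^sup>2 -
  u\<^sup>2\<bar> \<le> e * u\<^sup>2 + (1 + 1 / e) * (v - u)\<^sup>2\<close> for every \<open>e > 0\<close>.
\<close>

lemma integral_square_limit:
  fixes u :: "'a \<Rightarrow> real" and v :: "nat \<Rightarrow> 'a \<Rightarrow> real"
  assumes u: "integrable M (\<lambda>x. (u x)\<^sup>2)" "u \<in> borel_measurable M"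
    and v: "\<And>n. integrable M (\<lambda>x. (v n x)\<^sup>2)" "\<And>n. v n \<in> borel_measurable M"
    and lim: "(\<lambda>n. \<integral>x. (v n x - u x)\<^sup>2 \<partial>M) \<longlonglongrightarrow> 0"
  shows "(\<lambda>n. \<integral>x. (v n x)\<^sup>2 \<partial>M) \<longlonglongrightarrow> (\<integral>x. (u x)\<^sup>2 \<partial>M)"
proof (rule LIMSEQ_I)
  fix e :: real assume e: "e > 0"
  define U where "U = (\<integral>x. (u x)\<^sup>2 \<partial>M)"
  define \<eta> where "\<eta> = e / (2 * (U + 1))"
  have U: "U \<ge> 0" by (simp add: U_def)
  have \<eta>: "\<eta> > 0" using e U by (simp add: \<eta>_def)
  define c where "c = 1 + 1 / \<eta>"
  have c: "c > 0" using \<eta> by (simp add: c_def add_pos_pos)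
  have iuv: "integrable M (\<lambda>x. v n x * u x)" for n by (rule integrable_mult_of_squares) (use u v in auto)
  have ir: "integrable M (\<lambda>x. (v n x - u x)\<^sup>2)" for n
    unfolding power2_diff using u v iuv by (auto simp: mult.assoc)
  from order_tendstoD(2)[OF lim, of "e / (2 * c)"] e c
  obtain n0 where n0: "\<And>n. n \<ge> n0 \<Longrightarrow> (\<integral>x. (v n x - u x)\<^sup>2 \<partial>M) < e / (2 * c)"
    by (auto simp: eventually_sequentially add_pos_pos)
  show "\<exists>n0. \<forall>n\<ge>n0. norm ((\<integral>x. (v n x)\<^sup>2 \<partial>M) - (\<integral>x. (u x)\<^sup>2 \<partial>M)) < e"
  proof (intro exI allI impI)
    fix n assume n: "n \<ge> n0"
    let ?r = "\<lambda>x. v n x - u x"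
    have "\<bar>(\<integral>x. (v n x)\<^sup>2 \<partial>M) - (\<integral>x. (u x)\<^sup>2 \<partial>M)\<bar> = \<bar>\<integral>x. (v n x)\<^sup>2 - (u x)\<^sup>2 \<partial>M\<bar>"
      using u v by simp
    also have "\<dots> \<le> (\<integral>x. \<eta> * (u x)\<^sup>2 + c * (?r x)\<^sup>2 \<partial>M)"
    proof (rule order_trans[OF integral_abs_bound integral_mono])
      fix x
      have "0 \<le> (sqrt \<eta> * \<bar>u x\<bar> - \<bar>?r x\<bar> / sqrt \<eta>)\<^sup>2" by simp
      also have "\<dots> = \<eta> * (u x)\<^sup>2 + (?r x)\<^sup>2 / \<eta> - 2 * (\<bar>u x\<bar> * \<bar>?r x\<bar>)"
        using \<eta> by (simp add: power2_diff power_mult_distrib power_divide)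
      finally have "2 * \<bar>u x * ?r x\<bar> \<le> \<eta> * (u x)\<^sup>2 + (1 / \<eta>) * (?r x)\<^sup>2" by (simp add: abs_mult)
      moreover have "(v n x)\<^sup>2 - (u x)\<^sup>2 = 2 * (u x * ?r x) + (?r x)\<^sup>2" by (simp add: power2_eq_square algebra_simps)
      ultimately show "\<bar>(v n x)\<^sup>2 - (u x)\<^sup>2\<bar> \<le> \<eta> * (u x)\<^sup>2 + c * (?r x)\<^sup>2"
        using zero_le_power2[of "?r x"] unfolding c_def distrib_right abs_le_iff mult_1 by linarith
    qed (use u v ir in auto)
    also have "\<dots> = \<eta> * U + c * (\<integral>x. (?r x)\<^sup>2 \<partial>M)"
      using u ir by (simp add: U_def)
    also have "\<dots> < e / 2 + e / 2"
    proof (rule add_le_less_mono)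
      show "\<eta> * U \<le> e / 2" using U e by (simp add: \<eta>_def field_simps)
      have "c * (\<integral>x. (?r x)\<^sup>2 \<partial>M) < c * (e / (2 * c))"
        using c by (intro mult_strict_left_mono[OF n0[OF n]])
      also have "\<dots> = e / 2" using c by simp
      finally show "c * (\<integral>x. (?r x)\<^sup>2 \<partial>M) < e / 2" .
    qed
    finally show "norm ((\<integral>x. (v n x)\<^sup>2 \<partial>M) - (\<integral>x. (u x)\<^sup>2 \<partial>M)) < e" by simp
  qed
qed

lemma abs_le_one_plus_square: "\<bar>y\<bar> \<le> 1 + y\<^sup>2" for y :: real
proof -
  have "0 \<le> (\<bar>y\<bar> - 1 / 2)\<^sup>2" by simp
  also have "\<dots> = y\<^sup>2 - \<bar>y\<bar> + 1 / 4" by (simp add: power2_diff power_divide)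
  finally show ?thesis by simp
qed

text \<open>
  Put \<open>w = exp (a / 2) - 1\<close>. As \<open>exp a\<close> has mean one, \<open>E w = - E w\<^sup>2 / 2\<close>; as \<open>a = 2 * ln (1 +
  w)\<close>, the difference of two such \<open>a\<close> is a difference of terms \<open>2 * w - w\<^sup>2\<close> up to a remainder
  of higher order. So \<open>E (a1 - a0)\<close> is \<open>- 2 * (E w1\<^sup>2 - E w0\<^sup>2)\<close> up to \<open>o(s\<^sup>2)\<close>, and quadratic
  mean differentiability says that \<open>E w\<^sup>2 / s\<^sup>2\<close> converges to a quarter of the second moment of
  the score. In this way the information identity is obtained without differentiating a
  density twice.
\<close>

lemma (in prob_space) second_order_identity:
  fixes a0 a1 :: "nat \<Rightarrow> 'a \<Rightarrow> real" and g0 g1 F G :: "'a \<Rightarrow> real"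
  assumes s: "\<And>n. s n > 0" "s \<longlonglongrightarrow> 0"
    and meas: "\<And>n. a0 n \<in> borel_measurable M" "\<And>n. a1 n \<in> borel_measurable M"
    and one: "\<And>n. integrable M (\<lambda>x. exp (a0 n x))" "\<And>n. expectation (\<lambda>x. exp (a0 n x)) = 1"
       "\<And>n. integrable M (\<lambda>x. exp (a1 n x))" "\<And>n. expectation (\<lambda>x. exp (a1 n x)) = 1"
    and g: "g0 \<in> borel_measurable M" "integrable M (\<lambda>x. (g0 x)\<^sup>2)"
       "g1 \<in> borel_measurable M" "integrable M (\<lambda>x. (g1 x)\<^sup>2)"
    and qmd0: "(\<lambda>n. expectation (\<lambda>x. ((exp (a0 n x / 2) - 1) / s n - g0 x / 2)\<^sup>2)) \<longlonglongrightarrow> 0"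
    and qmd1: "(\<lambda>n. expectation (\<lambda>x. ((exp (a1 n x / 2) - 1) / s n - g1 x / 2)\<^sup>2)) \<longlonglongrightarrow> 0"
    and G: "G \<in> borel_measurable M" "integrable M (\<lambda>x. (G x)\<^sup>2)" "\<And>x. x \<in> space M \<Longrightarrow> 0 \<le> G x"
    and F: "integrable M F" "\<And>x. x \<in> space M \<Longrightarrow> 0 \<le> F x"
    and diff: "\<And>n x. x \<in> space M \<Longrightarrow> \<bar>a1 n x - a0 n x\<bar> \<le> s n * G x + (s n)\<^sup>2 * F x"
  shows "(\<lambda>n. expectation (\<lambda>x. a1 n x - a0 n x) / (s n)\<^sup>2) \<longlonglongrightarrow>
           - (expectation (\<lambda>x. (g1 x)\<^sup>2) - expectation (\<lambda>x. (g0 x)\<^sup>2)) / 2"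
proof -
  note [measurable] = meas g(1,3) G(1)
  have [measurable]: "F \<in> borel_measurable M" using F(1) by simp
  define w where "w a x = exp (a x / 2) - 1" for a :: "'a \<Rightarrow> real" and x
  have w_gt: "w a x > - 1" for a x by (simp add: w_def)
  have ln_w: "2 * ln (1 + w a x) = a x" for a x by (simp add: w_def)
  have sq: "(1 + w a x)\<^sup>2 = exp (a x)" for a x
    by (simp add: w_def exp_double[symmetric])
  have side: "(\<forall>n. integrable M (\<lambda>x. (w (a n) x)\<^sup>2)) \<and> (\<forall>n. integrable M (w (a n))) \<and>
      (\<forall>n. integrable M (\<lambda>x. (w (a n) x / s n - u x / 2)\<^sup>2)) \<and>
      (\<forall>n. expectation (w (a n)) = - expectation (\<lambda>x. (w (a n) x)\<^sup>2) / 2) \<and>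
      (\<lambda>n. expectation (\<lambda>x. (w (a n) x)\<^sup>2) / (s n)\<^sup>2) \<longlonglongrightarrow> expectation (\<lambda>x. (u x)\<^sup>2) / 4 \<and>
      (\<lambda>n. expectation (\<lambda>x. \<bar>w (a n) x\<bar>)) \<longlonglongrightarrow> 0"
    if [measurable]: "\<And>n. a n \<in> borel_measurable M" "u \<in> borel_measurable M"
      and one: "\<And>n. integrable M (\<lambda>x. exp (a n x))" "\<And>n. expectation (\<lambda>x. exp (a n x)) = 1"
      and u: "integrable M (\<lambda>x. (u x)\<^sup>2)"
      and qmd: "(\<lambda>n. expectation (\<lambda>x. ((exp (a n x / 2) - 1) / s n - u x / 2)\<^sup>2)) \<longlonglongrightarrow> 0"
    for a :: "nat \<Rightarrow> 'a \<Rightarrow> real" and u :: "'a \<Rightarrow> real"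
  proof -
    have [measurable]: "w (a n) \<in> borel_measurable M" for n unfolding w_def by measurable
    have i1: "integrable M (\<lambda>x. (1 + w (a n) x)\<^sup>2)" for n unfolding sq by (rule one)
    then have i2: "integrable M (\<lambda>x. 1 + w (a n) x)" for n by (rule integrable_of_square) simp
    have iw: "integrable M (w (a n))" for n
      using Bochner_Integration.integrable_diff[OF i2[of n] integrable_const[of 1]] by simp
    have "(\<lambda>x. (1 + w (a n) x)\<^sup>2 - 1 - 2 * w (a n) x) = (\<lambda>x. (w (a n) x)\<^sup>2)" for n
      by (auto simp: power2_eq_square algebra_simps)
    moreover have "integrable M (\<lambda>x. (1 + w (a n) x)\<^sup>2 - 1 - 2 * w (a n) x)" for n
      using i1 iw by auto
    ultimately have iw2: "integrable M (\<lambda>x. (w (a n) x)\<^sup>2)" for n by metis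
    have "expectation (\<lambda>x. (1 + w (a n) x)\<^sup>2) = 1 + 2 * expectation (w (a n)) + expectation (\<lambda>x. (w (a n) x)\<^sup>2)" for n
    proof -
      have "expectation (\<lambda>x. (1 + w (a n) x)\<^sup>2) = expectation (\<lambda>x. 1 + 2 * w (a n) x + (w (a n) x)\<^sup>2)"
        by (rule Bochner_Integration.integral_cong) (auto simp: power2_eq_square algebra_simps)
      then show ?thesis using iw iw2 by (simp add: prob_space)
    qed
    then have mean: "expectation (w (a n)) = - expectation (\<lambda>x. (w (a n) x)\<^sup>2) / 2" for n
      using one(2)[of n] unfolding sq by (simp add: field_simps)
    have iv: "integrable M (\<lambda>x. (w (a n) x / s n)\<^sup>2)" for n
      using iw2[of n] by (simp add: power_divide)
    have iu: "integrable M (\<lambda>x. (u x / 2)\<^sup>2)" using u by (simp add: power_divide)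
    have ir: "integrable M (\<lambda>x. (w (a n) x / s n - u x / 2)\<^sup>2)" for n
      unfolding power2_diff mult.assoc[of 2]
      by (intro Bochner_Integration.integrable_diff Bochner_Integration.integrable_add
            integrable_mult_right integrable_mult_of_squares iv iu) auto
    have lim: "(\<lambda>n. expectation (\<lambda>x. (w (a n) x / s n - u x / 2)\<^sup>2)) \<longlonglongrightarrow> 0"
      using qmd by (simp add: w_def)
    from integral_square_limit[OF iu _ iv _ this]
    have "(\<lambda>n. expectation (\<lambda>x. (w (a n) x / s n)\<^sup>2)) \<longlonglongrightarrow> expectation (\<lambda>x. (u x / 2)\<^sup>2)" by simp
    then have l2: "(\<lambda>n. expectation (\<lambda>x. (w (a n) x)\<^sup>2) / (s n)\<^sup>2) \<longlonglongrightarrow> expectation (\<lambda>x. (u x)\<^sup>2) / 4"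
      by (simp add: power_divide)
    have "(\<lambda>n. expectation (\<lambda>x. \<bar>w (a n) x\<bar>)) \<longlonglongrightarrow> 0"
    proof (rule tendsto_sandwich)
      show "\<forall>\<^sub>F n in sequentially. 0 \<le> expectation (\<lambda>x. \<bar>w (a n) x\<bar>)" by simp
      show "\<forall>\<^sub>F n in sequentially. expectation (\<lambda>x. \<bar>w (a n) x\<bar>) \<le> s n * (1 + (expectation (\<lambda>x. (w (a n) x)\<^sup>2) / (s n)\<^sup>2))"
      proof (rule always_eventually, rule allI)
        fix n
        have "expectation (\<lambda>x. \<bar>w (a n) x\<bar>) \<le> expectation (\<lambda>x. s n * (1 + (w (a n) x / s n)\<^sup>2))"
        proof (rule integral_mono)
          fix x
          have "\<bar>w (a n) x / s n\<bar> \<le> 1 + (w (a n) x / s n)\<^sup>2"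
            by (rule abs_le_one_plus_square)
          then have "s n * \<bar>w (a n) x / s n\<bar> \<le> s n * (1 + (w (a n) x / s n)\<^sup>2)"
            using s(1)[of n] by (intro mult_left_mono) auto
          then show "\<bar>w (a n) x\<bar> \<le> s n * (1 + (w (a n) x / s n)\<^sup>2)" using s(1)[of n] by simp
        qed (use iw iv in auto)
        also have "\<dots> = s n * (1 + (expectation (\<lambda>x. (w (a n) x)\<^sup>2) / (s n)\<^sup>2))"
          using iv[of n] by (simp add: prob_space power_divide)
        finally show "expectation (\<lambda>x. \<bar>w (a n) x\<bar>) \<le> s n * (1 + (expectation (\<lambda>x. (w (a n) x)\<^sup>2) / (s n)\<^sup>2))" .
      qed
      show "(\<lambda>n. s n * (1 + (expectation (\<lambda>x. (w (a n) x)\<^sup>2) / (s n)\<^sup>2))) \<longlonglongrightarrow> 0"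
        using tendsto_mult[OF s(2) tendsto_add[OF tendsto_const[of 1] l2]] by simp
    qed simp
    then show ?thesis using iw2 iw ir mean l2 by blast
  qed
  have S0: "\<And>n. integrable M (\<lambda>x. (w (a0 n) x)\<^sup>2)" "\<And>n. integrable M (w (a0 n))"
      "\<And>n. integrable M (\<lambda>x. (w (a0 n) x / s n - g0 x / 2)\<^sup>2)"
      "\<And>n. expectation (w (a0 n)) = - expectation (\<lambda>x. (w (a0 n) x)\<^sup>2) / 2"
      "(\<lambda>n. expectation (\<lambda>x. (w (a0 n) x)\<^sup>2) / (s n)\<^sup>2) \<longlonglongrightarrow> expectation (\<lambda>x. (g0 x)\<^sup>2) / 4"
      "(\<lambda>n. expectation (\<lambda>x. \<bar>w (a0 n) x\<bar>)) \<longlonglongrightarrow> 0"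
    using side[of a0 g0, OF meas(1) g(1) one(1,2) g(2) qmd0] by blast+
  have S1: "\<And>n. integrable M (\<lambda>x. (w (a1 n) x)\<^sup>2)" "\<And>n. integrable M (w (a1 n))"
      "\<And>n. integrable M (\<lambda>x. (w (a1 n) x / s n - g1 x / 2)\<^sup>2)"
      "\<And>n. expectation (w (a1 n)) = - expectation (\<lambda>x. (w (a1 n) x)\<^sup>2) / 2"
      "(\<lambda>n. expectation (\<lambda>x. (w (a1 n) x)\<^sup>2) / (s n)\<^sup>2) \<longlonglongrightarrow> expectation (\<lambda>x. (g1 x)\<^sup>2) / 4"
      "(\<lambda>n. expectation (\<lambda>x. \<bar>w (a1 n) x\<bar>)) \<longlonglongrightarrow> 0"
    using side[of a1 g1, OF meas(2) g(3) one(3,4) g(4) qmd1] by blast+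
  have [measurable]: "w (a0 n) \<in> borel_measurable M" "w (a1 n) \<in> borel_measurable M" for n
    unfolding w_def by measurable
  \<comment> \<open>the bounded factor of the remainder, which vanishes in the mean\<close>
  define \<phi> where "\<phi> n x = min 1 (\<bar>w (a0 n) x\<bar> + \<bar>w (a1 n) x\<bar>)" for n x
  have \<phi>m[measurable]: "\<phi> n \<in> borel_measurable M" for n unfolding \<phi>_def by measurable
  have \<phi>01: "0 \<le> \<phi> n x" "\<phi> n x \<le> 1" for n x by (auto simp: \<phi>_def)
  have i\<phi>: "integrable M (\<phi> n)" for n
    by (rule integrable_const_bound[where B = 1]) (use \<phi>01 in auto)
  have \<phi>lim: "(\<lambda>n. expectation (\<phi> n)) \<longlonglongrightarrow> 0"
  proof (rule tendsto_sandwich)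
    show "\<forall>\<^sub>F n in sequentially. 0 \<le> expectation (\<phi> n)" by (simp add: \<phi>01)
    show "\<forall>\<^sub>F n in sequentially. expectation (\<phi> n) \<le> expectation (\<lambda>x. \<bar>w (a0 n) x\<bar>) + expectation (\<lambda>x. \<bar>w (a1 n) x\<bar>)"
    proof (rule always_eventually, rule allI)
      fix n
      have "expectation (\<phi> n) \<le> expectation (\<lambda>x. \<bar>w (a0 n) x\<bar> + \<bar>w (a1 n) x\<bar>)"
        by (rule integral_mono) (use S0 S1 i\<phi> in \<open>auto simp: \<phi>_def\<close>)
      then show "expectation (\<phi> n) \<le> expectation (\<lambda>x. \<bar>w (a0 n) x\<bar>) + expectation (\<lambda>x. \<bar>w (a1 n) x\<bar>)"
        using S0 S1 by simp
    qed
    show "(\<lambda>n. expectation (\<lambda>x. \<bar>w (a0 n) x\<bar>) + expectation (\<lambda>x. \<bar>w (a1 n) x\<bar>)) \<longlonglongrightarrow> 0"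
      using tendsto_add[OF S0(6) S1(6)] by simp
  qed simp
  define E where "E x = (g0 x)\<^sup>2 / 2 + (g1 x)\<^sup>2 / 2 + (G x)\<^sup>2 + F x" for x
  have iE: "integrable M E" unfolding E_def using g G F by auto
  have E0: "E x \<ge> 0" if "x \<in> space M" for x using F(2)[OF that] by (simp add: E_def)
  have iE\<phi>: "integrable M (\<lambda>x. E x * \<phi> n x)" for n
    by (rule Bochner_Integration.integrable_bound[OF iE])
       (use iE E0 \<phi>01 in \<open>auto simp: abs_mult mult_left_le\<close>)
  have limE: "(\<lambda>n. expectation (\<lambda>x. E x * \<phi> n x)) \<longlonglongrightarrow> 0"
    by (rule integral_mult_vanishing[OF iE E0 \<phi>m \<phi>01 \<phi>lim])
  \<comment> \<open>remainder of the second order expansion of the log ratio\<close>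
  define D where "D n x = (a1 n x - a0 n x) - (2 * w (a1 n) x - (w (a1 n) x)\<^sup>2) + (2 * w (a0 n) x - (w (a0 n) x)\<^sup>2)" for n x
  define R where "R a u n x = (w (a n) x / s n - u x / 2)\<^sup>2" for a :: "nat \<Rightarrow> 'a \<Rightarrow> real" and u n x
  have wR: "(w (a n) x)\<^sup>2 / (s n)\<^sup>2 \<le> 2 * R a u n x + (u x)\<^sup>2 / 2" for a :: "nat \<Rightarrow> 'a \<Rightarrow> real" and u n x
  proof -
    have "(w (a n) x / s n)\<^sup>2 \<le> 2 * (w (a n) x / s n - u x / 2)\<^sup>2 + 2 * (u x / 2)\<^sup>2"
      using zero_le_power2[of "w (a n) x / s n - u x / 2 - u x / 2"]
      by (simp add: power2_eq_square algebra_simps)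
    then show ?thesis by (simp add: R_def power_divide)
  qed
  have iR: "integrable M (R a0 g0 n)" "integrable M (R a1 g1 n)" for n
    using S0(3)[of n] S1(3)[of n] by (simp_all add: R_def[abs_def])
  have limR: "(\<lambda>n. expectation (R a0 g0 n)) \<longlonglongrightarrow> 0" "(\<lambda>n. expectation (R a1 g1 n)) \<longlonglongrightarrow> 0"
    using qmd0 qmd1 by (simp_all add: R_def[abs_def] w_def)
  have Dbound: "\<bar>D n x / (s n)\<^sup>2\<bar> \<le> 24 * (2 * R a0 g0 n x + 2 * R a1 g1 n x + E x * \<phi> n x)"
    if x: "x \<in> space M" for n x
  proof -
    have s2: "(s n)\<^sup>2 > 0" using s(1)[of n] by simp
    have "\<bar>D n x\<bar> \<le> 24 * (((w (a0 n) x)\<^sup>2 + (w (a1 n) x)\<^sup>2 + (s n)\<^sup>2 * ((G x)\<^sup>2 + F x)) * \<phi> n x)"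
      using log_difference_expansion[OF w_gt[of "a0 n" x] w_gt[of "a1 n" x] G(3)[OF x] F(2)[OF x], of "s n"] diff[OF x, of n]
      unfolding ln_w D_def \<phi>_def by simp
    then have "\<bar>D n x\<bar> / (s n)\<^sup>2 \<le> 24 * (((w (a0 n) x)\<^sup>2 + (w (a1 n) x)\<^sup>2 + (s n)\<^sup>2 * ((G x)\<^sup>2 + F x)) * \<phi> n x) / (s n)\<^sup>2"
      using s2 by (intro divide_right_mono) auto
    also have "\<dots> = 24 * (((w (a0 n) x)\<^sup>2 / (s n)\<^sup>2 + (w (a1 n) x)\<^sup>2 / (s n)\<^sup>2 + ((G x)\<^sup>2 + F x)) * \<phi> n x)"
    proof -
      have "24 * ((p + q + S * r) * t) / S = 24 * ((p / S + q / S + r) * t)" if "S > 0" for p q r t S :: real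
        using that by (simp add: field_simps)
      from this[OF s2] show ?thesis .
    qed
    also have "\<dots> \<le> 24 * ((2 * R a0 g0 n x + 2 * R a1 g1 n x + E x) * \<phi> n x)"
      using wR[of a0 n x g0] wR[of a1 n x g1] \<phi>01(1)[of n x]
      by (intro mult_left_mono mult_right_mono) (auto simp: E_def)
    also have "\<dots> \<le> 24 * (2 * R a0 g0 n x + 2 * R a1 g1 n x + E x * \<phi> n x)"
    proof -
      have "(2 * R a0 g0 n x + 2 * R a1 g1 n x) * \<phi> n x \<le> (2 * R a0 g0 n x + 2 * R a1 g1 n x)"
        using \<phi>01[of n x] by (intro mult_left_le) (auto simp: R_def)
      then show ?thesis by (simp add: distrib_right)
    qed
    finally show ?thesis by (simp add: abs_divide)
  qed
  have ia: "integrable M (\<lambda>x. a1 n x - a0 n x)" for n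
  proof (rule Bochner_Integration.integrable_bound)
    show "integrable M (\<lambda>x. s n * G x + (s n)\<^sup>2 * F x)"
      using integrable_of_square[OF G(2,1)] F(1) by auto
    show "AE x in M. norm (a1 n x - a0 n x) \<le> norm (s n * G x + (s n)\<^sup>2 * F x)"
      using diff[of _ n] by (intro AE_I2) (simp, smt (verit))
  qed simp
  have iD: "integrable M (D n)" for n
    unfolding D_def using ia S0 S1 by auto
  have limD: "(\<lambda>n. expectation (D n) / (s n)\<^sup>2) \<longlonglongrightarrow> 0"
  proof (rule Lim_null_comparison)
    show "\<forall>\<^sub>F n in sequentially. norm (expectation (D n) / (s n)\<^sup>2) \<le>
       24 * (2 * expectation (R a0 g0 n) + 2 * expectation (R a1 g1 n) + expectation (\<lambda>x. E x * \<phi> n x))"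
    proof (rule always_eventually, rule allI)
      fix n
      have "norm (expectation (D n) / (s n)\<^sup>2) = \<bar>expectation (\<lambda>x. D n x / (s n)\<^sup>2)\<bar>" by simp
      also have "\<dots> \<le> expectation (\<lambda>x. 24 * (2 * R a0 g0 n x + 2 * R a1 g1 n x + E x * \<phi> n x))"
        by (rule order_trans[OF integral_abs_bound integral_mono])
           (use iD iR iE\<phi> Dbound in auto)
      also have "\<dots> = 24 * (2 * expectation (R a0 g0 n) + 2 * expectation (R a1 g1 n) + expectation (\<lambda>x. E x * \<phi> n x))"
        using iR iE\<phi> by simp
      finally show "norm (expectation (D n) / (s n)\<^sup>2) \<le> \<dots>" .
    qed
    have "(\<lambda>n. 24 * (2 * expectation (R a0 g0 n) + 2 * expectation (R a1 g1 n) + expectation (\<lambda>x. E x * \<phi> n x))) \<longlonglongrightarrow> 24 * (2 * 0 + 2 * 0 + 0)"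
      by (intro tendsto_intros limR limE)
    then show "(\<lambda>n. 24 * (2 * expectation (R a0 g0 n) + 2 * expectation (R a1 g1 n) + expectation (\<lambda>x. E x * \<phi> n x))) \<longlonglongrightarrow> 0" by simp
  qed
  have "expectation (\<lambda>x. a1 n x - a0 n x) / (s n)\<^sup>2 = expectation (D n) / (s n)\<^sup>2
      - 2 * (expectation (\<lambda>x. (w (a1 n) x)\<^sup>2) / (s n)\<^sup>2) + 2 * (expectation (\<lambda>x. (w (a0 n) x)\<^sup>2) / (s n)\<^sup>2)" for n
  proof -
    have "expectation (D n) = expectation (\<lambda>x. a1 n x - a0 n x) - (2 * expectation (w (a1 n)) - expectation (\<lambda>x. (w (a1 n) x)\<^sup>2))
        + (2 * expectation (w (a0 n)) - expectation (\<lambda>x. (w (a0 n) x)\<^sup>2))"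
      unfolding D_def using ia[of n] S0(1,2)[of n] S1(1,2)[of n] by simp
    then have "expectation (\<lambda>x. a1 n x - a0 n x) = expectation (D n) - 2 * expectation (\<lambda>x. (w (a1 n) x)\<^sup>2) + 2 * expectation (\<lambda>x. (w (a0 n) x)\<^sup>2)"
      using S0(4)[of n] S1(4)[of n] by simp
    then show ?thesis by (simp add: diff_divide_distrib add_divide_distrib)
  qed
  moreover have "(\<lambda>n. expectation (D n) / (s n)\<^sup>2
      - 2 * (expectation (\<lambda>x. (w (a1 n) x)\<^sup>2) / (s n)\<^sup>2) + 2 * (expectation (\<lambda>x. (w (a0 n) x)\<^sup>2) / (s n)\<^sup>2))
     \<longlonglongrightarrow> 0 - 2 * (expectation (\<lambda>x. (g1 x)\<^sup>2) / 4) + 2 * (expectation (\<lambda>x. (g0 x)\<^sup>2) / 4)"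
    by (intro tendsto_intros limD S0(5) S1(5))
  moreover have "0 - 2 * (expectation (\<lambda>x. (g1 x)\<^sup>2) / 4) + 2 * (expectation (\<lambda>x. (g0 x)\<^sup>2) / 4)
      = - (expectation (\<lambda>x. (g1 x)\<^sup>2) - expectation (\<lambda>x. (g0 x)\<^sup>2)) / 2" by (simp add: field_simps)
  ultimately show ?thesis by (simp only:)
qed


section \<open>Submodel log-likelihoods with integrable envelopes\<close>

text \<open>
  \<open>N\<close> is a neighbourhood of \<open>\<eta>0\<close> in the nuisance class, and \<open>\<delta>\<close> is the radius of the ball
  around \<open>\<theta>0\<close> on which the derivatives exist and have the envelope \<open>F\<close>. Measurability is
  required of \<open>f\<close>; its derivatives inherit it as limits of difference quotients.
\<close>

locale smooth_loglik = prob_space P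
  for P :: "'x measure" +
  fixes N :: "'h set" and f :: "real^'d \<Rightarrow> real^'d \<Rightarrow> 'h \<Rightarrow> 'x \<Rightarrow> real"
    and D10 :: "real^'d \<Rightarrow> real^'d \<Rightarrow> 'h \<Rightarrow> 'x \<Rightarrow> real^'d"
    and D20 D11 :: "real^'d \<Rightarrow> real^'d \<Rightarrow> 'h \<Rightarrow> 'x \<Rightarrow> real^'d^'d"
    and D30 D12 D21 :: "real^'d \<Rightarrow> real^'d \<Rightarrow> 'h \<Rightarrow> 'x \<Rightarrow> real^'d^'d^'d"
    and \<theta>0 :: "real^'d" and \<eta>0 :: 'h and \<delta> :: real and F :: "'x \<Rightarrow> real"
  assumes \<delta>_pos: "\<delta> > 0"
    and envelope: "integrable P F"
    and eta0_N: "\<eta>0 \<in> N"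
    and f_measurable: "\<And>t \<theta> \<eta>. t \<in> ball \<theta>0 \<delta> \<Longrightarrow> \<theta> \<in> ball \<theta>0 \<delta> \<Longrightarrow> \<eta> \<in> N \<Longrightarrow> f t \<theta> \<eta> \<in> borel_measurable P"
    and deriv: "\<And>t \<theta> \<eta> x. t \<in> ball \<theta>0 \<delta> \<Longrightarrow> \<theta> \<in> ball \<theta>0 \<delta> \<Longrightarrow> \<eta> \<in> N \<Longrightarrow> x \<in> space P \<Longrightarrow>
        ((\<lambda>u. f u \<theta> \<eta> x) has_derivative (\<lambda>h. D10 t \<theta> \<eta> x \<bullet> h)) (at t) \<and>
        ((\<lambda>u. D10 u \<theta> \<eta> x) has_derivative (\<lambda>h. D20 t \<theta> \<eta> x *v h)) (at t) \<and>
        ((\<lambda>u. D20 u \<theta> \<eta> x) has_derivative (\<lambda>h. \<chi> i j. D30 t \<theta> \<eta> x $ i $ j \<bullet> h)) (at t) \<and>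
        ((\<lambda>u. D10 t u \<eta> x) has_derivative (\<lambda>h. D11 t \<theta> \<eta> x *v h)) (at \<theta>) \<and>
        ((\<lambda>u. D11 t u \<eta> x) has_derivative (\<lambda>h. \<chi> i j. D12 t \<theta> \<eta> x $ i $ j \<bullet> h)) (at \<theta>) \<and>
        ((\<lambda>u. D20 t u \<eta> x) has_derivative (\<lambda>h. \<chi> i j. D21 t \<theta> \<eta> x $ i $ j \<bullet> h)) (at \<theta>)"
    and bound: "\<And>t \<theta> \<eta> x. t \<in> ball \<theta>0 \<delta> \<Longrightarrow> \<theta> \<in> ball \<theta>0 \<delta> \<Longrightarrow> \<eta> \<in> N \<Longrightarrow> x \<in> space P \<Longrightarrow>
        norm (D10 t \<theta> \<eta> x) \<le> F x \<and> norm (D20 t \<theta> \<eta> x) \<le> F x \<and>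
        norm (D30 t \<theta> \<eta> x) \<le> F x \<and> norm (D11 t \<theta> \<eta> x) \<le> F x \<and>
        norm (D12 t \<theta> \<eta> x) \<le> F x \<and> norm (D21 t \<theta> \<eta> x) \<le> F x"
begin

lemma centre: "\<theta>0 \<in> ball \<theta>0 \<delta>" using \<delta>_pos by simp

lemma F_nonneg: "x \<in> space P \<Longrightarrow> 0 \<le> F x"
  using bound[OF centre centre eta0_N, of x] norm_ge_zero order_trans by blast

lemma sub_ball: "t \<in> ball \<theta>0 \<delta> \<Longrightarrow> \<exists>r>0. ball t r \<subseteq> ball \<theta>0 \<delta>"
  using open_contains_ball by blast

lemma column: "((A :: real^'n^'m) *v axis j 1) $ i = A $ i $ j"
  by (simp add: matrix_vector_mult_basis column_def)

context
  fixes \<theta> \<eta> assumes th: "\<theta> \<in> ball \<theta>0 \<delta>" and et: "\<eta> \<in> N"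
begin

lemma D10_measurable: "t \<in> ball \<theta>0 \<delta> \<Longrightarrow> D10 t \<theta> \<eta> \<in> borel_measurable P"
proof -
  assume t: "t \<in> ball \<theta>0 \<delta>"
  obtain r where r: "r > 0" "ball t r \<subseteq> ball \<theta>0 \<delta>" using sub_ball[OF t] by blast
  have "(\<lambda>x. D10 t \<theta> \<eta> x \<bullet> b) \<in> borel_measurable P" for b
    by (rule measurable_directional_derivative[OF r(1), where g = "\<lambda>u. f u \<theta> \<eta>" and t = t and G = "\<lambda>x h. D10 t \<theta> \<eta> x \<bullet> h"])
       (use r f_measurable deriv th et t in auto)
  then show ?thesis by (subst borel_measurable_euclidean_space) blast
qed

lemma D20_measurable: "t \<in> ball \<theta>0 \<delta> \<Longrightarrow> D20 t \<theta> \<eta> \<in> borel_measurable P"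
proof -
  assume t: "t \<in> ball \<theta>0 \<delta>"
  obtain r where r: "r > 0" "ball t r \<subseteq> ball \<theta>0 \<delta>" using sub_ball[OF t] by blast
  have "(\<lambda>x. D20 t \<theta> \<eta> x *v b) \<in> borel_measurable P" for b
    by (rule measurable_directional_derivative[OF r(1), where g = "\<lambda>u. D10 u \<theta> \<eta>" and t = t and G = "\<lambda>x h. D20 t \<theta> \<eta> x *v h"])
       (use r D10_measurable deriv th et t in auto)
  from borel_measurable_vec_nth[OF this[of "axis _ 1"]] show ?thesis
    unfolding column by (intro borel_measurable_vecI)
qed

lemma D30_measurable: "t \<in> ball \<theta>0 \<delta> \<Longrightarrow> D30 t \<theta> \<eta> \<in> borel_measurable P"
proof -
  assume t: "t \<in> ball \<theta>0 \<delta>"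
  obtain r where r: "r > 0" "ball t r \<subseteq> ball \<theta>0 \<delta>" using sub_ball[OF t] by blast
  have "(\<lambda>x. \<chi> i j. D30 t \<theta> \<eta> x $ i $ j \<bullet> b) \<in> borel_measurable P" for b
    by (rule measurable_directional_derivative[OF r(1), where g = "\<lambda>u. D20 u \<theta> \<eta>" and t = t and G = "\<lambda>x h. \<chi> i j. D30 t \<theta> \<eta> x $ i $ j \<bullet> h"])
       (use r D20_measurable deriv th et t in auto)
  from borel_measurable_vec_nth[OF borel_measurable_vec_nth[OF this[of "axis _ 1"]]] show ?thesis
    by (intro borel_measurable_vecI) (simp add: inner_axis)
qed

end

lemma D11_measurable:
  assumes t: "t \<in> ball \<theta>0 \<delta>" and th: "\<theta> \<in> ball \<theta>0 \<delta>" and et: "\<eta> \<in> N"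
  shows "D11 t \<theta> \<eta> \<in> borel_measurable P"
proof -
  obtain r where r: "r > 0" "ball \<theta> r \<subseteq> ball \<theta>0 \<delta>" using sub_ball[OF th] by blast
  have "(\<lambda>x. D11 t \<theta> \<eta> x *v b) \<in> borel_measurable P" for b
    by (rule measurable_directional_derivative[OF r(1), where g = "\<lambda>u. D10 t u \<eta>" and t = \<theta> and G = "\<lambda>x h. D11 t \<theta> \<eta> x *v h"])
       (use r D10_measurable deriv th et t in auto)
  from borel_measurable_vec_nth[OF this[of "axis _ 1"]] show ?thesis
    unfolding column by (intro borel_measurable_vecI)
qed

lemma integrable_D:
  assumes t: "t \<in> ball \<theta>0 \<delta>" and th: "\<theta> \<in> ball \<theta>0 \<delta>" and et: "\<eta> \<in> N"
  shows "integrable P (D10 t \<theta> \<eta>)" "integrable P (D20 t \<theta> \<eta>)" "integrable P (D30 t \<theta> \<eta>)" "integrable P (D11 t \<theta> \<eta>)"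
  using D10_measurable[OF th et t] D20_measurable[OF th et t] D30_measurable[OF th et t] D11_measurable[OF t th et]
    bound[OF t th et]
  by (auto intro!: Bochner_Integration.integrable_bound[OF envelope] AE_I2 order_trans[OF _ abs_ge_self])

lemma integral_norm_le:
  fixes g :: "'x \<Rightarrow> 'b::{banach, second_countable_topology}"
  assumes "integrable P g" "\<And>x. x \<in> space P \<Longrightarrow> norm (g x) \<le> c * F x"
  shows "norm (\<integral>x. g x \<partial>P) \<le> c * (\<integral>x. F x \<partial>P)"
proof -
  have "norm (\<integral>x. g x \<partial>P) \<le> (\<integral>x. norm (g x) \<partial>P)" by (rule integral_norm_bound)
  also have "\<dots> \<le> (\<integral>x. c * F x \<partial>P)"
    by (rule integral_mono) (use assms envelope in auto)
  finally show ?thesis by simp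
qed

lemma integral_D30_bound:
  assumes "t \<in> ball \<theta>0 \<delta>" "\<theta> \<in> ball \<theta>0 \<delta>" "\<eta> \<in> N"
  shows "norm (\<integral>x. D30 t \<theta> \<eta> x \<partial>P) \<le> (\<integral>x. F x \<partial>P)"
  using integral_norm_le[OF integrable_D(3)[OF assms], of 1] bound[OF assms] by simp

lemma pointwise_lipschitz_\<theta>:
  assumes th: "\<theta> \<in> ball \<theta>0 \<delta>" "\<theta>' \<in> ball \<theta>0 \<delta>" and et: "\<eta> \<in> N" and x: "x \<in> space P"
  shows "norm (D20 \<theta>0 \<theta> \<eta> x - D20 \<theta>0 \<theta>' \<eta> x) \<le> F x * norm (\<theta> - \<theta>')"
    "norm (D11 \<theta>0 \<theta> \<eta> x - D11 \<theta>0 \<theta>' \<eta> x) \<le> F x * norm (\<theta> - \<theta>')"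
proof -
  have 1: "norm (\<chi> i j. D21 \<theta>0 u \<eta> x $ i $ j \<bullet> h) \<le> F x * norm h"
     "norm (\<chi> i j. D12 \<theta>0 u \<eta> x $ i $ j \<bullet> h) \<le> F x * norm h" if "u \<in> ball \<theta>0 \<delta>" for u h
    using bound[OF centre that et x]
    by (auto intro!: order_trans[OF norm_tensor_inner_le] mult_right_mono)
  show "norm (D20 \<theta>0 \<theta> \<eta> x - D20 \<theta>0 \<theta>' \<eta> x) \<le> F x * norm (\<theta> - \<theta>')"
    by (rule lipschitz_of_derivative_bound[of "ball \<theta>0 \<delta>" "\<lambda>u. D20 \<theta>0 u \<eta> x" "\<lambda>u h. \<chi> i j. D21 \<theta>0 u \<eta> x $ i $ j \<bullet> h"])
       (use 1 deriv[OF centre _ et x] th in auto)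
  show "norm (D11 \<theta>0 \<theta> \<eta> x - D11 \<theta>0 \<theta>' \<eta> x) \<le> F x * norm (\<theta> - \<theta>')"
    by (rule lipschitz_of_derivative_bound[of "ball \<theta>0 \<delta>" "\<lambda>u. D11 \<theta>0 u \<eta> x" "\<lambda>u h. \<chi> i j. D12 \<theta>0 u \<eta> x $ i $ j \<bullet> h"])
       (use 1 deriv[OF centre _ et x] th in auto)
qed

lemma integral_lipschitz_\<theta>:
  assumes th: "\<theta> \<in> ball \<theta>0 \<delta>" and et: "\<eta> \<in> N"
  shows "norm ((\<integral>x. D20 \<theta>0 \<theta> \<eta> x \<partial>P) - (\<integral>x. D20 \<theta>0 \<theta>0 \<eta> x \<partial>P)) \<le> norm (\<theta> - \<theta>0) * (\<integral>x. F x \<partial>P)"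
    "norm ((\<integral>x. D11 \<theta>0 \<theta> \<eta> x \<partial>P) - (\<integral>x. D11 \<theta>0 \<theta>0 \<eta> x \<partial>P)) \<le> norm (\<theta> - \<theta>0) * (\<integral>x. F x \<partial>P)"
  using integral_norm_le[of "\<lambda>x. D20 \<theta>0 \<theta> \<eta> x - D20 \<theta>0 \<theta>0 \<eta> x" "norm (\<theta> - \<theta>0)"]
    integral_norm_le[of "\<lambda>x. D11 \<theta>0 \<theta> \<eta> x - D11 \<theta>0 \<theta>0 \<eta> x" "norm (\<theta> - \<theta>0)"]
    integrable_D[OF centre th et] integrable_D[OF centre centre et] pointwise_lipschitz_\<theta>[OF th centre et]
  by (auto simp: mult.commute)

lemma integral_matrix_vector_inner:
  fixes A :: "'x \<Rightarrow> real^'d^'d"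
  assumes "integrable P A"
  shows "(\<integral>x. (A x *v v) \<bullet> u \<partial>P) = ((\<integral>x. A x \<partial>P) *v v) \<bullet> u" "integrable P (\<lambda>x. (A x *v v) \<bullet> u)"
proof -
  have "linear (\<lambda>B :: real^'d^'d. (B *v v) \<bullet> u)"
    by (rule linearI) (simp_all add: matrix_vector_mult_add_rdistrib inner_add_left scaleR_matrix_vector_assoc[symmetric])
  then have bl: "bounded_linear (\<lambda>B :: real^'d^'d. (B *v v) \<bullet> u)" by (simp add: linear_conv_bounded_linear)
  show "(\<integral>x. (A x *v v) \<bullet> u \<partial>P) = ((\<integral>x. A x \<partial>P) *v v) \<bullet> u"
    by (rule integral_bounded_linear[OF bl assms])
  show "integrable P (\<lambda>x. (A x *v v) \<bullet> u)" by (rule integrable_bounded_linear[OF bl assms])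
qed

lemma D20_symmetric:
  "((\<integral>x. D20 \<theta>0 \<theta>0 \<eta>0 x \<partial>P) *v a) \<bullet> b = ((\<integral>x. D20 \<theta>0 \<theta>0 \<eta>0 x \<partial>P) *v b) \<bullet> a"
proof -
  have "(D20 \<theta>0 \<theta>0 \<eta>0 x *v a) \<bullet> b = (D20 \<theta>0 \<theta>0 \<eta>0 x *v b) \<bullet> a" if x: "x \<in> space P" for x
    by (rule symmetric_second_derivative[OF \<delta>_pos, where f = "\<lambda>u. f u \<theta>0 \<eta>0 x" and ?D1.0 = "\<lambda>u. D10 u \<theta>0 \<eta>0 x"
          and ?D2.0 = "\<lambda>u. D20 u \<theta>0 \<eta>0 x" and ?D3.0 = "\<lambda>u. D30 u \<theta>0 \<eta>0 x" and B = "F x"])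
       (use deriv[OF _ centre eta0_N x] bound[OF _ centre eta0_N x] in auto)
  then have "(\<integral>x. (D20 \<theta>0 \<theta>0 \<eta>0 x *v a) \<bullet> b \<partial>P) = (\<integral>x. (D20 \<theta>0 \<theta>0 \<eta>0 x *v b) \<bullet> a \<partial>P)"
    by (intro Bochner_Integration.integral_cong) auto
  then show ?thesis using integral_matrix_vector_inner(1)[OF integrable_D(2)[OF centre centre eta0_N]] by simp
qed

text \<open>
  Three expansions are combined, each with a remainder of order \<open>s\<^sup>3\<close>: the likelihood in \<open>t\<close> to
  third order at the base point \<open>\<theta>0 + s *\<^sub>R e'\<close>, the gradient at that base point to
  second order in the base point, and the Hessian to first order in it. The increments are
  taken in \<open>t\<close> only, since \<open>f\<close> itself is not assumed to be differentiable in the base point.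
\<close>

lemma mixed_expansion:
  assumes x: "x \<in> space P" and s: "0 < s" "s * (norm e + norm e') < \<delta>"
  shows "\<bar>f (\<theta>0 + s *\<^sub>R e) (\<theta>0 + s *\<^sub>R e') \<eta>0 x - f \<theta>0 (\<theta>0 + s *\<^sub>R e') \<eta>0 x - s * (D10 \<theta>0 \<theta>0 \<eta>0 x \<bullet> e)
     - s\<^sup>2 * ((D11 \<theta>0 \<theta>0 \<eta>0 x *v e') \<bullet> e + (D20 \<theta>0 \<theta>0 \<eta>0 x *v e) \<bullet> e / 2)\<bar>
    \<le> s ^ 3 * (3 * (norm e + norm e') ^ 3 * F x)"
proof -
  define c where "c = norm e + norm e'"
  have c: "norm e \<le> c" "norm e' \<le> c" "0 \<le> c" by (auto simp: c_def)
  have se: "s * norm e < \<delta>" "s * norm e' < \<delta>"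
    using s mult_left_mono[OF c(1), of s] mult_left_mono[OF c(2), of s] unfolding c_def by linarith+
  let ?t = "\<theta>0 + s *\<^sub>R e" and ?h = "\<theta>0 + s *\<^sub>R e'"
  have mem: "?t \<in> ball \<theta>0 \<delta>" "?h \<in> ball \<theta>0 \<delta>" using se s by (auto simp: dist_norm)
  have F0: "F x \<ge> 0" using F_nonneg x by simp
  have sp: "s > 0" by (rule s)
  have 1: "\<bar>f ?t ?h \<eta>0 x - f \<theta>0 ?h \<eta>0 x - s * (D10 \<theta>0 ?h \<eta>0 x \<bullet> e) - s\<^sup>2 * ((D20 \<theta>0 ?h \<eta>0 x *v e) \<bullet> e / 2)\<bar> \<le> s ^ 3 * (F x * c ^ 3)"
  proof -
    have "\<bar>f ?t ?h \<eta>0 x - f \<theta>0 ?h \<eta>0 x - D10 \<theta>0 ?h \<eta>0 x \<bullet> (?t - \<theta>0) - (D20 \<theta>0 ?h \<eta>0 x *v (?t - \<theta>0)) \<bullet> (?t - \<theta>0) / 2\<bar>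
        \<le> F x * norm (?t - \<theta>0) ^ 3"
      by (rule taylor_third_order[OF convex_ball centre mem(1), where ?D3.0 = "\<lambda>u. D30 u ?h \<eta>0 x"])
         (use deriv[OF _ mem(2) eta0_N x] bound[OF _ mem(2) eta0_N x] in auto)
    also have "\<dots> = s ^ 3 * (F x * norm e ^ 3)" using sp by (simp add: power_mult_distrib)
    also have "\<dots> \<le> s ^ 3 * (F x * c ^ 3)" using sp F0 c by (intro mult_left_mono power_mono) auto
    finally show ?thesis by (simp add: matrix_vector_mult_scaleR power2_eq_square mult.assoc)
  qed
  have "norm (D10 \<theta>0 ?h \<eta>0 x - D10 \<theta>0 \<theta>0 \<eta>0 x - D11 \<theta>0 \<theta>0 \<eta>0 x *v (?h - \<theta>0)) \<le> F x * (norm (?h - \<theta>0))\<^sup>2"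
    by (rule taylor_second_order[OF convex_ball centre mem(2), where ?D3.0 = "\<lambda>u. D12 \<theta>0 u \<eta>0 x" and ?D1.0 = "\<lambda>u. D10 \<theta>0 u \<eta>0 x" and ?D2.0 = "\<lambda>u. D11 \<theta>0 u \<eta>0 x"])
         (use deriv[OF centre _ eta0_N x] bound[OF centre _ eta0_N x] in auto)
  also have "\<dots> = s\<^sup>2 * (F x * (norm e')\<^sup>2)" using sp by (simp add: power_mult_distrib)
  also have "\<dots> \<le> s\<^sup>2 * (F x * c\<^sup>2)" using sp F0 c by (intro mult_left_mono power_mono) auto
  finally have "\<bar>(D10 \<theta>0 ?h \<eta>0 x - D10 \<theta>0 \<theta>0 \<eta>0 x - D11 \<theta>0 \<theta>0 \<eta>0 x *v (?h - \<theta>0)) \<bullet> e\<bar> \<le> s\<^sup>2 * (F x * c\<^sup>2) * c"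
    using F0 c by (intro order_trans[OF Cauchy_Schwarz_ineq2 mult_mono]) auto
  then have "\<bar>s * (D10 \<theta>0 ?h \<eta>0 x \<bullet> e - D10 \<theta>0 \<theta>0 \<eta>0 x \<bullet> e - s * ((D11 \<theta>0 \<theta>0 \<eta>0 x *v e') \<bullet> e))\<bar> \<le> s * (s\<^sup>2 * (F x * c\<^sup>2) * c)"
    unfolding abs_mult using sp by (intro mult_mono) (auto simp: matrix_vector_mult_scaleR inner_diff_left)
  then have 2: "\<bar>s * (D10 \<theta>0 ?h \<eta>0 x \<bullet> e) - s * (D10 \<theta>0 \<theta>0 \<eta>0 x \<bullet> e) - s\<^sup>2 * ((D11 \<theta>0 \<theta>0 \<eta>0 x *v e') \<bullet> e)\<bar> \<le> s ^ 3 * (F x * c ^ 3)"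
    by (simp add: power2_eq_square power3_eq_cube algebra_simps)
  have "norm ((D20 \<theta>0 ?h \<eta>0 x - D20 \<theta>0 \<theta>0 \<eta>0 x) *v e) \<le> (F x * (s * c)) * c"
  proof (rule order_trans[OF norm_matrix_vector_le mult_mono])
    have "norm (D20 \<theta>0 ?h \<eta>0 x - D20 \<theta>0 \<theta>0 \<eta>0 x) \<le> F x * (s * norm e')"
      using pointwise_lipschitz_\<theta>(1)[OF mem(2) centre eta0_N x] sp by simp
    also have "\<dots> \<le> F x * (s * c)" using F0 sp c by (intro mult_left_mono) auto
    finally show "norm (D20 \<theta>0 ?h \<eta>0 x - D20 \<theta>0 \<theta>0 \<eta>0 x) \<le> F x * (s * c)" .
  qed (use c F0 sp in auto)
  then have "\<bar>((D20 \<theta>0 ?h \<eta>0 x - D20 \<theta>0 \<theta>0 \<eta>0 x) *v e) \<bullet> e\<bar> \<le> (F x * (s * c)) * c * c"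
    using F0 c sp by (intro order_trans[OF Cauchy_Schwarz_ineq2 mult_mono]) auto
  then have "s\<^sup>2 / 2 * \<bar>((D20 \<theta>0 ?h \<eta>0 x - D20 \<theta>0 \<theta>0 \<eta>0 x) *v e) \<bullet> e\<bar> \<le> s\<^sup>2 * ((F x * (s * c)) * c * c)"
    using F0 c sp by (intro mult_mono) auto
  then have "\<bar>s\<^sup>2 / 2 * (((D20 \<theta>0 ?h \<eta>0 x - D20 \<theta>0 \<theta>0 \<eta>0 x) *v e) \<bullet> e)\<bar> \<le> s\<^sup>2 * ((F x * (s * c)) * c * c)"
    by (simp add: abs_mult)
  then have 3: "\<bar>s\<^sup>2 * ((D20 \<theta>0 ?h \<eta>0 x *v e) \<bullet> e / 2) - s\<^sup>2 * ((D20 \<theta>0 \<theta>0 \<eta>0 x *v e) \<bullet> e / 2)\<bar> \<le> s ^ 3 * (F x * c ^ 3)"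
    by (simp add: matrix_vector_mult_diff_rdistrib inner_diff_left power2_eq_square power3_eq_cube algebra_simps)
  have "\<bar>f ?t ?h \<eta>0 x - f \<theta>0 ?h \<eta>0 x - s * (D10 \<theta>0 \<theta>0 \<eta>0 x \<bullet> e)
     - s\<^sup>2 * ((D11 \<theta>0 \<theta>0 \<eta>0 x *v e') \<bullet> e + (D20 \<theta>0 \<theta>0 \<eta>0 x *v e) \<bullet> e / 2)\<bar> \<le> 3 * (s ^ 3 * (F x * c ^ 3))"
  proof -
    have arith: "\<bar>A - p' - (q + r')\<bar> \<le> 3 * B" if "\<bar>A - p - r\<bar> \<le> B" "\<bar>p - p' - q\<bar> \<le> B" "\<bar>r - r'\<bar> \<le> B" for A p p' q r r' B :: real
      using that by linarith
    show ?thesis using arith[OF 1 2 3] by (simp add: distrib_left)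
  qed
  also have "\<dots> = s ^ 3 * (3 * c ^ 3 * F x)" by simp
  finally show ?thesis unfolding c_def .
qed

text \<open>
  The path along which \<open>t\<close> and the base point both move is compared with the path along which
  only the base point moves. Their scores are \<open>D10 \<bullet> e + b \<bullet> e'\<close> and \<open>b \<bullet> e'\<close>. Divided by
  \<open>s\<^sup>2\<close>, the expected log ratio of the two densities tends to \<open>- 1 / 2\<close> times the difference of
  the second moments of the two scores, where the cross term vanishes by orthogonality. By
  Taylor expansion it also tends to the expected second order term, because the first order
  term has mean zero.
\<close>

lemma joint_information:
  assumes e_def: "c = norm e + norm e' + 1" and s_def: "s = (\<lambda>n. \<delta> / c * inverse (real (Suc (Suc n))))"
    and dens: "\<And>t \<theta>. t \<in> ball \<theta>0 \<delta> \<Longrightarrow> \<theta> \<in> ball \<theta>0 \<delta> \<Longrightarrow>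
        integrable P (\<lambda>x. exp (f t \<theta> \<eta>0 x - f \<theta>0 \<theta>0 \<eta>0 x)) \<and> expectation (\<lambda>x. exp (f t \<theta> \<eta>0 x - f \<theta>0 \<theta>0 \<eta>0 x)) = 1"
    and qmd1: "(\<lambda>n. expectation (\<lambda>x. ((exp ((f (\<theta>0 + s n *\<^sub>R e) (\<theta>0 + s n *\<^sub>R e') \<eta>0 x - f \<theta>0 \<theta>0 \<eta>0 x) / 2) - 1) / s n
           - (D10 \<theta>0 \<theta>0 \<eta>0 x \<bullet> e + b x \<bullet> e') / 2)\<^sup>2)) \<longlonglongrightarrow> 0"
    and qmd0: "(\<lambda>n. expectation (\<lambda>x. ((exp ((f \<theta>0 (\<theta>0 + s n *\<^sub>R e') \<eta>0 x - f \<theta>0 \<theta>0 \<eta>0 x) / 2) - 1) / s n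
           - (b x \<bullet> e') / 2)\<^sup>2)) \<longlonglongrightarrow> 0"
    and b: "b \<in> borel_measurable P" "integrable P (\<lambda>x. (b x \<bullet> e')\<^sup>2)"
    and sq: "integrable P (\<lambda>x. (D10 \<theta>0 \<theta>0 \<eta>0 x \<bullet> e)\<^sup>2)"
    and mean: "expectation (\<lambda>x. D10 \<theta>0 \<theta>0 \<eta>0 x \<bullet> e) = 0"
    and orth: "expectation (\<lambda>x. (D10 \<theta>0 \<theta>0 \<eta>0 x \<bullet> e) * (b x \<bullet> e')) = 0"
  shows "((\<integral>x. D11 \<theta>0 \<theta>0 \<eta>0 x \<partial>P) *v e') \<bullet> e + ((\<integral>x. D20 \<theta>0 \<theta>0 \<eta>0 x \<partial>P) *v e) \<bullet> e / 2
     = - expectation (\<lambda>x. (D10 \<theta>0 \<theta>0 \<eta>0 x \<bullet> e)\<^sup>2) / 2"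
proof -
  have c: "c \<ge> 1" "norm e \<le> c" "norm e' \<le> c" "norm e + norm e' \<le> c" by (auto simp: e_def)
  have s0: "s n > 0" for n using \<delta>_pos c by (simp add: s_def)
  have sc: "s n * c < \<delta>" for n
  proof -
    have "s n * c = \<delta> * inverse (real (Suc (Suc n)))" using c by (simp add: s_def)
    also have "\<dots> < \<delta> * 1" using \<delta>_pos by (intro mult_strict_left_mono) (auto simp: inverse_less_1_iff)
    finally show ?thesis by simp
  qed
  have slim: "s \<longlonglongrightarrow> 0"
    unfolding s_def by (intro tendsto_mult_right_zero LIMSEQ_Suc LIMSEQ_inverse_real_of_nat)
  \<comment> \<open>a bound for the step sizes, so that the cubic remainder is absorbed in the quadratic one\<close>
  define A where "A = \<delta> / c"
  have sA: "s n \<le> A" for n using \<delta>_pos c sc[of n] by (simp add: A_def field_simps)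
  have mem: "\<theta>0 + s n *\<^sub>R e \<in> ball \<theta>0 \<delta>" "\<theta>0 + s n *\<^sub>R e' \<in> ball \<theta>0 \<delta>" for n
  proof -
    have "s n * norm e < \<delta>" "s n * norm e' < \<delta>"
      using mult_left_mono[OF c(2), of "s n"] mult_left_mono[OF c(3), of "s n"] s0[of n] sc[of n] by linarith+
    then show "\<theta>0 + s n *\<^sub>R e \<in> ball \<theta>0 \<delta>" "\<theta>0 + s n *\<^sub>R e' \<in> ball \<theta>0 \<delta>"
      using s0[of n] by (auto simp: dist_norm)
  qed
  have sce: "s n * (norm e + norm e') < \<delta>" for n
    using mult_left_mono[OF c(4), of "s n"] s0[of n] sc[of n] by linarith
  define a1 where "a1 n x = f (\<theta>0 + s n *\<^sub>R e) (\<theta>0 + s n *\<^sub>R e') \<eta>0 x - f \<theta>0 \<theta>0 \<eta>0 x" for n x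
  define a0 where "a0 n x = f \<theta>0 (\<theta>0 + s n *\<^sub>R e') \<eta>0 x - f \<theta>0 \<theta>0 \<eta>0 x" for n x
  define S where "S x = D10 \<theta>0 \<theta>0 \<eta>0 x \<bullet> e" for x
  define Q where "Q x = (D11 \<theta>0 \<theta>0 \<eta>0 x *v e') \<bullet> e + (D20 \<theta>0 \<theta>0 \<eta>0 x *v e) \<bullet> e / 2" for x
  define T where "T x = 3 * (norm e + norm e') ^ 3 * F x" for x
  note [measurable] = b(1) D10_measurable[OF centre eta0_N centre]
  have Sm[measurable]: "S \<in> borel_measurable P" unfolding S_def by measurable
  have iS: "integrable P S" unfolding S_def using sq by (rule integrable_of_square) measurable
  have iQ: "integrable P Q" unfolding Q_def
    by (intro Bochner_Integration.integrable_add Bochner_Integration.integrable_divide integral_matrix_vector_inner integrable_D centre eta0_N)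
  have iT: "integrable P T" unfolding T_def using envelope by simp
  have T0: "T x \<ge> 0" if "x \<in> space P" for x using F_nonneg[OF that] by (simp add: T_def)
  have exp1: "\<bar>a1 n x - a0 n x - s n * S x - (s n)\<^sup>2 * Q x\<bar> \<le> s n ^ 3 * T x" if "x \<in> space P" for n x
    using mixed_expansion[OF that s0 sce, of n] unfolding a1_def a0_def S_def Q_def T_def by simp
  have EQ: "expectation Q = ((\<integral>x. D11 \<theta>0 \<theta>0 \<eta>0 x \<partial>P) *v e') \<bullet> e + ((\<integral>x. D20 \<theta>0 \<theta>0 \<eta>0 x \<partial>P) *v e) \<bullet> e / 2"
    unfolding Q_def using integral_matrix_vector_inner[OF integrable_D(2)[OF centre centre eta0_N]]
      integral_matrix_vector_inner[OF integrable_D(4)[OF centre centre eta0_N]] by simp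
  have a_meas[measurable]: "a0 n \<in> borel_measurable P" "a1 n \<in> borel_measurable P" for n
    unfolding a0_def a1_def using f_measurable[OF _ _ eta0_N] mem centre by auto
  have diff: "\<bar>a1 n x - a0 n x\<bar> \<le> s n * \<bar>S x\<bar> + (s n)\<^sup>2 * (\<bar>Q x\<bar> + A * T x)" if x: "x \<in> space P" for n x
  proof -
    have "s n ^ 3 * T x \<le> (s n)\<^sup>2 * (A * T x)"
      using sA[of n] T0[OF x] by (auto simp: power3_eq_cube power2_eq_square mult.assoc intro!: mult_left_mono mult_right_mono less_imp_le[OF s0])
    moreover have "\<bar>s n * S x\<bar> = s n * \<bar>S x\<bar>" "\<bar>(s n)\<^sup>2 * Q x\<bar> = (s n)\<^sup>2 * \<bar>Q x\<bar>"
      using s0[of n] by (auto simp: abs_mult)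
    ultimately show ?thesis using exp1[OF x, of n] unfolding distrib_left by linarith
  qed
  have "(\<lambda>n. expectation (\<lambda>x. a1 n x - a0 n x) / (s n)\<^sup>2) \<longlonglongrightarrow>
      - (expectation (\<lambda>x. (S x + b x \<bullet> e')\<^sup>2) - expectation (\<lambda>x. (b x \<bullet> e')\<^sup>2)) / 2"
  proof (rule second_order_identity[OF s0 slim, where G = "\<lambda>x. \<bar>S x\<bar>" and F = "\<lambda>x. \<bar>Q x\<bar> + A * T x"])
    show "integrable P (\<lambda>x. (S x + b x \<bullet> e')\<^sup>2)"
      unfolding power2_sum mult.assoc[of 2] using sq b
      by (intro Bochner_Integration.integrable_add integrable_mult_right integrable_mult_of_squares) (auto simp: S_def)
    show "integrable P (\<lambda>x. exp (a0 n x))" "expectation (\<lambda>x. exp (a0 n x)) = 1"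
      "integrable P (\<lambda>x. exp (a1 n x))" "expectation (\<lambda>x. exp (a1 n x)) = 1" for n
      using dens[OF centre mem(2)] dens[OF mem] by (auto simp: a0_def a1_def)
    show "(\<lambda>n. expectation (\<lambda>x. ((exp (a0 n x / 2) - 1) / s n - b x \<bullet> e' / 2)\<^sup>2)) \<longlonglongrightarrow> 0"
      using qmd0 by (simp add: a0_def)
    show "(\<lambda>n. expectation (\<lambda>x. ((exp (a1 n x / 2) - 1) / s n - (S x + b x \<bullet> e') / 2)\<^sup>2)) \<longlonglongrightarrow> 0"
      using qmd1 by (simp add: a1_def S_def)
    show "0 \<le> \<bar>Q x\<bar> + A * T x" if "x \<in> space P" for x using T0[OF that] \<delta>_pos c by (simp add: A_def)
  qed (use sq b iQ iT diff in \<open>auto simp: S_def\<close>)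
  moreover have "expectation (\<lambda>x. (S x + b x \<bullet> e')\<^sup>2) = expectation (\<lambda>x. (S x)\<^sup>2) + expectation (\<lambda>x. (b x \<bullet> e')\<^sup>2)"
  proof -
    have i: "integrable P (\<lambda>x. 2 * (S x * (b x \<bullet> e')))"
      using sq b by (intro integrable_mult_right integrable_mult_of_squares) (auto simp: S_def)
    have "expectation (\<lambda>x. (S x + b x \<bullet> e')\<^sup>2) = expectation (\<lambda>x. (S x)\<^sup>2 + (b x \<bullet> e')\<^sup>2 + 2 * (S x * (b x \<bullet> e')))"
      by (simp add: power2_sum mult.assoc)
    also have "\<dots> = expectation (\<lambda>x. (S x)\<^sup>2) + expectation (\<lambda>x. (b x \<bullet> e')\<^sup>2) + expectation (\<lambda>x. 2 * (S x * (b x \<bullet> e')))"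
      using sq b i by (simp add: S_def)
    also have "expectation (\<lambda>x. 2 * (S x * (b x \<bullet> e'))) = 0" using orth by (simp add: S_def)
    finally show ?thesis by simp
  qed
  ultimately have lim1: "(\<lambda>n. expectation (\<lambda>x. a1 n x - a0 n x) / (s n)\<^sup>2) \<longlonglongrightarrow> - expectation (\<lambda>x. (S x)\<^sup>2) / 2" by simp
  have "(\<lambda>n. expectation (\<lambda>x. a1 n x - a0 n x) / (s n)\<^sup>2 - expectation Q) \<longlonglongrightarrow> 0"
  proof (rule Lim_null_comparison)
    show "\<forall>\<^sub>F n in sequentially. norm (expectation (\<lambda>x. a1 n x - a0 n x) / (s n)\<^sup>2 - expectation Q) \<le> s n * expectation T"
    proof (rule always_eventually, rule allI)
      fix n
      have ia: "integrable P (\<lambda>x. a1 n x - a0 n x)"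
      proof (rule Bochner_Integration.integrable_bound)
        show "integrable P (\<lambda>x. s n * \<bar>S x\<bar> + (s n)\<^sup>2 * (\<bar>Q x\<bar> + A * T x))" using iS iQ iT by simp
        show "AE x in P. norm (a1 n x - a0 n x) \<le> norm (s n * \<bar>S x\<bar> + (s n)\<^sup>2 * (\<bar>Q x\<bar> + A * T x))"
          using diff[of _ n] by (intro AE_I2) (simp, meson abs_ge_self order_trans)
      qed simp
      let ?R = "\<lambda>x. a1 n x - a0 n x - s n * S x - (s n)\<^sup>2 * Q x"
      have "expectation ?R = expectation (\<lambda>x. a1 n x - a0 n x) - s n * expectation S - (s n)\<^sup>2 * expectation Q"
        using ia iS iQ by simp
      also have "expectation S = 0" using mean by (simp add: S_def[abs_def])
      finally have R: "expectation ?R = expectation (\<lambda>x. a1 n x - a0 n x) - (s n)\<^sup>2 * expectation Q" by simp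
      have "\<bar>expectation ?R\<bar> \<le> expectation (\<lambda>x. s n ^ 3 * T x)"
        by (rule order_trans[OF integral_abs_bound integral_mono]) (use ia iS iQ iT exp1 in auto)
      then have "\<bar>expectation ?R / (s n)\<^sup>2\<bar> \<le> s n ^ 3 * expectation T / (s n)\<^sup>2"
        using s0[of n] by (simp add: abs_divide divide_right_mono)
      also have "\<dots> = s n * expectation T" using s0[of n] by (simp add: power3_eq_cube power2_eq_square)
      finally show "norm (expectation (\<lambda>x. a1 n x - a0 n x) / (s n)\<^sup>2 - expectation Q) \<le> s n * expectation T"
        using s0[of n] by (simp add: R diff_divide_distrib)
    qed
    show "(\<lambda>n. s n * expectation T) \<longlonglongrightarrow> 0" using tendsto_mult_left_zero[OF slim] .
  qed
  then have "(\<lambda>n. expectation (\<lambda>x. a1 n x - a0 n x) / (s n)\<^sup>2) \<longlonglongrightarrow> expectation Q" by (rule LIM_zero_cancel)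
  from LIMSEQ_unique[OF this lim1] show ?thesis by (simp add: EQ S_def)
qed

end


section \<open>Information identities\<close>

lemma ennreal_divide_scale:
  assumes "s > 0" "c > 0"
  shows "N / ennreal s = N / ennreal (s * c) * ennreal c"
proof -
  have "inverse (ennreal (s * c)) * ennreal c = inverse (ennreal s)"
    using assms by (simp add: inverse_ennreal ennreal_mult[symmetric] del: ennreal_mult)
  then show ?thesis by (simp add: divide_ennreal_def mult.assoc)
qed

text \<open>
  This rewrites the integrand of quadratic mean differentiability as the density at the true
  value times the square of an increment of \<open>exp (a / 2)\<close>, where \<open>a\<close> is the log density ratio.
\<close>

lemma sqrt_density_increment:
  "(sqrt (exp y) - sqrt (exp y0) - z / 2 * sqrt (exp y0))\<^sup>2 = exp y0 * (exp ((y - y0) / 2) - 1 - z / 2)\<^sup>2" for y y0 z :: real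
proof -
  have sq: "sqrt (exp t) = exp (t / 2)" for t :: real
    by (rule real_sqrt_unique) (simp_all add: exp_double[symmetric])
  have "exp (y / 2) = exp (y0 / 2) * exp ((y - y0) / 2)"
    by (simp add: exp_add[symmetric] diff_divide_distrib)
  then have "exp (y / 2) - exp (y0 / 2) - z / 2 * exp (y0 / 2) = exp (y0 / 2) * (exp ((y - y0) / 2) - 1 - z / 2)"
    by (simp add: algebra_simps)
  moreover have "(exp (y0 / 2))\<^sup>2 = exp y0" by (simp add: exp_double[symmetric])
  ultimately show ?thesis unfolding sq by (simp add: power_mult_distrib)
qed

text \<open>
  Along one direction \<open>V\<close>, quadratic mean differentiability is convergence in mean square,
  under the law at \<open>v0\<close>, of the increments of the square root density ratio to half the score.
\<close>

lemma qmd_sequence: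
  fixes L :: "'v::euclidean_space \<Rightarrow> 'x \<Rightarrow> real"
  assumes qmd: "qmd \<mu> (\<lambda>v x. exp (L v x)) v0 UNIV g"
    and P: "P = density \<mu> (\<lambda>x. ennreal (exp (L v0 x)))" "prob_space P"
    and s: "\<And>n. s n > (0::real)" "s \<longlonglongrightarrow> 0"
    and meas: "L v0 \<in> borel_measurable \<mu>" "\<And>n. L (v0 + s n *\<^sub>R V) \<in> borel_measurable \<mu>"
    and one: "\<And>n. integrable P (\<lambda>x. exp (L (v0 + s n *\<^sub>R V) x - L v0 x))"
  shows "integrable P (\<lambda>x. (g x \<bullet> V)\<^sup>2) \<and>
    (\<lambda>n. \<integral>x. ((exp ((L (v0 + s n *\<^sub>R V) x - L v0 x) / 2) - 1) / s n - (g x \<bullet> V) / 2)\<^sup>2 \<partial>P) \<longlonglongrightarrow> 0"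
proof (cases "V = 0")
  case False
  interpret prob_space P by fact
  have gm: "g \<in> borel_measurable \<mu>" using qmd by (simp add: qmd_def)
  have sets: "borel_measurable P = (borel_measurable \<mu> :: ('x \<Rightarrow> real) set)"
     "borel_measurable P = (borel_measurable \<mu> :: ('x \<Rightarrow> 'v) set)"
    unfolding P(1) by (auto intro: measurable_cong_sets)
  define Y where "Y n x = (exp ((L (v0 + s n *\<^sub>R V) x - L v0 x) / 2) - 1) / s n - (g x \<bullet> V) / 2" for n x
  note [measurable] = meas gm
  have Ym[measurable]: "Y n \<in> borel_measurable \<mu>" for n unfolding Y_def by measurable
  let ?Q = "\<lambda>v. (\<integral>\<^sup>+x. ennreal ((sqrt (exp (L v x)) - sqrt (exp (L v0 x)) - (g x \<bullet> (v - v0)) / 2 * sqrt (exp (L v0 x)))\<^sup>2) \<partial>\<mu>) / ennreal ((norm (v - v0))\<^sup>2)"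
  have Qeq: "?Q (v0 + s n *\<^sub>R V) * ennreal ((norm V)\<^sup>2) = (\<integral>\<^sup>+x. ennreal ((Y n x)\<^sup>2) \<partial>P)" for n
  proof -
    have "(\<integral>\<^sup>+x. ennreal ((Y n x)\<^sup>2) \<partial>P) = (\<integral>\<^sup>+x. ennreal (exp (L v0 x)) * ennreal ((Y n x)\<^sup>2) \<partial>\<mu>)"
      unfolding P(1) by (intro nn_integral_density) auto
    also have "\<dots> = (\<integral>\<^sup>+x. inverse (ennreal ((s n)\<^sup>2)) * ennreal ((sqrt (exp (L (v0 + s n *\<^sub>R V) x)) - sqrt (exp (L v0 x)) - (g x \<bullet> (s n *\<^sub>R V)) / 2 * sqrt (exp (L v0 x)))\<^sup>2) \<partial>\<mu>)"
    proof (rule nn_integral_cong)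
      fix x
      have "exp ((L (v0 + s n *\<^sub>R V) x - L v0 x) / 2) - 1 - (g x \<bullet> (s n *\<^sub>R V)) / 2 = s n * Y n x"
        using s(1)[of n] by (simp add: Y_def field_simps)
      then show "ennreal (exp (L v0 x)) * ennreal ((Y n x)\<^sup>2) = inverse (ennreal ((s n)\<^sup>2)) * ennreal ((sqrt (exp (L (v0 + s n *\<^sub>R V) x)) - sqrt (exp (L v0 x)) - (g x \<bullet> (s n *\<^sub>R V)) / 2 * sqrt (exp (L v0 x)))\<^sup>2)"
        unfolding sqrt_density_increment using s(1)[of n]
        by (simp add: inverse_ennreal ennreal_mult[symmetric] power_mult_distrib field_simps del: ennreal_mult)
    qed
    also have "\<dots> = (\<integral>\<^sup>+x. ennreal ((sqrt (exp (L (v0 + s n *\<^sub>R V) x)) - sqrt (exp (L v0 x)) - (g x \<bullet> (s n *\<^sub>R V)) / 2 * sqrt (exp (L v0 x)))\<^sup>2) \<partial>\<mu>) / ennreal ((s n)\<^sup>2)"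
      by (subst nn_integral_cmult) (auto simp: divide_ennreal_def mult.commute)
    also have "\<dots> = ?Q (v0 + s n *\<^sub>R V) * ennreal ((norm V)\<^sup>2)"
      using s(1)[of n] False
      by (subst ennreal_divide_scale[of "(s n)\<^sup>2" "(norm V)\<^sup>2"]) (auto simp: power_mult_distrib)
    finally show ?thesis ..
  qed
  have "filterlim (\<lambda>n. v0 + s n *\<^sub>R V) (at v0) sequentially"
    unfolding filterlim_at
  proof
    have "(\<lambda>n. v0 + s n *\<^sub>R V) \<longlonglongrightarrow> v0 + 0 *\<^sub>R V" by (intro tendsto_intros s)
    then show "(\<lambda>n. v0 + s n *\<^sub>R V) \<longlonglongrightarrow> v0" by simp
    show "\<forall>\<^sub>F n in sequentially. v0 + s n *\<^sub>R V \<in> UNIV \<and> v0 + s n *\<^sub>R V \<noteq> v0"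
      using s(1) False by (auto intro!: always_eventually simp: less_imp_neq[THEN not_sym])
  qed
  moreover have "(?Q \<longlongrightarrow> 0) (at v0)" using qmd unfolding qmd_def by blast
  ultimately have "(\<lambda>n. ?Q (v0 + s n *\<^sub>R V)) \<longlonglongrightarrow> 0"
    by (rule filterlim_compose[rotated])
  then have "(\<lambda>n. ?Q (v0 + s n *\<^sub>R V) * ennreal ((norm V)\<^sup>2)) \<longlonglongrightarrow> 0 * ennreal ((norm V)\<^sup>2)"
    by (intro tendsto_mult_ennreal tendsto_const) auto
  then have lim: "(\<lambda>n. \<integral>\<^sup>+x. ennreal ((Y n x)\<^sup>2) \<partial>P) \<longlonglongrightarrow> 0" unfolding Qeq by simp
  have sqexp: "(exp (y / 2))\<^sup>2 = exp y" for y :: real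
    by (simp add: power2_eq_square exp_add[symmetric])
  have iW: "integrable P (\<lambda>x. ((exp ((L (v0 + s n *\<^sub>R V) x - L v0 x) / 2) - 1) / s n)\<^sup>2)" for n
  proof -
    have *: "integrable P (\<lambda>x. (exp ((L (v0 + s n *\<^sub>R V) x - L v0 x) / 2))\<^sup>2)"
      using one[of n] unfolding sqexp .
    have m: "(\<lambda>x. exp ((L (v0 + s n *\<^sub>R V) x - L v0 x) / 2)) \<in> borel_measurable P" unfolding sets by measurable
    have "integrable P (\<lambda>x. (exp ((L (v0 + s n *\<^sub>R V) x - L v0 x) / 2) - 1)\<^sup>2)"
      unfolding power2_diff using * integrable_of_square[OF * m] by simp
    then show ?thesis by (simp add: power_divide)
  qed
  from order_tendstoD(2)[OF lim, of 1] obtain n0 where "(\<integral>\<^sup>+x. ennreal ((Y n0 x)\<^sup>2) \<partial>P) < 1"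
    by (auto simp: eventually_sequentially)
  then have iY0: "integrable P (\<lambda>x. (Y n0 x)\<^sup>2)"
    by (intro integrableI_nonneg) (auto simp: sets intro: order.strict_trans)
  have diffsq: "integrable P (\<lambda>x. (a x - b x)\<^sup>2)"
    if "integrable P (\<lambda>x. (a x)\<^sup>2)" "integrable P (\<lambda>x. (b x)\<^sup>2)" "a \<in> borel_measurable \<mu>" "b \<in> borel_measurable \<mu>" for a b :: "'x \<Rightarrow> real"
    unfolding power2_diff mult.assoc[of 2] using that
    by (intro Bochner_Integration.integrable_diff Bochner_Integration.integrable_add
            integrable_mult_right integrable_mult_of_squares) (auto simp: sets)
  have "integrable P (\<lambda>x. (((exp ((L (v0 + s n0 *\<^sub>R V) x - L v0 x) / 2) - 1) / s n0) - Y n0 x)\<^sup>2)"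
    by (rule diffsq[OF iW iY0]) measurable
  then have "integrable P (\<lambda>x. ((g x \<bullet> V) / 2)\<^sup>2)" by (simp add: Y_def)
  then have "integrable P (\<lambda>x. 4 * ((g x \<bullet> V) / 2)\<^sup>2)" by (rule integrable_mult_right)
  then have ig: "integrable P (\<lambda>x. (g x \<bullet> V)\<^sup>2)" by (simp add: power_divide)
  have iY: "integrable P (\<lambda>x. (Y n x)\<^sup>2)" for n
    unfolding Y_def by (rule diffsq[OF iW]) (use ig in \<open>auto simp: power_divide\<close>)
  have "(\<lambda>n. \<integral>x. (Y n x)\<^sup>2 \<partial>P) \<longlonglongrightarrow> 0"
  proof -
    have "ennreal (\<integral>x. (Y n x)\<^sup>2 \<partial>P) = (\<integral>\<^sup>+x. ennreal ((Y n x)\<^sup>2) \<partial>P)" for n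
      by (rule nn_integral_eq_integral[symmetric, OF iY]) auto
    then have "(\<lambda>n. ennreal (\<integral>x. (Y n x)\<^sup>2 \<partial>P)) \<longlonglongrightarrow> ennreal 0" using lim by simp
    then show ?thesis by (subst (asm) tendsto_ennreal_iff) auto
  qed
  then show ?thesis using ig unfolding Y_def by simp
qed simp

text \<open>
  When only the second component of the parameter moves, the score is the second component of
  the joint score. For the submodel this component moves the base point at fixed \<open>t\<close>, so that
  only the nuisance parameter changes.
\<close>

lemma qmd_along_ray:
  fixes L :: "'u::euclidean_space \<times> 'v::euclidean_space \<Rightarrow> 'x \<Rightarrow> real"
  assumes qmd: "qmd \<mu> (\<lambda>v x. exp (L v x)) (u0, v0) UNIV (\<lambda>x. (a x, b x))"
    and p: "\<And>s. 0 \<le> s \<Longrightarrow> s < r \<Longrightarrow> p s = L (u0, v0 + s *\<^sub>R e)" and r: "r > 0" and e: "e \<noteq> 0"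
  shows "qmd \<mu> (\<lambda>s x. exp (p s x)) (0::real) {0..} (\<lambda>x. b x \<bullet> e)"
  unfolding qmd_def
proof
  have "(\<lambda>x. (a x, b x)) \<in> borel_measurable \<mu>" using qmd by (simp add: qmd_def)
  then have "(\<lambda>x. snd (a x, b x)) \<in> borel_measurable \<mu>"
    by (rule measurable_compose) (intro borel_measurable_continuous_onI continuous_intros)
  then show "(\<lambda>x. b x \<bullet> e) \<in> borel_measurable \<mu>" by simp
  let ?g = "\<lambda>x. (a x, b x)" and ?c = "(u0, v0)"
  let ?Q = "\<lambda>v. (\<integral>\<^sup>+x. ennreal ((sqrt (exp (L v x)) - sqrt (exp (L ?c x)) - (?g x \<bullet> (v - ?c)) / 2 * sqrt (exp (L ?c x)))\<^sup>2) \<partial>\<mu>) / ennreal ((norm (v - ?c))\<^sup>2)"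
  let ?v = "\<lambda>s. (u0, v0 + s *\<^sub>R e)"
  have "filterlim ?v (at ?c) (at 0 within {0..})"
    unfolding filterlim_at
  proof
    have "(?v \<longlongrightarrow> (u0, v0 + 0 *\<^sub>R e)) (at 0 within {0..})" by (intro tendsto_intros)
    then show "(?v \<longlongrightarrow> ?c) (at 0 within {0..})" by simp
    show "\<forall>\<^sub>F s in at 0 within {0..}. ?v s \<in> UNIV \<and> ?v s \<noteq> ?c"
      using e by (auto simp: eventually_at_filter)
  qed
  moreover have "(?Q \<longlongrightarrow> 0) (at ?c)" using qmd unfolding qmd_def by blast
  ultimately have "((\<lambda>s. ?Q (?v s)) \<longlongrightarrow> 0) (at 0 within {0..})"
    by (rule filterlim_compose[rotated])
  then have "((\<lambda>s. ?Q (?v s) * ennreal ((norm e)\<^sup>2)) \<longlongrightarrow> 0 * ennreal ((norm e)\<^sup>2)) (at 0 within {0..})"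
    by (intro tendsto_mult_ennreal tendsto_const) auto
  then have "((\<lambda>s. ?Q (?v s) * ennreal ((norm e)\<^sup>2)) \<longlongrightarrow> 0) (at 0 within {0..})" by simp
  moreover have "\<forall>\<^sub>F s in at 0 within {0..}. ?Q (?v s) * ennreal ((norm e)\<^sup>2) =
      (\<integral>\<^sup>+ x. ennreal ((sqrt (exp (p s x)) - sqrt (exp (p 0 x)) - (b x \<bullet> e) \<bullet> (s - 0) / 2 * sqrt (exp (p 0 x)))\<^sup>2) \<partial>\<mu>) / ennreal ((norm (s - 0))\<^sup>2)"
  proof -
    have "\<forall>\<^sub>F s in at 0 within {0..}. 0 < s \<and> s < r"
      using r by (auto simp: eventually_at dist_real_def intro!: exI[of _ r])
    then show ?thesis
    proof eventually_elim
      case (elim s)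
      have "?Q (?v s) * ennreal ((norm e)\<^sup>2) =
        (\<integral>\<^sup>+x. ennreal ((sqrt (exp (L (?v s) x)) - sqrt (exp (L ?c x)) - (?g x \<bullet> (?v s - ?c)) / 2 * sqrt (exp (L ?c x)))\<^sup>2) \<partial>\<mu>) / ennreal (s\<^sup>2)"
        using elim e by (subst ennreal_divide_scale[of "s\<^sup>2" "(norm e)\<^sup>2"]) (auto simp: power_mult_distrib)
      then show ?case using elim p[of s] p[of 0] r by (simp add: mult.commute)
    qed
  qed
  ultimately show "((\<lambda>s. (\<integral>\<^sup>+ x. ennreal ((sqrt (exp (p s x)) - sqrt (exp (p 0 x)) - (b x \<bullet> e) \<bullet> (s - 0) / 2 * sqrt (exp (p 0 x)))\<^sup>2) \<partial>\<mu>) / ennreal ((norm (s - 0))\<^sup>2)) \<longlongrightarrow> 0) (at 0 within {0..})"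
    by (rule Lim_transform_eventually)
qed

context smooth_loglik
begin

text \<open>
  For a direction \<open>e'\<close> of the base point, the map \<open>s \<mapsto> sub \<theta>0 (\<theta>0 + s *\<^sub>R e')
  \<eta>0\<close> is a path in the nuisance class with score \<open>b \<bullet> e'\<close>, to which the efficient score is
  orthogonal. This makes \<open>joint_information\<close> applicable in all directions. With \<open>e' = 0\<close> it
  gives the quadratic form of the mean Hessian, then the mean mixed derivative is zero, and
  symmetry of the Hessian recovers the matrix from its quadratic form.
\<close>

lemma information_identities:
  fixes H :: "'h set"
  assumes P_eq: "P = model_law \<mu> ll \<theta>0 \<eta>0" and f_eq: "f = submodel_loglik ll sub"
    and model: "semiparametric_model \<mu> \<Theta> H ll"
    and ball: "ball \<theta>0 \<delta> \<subseteq> \<Theta>" and NH: "N \<subseteq> H"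
    and sub: "\<And>t \<theta> \<eta>. t \<in> ball \<theta>0 \<delta> \<Longrightarrow> \<theta> \<in> ball \<theta>0 \<delta> \<Longrightarrow> \<eta> \<in> N \<Longrightarrow> sub t \<theta> \<eta> \<in> H \<and> sub \<theta> \<theta> \<eta> = \<eta>"
    and lf: "least_favorable \<mu> \<Theta> H ll \<theta>0 \<eta>0 sub D10 ltilde"
    and mean: "(\<integral>x. D10 \<theta>0 \<theta>0 \<eta>0 x \<partial>P) = 0"
  shows "(\<integral>x. D20 \<theta>0 \<theta>0 \<eta>0 x \<partial>P) = - cov_matrix P ltilde"
    and "(\<integral>x. D11 \<theta>0 \<theta>0 \<eta>0 x \<partial>P) = 0"
    and "integrable P (\<lambda>x. (norm (D10 \<theta>0 \<theta>0 \<eta>0 x))\<^sup>2)"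
proof -
  let ?D = "D10 \<theta>0 \<theta>0 \<eta>0"
  let ?L = "\<lambda>(t, \<theta>). f t \<theta> \<eta>0"
  have setsP: "sets P = sets \<mu>" unfolding P_eq model_law_def by simp
  have sets: "\<And>g :: 'x \<Rightarrow> real. g \<in> borel_measurable P \<longleftrightarrow> g \<in> borel_measurable \<mu>"
     "\<And>g :: 'x \<Rightarrow> real^'d. g \<in> borel_measurable P \<longleftrightarrow> g \<in> borel_measurable \<mu>"
    by (simp_all add: measurable_cong_sets[OF setsP refl])
  have f0: "f \<theta>0 \<theta>0 \<eta>0 = ll \<theta>0 \<eta>0"
    using sub[OF centre centre eta0_N] by (simp add: f_eq submodel_loglik_def)
  have P_dens: "P = density \<mu> (\<lambda>x. ennreal (exp (?L (\<theta>0, \<theta>0) x)))"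
    by (simp add: f0 P_eq model_law_def)
  have fm: "f t \<theta> \<eta>0 \<in> borel_measurable \<mu>" if "t \<in> ball \<theta>0 \<delta>" "\<theta> \<in> ball \<theta>0 \<delta>" for t \<theta>
    using f_measurable[OF that eta0_N] by (simp add: sets)
  have dens: "integrable P (\<lambda>x. exp (f t \<theta> \<eta>0 x - f \<theta>0 \<theta>0 \<eta>0 x)) \<and> expectation (\<lambda>x. exp (f t \<theta> \<eta>0 x - f \<theta>0 \<theta>0 \<eta>0 x)) = 1"
    if th: "t \<in> ball \<theta>0 \<delta>" "\<theta> \<in> ball \<theta>0 \<delta>" for t \<theta>
  proof -
    note [measurable] = fm[OF th] fm[OF centre centre]
    have law: "prob_space (model_law \<mu> ll t (sub t \<theta> \<eta>0))"
      using model th ball sub[OF th eta0_N] unfolding semiparametric_model_def by blast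
    have "(\<integral>\<^sup>+x. ennreal (exp (f t \<theta> \<eta>0 x - f \<theta>0 \<theta>0 \<eta>0 x)) \<partial>P)
       = (\<integral>\<^sup>+x. ennreal (exp (f \<theta>0 \<theta>0 \<eta>0 x)) * ennreal (exp (f t \<theta> \<eta>0 x - f \<theta>0 \<theta>0 \<eta>0 x)) \<partial>\<mu>)"
      by (subst P_dens) (subst nn_integral_density, auto)
    also have "\<dots> = (\<integral>\<^sup>+x. ennreal (exp (f t \<theta> \<eta>0 x)) * 1 \<partial>\<mu>)"
      by (intro nn_integral_cong) (simp add: ennreal_mult[symmetric] exp_add[symmetric])
    also have "\<dots> = (\<integral>\<^sup>+x. 1 \<partial>model_law \<mu> ll t (sub t \<theta> \<eta>0))"
      unfolding model_law_def using fm[OF th] by (subst nn_integral_density) (auto simp: f_eq submodel_loglik_def)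
    also have "\<dots> = 1" using prob_space.emeasure_space_1[OF law] by simp
    finally have nn: "(\<integral>\<^sup>+x. ennreal (exp (f t \<theta> \<eta>0 x - f \<theta>0 \<theta>0 \<eta>0 x)) \<partial>P) = 1" .
    have m: "(\<lambda>x. exp (f t \<theta> \<eta>0 x - f \<theta>0 \<theta>0 \<eta>0 x)) \<in> borel_measurable P" unfolding sets by measurable
    have "integrable P (\<lambda>x. exp (f t \<theta> \<eta>0 x - f \<theta>0 \<theta>0 \<eta>0 x))"
      by (rule integrableI_nonneg[OF m]) (auto simp: nn)
    moreover from nn_integral_eq_integral[OF this] nn
    have "expectation (\<lambda>x. exp (f t \<theta> \<eta>0 x - f \<theta>0 \<theta>0 \<eta>0 x)) = 1" by simp
    ultimately show ?thesis by simp
  qed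
  obtain b where qmd: "qmd \<mu> (\<lambda>v x. exp (?L v x)) (\<theta>0, \<theta>0) UNIV (\<lambda>x. (?D x, b x))"
  proof -
    have "(\<lambda>(t, \<theta>) x. exp (submodel_loglik ll sub t \<theta> \<eta>0 x)) = (\<lambda>v x. exp (?L v x))"
      by (auto simp: fun_eq_iff f_eq)
    then show ?thesis using lf that unfolding least_favorable_def by auto
  qed
  have bm: "b \<in> borel_measurable \<mu>"
  proof -
    have "(\<lambda>x. (?D x, b x)) \<in> borel_measurable \<mu>" using qmd by (simp add: qmd_def)
    then have "(\<lambda>x. snd (?D x, b x)) \<in> borel_measurable \<mu>"
      by (rule measurable_compose) (intro borel_measurable_continuous_onI continuous_intros)
    then show ?thesis by simp
  qed
  note bP = bm[folded sets]
  have eff: "efficient_score \<mu> \<Theta> H ll \<theta>0 \<eta>0 ltilde" and AE: "AE x in P. ?D x = ltilde x"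
    using lf unfolding least_favorable_def P_eq[symmetric] by auto
  have ltm: "ltilde \<in> borel_measurable P" and lt2: "integrable P (\<lambda>x. (norm (ltilde x))\<^sup>2)"
    and perp: "\<And>i h. in_tangent_space P (nuisance_scores \<mu> H ll \<theta>0 \<eta>0) h \<Longrightarrow> (\<integral>x. ltilde x $ i * h x \<partial>P) = 0"
    using eff unfolding efficient_score_def Let_def P_eq[symmetric] by auto
  note Dm = D10_measurable[OF centre eta0_N centre]
  have "integrable P (\<lambda>x. (norm (?D x))\<^sup>2) \<longleftrightarrow> integrable P (\<lambda>x. (norm (ltilde x))\<^sup>2)"
    by (rule integrable_cong_AE) (use AE Dm ltm in auto)
  then show D2: "integrable P (\<lambda>x. (norm (?D x))\<^sup>2)" using lt2 by simp
  have De2: "integrable P (\<lambda>x. (?D x \<bullet> e)\<^sup>2)" for e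
  proof (rule Bochner_Integration.integrable_bound)
    show "integrable P (\<lambda>x. (norm (?D x))\<^sup>2 * (norm e)\<^sup>2)" using D2 by simp
    show "AE x in P. norm ((?D x \<bullet> e)\<^sup>2) \<le> norm ((norm (?D x))\<^sup>2 * (norm e)\<^sup>2)"
      by (intro AE_I2) (auto simp: power_mult_distrib[symmetric] intro!: power2_mono Cauchy_Schwarz_ineq2 order_trans[OF Cauchy_Schwarz_ineq2])
  qed (use Dm in measurable)
  have De: "expectation (\<lambda>x. ?D x \<bullet> e) = 0" for e
    using integral_inner_left[OF integrable_D(1)[OF centre centre eta0_N], of e] mean by simp
  \<comment> \<open>step sizes for which all displaced parameters stay in the ball, if \<open>c\<close> exceeds the length of the directions\<close>
  define s where "s c = (\<lambda>n. \<delta> / c * inverse (real (Suc (Suc n))))" for c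
  have joint: "((\<integral>x. D11 \<theta>0 \<theta>0 \<eta>0 x \<partial>P) *v e') \<bullet> e + ((\<integral>x. D20 \<theta>0 \<theta>0 \<eta>0 x \<partial>P) *v e) \<bullet> e / 2
     = - expectation (\<lambda>x. (?D x \<bullet> e)\<^sup>2) / 2" for e e'
  proof -
    define c where "c = norm e + norm e' + 1"
    have c: "c \<ge> 1" "norm e \<le> c" "norm e' \<le> c" by (auto simp: c_def)
    have s0: "s c n > 0" for n using \<delta>_pos c by (simp add: s_def)
    have sc: "s c n * c < \<delta>" for n
    proof -
      have "s c n * c = \<delta> * inverse (real (Suc (Suc n)))" using c by (simp add: s_def)
      also have "\<dots> < \<delta> * 1" using \<delta>_pos by (intro mult_strict_left_mono) (auto simp: inverse_less_1_iff)
      finally show ?thesis by simp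
    qed
    have slim: "s c \<longlonglongrightarrow> 0"
      unfolding s_def by (intro tendsto_mult_right_zero LIMSEQ_Suc LIMSEQ_inverse_real_of_nat)
    have mem: "\<theta>0 + s c n *\<^sub>R e \<in> ball \<theta>0 \<delta>" "\<theta>0 + s c n *\<^sub>R e' \<in> ball \<theta>0 \<delta>" for n
    proof -
      have "s c n * norm e < \<delta>" "s c n * norm e' < \<delta>"
        using mult_left_mono[OF c(2), of "s c n"] mult_left_mono[OF c(3), of "s c n"] s0[of n] sc[of n] by linarith+
      then show "\<theta>0 + s c n *\<^sub>R e \<in> ball \<theta>0 \<delta>" "\<theta>0 + s c n *\<^sub>R e' \<in> ball \<theta>0 \<delta>"
        using s0[of n] by (auto simp: dist_norm)
    qed
    have fm0: "?L (\<theta>0, \<theta>0) \<in> borel_measurable \<mu>" using fm[OF centre centre] by simp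
    have seq1: "(\<lambda>n. expectation (\<lambda>x. ((exp ((f (\<theta>0 + s c n *\<^sub>R e) (\<theta>0 + s c n *\<^sub>R e') \<eta>0 x - f \<theta>0 \<theta>0 \<eta>0 x) / 2) - 1) / s c n
           - (?D x \<bullet> e + b x \<bullet> e') / 2)\<^sup>2)) \<longlonglongrightarrow> 0"
      using qmd_sequence[OF qmd P_dens prob_space_axioms s0 slim fm0, of "(e, e')"] fm[OF mem] dens[OF mem] by simp
    have seq0: "integrable P (\<lambda>x. (b x \<bullet> e')\<^sup>2)"
        "(\<lambda>n. expectation (\<lambda>x. ((exp ((f \<theta>0 (\<theta>0 + s c n *\<^sub>R e') \<eta>0 x - f \<theta>0 \<theta>0 \<eta>0 x) / 2) - 1) / s c n
           - (b x \<bullet> e') / 2)\<^sup>2)) \<longlonglongrightarrow> 0"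
      using qmd_sequence[OF qmd P_dens prob_space_axioms s0 slim fm0, of "(0, e')"] fm[OF centre mem(2)] dens[OF centre mem(2)] by simp_all
    have orth: "expectation (\<lambda>x. (?D x \<bullet> e) * (b x \<bullet> e')) = 0"
    proof (cases "e' = 0")
      case False
      \<comment> \<open>a path has to be given for all \<open>s \<ge> 0\<close>, so it is set to \<open>\<eta>0\<close> once it would leave the ball\<close>
      define path where "path s = (if s < \<delta> / norm e' then sub \<theta>0 (\<theta>0 + s *\<^sub>R e') \<eta>0 else \<eta>0)" for s :: real
      have pos: "\<delta> / norm e' > 0" using False \<delta>_pos by simp
      have pm: "\<theta>0 + s *\<^sub>R e' \<in> ball \<theta>0 \<delta>" if "0 \<le> s" "s < \<delta> / norm e'" for s
        using that False by (simp add: dist_norm field_simps)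
      have "(\<lambda>x. b x \<bullet> e') \<in> nuisance_scores \<mu> H ll \<theta>0 \<eta>0"
        unfolding nuisance_scores_def mem_Collect_eq
      proof (intro exI[of _ path] conjI allI impI)
        show "path 0 = \<eta>0" using pos sub[OF centre centre eta0_N] by (simp add: path_def)
        show "path s \<in> H" if "s \<ge> 0" for s
          using sub[OF centre pm eta0_N] that NH eta0_N by (auto simp: path_def)
        show "qmd \<mu> (\<lambda>s x. exp (ll \<theta>0 (path s) x)) 0 {0..} (\<lambda>x. b x \<bullet> e')"
          by (rule qmd_along_ray[OF qmd _ pos False]) (simp add: path_def f_eq submodel_loglik_def)
      qed
      then have tang: "in_tangent_space P (nuisance_scores \<mu> H ll \<theta>0 \<eta>0) (\<lambda>x. b x \<bullet> e')"
        unfolding in_tangent_space_def using bP seq0(1)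
        by (auto intro!: exI[of _ "{\<lambda>x. b x \<bullet> e'}"] exI[of _ "\<lambda>_. 1"])
      have bm': "(\<lambda>x. b x \<bullet> e') \<in> borel_measurable P" using bP by measurable
      have lti2: "integrable P (\<lambda>x. (ltilde x $ i)\<^sup>2)" for i
      proof (rule Bochner_Integration.integrable_bound[OF lt2])
        show "AE x in P. norm ((ltilde x $ i)\<^sup>2) \<le> norm ((norm (ltilde x))\<^sup>2)"
          by (intro AE_I2) (auto intro!: power2_mono component_le_norm_cart)
      qed (use ltm in measurable)
      have ii: "integrable P (\<lambda>x. ltilde x $ i * (b x \<bullet> e'))" for i
        by (rule integrable_mult_of_squares[OF lti2 seq0(1)]) (use ltm bm' in auto)
      have "expectation (\<lambda>x. (?D x \<bullet> e) * (b x \<bullet> e')) = expectation (\<lambda>x. \<Sum>i\<in>UNIV. e $ i * (ltilde x $ i * (b x \<bullet> e')))"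
      proof (rule integral_cong_AE)
        show "AE x in P. (?D x \<bullet> e) * (b x \<bullet> e') = (\<Sum>i\<in>UNIV. e $ i * (ltilde x $ i * (b x \<bullet> e')))"
          using AE
        proof eventually_elim
          case (elim x)
          have "?D x \<bullet> e = (\<Sum>i\<in>UNIV. e $ i * ltilde x $ i)" using elim by (simp add: inner_vec_def mult.commute)
          then show ?case by (simp add: sum_distrib_right mult.assoc)
        qed
      qed (use Dm ltm bm' in auto)
      also have "\<dots> = (\<Sum>i\<in>UNIV. e $ i * expectation (\<lambda>x. ltilde x $ i * (b x \<bullet> e')))"
        using ii by simp
      also have "\<dots> = 0" using perp[OF tang] by simp
      finally show ?thesis .
    qed simp
    show ?thesis
      by (rule joint_information[OF c_def s_def dens seq1 seq0(2) bP seq0(1) De2 De orth])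
  qed
  have quad: "((\<integral>x. D20 \<theta>0 \<theta>0 \<eta>0 x \<partial>P) *v e) \<bullet> e = - expectation (\<lambda>x. (?D x \<bullet> e)\<^sup>2)" for e
    using joint[of 0 e] by simp
  have D11v: "((\<integral>x. D11 \<theta>0 \<theta>0 \<eta>0 x \<partial>P) *v e') \<bullet> e = 0" for e e'
    using joint[of e' e] quad[of e] by simp
  have "(\<integral>x. D11 \<theta>0 \<theta>0 \<eta>0 x \<partial>P) *v e' = 0" for e' using D11v[of e' "(\<integral>x. D11 \<theta>0 \<theta>0 \<eta>0 x \<partial>P) *v e'"] by simp
  then show "(\<integral>x. D11 \<theta>0 \<theta>0 \<eta>0 x \<partial>P) = 0" by (simp add: matrix_eq)
  have iDD: "integrable P (\<lambda>x. (?D x \<bullet> a) * (?D x \<bullet> c))" for a c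
    by (rule integrable_mult_of_squares[OF De2 De2]) (use Dm in auto)
  have bil: "((\<integral>x. D20 \<theta>0 \<theta>0 \<eta>0 x \<partial>P) *v a) \<bullet> c = - expectation (\<lambda>x. (?D x \<bullet> a) * (?D x \<bullet> c))" for a c
  proof -
    let ?A = "\<integral>x. D20 \<theta>0 \<theta>0 \<eta>0 x \<partial>P"
    have "(?A *v (a + c)) \<bullet> (a + c) = (?A *v a) \<bullet> a + (?A *v c) \<bullet> c + 2 * ((?A *v a) \<bullet> c)"
      using D20_symmetric[of a c] by (simp add: matrix_vector_right_distrib inner_add_left inner_add_right)
    moreover have "expectation (\<lambda>x. (?D x \<bullet> (a + c))\<^sup>2) =
        expectation (\<lambda>x. (?D x \<bullet> a)\<^sup>2 + (?D x \<bullet> c)\<^sup>2 + 2 * ((?D x \<bullet> a) * (?D x \<bullet> c)))"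
      by (simp add: inner_add_right power2_sum mult.assoc)
    then have "expectation (\<lambda>x. (?D x \<bullet> (a + c))\<^sup>2) =
        expectation (\<lambda>x. (?D x \<bullet> a)\<^sup>2) + expectation (\<lambda>x. (?D x \<bullet> c)\<^sup>2) + 2 * expectation (\<lambda>x. (?D x \<bullet> a) * (?D x \<bullet> c))"
      using De2 iDD by simp
    ultimately show ?thesis using quad[of "a + c"] quad[of a] quad[of c] by linarith
  qed
  show "(\<integral>x. D20 \<theta>0 \<theta>0 \<eta>0 x \<partial>P) = - cov_matrix P ltilde"
  proof (simp only: vec_eq_iff, intro allI)
    fix i j
    have lt0: "expectation (\<lambda>x. ltilde x $ k) = 0" for k
    proof -
      have "expectation (\<lambda>x. ltilde x $ k) = expectation (\<lambda>x. ?D x \<bullet> axis k 1)"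
        by (rule integral_cong_AE) (use AE Dm ltm in \<open>auto simp: inner_axis\<close>)
      then show ?thesis using De by simp
    qed
    have "cov_matrix P ltilde $ i $ j = expectation (\<lambda>x. ltilde x $ i * ltilde x $ j)"
      by (simp add: cov_matrix_def lt0)
    also have "\<dots> = expectation (\<lambda>x. (?D x \<bullet> axis j 1) * (?D x \<bullet> axis i 1))"
      by (rule integral_cong_AE) (use AE Dm ltm in \<open>auto simp: inner_axis mult.commute\<close>)
    also have "\<dots> = - (((\<integral>x. D20 \<theta>0 \<theta>0 \<eta>0 x \<partial>P) *v axis j 1) \<bullet> axis i 1)" by (simp add: bil)
    also have "\<dots> = - ((\<integral>x. D20 \<theta>0 \<theta>0 \<eta>0 x \<partial>P) $ i $ j)" by (simp add: inner_axis column)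
    finally show "(\<integral>x. D20 \<theta>0 \<theta>0 \<eta>0 x \<partial>P) $ i $ j = (- cov_matrix P ltilde) $ i $ j" by simp
  qed
qed

end


section \<open>Empirical means\<close>

lemma (in prob_space) second_moment_sum_indep:
  fixes X :: "nat \<Rightarrow> 'a \<Rightarrow> 'x" and h :: "'x \<Rightarrow> real"
  assumes indep: "indep_vars (\<lambda>i. P) X UNIV" and ident: "\<And>i. distr M P (X i) = P"
    and h: "h \<in> borel_measurable P" "integrable P (\<lambda>x. (h x)\<^sup>2)" "(\<integral>x. h x \<partial>P) = 0" "integrable P h"
  shows "integrable M (\<lambda>\<omega>. (\<Sum>i<n. h (X i \<omega>))\<^sup>2)"
    "expectation (\<lambda>\<omega>. (\<Sum>i<n. h (X i \<omega>))\<^sup>2) = real n * (\<integral>x. (h x)\<^sup>2 \<partial>P)"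
proof -
  have Xm[measurable]: "X i \<in> measurable M P" for i using indep by (auto simp: indep_vars_def)
  note [measurable] = h(1)
  have ih: "integrable M (\<lambda>\<omega>. h (X i \<omega>))" for i
    using h(4) integrable_distr_eq[OF Xm[of i] h(1)] by (simp add: ident)
  have Eh: "expectation (\<lambda>\<omega>. h (X i \<omega>)) = 0" for i
    using integral_distr[OF Xm[of i] h(1)] h(3) by (simp add: ident)
  have ih2: "integrable M (\<lambda>\<omega>. (h (X i \<omega>))\<^sup>2)" for i
    using h(2) integrable_distr_eq[OF Xm[of i], of "\<lambda>x. (h x)\<^sup>2"] by (simp add: ident)
  have Eh2: "expectation (\<lambda>\<omega>. (h (X i \<omega>))\<^sup>2) = (\<integral>x. (h x)\<^sup>2 \<partial>P)" for i
    using integral_distr[OF Xm[of i], of "\<lambda>x. (h x)\<^sup>2"] by (simp add: ident)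
  have ind: "indep_vars (\<lambda>_. borel) (\<lambda>i \<omega>. h (X i \<omega>)) UNIV"
    by (rule indep_vars_compose2[OF indep]) simp
  have pair: "integrable M (\<lambda>\<omega>. h (X i \<omega>) * h (X k \<omega>)) \<and>
     expectation (\<lambda>\<omega>. h (X i \<omega>) * h (X k \<omega>)) = (if i = k then (\<integral>x. (h x)\<^sup>2 \<partial>P) else 0)" for i k
  proof (cases "i = k")
    case True then show ?thesis using ih2[of i] Eh2[of i] by (simp add: power2_eq_square)
  next
    case False
    have i: "indep_vars (\<lambda>_. borel) (\<lambda>i \<omega>. h (X i \<omega>)) {i, k}" by (rule indep_vars_subset[OF ind]) simp
    from indep_vars_integrable[OF _ i ih] indep_vars_lebesgue_integral[OF _ i ih] False Eh
    show ?thesis by simp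
  qed
  have sq: "(\<lambda>\<omega>. (\<Sum>i<n. h (X i \<omega>))\<^sup>2) = (\<lambda>\<omega>. \<Sum>i<n. \<Sum>k<n. h (X i \<omega>) * h (X k \<omega>))"
    by (simp add: power2_eq_square sum_product)
  show "integrable M (\<lambda>\<omega>. (\<Sum>i<n. h (X i \<omega>))\<^sup>2)" unfolding sq using pair by simp
  show "expectation (\<lambda>\<omega>. (\<Sum>i<n. h (X i \<omega>))\<^sup>2) = real n * (\<integral>x. (h x)\<^sup>2 \<partial>P)"
    unfolding sq using pair by simp
qed

text \<open>
  Chebyshev's inequality: the squared norm of the sum of \<open>n\<close> observations of \<open>g\<close> has
  expectation \<open>n\<close> times the second moment of \<open>g\<close>.
\<close>

lemma (in prob_space) empirical_mean_bigO_P: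
  fixes X :: "nat \<Rightarrow> 'a \<Rightarrow> 'x" and g :: "'x \<Rightarrow> real^'d"
  assumes indep: "indep_vars (\<lambda>i. P) X UNIV" and ident: "\<And>i. distr M P (X i) = P"
    and g: "integrable P g" "integrable P (\<lambda>x. (norm (g x))\<^sup>2)" "(\<integral>x. g x \<partial>P) = 0"
  shows "bigO_P M (\<lambda>n \<omega>. emp X n \<omega> g) (\<lambda>n \<omega>. 1 / sqrt (real n))"
  unfolding bigO_P_def
proof (intro allI impI)
  fix \<epsilon> :: real assume \<epsilon>: "\<epsilon> > 0"
  have gm[measurable]: "g \<in> borel_measurable P" using g(1) by simp
  have Xm[measurable]: "X i \<in> measurable M P" for i using indep by (auto simp: indep_vars_def)
  define \<sigma> where "\<sigma> = (\<integral>x. (norm (g x))\<^sup>2 \<partial>P)"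
  have \<sigma>: "\<sigma> \<ge> 0" by (simp add: \<sigma>_def)
  define C where "C = sqrt ((\<sigma> + 1) / \<epsilon>)"
  define V where "V n \<omega> = (\<Sum>j\<in>UNIV. (\<Sum>i<n. g (X i \<omega>) $ j)\<^sup>2)" for n \<omega>
  have sqj: "integrable P (\<lambda>x. (g x $ j)\<^sup>2)" for j
  proof (rule Bochner_Integration.integrable_bound[OF g(2)])
    show "AE x in P. norm ((g x $ j)\<^sup>2) \<le> norm ((norm (g x))\<^sup>2)"
      by (intro AE_I2) (auto intro!: power2_mono component_le_norm_cart)
  qed measurable
  have gj: "integrable P (\<lambda>x. g x $ j)" "(\<integral>x. g x $ j \<partial>P) = 0" for j
    using integrable_bounded_linear[OF bounded_linear_vec_nth g(1), of j] integral_bounded_linear[OF bounded_linear_vec_nth g(1), of j] g(3)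
    by auto
  have nsq: "(norm v)\<^sup>2 = (\<Sum>j\<in>UNIV. (v $ j)\<^sup>2)" for v :: "real^'d"
    by (simp add: norm_vec_def L2_set_def sum_nonneg)
  note S = second_moment_sum_indep[OF indep ident _ sqj gj(2,1)]
  have iV: "integrable M (V n)" and EV: "expectation (V n) = real n * \<sigma>" for n
  proof -
    show "integrable M (V n)" unfolding V_def using S by auto
    have "expectation (V n) = (\<Sum>j\<in>UNIV. real n * (\<integral>x. (g x $ j)\<^sup>2 \<partial>P))"
      unfolding V_def using S by (subst Bochner_Integration.integral_sum) auto
    also have "\<dots> = real n * (\<integral>x. (\<Sum>j\<in>UNIV. (g x $ j)\<^sup>2) \<partial>P)"
      using sqj by (simp add: sum_distrib_left)
    finally show "expectation (V n) = real n * \<sigma>" by (simp add: \<sigma>_def nsq)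
  qed
  have V0: "V n \<omega> \<ge> 0" for n \<omega> by (simp add: V_def sum_nonneg)
  have Vn: "norm (emp X n \<omega> g) = sqrt (V n \<omega>) / real n" for n \<omega>
  proof -
    have "(norm (\<Sum>i<n. g (X i \<omega>)))\<^sup>2 = V n \<omega>" unfolding nsq V_def by simp
    then have "norm (\<Sum>i<n. g (X i \<omega>)) = sqrt (V n \<omega>)" by (metis norm_ge_zero real_sqrt_unique)
    then show ?thesis by (simp add: emp_def)
  qed
  have C2: "C\<^sup>2 = (\<sigma> + 1) / \<epsilon>" "C > 0" using \<sigma> \<epsilon> by (auto simp: C_def)
  show "\<exists>C. \<forall>\<^sub>F n in sequentially. \<exists>A\<in>sets M. 1 - \<epsilon> \<le> measure M A \<and> (\<forall>\<omega>\<in>A. norm (emp X n \<omega> g) \<le> C * \<bar>1 / sqrt (real n)\<bar>)"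
  proof (intro exI[of _ C] eventually_mono[OF eventually_gt_at_top[of 0]])
    fix n :: nat assume n: "n > 0"
    define A where "A = {\<omega>\<in>space M. V n \<omega> < real n * C\<^sup>2}"
    have [measurable]: "V n \<in> borel_measurable M" using iV by simp
    have A: "A \<in> sets M" unfolding A_def by measurable
    have "prob {\<omega>\<in>space M. V n \<omega> \<ge> real n * C\<^sup>2} \<le> expectation (V n) / (real n * C\<^sup>2)"
      by (rule integral_Markov_inequality_measure[OF iV, of "{}"]) (use V0 n C2(2) in auto)
    also have "\<dots> = \<sigma> / C\<^sup>2" using n by (simp add: EV)
    also have "\<dots> \<le> \<epsilon>" using C2 \<sigma> \<epsilon> by (simp add: divide_le_eq field_simps)
    finally have "prob {\<omega>\<in>space M. V n \<omega> \<ge> real n * C\<^sup>2} \<le> \<epsilon>" .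
    moreover have "{\<omega>\<in>space M. V n \<omega> \<ge> real n * C\<^sup>2} = space M - A" by (auto simp: A_def)
    ultimately have "1 - \<epsilon> \<le> prob A" using prob_compl[OF A] by simp
    moreover have "norm (emp X n \<omega> g) \<le> C * \<bar>1 / sqrt (real n)\<bar>" if "\<omega> \<in> A" for \<omega>
    proof -
      have "sqrt (V n \<omega>) \<le> sqrt (real n) * C"
        using that C2 by (intro real_le_lsqrt) (auto simp: A_def V0 power_mult_distrib)
      then have "sqrt (V n \<omega>) / real n \<le> sqrt (real n) * C / real n" using n by (intro divide_right_mono) auto
      also have "\<dots> = C * (1 / sqrt (real n))" using n by (simp add: real_div_sqrt field_simps)
      finally show ?thesis by (simp add: Vn)
    qed
    ultimately show "\<exists>A\<in>sets M. 1 - \<epsilon> \<le> prob A \<and> (\<forall>\<omega>\<in>A. norm (emp X n \<omega> g) \<le> C * \<bar>1 / sqrt (real n)\<bar>)"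
      using A by blast
  qed
qed

lemma emp_linear:
  assumes "linear T"
  shows "emp X n \<omega> (\<lambda>x. T (g x)) = T (emp X n \<omega> g)"
  unfolding emp_def linear_cmul[OF assms] linear_sum[OF assms] ..

lemma emp_diff: "emp X n \<omega> (\<lambda>x. g x - h x) = emp X n \<omega> g - emp X n \<omega> h"
  by (simp add: emp_def sum_subtractf scaleR_diff_right)

lemma emp_has_derivative:
  assumes "\<And>i. ((\<lambda>u. g u (X i \<omega>)) has_derivative G (X i \<omega>)) (at t)"
  shows "((\<lambda>u. emp X n \<omega> (g u)) has_derivative (\<lambda>h. emp X n \<omega> (\<lambda>x. G x h))) (at t)"
  unfolding emp_def using assms by (intro has_derivative_scaleR_right has_derivative_sum)

lemma linear_matrix_vector_left: "linear (\<lambda>A :: real^'n^'m. A *v h)"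
  by (rule linearI) (simp_all add: matrix_vector_mult_add_rdistrib scaleR_matrix_vector_assoc[symmetric])

lemma linear_tensor_inner: "linear (\<lambda>D :: real^'n^'m^'l. (\<chi> i j. D $ i $ j \<bullet> h))"
  by (rule linearI) (simp_all add: vec_eq_iff inner_add_left)

text \<open>
  An upper bound for the increments suffices, because it can be used in the direction of the
  gradient itself. At a maximizer of a penalized criterion only such a bound is available.
\<close>

lemma gradient_bound_of_one_sided_lipschitz:
  fixes g :: "real^'d \<Rightarrow> real"
  assumes r: "r > 0" and deriv: "(g has_derivative (\<lambda>h. D \<bullet> h)) (at c)"
    and le: "\<And>t. t \<in> ball c r \<Longrightarrow> g t - g c \<le> B * norm (t - c)"
  shows "norm D \<le> B"
proof -
  have key: "D \<bullet> b \<le> B * norm b" if b: "b \<noteq> 0" for b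
  proof -
    have "((\<lambda>s. c + s *\<^sub>R b) has_derivative (\<lambda>s. s *\<^sub>R b)) (at (0::real))"
      by (auto intro!: derivative_eq_intros)
    from has_derivative_compose[OF this, of g "\<lambda>h. D \<bullet> h"] deriv
    have "((\<lambda>s. g (c + s *\<^sub>R b)) has_field_derivative (D \<bullet> b)) (at 0)"
      unfolding has_field_derivative_def by (simp add: fun_eq_iff[THEN iffD2, of "\<lambda>x. x * (D \<bullet> b)" "(*) (D \<bullet> b)"])
    then have "((\<lambda>s. (g (c + s *\<^sub>R b) - g c) / s) \<longlongrightarrow> D \<bullet> b) (at 0)" by (simp add: DERIV_def)
    then have "((\<lambda>s. (g (c + s *\<^sub>R b) - g c) / s) \<longlongrightarrow> D \<bullet> b) (at_right 0)"
      by (rule filterlim_mono[OF _ order_refl]) (simp add: at_le)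
    moreover have "eventually (\<lambda>s. (g (c + s *\<^sub>R b) - g c) / s \<le> B * norm b) (at_right 0)"
      unfolding eventually_at_right_field
    proof (intro exI[of _ "r / norm b"] conjI allI impI)
      fix s :: real assume s: "s > 0" "s < r / norm b"
      have "g (c + s *\<^sub>R b) - g c \<le> B * norm (s *\<^sub>R b)"
        using le[of "c + s *\<^sub>R b"] s b by (simp add: dist_norm field_simps)
      then show "(g (c + s *\<^sub>R b) - g c) / s \<le> B * norm b" using s(1) by (simp add: field_simps)
    qed (use r b in simp)
    ultimately show ?thesis by (intro tendsto_upperbound[of _ _ "at_right 0"]) auto
  qed
  show ?thesis
  proof (cases "D = 0")
    case True
    obtain b :: "real^'d" where b: "b \<noteq> 0" by (metis axis_eq_0_iff zero_neq_one)
    then show ?thesis using key[OF b] True by (simp add: zero_le_mult_iff)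
  next
    case False
    then show ?thesis using key[of D] by (simp add: dot_square_norm power2_eq_square)
  qed
qed


section \<open>Quadratic expansion of the log profile likelihood\<close>

text \<open>
  One sample point \<open>\<omega>\<close> and one sample size \<open>n\<close> for which all stochastic bounds hold with the
  same constant \<open>K\<close>, uniformly on the ball of radius \<open>R\<close> around \<open>\<theta>0\<close>. Here \<open>l\<close> is the
  smoothing parameter, \<open>L\<close> the log profile likelihood, and \<open>dist0\<close> the distance to \<open>\<eta>0\<close>. The
  locale makes the expansion of \<open>L\<close> a deterministic statement.
\<close>

locale profile_realization = smooth_loglik P N f D10 D20 D11 D30 D12 D21 \<theta>0 \<eta>0 \<delta> F
  for P :: "'x measure" and N :: "'h set" and f D10 D20 D11 D30 D12 D21
    and \<theta>0 :: "real^'d" and \<eta>0 \<delta> F +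
  fixes X :: "nat \<Rightarrow> 'w \<Rightarrow> 'x" and n :: nat and \<omega> :: 'w and l :: real and J :: "'h \<Rightarrow> real"
    and etahat :: "real^'d \<Rightarrow> 'h" and L :: "real^'d \<Rightarrow> real" and thetahat :: "real^'d"
    and I0 :: "real^'d^'d" and R K :: real and k :: nat
    and sub :: "real^'d \<Rightarrow> real^'d \<Rightarrow> 'h \<Rightarrow> 'h" and dist0 :: "'h \<Rightarrow> real"
  assumes n_pos: "n > 0" and sample: "\<And>i. X i \<omega> \<in> space P"
    and K1: "K \<ge> 1" and PF: "(\<integral>x. F x \<partial>P) \<le> K" and R: "0 < R" "R \<le> \<delta>" "R \<le> 1"
    and l_pos: "l > 0" and J_nonneg: "\<And>\<eta>. J \<eta> \<ge> 0" and dist0_nonneg: "\<And>\<eta>. \<eta> \<in> N \<Longrightarrow> dist0 \<eta> \<ge> 0"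
    and score_mean: "(\<integral>x. D10 \<theta>0 \<theta>0 \<eta>0 x \<partial>P) = 0"
    and S2: "\<And>\<eta>. \<eta> \<in> N \<Longrightarrow> norm ((\<integral>x. D20 \<theta>0 \<theta>0 \<eta> x \<partial>P) + I0) \<le> K * dist0 \<eta>"
       "\<And>\<eta>. \<eta> \<in> N \<Longrightarrow> norm (\<integral>x. D11 \<theta>0 \<theta>0 \<eta> x \<partial>P) \<le> K * dist0 \<eta>"
       "\<And>\<eta>. \<eta> \<in> N \<Longrightarrow> norm (\<integral>x. D10 \<theta>0 \<theta>0 \<eta> x \<partial>P) \<le> K * (dist0 \<eta>)\<^sup>2"
    and etahat_N: "\<And>\<theta>. \<theta> \<in> ball \<theta>0 R \<Longrightarrow> etahat \<theta> \<in> N"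
    and rate_d: "\<And>\<theta>. \<theta> \<in> ball \<theta>0 R \<Longrightarrow> dist0 (etahat \<theta>) \<le> K * (l + norm (\<theta> - \<theta>0))"
    and rate_J: "\<And>\<theta>. \<theta> \<in> ball \<theta>0 R \<Longrightarrow> l * J (etahat \<theta>) \<le> K * (l + norm (\<theta> - \<theta>0))"
    and E10: "\<And>\<theta>. \<theta> \<in> ball \<theta>0 R \<Longrightarrow> norm (emp_process P X n \<omega>
            (\<lambda>x. D10 \<theta>0 \<theta>0 (etahat \<theta>) x - D10 \<theta>0 \<theta>0 \<eta>0 x)) \<le> K * (real n powr (1 / (4 * real k + 2)) * (l + norm (\<theta> - \<theta>0)))"
    and E20: "\<And>\<theta>. \<theta> \<in> ball \<theta>0 R \<Longrightarrow> norm (emp_process P X n \<omega> (D20 \<theta>0 \<theta> (etahat \<theta>))) \<le> K"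
    and E11: "\<And>\<theta> \<theta>'. \<theta> \<in> ball \<theta>0 R \<Longrightarrow> \<theta>' \<in> ball \<theta>0 R \<Longrightarrow> norm (emp_process P X n \<omega> (D11 \<theta>0 \<theta>' (etahat \<theta>))) \<le> K"
    and E30: "\<And>\<theta> \<theta>'. \<theta> \<in> ball \<theta>0 R \<Longrightarrow> \<theta>' \<in> ball \<theta>0 R \<Longrightarrow>
        norm (emp X n \<omega> (D30 \<theta>' \<theta> (etahat \<theta>)) - (\<integral>x. D30 \<theta>' \<theta> (etahat \<theta>) x \<partial>P)) \<le> K"
    and lower: "inverse l \<le> K * real n powr (real k / (2 * real k + 1))"
    and score: "norm (emp X n \<omega> (D10 \<theta>0 \<theta>0 \<eta>0)) \<le> K / sqrt (real n)"
    and profile: "\<And>\<theta>. \<theta> \<in> ball \<theta>0 R \<Longrightarrow> L \<theta> = real n * (emp X n \<omega> (f \<theta> \<theta> (etahat \<theta>)) - l\<^sup>2 * (J (etahat \<theta>))\<^sup>2)"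
    and profile_ge: "\<And>\<theta> t. \<theta> \<in> ball \<theta>0 R \<Longrightarrow> t \<in> ball \<theta>0 R \<Longrightarrow>
        real n * (emp X n \<omega> (f t \<theta> (etahat \<theta>)) - l\<^sup>2 * (J (sub t \<theta> (etahat \<theta>)))\<^sup>2) \<le> L t"
    and J_lipschitz: "\<And>\<theta> t \<eta>. \<theta> \<in> ball \<theta>0 R \<Longrightarrow> t \<in> ball \<theta>0 R \<Longrightarrow> \<eta> \<in> N \<Longrightarrow>
        \<bar>J (sub t \<theta> \<eta>) - J \<eta>\<bar> \<le> K * (1 + J \<eta>) * norm (t - \<theta>)"
    and thetahat_ball: "thetahat \<in> ball \<theta>0 R" and thetahat_max: "\<And>\<theta>. \<theta> \<in> ball \<theta>0 R \<Longrightarrow> L \<theta> \<le> L thetahat"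
begin

abbreviation "\<theta>ball \<equiv> ball \<theta>0 R"

definition "S = emp X n \<omega> (D10 \<theta>0 \<theta>0 \<eta>0)"

lemma centreR: "\<theta>0 \<in> \<theta>ball" using R by simp

definition "rate t = l + norm (t - \<theta>0)"

lemma in_\<delta>: "\<theta> \<in> \<theta>ball \<Longrightarrow> \<theta> \<in> ball \<theta>0 \<delta>" using R by auto

lemma K_pow: "K \<le> K^2" "K \<le> K^3" "K\<^sup>2 \<le> K^3" "K^3 \<le> K^4" "K \<le> K^4" "K\<^sup>2 \<le> K^4" "1 \<le> K^4" "1 \<le> K^2" "1 \<le> K ^ 3"
  using K1 power_increasing[of _ _ K] self_le_power[of K] by auto

lemma sqrt_n: "sqrt (real n) > 0" using n_pos by simp

text \<open>
  Since \<open>k / (2 * k + 1) < 1 / 2\<close>, the smoothing parameter is at least of the parametric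
  order.
\<close>

lemma root_rate: "1 / sqrt (real n) \<le> K * l"
proof -
  have "real n powr (real k / (2 * real k + 1)) \<le> real n powr (1 / 2)"
    using n_pos by (intro powr_mono) (auto simp: divide_simps)
  also have "\<dots> = sqrt (real n)" by (simp add: powr_half_sqrt)
  finally have "K * real n powr (real k / (2 * real k + 1)) \<le> K * sqrt (real n)" using K1 by (intro mult_left_mono) auto
  then have "inverse l \<le> K * sqrt (real n)" using lower by linarith
  then show ?thesis using l_pos sqrt_n by (simp add: field_simps)
qed

text \<open>
  The exponents match: \<open>1 / (4 * k + 2) - 1 / 2 = - k / (2 * k + 1)\<close>. Hence the growth that is
  allowed for the empirical process of scores costs exactly a factor \<open>l\<close> after division by
  \<open>sqrt n\<close>.
\<close>

lemma process_rate: "real n powr (1 / (4 * real k + 2)) / sqrt (real n) \<le> K * l"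
proof -
  have "real n powr (1 / (4 * real k + 2)) / sqrt (real n) = real n powr (1 / (4 * real k + 2) - 1 / 2)"
    by (simp add: powr_diff powr_half_sqrt)
  also have "1 / (4 * real k + 2) - 1 / 2 = - (real k / (2 * real k + 1))"
    by (simp add: divide_simps)
  also have "real n powr - (real k / (2 * real k + 1)) = inverse (real n powr (real k / (2 * real k + 1)))"
    by (rule powr_minus)
  also have "\<dots> \<le> K * l"
  proof -
    have "real n powr (real k / (2 * real k + 1)) > 0" using n_pos by simp
    then show ?thesis using lower l_pos by (simp add: field_simps)
  qed
  finally show ?thesis .
qed

lemma emp_of_process:
  fixes g :: "'x \<Rightarrow> 'b::{banach, second_countable_topology}"
  shows "emp X n \<omega> g = (1 / sqrt (real n)) *\<^sub>R emp_process P X n \<omega> g + (\<integral>x. g x \<partial>P)"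
  using sqrt_n by (simp add: emp_process_def)

context
  fixes \<theta> assumes th: "\<theta> \<in> \<theta>ball"
begin

lemma rate_bounds: "0 < rate \<theta>" "l \<le> rate \<theta>" "norm (\<theta> - \<theta>0) \<le> rate \<theta>"
  using l_pos by (auto simp: rate_def add_pos_nonneg)

lemma etahat_mem: "etahat \<theta> \<in> N" using etahat_N th .

text \<open>
  Along the submodel the roughness changes by a multiple of \<open>(1 + J) * norm (t - \<theta>)\<close>, and \<open>l *
  (1 + J)\<close> is at most of order \<open>rate \<theta>\<close>. The difference of the squares is a product of two
  such factors.
\<close>

lemma penalty_change:
  assumes t: "t \<in> \<theta>ball"
  shows "\<bar>l\<^sup>2 * (J (sub t \<theta> (etahat \<theta>)))\<^sup>2 - l\<^sup>2 * (J (etahat \<theta>))\<^sup>2\<bar> \<le> 16 * K^4 * (rate \<theta>)\<^sup>2 * norm (t - \<theta>)"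
proof -
  define j j' m where "j = J (etahat \<theta>)" "j' = J (sub t \<theta> (etahat \<theta>))" "m = norm (t - \<theta>)"
  have j: "j \<ge> 0" "j' \<ge> 0" "m \<ge> 0" using J_nonneg by (auto simp: j_j'_m_def)
  have m2: "m \<le> 2"
  proof -
    have "m \<le> norm (t - \<theta>0) + norm (\<theta> - \<theta>0)" unfolding j_j'_m_def by (metis norm_triangle_ineq4 diff_diff_eq2 diff_add_cancel add_diff_cancel_right)
    then show ?thesis using t th R by (auto simp: dist_norm norm_minus_commute)
  qed
  have d: "\<bar>j' - j\<bar> \<le> K * (1 + j) * m" unfolding j_j'_m_def by (rule J_lipschitz[OF th t etahat_mem])
  have "K * (1 + j) * m \<le> K * (1 + j) * 2" using K1 j m2 by (intro mult_left_mono) auto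
  moreover have "2 * j \<le> 2 * (K * (1 + j))"
  proof -
    have "1 * (1 + j) \<le> K * (1 + j)" using K1 j by (intro mult_right_mono) auto
    then show ?thesis by simp
  qed
  ultimately have "j' + j \<le> 4 * K * (1 + j)" using d by (simp add: abs_le_iff)
  then have "\<bar>j' - j\<bar> * (j' + j) \<le> (K * (1 + j) * m) * (4 * K * (1 + j))"
    using d j K1 by (intro mult_mono) auto
  moreover have "\<bar>j'\<^sup>2 - j\<^sup>2\<bar> = \<bar>j' - j\<bar> * (j' + j)"
    using j by (simp add: power2_eq_square square_diff_square_factored abs_mult mult.commute)
  ultimately have "\<bar>j'\<^sup>2 - j\<^sup>2\<bar> \<le> 4 * K\<^sup>2 * (1 + j)\<^sup>2 * m"
    by (simp add: power2_eq_square mult_ac)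
  then have "l\<^sup>2 * \<bar>j'\<^sup>2 - j\<^sup>2\<bar> \<le> l\<^sup>2 * (4 * K\<^sup>2 * (1 + j)\<^sup>2 * m)" by (rule mult_left_mono) simp
  also have "\<dots> = 4 * K\<^sup>2 * (l + l * j)\<^sup>2 * m"
  proof -
    have "l + l * j = l * (1 + j)" by (simp add: distrib_left)
    then show ?thesis by (simp add: power_mult_distrib)
  qed
  also have "\<dots> \<le> 4 * K\<^sup>2 * (2 * K * rate \<theta>)\<^sup>2 * m"
  proof -
    have "l * j \<le> K * rate \<theta>" using rate_J[OF th] by (simp add: j_j'_m_def rate_def)
    moreover have "l \<le> K * rate \<theta>" using rate_bounds K1 mult_right_mono[OF K1, of "rate \<theta>"] by linarith
    ultimately have "(l + l * j)\<^sup>2 \<le> (2 * K * rate \<theta>)\<^sup>2" using l_pos j by (intro power_mono) auto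
    then show ?thesis using j by (intro mult_right_mono mult_left_mono) auto
  qed
  also have "\<dots> = 16 * K^4 * (rate \<theta>)\<^sup>2 * m" by (simp add: power_mult_distrib power4_eq_xxxx power2_eq_square)
  finally have "l\<^sup>2 * \<bar>j'\<^sup>2 - j\<^sup>2\<bar> \<le> 16 * K^4 * (rate \<theta>)\<^sup>2 * m" .
  moreover have "\<bar>l\<^sup>2 * j'\<^sup>2 - l\<^sup>2 * j\<^sup>2\<bar> = l\<^sup>2 * \<bar>j'\<^sup>2 - j\<^sup>2\<bar>"
    by (simp add: right_diff_distrib[symmetric] abs_mult)
  ultimately show ?thesis by (simp add: j_j'_m_def)
qed

text \<open>
  The empirical process part is of order \<open>l * rate \<theta>\<close>, and the bias is quadratic in the
  distance of \<open>etahat \<theta>\<close> from \<open>\<eta>0\<close>, so both are \<open>O((rate \<theta>)\<^sup>2)\<close>.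
\<close>

lemma score_at_true_value: "norm (emp X n \<omega> (D10 \<theta>0 \<theta>0 (etahat \<theta>)) - S) \<le> 2 * K^3 * (rate \<theta>)\<^sup>2"
proof -
  let ?g = "\<lambda>x. D10 \<theta>0 \<theta>0 (etahat \<theta>) x - D10 \<theta>0 \<theta>0 \<eta>0 x"
  have "emp X n \<omega> (D10 \<theta>0 \<theta>0 (etahat \<theta>)) - S = emp X n \<omega> ?g" by (simp add: S_def emp_diff)
  also have "\<dots> = (1 / sqrt (real n)) *\<^sub>R emp_process P X n \<omega> ?g + (\<integral>x. ?g x \<partial>P)" by (rule emp_of_process)
  also have "(\<integral>x. ?g x \<partial>P) = (\<integral>x. D10 \<theta>0 \<theta>0 (etahat \<theta>) x \<partial>P)"
    using integrable_D(1)[OF centre centre etahat_mem] integrable_D(1)[OF centre centre eta0_N] score_mean by simp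
  finally have "norm (emp X n \<omega> (D10 \<theta>0 \<theta>0 (etahat \<theta>)) - S)
      \<le> norm (emp_process P X n \<omega> ?g) / sqrt (real n) + norm (\<integral>x. D10 \<theta>0 \<theta>0 (etahat \<theta>) x \<partial>P)"
    using norm_triangle_ineq[of "(1 / sqrt (real n)) *\<^sub>R emp_process P X n \<omega> ?g"] by simp
  moreover have "norm (emp_process P X n \<omega> ?g) / sqrt (real n) \<le> K^3 * (rate \<theta>)\<^sup>2"
  proof -
    have "norm (emp_process P X n \<omega> ?g) / sqrt (real n) \<le> K * (real n powr (1 / (4 * real k + 2)) * rate \<theta>) / sqrt (real n)"
      using E10[OF th] sqrt_n unfolding rate_def by (intro divide_right_mono) auto
    also have "\<dots> = (K * rate \<theta>) * (real n powr (1 / (4 * real k + 2)) / sqrt (real n))" by simp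
    also have "\<dots> \<le> (K * rate \<theta>) * (K * l)" using process_rate K1 rate_bounds by (intro mult_left_mono) auto
    also have "\<dots> \<le> (K * rate \<theta>) * (K * rate \<theta>)" using K1 rate_bounds by (intro mult_left_mono) auto
    also have "\<dots> = K\<^sup>2 * (rate \<theta>)\<^sup>2" by (simp add: power2_eq_square)
    also have "\<dots> \<le> K^3 * (rate \<theta>)\<^sup>2" using K_pow by (intro mult_right_mono) auto
    finally show ?thesis .
  qed
  moreover have "norm (\<integral>x. D10 \<theta>0 \<theta>0 (etahat \<theta>) x \<partial>P) \<le> K^3 * (rate \<theta>)\<^sup>2"
  proof -
    have "(dist0 (etahat \<theta>))\<^sup>2 \<le> (K * rate \<theta>)\<^sup>2"
      using rate_d[OF th] dist0_nonneg[OF etahat_mem] by (intro power_mono) (auto simp: rate_def)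
    then have "K * (dist0 (etahat \<theta>))\<^sup>2 \<le> K * (K * rate \<theta>)\<^sup>2" using K1 by (intro mult_left_mono) auto
    also have "\<dots> = K^3 * (rate \<theta>)\<^sup>2" by (simp add: power2_eq_square power3_eq_cube)
    finally show ?thesis using S2(3)[OF etahat_mem] by linarith
  qed
  ultimately show ?thesis by linarith
qed

lemma dist0_rate: "K * dist0 (etahat \<theta>) \<le> K\<^sup>2 * rate \<theta>"
  using mult_left_mono[OF rate_d[OF th], of K] K1 by (simp add: rate_def power2_eq_square)

lemma root_rate': "K / sqrt (real n) \<le> K\<^sup>2 * l"
  using mult_left_mono[OF root_rate, of K] K1 by (simp add: power2_eq_square)

lemma hessian_approximation: "norm (emp X n \<omega> (D20 \<theta>0 \<theta> (etahat \<theta>)) + I0) \<le> 2 * K\<^sup>2 * rate \<theta>"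
proof -
  let ?g = "D20 \<theta>0 \<theta> (etahat \<theta>)"
  have "emp X n \<omega> ?g + I0 = (1 / sqrt (real n)) *\<^sub>R emp_process P X n \<omega> ?g
      + ((\<integral>x. ?g x \<partial>P) - (\<integral>x. D20 \<theta>0 \<theta>0 (etahat \<theta>) x \<partial>P)) + ((\<integral>x. D20 \<theta>0 \<theta>0 (etahat \<theta>) x \<partial>P) + I0)"
    by (subst emp_of_process) simp
  then have "norm (emp X n \<omega> ?g + I0) \<le> norm ((1 / sqrt (real n)) *\<^sub>R emp_process P X n \<omega> ?g)
      + norm ((\<integral>x. ?g x \<partial>P) - (\<integral>x. D20 \<theta>0 \<theta>0 (etahat \<theta>) x \<partial>P)) + norm ((\<integral>x. D20 \<theta>0 \<theta>0 (etahat \<theta>) x \<partial>P) + I0)"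
    by (metis (no_types, lifting) norm_triangle_ineq norm_triangle_mono order_refl)
  moreover have "norm ((1 / sqrt (real n)) *\<^sub>R emp_process P X n \<omega> ?g) \<le> K\<^sup>2 * l"
    using divide_right_mono[OF E20[OF th], of "sqrt (real n)"] sqrt_n root_rate' by simp
  moreover have "norm ((\<integral>x. ?g x \<partial>P) - (\<integral>x. D20 \<theta>0 \<theta>0 (etahat \<theta>) x \<partial>P)) \<le> K\<^sup>2 * norm (\<theta> - \<theta>0)"
  proof -
    have "norm (\<theta> - \<theta>0) * (\<integral>x. F x \<partial>P) \<le> norm (\<theta> - \<theta>0) * K\<^sup>2" using PF K_pow by (intro mult_left_mono) auto
    then show ?thesis using integral_lipschitz_\<theta>(1)[OF in_\<delta>[OF th] etahat_mem] by (simp add: mult.commute)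
  qed
  moreover have "norm ((\<integral>x. D20 \<theta>0 \<theta>0 (etahat \<theta>) x \<partial>P) + I0) \<le> K\<^sup>2 * rate \<theta>"
    using S2(1)[OF etahat_mem] dist0_rate by linarith
  moreover have "K\<^sup>2 * l + K\<^sup>2 * norm (\<theta> - \<theta>0) = K\<^sup>2 * rate \<theta>" by (simp add: rate_def distrib_left)
  ultimately show ?thesis by linarith
qed

lemma mixed_derivative_small:
  assumes th': "\<theta>' \<in> \<theta>ball" "norm (\<theta>' - \<theta>0) \<le> norm (\<theta> - \<theta>0)"
  shows "norm (emp X n \<omega> (D11 \<theta>0 \<theta>' (etahat \<theta>))) \<le> 2 * K\<^sup>2 * rate \<theta>"
proof -
  let ?g = "D11 \<theta>0 \<theta>' (etahat \<theta>)"
  have "emp X n \<omega> ?g = (1 / sqrt (real n)) *\<^sub>R emp_process P X n \<omega> ?g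
      + ((\<integral>x. ?g x \<partial>P) - (\<integral>x. D11 \<theta>0 \<theta>0 (etahat \<theta>) x \<partial>P)) + (\<integral>x. D11 \<theta>0 \<theta>0 (etahat \<theta>) x \<partial>P)"
    by (subst emp_of_process) simp
  then have "norm (emp X n \<omega> ?g) \<le> norm ((1 / sqrt (real n)) *\<^sub>R emp_process P X n \<omega> ?g)
      + norm ((\<integral>x. ?g x \<partial>P) - (\<integral>x. D11 \<theta>0 \<theta>0 (etahat \<theta>) x \<partial>P)) + norm (\<integral>x. D11 \<theta>0 \<theta>0 (etahat \<theta>) x \<partial>P)"
    by (metis (no_types, lifting) norm_triangle_ineq norm_triangle_mono order_refl)
  moreover have "norm ((1 / sqrt (real n)) *\<^sub>R emp_process P X n \<omega> ?g) \<le> K\<^sup>2 * l"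
    using divide_right_mono[OF E11[OF th th'(1)], of "sqrt (real n)"] sqrt_n root_rate' by simp
  moreover have "norm ((\<integral>x. ?g x \<partial>P) - (\<integral>x. D11 \<theta>0 \<theta>0 (etahat \<theta>) x \<partial>P)) \<le> K\<^sup>2 * norm (\<theta> - \<theta>0)"
  proof -
    have "norm (\<theta>' - \<theta>0) * (\<integral>x. F x \<partial>P) \<le> norm (\<theta> - \<theta>0) * K\<^sup>2"
      using PF K_pow th'(2) K1 order_trans[OF PF K_pow(1)] by (intro mult_mono') (auto intro!: integral_nonneg_AE AE_I2 F_nonneg)
    then show ?thesis using integral_lipschitz_\<theta>(2)[OF in_\<delta>[OF th'(1)] etahat_mem] by (simp add: mult.commute)
  qed
  moreover have "norm (\<integral>x. D11 \<theta>0 \<theta>0 (etahat \<theta>) x \<partial>P) \<le> K\<^sup>2 * rate \<theta>"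
    using S2(2)[OF etahat_mem] dist0_rate by linarith
  moreover have "K\<^sup>2 * l + K\<^sup>2 * norm (\<theta> - \<theta>0) = K\<^sup>2 * rate \<theta>" by (simp add: rate_def distrib_left)
  ultimately show ?thesis by linarith
qed

lemma third_derivative_bounded:
  assumes th': "\<theta>' \<in> \<theta>ball"
  shows "norm (emp X n \<omega> (D30 \<theta>' \<theta> (etahat \<theta>))) \<le> 2 * K"
  using E30[OF th th'] integral_D30_bound[OF in_\<delta>[OF th'] in_\<delta>[OF th] etahat_mem] PF
    norm_triangle_sub[of "emp X n \<omega> (D30 \<theta>' \<theta> (etahat \<theta>))" "\<integral>x. D30 \<theta>' \<theta> (etahat \<theta>) x \<partial>P"] by linarith

lemma emp_derivs:
  assumes t: "t \<in> \<theta>ball" and u: "u \<in> \<theta>ball"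
  shows "((\<lambda>s. emp X n \<omega> (f s u (etahat \<theta>))) has_derivative (\<lambda>h. emp X n \<omega> (D10 t u (etahat \<theta>)) \<bullet> h)) (at t)"
    "((\<lambda>s. emp X n \<omega> (D10 s u (etahat \<theta>))) has_derivative (\<lambda>h. emp X n \<omega> (D20 t u (etahat \<theta>)) *v h)) (at t)"
    "((\<lambda>s. emp X n \<omega> (D20 s u (etahat \<theta>))) has_derivative (\<lambda>h. \<chi> i j. emp X n \<omega> (D30 t u (etahat \<theta>)) $ i $ j \<bullet> h)) (at t)"
    "((\<lambda>s. emp X n \<omega> (D10 t s (etahat \<theta>))) has_derivative (\<lambda>h. emp X n \<omega> (D11 t u (etahat \<theta>)) *v h)) (at u)"
proof -
  note D = deriv[OF in_\<delta>[OF t] in_\<delta>[OF u] etahat_mem sample]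
  have lin: "linear (\<lambda>v :: real^'d. v \<bullet> h)" for h by (rule linearI) (simp_all add: inner_add_left)
  show "((\<lambda>s. emp X n \<omega> (f s u (etahat \<theta>))) has_derivative (\<lambda>h. emp X n \<omega> (D10 t u (etahat \<theta>)) \<bullet> h)) (at t)"
    unfolding emp_linear[OF lin, symmetric] by (rule emp_has_derivative) (use D in blast)
  show "((\<lambda>s. emp X n \<omega> (D10 s u (etahat \<theta>))) has_derivative (\<lambda>h. emp X n \<omega> (D20 t u (etahat \<theta>)) *v h)) (at t)"
    unfolding emp_linear[OF linear_matrix_vector_left, symmetric] by (rule emp_has_derivative) (use D in blast)
  show "((\<lambda>s. emp X n \<omega> (D20 s u (etahat \<theta>))) has_derivative (\<lambda>h. \<chi> i j. emp X n \<omega> (D30 t u (etahat \<theta>)) $ i $ j \<bullet> h)) (at t)"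
    unfolding emp_linear[OF linear_tensor_inner, symmetric] by (rule emp_has_derivative) (use D in blast)
  show "((\<lambda>s. emp X n \<omega> (D10 t s (etahat \<theta>))) has_derivative (\<lambda>h. emp X n \<omega> (D11 t u (etahat \<theta>)) *v h)) (at u)"
    unfolding emp_linear[OF linear_matrix_vector_left, symmetric] by (rule emp_has_derivative) (use D in blast)
qed

text \<open>
  Replacing the base point \<open>\<theta>0\<close> by \<open>\<theta>\<close> changes the score by the mixed derivative times \<open>\<theta> -
  \<theta>0\<close>. The mixed derivative has mean zero at the true value and is itself of order \<open>rate \<theta>\<close>.
\<close>

lemma score_approximation: "norm (emp X n \<omega> (D10 \<theta>0 \<theta> (etahat \<theta>)) - S) \<le> 4 * K^3 * (rate \<theta>)\<^sup>2"
proof -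
  have "norm (emp X n \<omega> (D10 \<theta>0 \<theta> (etahat \<theta>)) - emp X n \<omega> (D10 \<theta>0 \<theta>0 (etahat \<theta>))) \<le> 2 * K\<^sup>2 * rate \<theta> * norm (\<theta> - \<theta>0)"
  proof (rule lipschitz_of_derivative_bound[of "cball \<theta>0 (norm (\<theta> - \<theta>0))" _ "\<lambda>u h. emp X n \<omega> (D11 \<theta>0 u (etahat \<theta>)) *v h"])
    fix u assume "u \<in> cball \<theta>0 (norm (\<theta> - \<theta>0))"
    then have u: "u \<in> \<theta>ball" "norm (u - \<theta>0) \<le> norm (\<theta> - \<theta>0)"
      using th by (auto simp: dist_norm norm_minus_commute)
    show "((\<lambda>s. emp X n \<omega> (D10 \<theta>0 s (etahat \<theta>))) has_derivative (\<lambda>h. emp X n \<omega> (D11 \<theta>0 u (etahat \<theta>)) *v h)) (at u)"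
      by (rule emp_derivs(4)[OF centreR u(1)])
    show "norm (emp X n \<omega> (D11 \<theta>0 u (etahat \<theta>)) *v h) \<le> 2 * K\<^sup>2 * rate \<theta> * norm h" for h
      by (rule order_trans[OF norm_matrix_vector_le mult_right_mono[OF mixed_derivative_small[OF u]]]) simp
  qed (auto simp: dist_norm norm_minus_commute)
  also have "\<dots> \<le> 2 * K\<^sup>2 * rate \<theta> * rate \<theta>" using rate_bounds by (intro mult_left_mono) auto
  also have "\<dots> = 2 * K\<^sup>2 * (rate \<theta>)\<^sup>2" by (simp add: power2_eq_square)
  also have "\<dots> \<le> 2 * K^3 * (rate \<theta>)\<^sup>2" using K_pow by (intro mult_right_mono) auto
  finally show ?thesis using score_at_true_value
      norm_triangle_ineq[of "emp X n \<omega> (D10 \<theta>0 \<theta> (etahat \<theta>)) - emp X n \<omega> (D10 \<theta>0 \<theta>0 (etahat \<theta>))" "emp X n \<omega> (D10 \<theta>0 \<theta>0 (etahat \<theta>)) - S"]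
    by simp
qed

text \<open>
  Taylor expansion in \<open>t\<close> with the submodel fixed at \<open>(\<theta>, etahat \<theta>)\<close>, after which the
  empirical gradient and Hessian are replaced by \<open>S\<close> and \<open>- I0\<close>.
\<close>

lemma likelihood_taylor:
  assumes v: "\<theta>0 + v \<in> \<theta>ball"
  shows "\<bar>emp X n \<omega> (f (\<theta>0 + v) \<theta> (etahat \<theta>)) - emp X n \<omega> (f \<theta>0 \<theta> (etahat \<theta>)) - S \<bullet> v + (I0 *v v) \<bullet> v / 2\<bar>
     \<le> norm v * (4 * K^3 * (rate \<theta>)\<^sup>2 + K\<^sup>2 * rate \<theta> * norm v + 2 * K * (norm v)\<^sup>2)"
proof -
  let ?D = "emp X n \<omega> (D10 \<theta>0 \<theta> (etahat \<theta>))" and ?H = "emp X n \<omega> (D20 \<theta>0 \<theta> (etahat \<theta>))"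
  have 1: "\<bar>emp X n \<omega> (f (\<theta>0 + v) \<theta> (etahat \<theta>)) - emp X n \<omega> (f \<theta>0 \<theta> (etahat \<theta>)) - ?D \<bullet> (\<theta>0 + v - \<theta>0)
      - (?H *v (\<theta>0 + v - \<theta>0)) \<bullet> (\<theta>0 + v - \<theta>0) / 2\<bar> \<le> 2 * K * norm (\<theta>0 + v - \<theta>0) ^ 3"
    by (rule taylor_third_order[OF convex_ball centreR v, where ?D3.0 = "\<lambda>u. emp X n \<omega> (D30 u \<theta> (etahat \<theta>))"])
       (use emp_derivs[OF _ th] third_derivative_bounded in auto)
  have 2: "\<bar>(?D - S) \<bullet> v\<bar> \<le> (4 * K^3 * (rate \<theta>)\<^sup>2) * norm v"
    by (rule order_trans[OF Cauchy_Schwarz_ineq2 mult_right_mono[OF score_approximation]]) simp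
  have 3: "\<bar>((?H + I0) *v v) \<bullet> v\<bar> \<le> ((2 * K\<^sup>2 * rate \<theta>) * norm v) * norm v"
    by (rule order_trans[OF Cauchy_Schwarz_ineq2 mult_right_mono[OF order_trans[OF norm_matrix_vector_le mult_right_mono[OF hessian_approximation]]]]) auto
  have arith: "\<bar>A - s + i / 2\<bar> \<le> b1 + b2 + b3 / 2" if "\<bar>A - p - q / 2\<bar> \<le> b1" "\<bar>p - s\<bar> \<le> b2" "\<bar>q + i\<bar> \<le> b3"
    for A s i p q b1 b2 b3 :: real using that by (simp add: abs_le_iff)
  have "\<bar>emp X n \<omega> (f (\<theta>0 + v) \<theta> (etahat \<theta>)) - emp X n \<omega> (f \<theta>0 \<theta> (etahat \<theta>)) - S \<bullet> v + (I0 *v v) \<bullet> v / 2\<bar>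
     \<le> 2 * K * norm v ^ 3 + (4 * K^3 * (rate \<theta>)\<^sup>2) * norm v + ((2 * K\<^sup>2 * rate \<theta>) * norm v) * norm v / 2"
    by (rule arith[of _ "?D \<bullet> v" "(?H *v v) \<bullet> v"])
       (use 1 2 3 in \<open>auto simp: inner_diff_left matrix_vector_mult_add_rdistrib inner_add_left\<close>)
  also have "\<dots> = norm v * (4 * K^3 * (rate \<theta>)\<^sup>2 + K\<^sup>2 * rate \<theta> * norm v + 2 * K * (norm v)\<^sup>2)"
    by (simp add: power2_eq_square power3_eq_cube algebra_simps)
  finally show ?thesis .
qed

end

lemma rate_centre: "rate \<theta>0 = l" "rate t = l + norm (t - \<theta>0)" by (auto simp: rate_def)

text \<open>
  The submodel through \<open>(\<theta>, etahat \<theta>)\<close> passes a competitor for \<open>etahat \<theta>0\<close> at \<open>\<theta>0\<close>, and the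
  submodel through \<open>(\<theta>0, etahat \<theta>0)\<close> passes a competitor for \<open>etahat \<theta>\<close> at \<open>\<theta>\<close>. This bounds \<open>L
  \<theta> - L \<theta>0\<close> from above and below by increments of the likelihood along a submodel. The
  constant consists of \<open>4 + 1 + 2\<close> from the three terms of \<open>likelihood_taylor\<close> and \<open>16\<close> from
  the penalty.
\<close>

lemma profile_expansion:
  assumes th: "\<theta> \<in> \<theta>ball"
  shows "\<bar>L \<theta> - L \<theta>0 - real n * (S \<bullet> (\<theta> - \<theta>0) - (I0 *v (\<theta> - \<theta>0)) \<bullet> (\<theta> - \<theta>0) / 2)\<bar>
     \<le> 23 * K^4 * (real n * (norm (\<theta> - \<theta>0) * (rate \<theta>)\<^sup>2))"
proof -
  define v where "v = \<theta> - \<theta>0"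
  define r where "r = rate \<theta>"
  define Q where "Q = S \<bullet> v - (I0 *v v) \<bullet> v / 2"
  define E where "E = 23 * K^4 * (norm v * r\<^sup>2)"
  have r: "0 < r" "l \<le> r" "norm v \<le> r" using rate_bounds[OF th] by (auto simp: r_def v_def)
  have tv: "\<theta>0 + v = \<theta>" by (simp add: v_def)
  have bound: "norm v * (4 * K^3 * q\<^sup>2 + K\<^sup>2 * q * norm v + 2 * K * (norm v)\<^sup>2) \<le> 7 * K^4 * (norm v * r\<^sup>2)"
    if q: "0 \<le> q" "q \<le> r" for q
  proof -
    have "4 * K^3 * q\<^sup>2 \<le> 4 * K^4 * r\<^sup>2" using q K_pow K1 by (intro mult_mono power_mono) auto
    moreover have "K\<^sup>2 * q * norm v \<le> K^4 * r * r" using q r K_pow K1 by (intro mult_mono) auto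
    moreover have "2 * K * (norm v)\<^sup>2 \<le> 2 * K^4 * r\<^sup>2" using r K_pow K1 by (intro mult_mono power_mono) auto
    ultimately have "4 * K^3 * q\<^sup>2 + K\<^sup>2 * q * norm v + 2 * K * (norm v)\<^sup>2 \<le> 7 * K^4 * r\<^sup>2"
      by (simp add: power2_eq_square mult.assoc)
    then have "norm v * (4 * K^3 * q\<^sup>2 + K\<^sup>2 * q * norm v + 2 * K * (norm v)\<^sup>2) \<le> norm v * (7 * K^4 * r\<^sup>2)"
      by (rule mult_left_mono) simp
    then show ?thesis by (simp add: mult_ac)
  qed
  have pen: "16 * K^4 * q\<^sup>2 * norm v \<le> 16 * K^4 * (norm v * r\<^sup>2)" if "0 \<le> q" "q \<le> r" for q
  proof -
    have "q\<^sup>2 * norm v \<le> r\<^sup>2 * norm v" using that by (intro mult_right_mono power_mono) auto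
    then have "16 * K^4 * (q\<^sup>2 * norm v) \<le> 16 * K^4 * (r\<^sup>2 * norm v)" using K1 by (intro mult_left_mono) auto
    then show ?thesis by (simp add: mult_ac)
  qed
  have E: "E = 7 * K^4 * (norm v * r\<^sup>2) + 16 * K^4 * (norm v * r\<^sup>2)" by (simp add: E_def)
  have up: "L \<theta> - L \<theta>0 \<le> real n * (Q + E)"
  proof -
    have b2: "\<bar>emp X n \<omega> (f \<theta> \<theta> (etahat \<theta>)) - emp X n \<omega> (f \<theta>0 \<theta> (etahat \<theta>)) - Q\<bar> \<le> 7 * K^4 * (norm v * r\<^sup>2)"
      using likelihood_taylor[OF th, of v] bound[of r] r th unfolding tv by (simp add: Q_def r_def)
    have p: "\<bar>l\<^sup>2 * (J (sub \<theta>0 \<theta> (etahat \<theta>)))\<^sup>2 - l\<^sup>2 * (J (etahat \<theta>))\<^sup>2\<bar> \<le> 16 * K^4 * (norm v * r\<^sup>2)"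
      using penalty_change[OF th centreR] pen[of r] r by (simp add: v_def r_def norm_minus_commute mult_ac)
    have "L \<theta> - L \<theta>0 \<le> real n * ((emp X n \<omega> (f \<theta> \<theta> (etahat \<theta>)) - l\<^sup>2 * (J (etahat \<theta>))\<^sup>2)
        - (emp X n \<omega> (f \<theta>0 \<theta> (etahat \<theta>)) - l\<^sup>2 * (J (sub \<theta>0 \<theta> (etahat \<theta>)))\<^sup>2))"
      using profile[OF th] profile_ge[OF th centreR] by (simp add: right_diff_distrib)
    also have "\<dots> \<le> real n * (Q + E)" using b2 p unfolding E abs_le_iff by (intro mult_left_mono of_nat_0_le_iff) linarith
    finally show ?thesis .
  qed
  have low: "real n * (Q - E) \<le> L \<theta> - L \<theta>0"
  proof -
    have b2: "\<bar>emp X n \<omega> (f \<theta> \<theta>0 (etahat \<theta>0)) - emp X n \<omega> (f \<theta>0 \<theta>0 (etahat \<theta>0)) - Q\<bar> \<le> 7 * K^4 * (norm v * r\<^sup>2)"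
      using likelihood_taylor[OF centreR, of v] bound[of l] r th l_pos unfolding tv by (simp add: Q_def rate_centre(1))
    have p: "\<bar>l\<^sup>2 * (J (sub \<theta> \<theta>0 (etahat \<theta>0)))\<^sup>2 - l\<^sup>2 * (J (etahat \<theta>0))\<^sup>2\<bar> \<le> 16 * K^4 * (norm v * r\<^sup>2)"
      using penalty_change[OF centreR th] pen[of l] r l_pos by (simp add: v_def rate_centre(1))
    have "real n * (Q - E) \<le> real n * ((emp X n \<omega> (f \<theta> \<theta>0 (etahat \<theta>0)) - l\<^sup>2 * (J (sub \<theta> \<theta>0 (etahat \<theta>0)))\<^sup>2)
        - (emp X n \<omega> (f \<theta>0 \<theta>0 (etahat \<theta>0)) - l\<^sup>2 * (J (etahat \<theta>0))\<^sup>2))"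
      using b2 p unfolding E abs_le_iff by (intro mult_left_mono of_nat_0_le_iff) linarith
    also have "\<dots> \<le> L \<theta> - L \<theta>0"
      using profile[OF centreR] profile_ge[OF centreR th] by (simp add: right_diff_distrib)
    finally show ?thesis .
  qed
  have "\<bar>L \<theta> - L \<theta>0 - real n * Q\<bar> \<le> real n * E"
    using up low by (simp add: abs_le_iff distrib_left right_diff_distrib)
  also have "real n * E = 23 * K^4 * (real n * (norm v * r\<^sup>2))" by (simp add: E_def)
  finally show ?thesis by (simp add: Q_def v_def r_def)
qed

text \<open>
  Along the submodel through \<open>(thetahat, etahat thetahat)\<close> the penalized likelihood is maximal
  at \<open>thetahat\<close>. The penalty need not be differentiable along the submodel, but it is
  Lipschitz with constant \<open>O((rate thetahat)\<^sup>2)\<close>, so the gradient of the likelihood at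
  \<open>thetahat\<close> is of that order. Expanding the gradient around \<open>\<theta>0\<close> gives the equation, with the
  constant \<open>16 + 2 + 4 + 2\<close> from the penalty, the third derivative, the score and the Hessian.
\<close>

lemma score_equation: "norm (S - I0 *v (thetahat - \<theta>0)) \<le> 24 * K^4 * (rate thetahat)\<^sup>2"
proof -
  define h where "h = thetahat - \<theta>0"
  define r where "r = rate thetahat"
  let ?e = "etahat thetahat"
  have r: "0 < r" "norm h \<le> r" using rate_bounds[OF thetahat_ball] by (auto simp: r_def h_def)
  obtain s where s: "s > 0" "ball thetahat s \<subseteq> \<theta>ball"
    using thetahat_ball open_contains_ball open_ball by blast
  have g: "norm (emp X n \<omega> (D10 thetahat thetahat ?e)) \<le> 16 * K^4 * r\<^sup>2"
  proof (rule gradient_bound_of_one_sided_lipschitz[OF s(1) emp_derivs(1)[OF thetahat_ball thetahat_ball thetahat_ball]])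
    fix t assume "t \<in> ball thetahat s"
    then have t: "t \<in> \<theta>ball" using s by blast
    have "real n * (emp X n \<omega> (f t thetahat ?e) - l\<^sup>2 * (J (sub t thetahat ?e))\<^sup>2)
       \<le> real n * (emp X n \<omega> (f thetahat thetahat ?e) - l\<^sup>2 * (J ?e)\<^sup>2)"
      using profile_ge[OF thetahat_ball t] thetahat_max[OF t] profile[OF thetahat_ball] by linarith
    then have "emp X n \<omega> (f t thetahat ?e) - l\<^sup>2 * (J (sub t thetahat ?e))\<^sup>2
       \<le> emp X n \<omega> (f thetahat thetahat ?e) - l\<^sup>2 * (J ?e)\<^sup>2" using n_pos by simp
    then show "emp X n \<omega> (f t thetahat ?e) - emp X n \<omega> (f thetahat thetahat ?e) \<le> 16 * K^4 * r\<^sup>2 * norm (t - thetahat)"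
      using penalty_change[OF thetahat_ball t] unfolding r_def by (simp add: abs_le_iff)
  qed
  have t2: "norm (emp X n \<omega> (D10 thetahat thetahat ?e) - emp X n \<omega> (D10 \<theta>0 thetahat ?e) - emp X n \<omega> (D20 \<theta>0 thetahat ?e) *v h) \<le> 2 * K * (norm h)\<^sup>2"
    unfolding h_def
    by (rule taylor_second_order[OF convex_ball centreR thetahat_ball, where ?D3.0 = "\<lambda>u. emp X n \<omega> (D30 u thetahat ?e)"
           and ?D1.0 = "\<lambda>u. emp X n \<omega> (D10 u thetahat ?e)" and ?D2.0 = "\<lambda>u. emp X n \<omega> (D20 u thetahat ?e)"])
       (use emp_derivs[OF thetahat_ball _ thetahat_ball] third_derivative_bounded[OF thetahat_ball] in auto)
  have "2 * K * (norm h)\<^sup>2 \<le> 2 * K^4 * r\<^sup>2" using r K_pow K1 by (intro mult_mono power_mono) auto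
  note t2' = order_trans[OF t2 this]
  have "norm ((emp X n \<omega> (D20 \<theta>0 thetahat ?e) + I0) *v h) \<le> (2 * K\<^sup>2 * r) * norm h"
    by (rule order_trans[OF norm_matrix_vector_le mult_right_mono[OF hessian_approximation[OF thetahat_ball, folded r_def]]]) simp
  also have "\<dots> \<le> 2 * K^4 * r * r" using r K_pow by (intro mult_mono) auto
  finally have h2: "norm ((emp X n \<omega> (D20 \<theta>0 thetahat ?e) + I0) *v h) \<le> 2 * K^4 * r\<^sup>2"
    by (simp add: power2_eq_square mult.assoc)
  have "4 * K^3 * r\<^sup>2 \<le> 4 * K^4 * r\<^sup>2" using K_pow by (intro mult_right_mono) auto
  note b1 = order_trans[OF score_approximation[OF thetahat_ball, folded r_def] this]
  have "S - I0 *v h = (emp X n \<omega> (D10 thetahat thetahat ?e))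
       - (emp X n \<omega> (D10 thetahat thetahat ?e) - emp X n \<omega> (D10 \<theta>0 thetahat ?e) - emp X n \<omega> (D20 \<theta>0 thetahat ?e) *v h)
       - (emp X n \<omega> (D10 \<theta>0 thetahat ?e) - S) - (emp X n \<omega> (D20 \<theta>0 thetahat ?e) + I0) *v h"
    by (simp add: matrix_vector_mult_add_rdistrib)
  also have "norm \<dots> \<le> 16 * K^4 * r\<^sup>2 + 2 * K^4 * r\<^sup>2 + 4 * K^4 * r\<^sup>2 + 2 * K^4 * r\<^sup>2"
    by (intro norm_triangle_le_diff add_mono g t2' b1 h2 order_trans[OF norm_triangle_ineq4])
  finally show ?thesis by (simp add: h_def r_def)
qed

end


section \<open>Localisation of the estimator and recentring of the expansion\<close>

text \<open>
  The constants of the expansion around the estimator, in terms of \<open>K\<close> and the least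
  eigenvalue bound \<open>c\<close> of the information matrix: \<open>loc_radius\<close> for the distance of the
  estimator from \<open>\<theta>0\<close> in units of \<open>1 / sqrt n\<close>, \<open>loc_score\<close> for the residual in the score equation
  in units of \<open>l\<^sup>2\<close>, and \<open>loc_const\<close> as a common constant for the remainder of the expansion
  and for the height of its Gaussian majorant. The first summands of \<open>loc_const\<close> make it
  dominate \<open>K\<^sup>2\<close> and \<open>loc_radius\<close> as well.
\<close>

definition loc_radius :: "real \<Rightarrow> real \<Rightarrow> real"
  where "loc_radius K c = 98 * K ^ 4 / c"

definition loc_score :: "real \<Rightarrow> real \<Rightarrow> real"
  where "loc_score K c = 24 * K ^ 4 * (1 + loc_radius K c * K)\<^sup>2"

definition loc_const :: "real \<Rightarrow> real \<Rightarrow> real"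
  where "loc_const K c = (let a = loc_radius K c; b = loc_score K c in
    K\<^sup>2 + a + (b + 23 * K ^ 4 * ((1 + a) * (1 + K * (1 + a))\<^sup>2 + a * (1 + a * K)\<^sup>2))
    + (23 * K ^ 4 * (a * (1 + a * K)\<^sup>2 + 2 * a + 4 * a\<^sup>2) + 2 * (b + 46 * K ^ 4)\<^sup>2 / c))"

context profile_realization
begin

context
  fixes c :: real
  assumes c: "c > 0" and sym: "\<And>u v. (I0 *v u) \<bullet> v = (I0 *v v) \<bullet> u"
    and coercive: "\<And>u. c * (norm u)\<^sup>2 \<le> (I0 *v u) \<bullet> u"
    and small_R: "768 * K ^ 4 * R \<le> c" and small_l: "sqrt (real n) * l\<^sup>2 \<le> 1"
begin

text \<open>
  The relative error of the Gaussian approximation; it tends to zero when \<open>l = o(n powr (- 1 /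
  4))\<close>.
\<close>

definition "slack = sqrt (real n) * l\<^sup>2"

abbreviation "a \<equiv> loc_radius K c"
abbreviation "b \<equiv> loc_score K c"

lemma slack: "slack > 0" "slack \<le> 1" using small_l l_pos sqrt_n by (auto simp: slack_def)

lemma a_nonneg: "a \<ge> 0" and b_nonneg: "b \<ge> 0" using c K1 by (auto simp: loc_radius_def loc_score_def)

lemma KR: "768 * (K ^ 4 * R) \<le> c" "0 \<le> K ^ 4 * R"
  using small_R R by (simp_all add: mult.assoc)

lemma l_square: "l\<^sup>2 = slack / sqrt (real n)" using sqrt_n by (simp add: slack_def)

lemma root_slack: "1 / sqrt (real n) \<le> K\<^sup>2 * slack"
proof -
  have "(1 / sqrt (real n))\<^sup>2 \<le> (K * l)\<^sup>2" using root_rate by (intro power_mono) auto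
  then have "1 / real n \<le> K\<^sup>2 * l\<^sup>2" by (simp add: power_mult_distrib power_divide)
  then have "sqrt (real n) * (1 / real n) \<le> sqrt (real n) * (K\<^sup>2 * l\<^sup>2)" by (intro mult_left_mono) auto
  moreover have "sqrt (real n) * (1 / real n) = 1 / sqrt (real n)"
    using n_pos by (simp add: real_div_sqrt field_simps)
  ultimately show ?thesis by (simp add: slack_def mult_ac)
qed

lemma rate_sq: "(rate t)\<^sup>2 \<le> 2 * l\<^sup>2 + 2 * (norm (t - \<theta>0))\<^sup>2"
  using zero_le_power2[of "l - norm (t - \<theta>0)"] by (simp add: rate_def power2_diff power2_sum)

text \<open>
  By coercivity and the score equation, \<open>c * norm h \<le> norm S + O(l\<^sup>2 + (norm h)\<^sup>2)\<close> for \<open>h =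
  thetahat - \<theta>0\<close>. The ball is so small that the quadratic term is at most \<open>c / 2 * norm h\<close>,
  and \<open>norm S\<close> and \<open>l\<^sup>2\<close> are at most of order \<open>1 / sqrt n\<close>. The constant \<open>98\<close> is \<open>2 * (1 + 48)\<close>.
\<close>

lemma localisation: "norm (thetahat - \<theta>0) \<le> a / sqrt (real n)"
proof -
  define h where "h = thetahat - \<theta>0"
  have hR: "norm h \<le> R" using thetahat_ball by (simp add: h_def dist_norm norm_minus_commute)
  have low: "c * norm h \<le> norm (I0 *v h)"
  proof (cases "h = 0")
    case False
    have "c * (norm h)\<^sup>2 \<le> norm (I0 *v h) * norm h"
      using coercive[of h] norm_cauchy_schwarz[of "I0 *v h" h] by linarith
    then show ?thesis using False by (simp add: power2_eq_square)
  qed simp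
  have "24 * K^4 * (rate thetahat)\<^sup>2 \<le> 24 * K^4 * (2 * l\<^sup>2 + 2 * (norm h)\<^sup>2)"
    using rate_sq[of thetahat] by (intro mult_left_mono) (auto simp: h_def)
  then have "norm (I0 *v h) \<le> norm S + 24 * K^4 * (2 * l\<^sup>2 + 2 * (norm h)\<^sup>2)"
    using score_equation norm_triangle_sub[of "I0 *v h" S] by (simp add: h_def norm_minus_commute)
  moreover have "24 * K^4 * (2 * (norm h)\<^sup>2) \<le> c / 2 * norm h"
  proof -
    have k48: "48 * K^4 * R \<le> c / 2" using KR unfolding mult.assoc by linarith
    have "(48 * K^4 * norm h) * norm h \<le> (48 * K^4 * R) * norm h"
      using hR by (intro mult_right_mono mult_left_mono) auto
    also have "\<dots> \<le> (c / 2) * norm h" by (rule mult_right_mono[OF k48 norm_ge_zero])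
    finally show ?thesis by (simp add: power2_eq_square mult_ac)
  qed
  moreover have "norm S \<le> K ^ 4 / sqrt (real n)"
    unfolding S_def by (rule order_trans[OF score divide_right_mono[OF K_pow(5)]]) simp
  moreover have "24 * K^4 * (2 * l\<^sup>2) \<le> 48 * K^4 / sqrt (real n)"
  proof -
    have "l\<^sup>2 \<le> 1 / sqrt (real n)" using slack sqrt_n by (simp add: l_square divide_right_mono)
    then have "48 * K^4 * l\<^sup>2 \<le> 48 * K^4 * (1 / sqrt (real n))" by (intro mult_left_mono) auto
    then show ?thesis by simp
  qed
  ultimately have "c / 2 * norm h \<le> 49 * K ^ 4 / sqrt (real n)" using low by (simp add: distrib_left)
  from mult_left_mono[OF this, of "2 / c"] c
  have "(2 / c) * (c / 2 * norm h) \<le> (2 / c) * (49 * K ^ 4 / sqrt (real n))" by simp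
  then show ?thesis using c by (simp add: h_def loc_radius_def)
qed

lemma localisation_l: "norm (thetahat - \<theta>0) \<le> a * K * l"
  using order_trans[OF localisation, of "a * K * l"] mult_left_mono[OF root_rate a_nonneg] by (simp add: mult.assoc)

lemma rate_thetahat: "(rate thetahat)\<^sup>2 \<le> (1 + a * K)\<^sup>2 * l\<^sup>2"
proof -
  have "(rate thetahat)\<^sup>2 \<le> ((1 + a * K) * l)\<^sup>2"
    using localisation_l l_pos by (intro power_mono) (auto simp: rate_def distrib_right)
  then show ?thesis by (simp add: power_mult_distrib)
qed

lemma score_localised: "norm (S - I0 *v (thetahat - \<theta>0)) \<le> b * l\<^sup>2"
proof -
  have "24 * K^4 * (rate thetahat)\<^sup>2 \<le> 24 * K^4 * ((1 + a * K)\<^sup>2 * l\<^sup>2)"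
    using rate_thetahat by (intro mult_left_mono) auto
  then show ?thesis using score_equation by (simp add: loc_score_def)
qed

text \<open>
  Subtracting the expansion at \<open>thetahat\<close> from that at \<open>\<theta>\<close> leaves the quadratic form in \<open>\<theta> -
  thetahat\<close> and the linear term with coefficient \<open>S - I0 *v (thetahat - \<theta>0)\<close>, which the score
  equation controls.
\<close>

lemma recentred_remainder:
  assumes th: "\<theta> \<in> \<theta>ball"
  defines "v \<equiv> \<theta> - thetahat" and "x \<equiv> sqrt (real n) * norm (\<theta> - thetahat)"
  shows "\<bar>L \<theta> - L thetahat + real n * ((I0 *v v) \<bullet> v) / 2\<bar>
     \<le> b * slack * x + 23 * K ^ 4 * (real n * (norm (\<theta> - \<theta>0) * (rate \<theta>)\<^sup>2) + a * (1 + a * K)\<^sup>2 * slack)"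
proof -
  define h where "h = \<theta> - \<theta>0"
  define g where "g = thetahat - \<theta>0"
  have hg: "h = v + g" by (simp add: h_def g_def v_def)
  have E1: "\<bar>L \<theta> - L \<theta>0 - real n * (S \<bullet> h - (I0 *v h) \<bullet> h / 2)\<bar> \<le> 23 * K^4 * (real n * (norm h * (rate \<theta>)\<^sup>2))"
    using profile_expansion[OF th] by (simp add: h_def)
  have E2: "\<bar>L thetahat - L \<theta>0 - real n * (S \<bullet> g - (I0 *v g) \<bullet> g / 2)\<bar> \<le> 23 * K^4 * (a * (1 + a * K)\<^sup>2 * slack)"
  proof -
    have "real n * (norm g * (rate thetahat)\<^sup>2) \<le> real n * (a / sqrt (real n) * ((1 + a * K)\<^sup>2 * l\<^sup>2))"
      using localisation rate_thetahat a_nonneg by (intro mult_left_mono mult_mono) (auto simp: g_def)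
    also have "\<dots> = a * (1 + a * K)\<^sup>2 * (real n / sqrt (real n) * l\<^sup>2)" by simp
    also have "real n / sqrt (real n) * l\<^sup>2 = slack" by (simp add: real_div_sqrt slack_def)
    finally have "23 * K^4 * (real n * (norm g * (rate thetahat)\<^sup>2)) \<le> 23 * K^4 * (a * (1 + a * K)\<^sup>2 * slack)"
      by (intro mult_left_mono) auto
    then show ?thesis using profile_expansion[OF thetahat_ball] by (simp add: g_def)
  qed
  have E3: "\<bar>real n * ((S - I0 *v g) \<bullet> v)\<bar> \<le> b * slack * x"
  proof -
    have "\<bar>(S - I0 *v g) \<bullet> v\<bar> \<le> (b * l\<^sup>2) * norm v"
      using score_localised by (intro order_trans[OF Cauchy_Schwarz_ineq2 mult_right_mono]) (auto simp: g_def)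
    then have "real n * \<bar>(S - I0 *v g) \<bullet> v\<bar> \<le> real n * ((b * l\<^sup>2) * norm v)" by (intro mult_left_mono) auto
    also have "\<dots> = (sqrt (real n) * sqrt (real n)) * ((b * l\<^sup>2) * norm v)" by simp
    also have "\<dots> = b * slack * x" unfolding slack_def x_def v_def by (simp only: mult_ac)
    finally show ?thesis by (simp add: abs_mult)
  qed
  have quad: "(I0 *v h) \<bullet> h = (I0 *v v) \<bullet> v + 2 * ((I0 *v g) \<bullet> v) + (I0 *v g) \<bullet> g"
    using sym[of v g] by (simp add: hg matrix_vector_right_distrib inner_add_left inner_add_right)
  have eq: "L \<theta> - L thetahat + real n * ((I0 *v v) \<bullet> v) / 2 =
      (L \<theta> - L \<theta>0 - real n * (S \<bullet> h - (I0 *v h) \<bullet> h / 2))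
      - (L thetahat - L \<theta>0 - real n * (S \<bullet> g - (I0 *v g) \<bullet> g / 2)) + real n * ((S - I0 *v g) \<bullet> v)"
    unfolding quad by (simp add: hg inner_add_right inner_diff_left algebra_simps add_divide_distrib)
  have tri: "\<bar>p - q + r\<bar> \<le> \<bar>p\<bar> + \<bar>q\<bar> + \<bar>r\<bar>" for p q r :: real by simp
  show ?thesis
    unfolding eq by (rule order_trans[OF tri]) (use E1 E2 E3 in \<open>simp add: h_def distrib_left\<close>)
qed

lemma h_bound:
  "norm (\<theta> - \<theta>0) \<le> (a + sqrt (real n) * norm (\<theta> - thetahat)) / sqrt (real n)"
proof -
  have "norm (\<theta> - \<theta>0) \<le> norm (\<theta> - thetahat) + norm (thetahat - \<theta>0)"
    using norm_triangle_ineq[of "\<theta> - thetahat" "thetahat - \<theta>0"] by simp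
  then show ?thesis using localisation sqrt_n by (simp add: add_divide_distrib)
qed

lemma n_root: "real n / sqrt (real n) = sqrt (real n)" by (simp add: real_div_sqrt)

text \<open>
  In units of \<open>1 / sqrt n\<close> and \<open>l\<close>, the quantities \<open>norm (\<theta> - \<theta>0)\<close> and \<open>rate \<theta>\<close> are at most linear
  in the rescaled distance to the estimator. Hence the remainder \<open>n * norm (\<theta> - \<theta>0) * (rate
  \<theta>)\<^sup>2\<close> is cubic in that distance, with a factor \<open>sqrt n * l\<^sup>2\<close>.
\<close>

lemma localised_expansion:
  assumes th: "\<theta> \<in> \<theta>ball"
  shows "\<bar>L \<theta> - L thetahat + real n * ((I0 *v (\<theta> - thetahat)) \<bullet> (\<theta> - thetahat)) / 2\<bar>
     \<le> loc_const K c * slack * (1 + sqrt (real n) * norm (\<theta> - thetahat)) ^ 3"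
proof -
  define x where "x = sqrt (real n) * norm (\<theta> - thetahat)"
  have x0: "x \<ge> 0" by (simp add: x_def)
  have a0: "a \<ge> 0" and b0: "b \<ge> 0" by (rule a_nonneg b_nonneg)+
  have hb: "norm (\<theta> - \<theta>0) \<le> (a + x) / sqrt (real n)" using h_bound by (simp add: x_def)
  have ax: "a + x \<le> (1 + a) * (1 + x)" using a0 x0 by (simp add: algebra_simps)
  have rt: "rate \<theta> \<le> (1 + K * (1 + a)) * (1 + x) * l"
  proof -
    have "rate \<theta> \<le> l + (a + x) * (1 / sqrt (real n))" using hb by (simp add: rate_def)
    moreover have "(a + x) * (1 / sqrt (real n)) \<le> ((1 + a) * (1 + x)) * (K * l)"
      using ax root_rate a0 x0 sqrt_n by (intro mult_mono) auto
    moreover have "l \<le> (1 + x) * l" using x0 l_pos by simp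
    moreover have "(1 + x) * l + ((1 + a) * (1 + x)) * (K * l) = (1 + K * (1 + a)) * (1 + x) * l"
      by (simp add: algebra_simps)
    ultimately show ?thesis by linarith
  qed
  have rt2: "(rate \<theta>)\<^sup>2 \<le> ((1 + K * (1 + a)) * (1 + x) * l)\<^sup>2"
    using rt rate_bounds(1)[OF th] by (intro power_mono) auto
  have "real n * (norm (\<theta> - \<theta>0) * (rate \<theta>)\<^sup>2) \<le> real n * (((1 + a) * (1 + x) / sqrt (real n)) * ((1 + K * (1 + a)) * (1 + x) * l)\<^sup>2)"
    using order_trans[OF hb divide_right_mono[OF ax]] rt2 a0 x0 sqrt_n by (intro mult_left_mono mult_mono) auto
  also have "\<dots> = (1 + a) * (1 + K * (1 + a))\<^sup>2 * ((1 + x) * (1 + x)\<^sup>2) * (real n / sqrt (real n) * l\<^sup>2)"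
    by (simp add: power_mult_distrib)
  also have "\<dots> = (1 + a) * (1 + K * (1 + a))\<^sup>2 * slack * (1 + x) ^ 3"
    unfolding n_root slack_def by (simp add: power2_eq_square power3_eq_cube)
  finally have 1: "real n * (norm (\<theta> - \<theta>0) * (rate \<theta>)\<^sup>2) \<le> (1 + a) * (1 + K * (1 + a))\<^sup>2 * slack * (1 + x) ^ 3" .
  have one: "1 \<le> (1 + x) ^ 3" using x0 by simp
  have xx: "x \<le> (1 + x) ^ 3" using power_increasing[of 1 3 "1 + x"] x0 by simp
  have 2: "a * (1 + a * K)\<^sup>2 * slack \<le> a * (1 + a * K)\<^sup>2 * slack * (1 + x) ^ 3"
    using mult_left_mono[OF one, of "a * (1 + a * K)\<^sup>2 * slack"] a0 slack by simp
  have 3: "b * slack * x \<le> b * slack * (1 + x) ^ 3"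
    using xx b0 slack by (intro mult_left_mono) auto
  have "b * slack * x + 23 * K ^ 4 * (real n * (norm (\<theta> - \<theta>0) * (rate \<theta>)\<^sup>2) + a * (1 + a * K)\<^sup>2 * slack)
     \<le> b * slack * (1 + x) ^ 3 + 23 * K ^ 4 * ((1 + a) * (1 + K * (1 + a))\<^sup>2 * slack * (1 + x) ^ 3 + a * (1 + a * K)\<^sup>2 * slack * (1 + x) ^ 3)"
    by (rule add_mono[OF 3 mult_left_mono[OF add_mono[OF 1 2]]]) simp
  also have "\<dots> = (b + 23 * K ^ 4 * ((1 + a) * (1 + K * (1 + a))\<^sup>2 + a * (1 + a * K)\<^sup>2)) * (slack * (1 + x) ^ 3)"
    by (simp add: algebra_simps)
  also have "\<dots> \<le> loc_const K c * (slack * (1 + x) ^ 3)"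
    using a0 b0 c slack x0 by (intro mult_right_mono) (auto simp: loc_const_def Let_def)
  finally show ?thesis using recentred_remainder[OF th] by (simp add: x_def mult.assoc)
qed

text \<open>
  The cubic remainder is useless at distances much larger than \<open>1 / sqrt n\<close>. On the whole ball one
  uses \<open>norm (\<theta> - \<theta>0) \<le> R\<close> instead, which makes the remainder quadratic with a coefficient
  proportional to \<open>R\<close>. The condition on \<open>R\<close> is chosen for \<open>92 * (K ^ 4 * R) \<le> c / 8\<close>. Another
  \<open>c / 8\<close> absorbs the linear terms, and \<open>c / 4\<close> of the coefficient \<open>c / 2\<close> remains.
\<close>

lemma localised_majorant:
  assumes th: "\<theta> \<in> \<theta>ball"
  shows "L \<theta> - L thetahat \<le> loc_const K c - c / 4 * (sqrt (real n) * norm (\<theta> - thetahat))\<^sup>2"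
proof -
  define x where "x = sqrt (real n) * norm (\<theta> - thetahat)"
  define h where "h = norm (\<theta> - \<theta>0)"
  have x0: "x \<ge> 0" by (simp add: x_def)
  have a0: "a \<ge> 0" and b0: "b \<ge> 0" by (rule a_nonneg b_nonneg)+
  have hR: "h \<le> R" using th by (simp add: h_def dist_norm norm_minus_commute)
  have h0: "h \<ge> 0" by (simp add: h_def)
  have hb: "h \<le> (a + x) / sqrt (real n)" using h_bound by (simp add: x_def h_def)
  have K4: "0 \<le> K ^ 4" by simp
  have "real n * (h * (rate \<theta>)\<^sup>2) \<le> real n * (h * (2 * l\<^sup>2 + 2 * h\<^sup>2))"
    using rate_sq[of \<theta>] h0 by (intro mult_left_mono) (auto simp: h_def)
  also have "\<dots> = 2 * (real n * h * l\<^sup>2) + 2 * h * (real n * h\<^sup>2)" by (simp add: algebra_simps)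
  also have "\<dots> \<le> 2 * (a + x) + 2 * R * (2 * a\<^sup>2 + 2 * x\<^sup>2)"
  proof (rule add_mono)
    have "real n * h * l\<^sup>2 \<le> real n * ((a + x) / sqrt (real n)) * l\<^sup>2"
      using hb by (intro mult_right_mono mult_left_mono) auto
    also have "\<dots> = (a + x) * (real n / sqrt (real n) * l\<^sup>2)" by simp
    also have "\<dots> = (a + x) * slack" unfolding n_root slack_def ..
    also have "\<dots> \<le> (a + x) * 1" using slack a0 x0 by (intro mult_left_mono) auto
    finally show "2 * (real n * h * l\<^sup>2) \<le> 2 * (a + x)" by simp
    have "h\<^sup>2 \<le> ((a + x) / sqrt (real n))\<^sup>2" using hb h0 by (intro power_mono) auto
    then have "real n * h\<^sup>2 \<le> (a + x)\<^sup>2" using n_pos by (simp add: power_divide field_simps)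
    also have "\<dots> \<le> 2 * a\<^sup>2 + 2 * x\<^sup>2"
      using zero_le_power2[of "a - x"] by (simp add: power2_diff power2_sum)
    finally show "2 * h * (real n * h\<^sup>2) \<le> 2 * R * (2 * a\<^sup>2 + 2 * x\<^sup>2)"
      using hR h0 R by (intro mult_mono) auto
  qed
  finally have 1: "real n * (h * (rate \<theta>)\<^sup>2) \<le> 2 * a + 2 * x + 4 * R * a\<^sup>2 + 4 * R * x\<^sup>2" by (simp add: algebra_simps)
  also have "\<dots> \<le> 2 * a + 2 * x + 4 * a\<^sup>2 + 4 * R * x\<^sup>2"
    using R mult_right_mono[of R 1 "a\<^sup>2"] by simp
  finally have "23 * K ^ 4 * (real n * (h * (rate \<theta>)\<^sup>2)) \<le> 23 * K ^ 4 * (2 * a + 2 * x + 4 * a\<^sup>2 + 4 * R * x\<^sup>2)"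
    using K4 by (intro mult_left_mono) auto
  also have "\<dots> = 23 * K ^ 4 * (2 * a + 4 * a\<^sup>2) + 46 * K ^ 4 * x + 92 * (K ^ 4 * R) * x\<^sup>2" by (simp add: algebra_simps)
  also have "92 * (K ^ 4 * R) * x\<^sup>2 \<le> c / 8 * x\<^sup>2" using KR by (intro mult_right_mono) auto
  finally have A: "23 * K ^ 4 * (real n * (h * (rate \<theta>)\<^sup>2)) \<le> 23 * K ^ 4 * (2 * a + 4 * a\<^sup>2) + 46 * K ^ 4 * x + c / 8 * x\<^sup>2" by simp
  have Bk: "23 * K ^ 4 * (a * (1 + a * K)\<^sup>2 * slack) \<le> 23 * K ^ 4 * (a * (1 + a * K)\<^sup>2)"
    using slack a0 by (intro mult_left_mono) (auto intro: mult_right_le_one_le)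
  have Ck: "b * slack * x \<le> b * x" using slack b0 x0 by (auto intro!: mult_right_mono mult_right_le_one_le)
  have Dk: "(b + 46 * K ^ 4) * x \<le> c / 8 * x\<^sup>2 + 2 * (b + 46 * K ^ 4)\<^sup>2 / c"
  proof -
    have "0 \<le> (sqrt (c / 8) * x - (b + 46 * K ^ 4) / (2 * sqrt (c / 8)))\<^sup>2" by simp
    also have "\<dots> = c / 8 * x\<^sup>2 - (b + 46 * K ^ 4) * x + 2 * (b + 46 * K ^ 4)\<^sup>2 / c"
      using c by (simp add: power2_diff power_mult_distrib power_divide)
    finally show ?thesis by simp
  qed
  have lower: "c * x\<^sup>2 \<le> real n * ((I0 *v (\<theta> - thetahat)) \<bullet> (\<theta> - thetahat))"
  proof -
    have "c * x\<^sup>2 = real n * (c * (norm (\<theta> - thetahat))\<^sup>2)" by (simp add: x_def power_mult_distrib)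
    also have "\<dots> \<le> real n * ((I0 *v (\<theta> - thetahat)) \<bullet> (\<theta> - thetahat))" using coercive by (intro mult_left_mono) auto
    finally show ?thesis .
  qed
  have main: "L \<theta> - L thetahat + real n * ((I0 *v (\<theta> - thetahat)) \<bullet> (\<theta> - thetahat)) / 2
      \<le> b * slack * x + (23 * K ^ 4 * (real n * (h * (rate \<theta>)\<^sup>2)) + 23 * K ^ 4 * (a * (1 + a * K)\<^sup>2 * slack))"
    using recentred_remainder[OF th] unfolding x_def h_def by (simp add: abs_le_iff distrib_left)
  have LC: "23 * K ^ 4 * (2 * a + 4 * a\<^sup>2) + 23 * K ^ 4 * (a * (1 + a * K)\<^sup>2) + 2 * (b + 46 * K ^ 4)\<^sup>2 / c \<le> loc_const K c"
  proof -
    have "0 \<le> K\<^sup>2 + a + (b + 23 * K ^ 4 * ((1 + a) * (1 + K * (1 + a))\<^sup>2 + a * (1 + a * K)\<^sup>2))"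
      using a0 b0 by simp
    then show ?thesis unfolding loc_const_def Let_def distrib_left[of "23 * K ^ 4" "a * (1 + a * K)\<^sup>2 + 2 * a"]
       distrib_left[of "23 * K ^ 4" "a * (1 + a * K)\<^sup>2"] distrib_left[of "23 * K ^ 4" "2 * a"] by linarith
  qed
  have "(b + 46 * K ^ 4) * x = b * x + 46 * K ^ 4 * x" by (simp add: distrib_right)
  then show ?thesis using main A Bk Ck Dk lower LC unfolding x_def[symmetric] by linarith
qed

end

end


section \<open>Gaussian integrals\<close>

lemma lborel_integral_affine_euclidean:
  fixes f :: "'a::euclidean_space \<Rightarrow> 'b::{banach, second_countable_topology}" and c :: real
  assumes c: "c \<noteq> 0" and f[measurable]: "f \<in> borel_measurable borel"
  shows "(\<integral>x. f x \<partial>lborel) = \<bar>c\<bar> ^ DIM('a) *\<^sub>R (\<integral>x. f (t + c *\<^sub>R x) \<partial>lborel)"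
    "integrable lborel f \<longleftrightarrow> integrable lborel (\<lambda>x. f (t + c *\<^sub>R x))"
proof -
  have eq: "lborel = density (distr lborel borel (\<lambda>x. t + c *\<^sub>R x)) (\<lambda>_. ennreal (\<bar>c\<bar> ^ DIM('a)))"
    using lborel_affine[OF c, of t] by simp
  show "(\<integral>x. f x \<partial>lborel) = \<bar>c\<bar> ^ DIM('a) *\<^sub>R (\<integral>x. f (t + c *\<^sub>R x) \<partial>lborel)"
    by (subst eq) (simp add: integral_density integral_distr)
  have "integrable lborel f \<longleftrightarrow> integrable (density (distr lborel borel (\<lambda>x. t + c *\<^sub>R x)) (\<lambda>_. ennreal (\<bar>c\<bar> ^ DIM('a)))) f"
    by (subst eq) simp
  also have "\<dots> \<longleftrightarrow> integrable lborel (\<lambda>x. \<bar>c\<bar> ^ DIM('a) *\<^sub>R f (t + c *\<^sub>R x))"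
    by (simp add: integrable_density integrable_distr_eq)
  also have "\<dots> \<longleftrightarrow> integrable lborel (\<lambda>x. f (t + c *\<^sub>R x))"
  proof
    assume "integrable lborel (\<lambda>x. \<bar>c\<bar> ^ DIM('a) *\<^sub>R f (t + c *\<^sub>R x))"
    then have "integrable lborel (\<lambda>x. inverse (\<bar>c\<bar> ^ DIM('a)) *\<^sub>R (\<bar>c\<bar> ^ DIM('a) *\<^sub>R f (t + c *\<^sub>R x)))"
      by (rule integrable_bounded_linear[OF bounded_linear_scaleR_right])
    moreover have "(\<lambda>x. inverse (\<bar>c\<bar> ^ DIM('a)) *\<^sub>R (\<bar>c\<bar> ^ DIM('a) *\<^sub>R f (t + c *\<^sub>R x))) = (\<lambda>x. f (t + c *\<^sub>R x))"
      using c by simp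
    ultimately show "integrable lborel (\<lambda>x. f (t + c *\<^sub>R x))" by (simp only:)
  qed auto
  finally show "integrable lborel f \<longleftrightarrow> integrable lborel (\<lambda>x. f (t + c *\<^sub>R x))" .
qed

lemma integrable_exp_neg_square_real:
  fixes c :: real
  assumes "c > 0"
  shows "integrable lborel (\<lambda>x. exp (- c * x\<^sup>2))"
proof -
  define \<sigma> where "\<sigma> = sqrt (1 / (2 * c))"
  have \<sigma>: "\<sigma> > 0" "\<sigma>\<^sup>2 = 1 / (2 * c)" using assms by (auto simp: \<sigma>_def)
  have "integrable lborel (\<lambda>x. sqrt (2 * pi * \<sigma>\<^sup>2) * normal_density 0 \<sigma> x)"
    using \<sigma> by (intro integrable_mult_right integrable_normal_density) auto
  moreover have "sqrt (2 * pi * \<sigma>\<^sup>2) * normal_density 0 \<sigma> x = exp (- c * x\<^sup>2)" for x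
    using \<sigma> assms by (simp add: normal_density_def)
  ultimately show ?thesis by simp
qed

lemma integrable_exp_neg_norm_square:
  fixes c :: real
  assumes c: "c > 0"
  shows "integrable lborel (\<lambda>u :: 'a::euclidean_space. exp (- c * (norm u)\<^sup>2))"
proof (rule integrableI_nonneg)
  have "exp (- c * (norm u)\<^sup>2) = (\<Prod>b\<in>Basis. exp (- c * (u \<bullet> b)\<^sup>2))" for u :: 'a
  proof -
    have "(norm u)\<^sup>2 = (\<Sum>b\<in>Basis. (u \<bullet> b)\<^sup>2)"
      unfolding power2_norm_eq_inner by (subst euclidean_inner) (simp add: power2_eq_square)
    then show ?thesis by (simp add: exp_sum[symmetric] sum_distrib_left)
  qed
  then have "(\<integral>\<^sup>+u. ennreal (exp (- c * (norm (u :: 'a))\<^sup>2)) \<partial>lborel) =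
       (\<integral>\<^sup>+u. (\<Prod>b\<in>Basis. ennreal (exp (- c * ((u :: 'a) \<bullet> b)\<^sup>2))) \<partial>lborel)"
    by (simp add: prod_ennreal)
  also have "\<dots> = (\<Prod>b\<in>(Basis :: 'a set). (\<integral>\<^sup>+x. ennreal (exp (- c * x\<^sup>2)) \<partial>lborel))"
    by (rule nn_integral_lborel_prod[of "\<lambda>b x. ennreal (exp (- c * x\<^sup>2))"]) auto
  also have "\<dots> < \<infinity>"
    using nn_integral_eq_integral[OF integrable_exp_neg_square_real[OF c]] by (simp add: ennreal_power)
  finally show "(\<integral>\<^sup>+u. ennreal (exp (- c * (norm (u :: 'a))\<^sup>2)) \<partial>lborel) < \<infinity>" .
qed auto

text \<open>
  Since \<open>1 + t \<le> exp t\<close>, the first two factors are at most \<open>exp ((p + k) * t)\<close>, and completing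
  the square takes half of the Gaussian exponent.
\<close>

lemma polynomial_exponential_gaussian_bound:
  fixes c k t :: real
  assumes c: "c > 0" and t: "t \<ge> 0"
  shows "(1 + t) ^ p * exp (k * t) * exp (- c * t\<^sup>2) \<le> exp ((real p + k)\<^sup>2 / (2 * c)) * exp (- (c / 2) * t\<^sup>2)"
proof -
  have "(1 + t) ^ p \<le> exp t ^ p" using t by (intro power_mono exp_ge_add_one_self) auto
  also have "\<dots> = exp (real p * t)" by (simp add: exp_of_nat_mult)
  finally have "(1 + t) ^ p * exp (k * t) * exp (- c * t\<^sup>2) \<le> exp (real p * t) * exp (k * t) * exp (- c * t\<^sup>2)"
    by (intro mult_right_mono) auto
  also have "\<dots> = exp ((real p + k) * t - c * t\<^sup>2)" by (simp add: exp_add[symmetric] algebra_simps)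
  also have "\<dots> \<le> exp ((real p + k)\<^sup>2 / (2 * c) - c / 2 * t\<^sup>2)"
  proof -
    have "0 \<le> (sqrt (c / 2) * t - (real p + k) / (2 * sqrt (c / 2)))\<^sup>2" by simp
    also have "\<dots> = c / 2 * t\<^sup>2 - (real p + k) * t + (real p + k)\<^sup>2 / (2 * c)"
      using c by (simp add: power2_diff power_mult_distrib power_divide)
    finally show ?thesis by simp
  qed
  also have "\<dots> = exp ((real p + k)\<^sup>2 / (2 * c)) * exp (- (c / 2) * t\<^sup>2)" by (simp add: exp_add[symmetric])
  finally show ?thesis .
qed

lemma integrable_polynomial_gaussian:
  fixes c :: real
  assumes c: "c > 0"
  shows "integrable lborel (\<lambda>u :: 'a::euclidean_space. (1 + norm u) ^ p * exp (k * norm u) * exp (- c * (norm u)\<^sup>2))"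
proof (rule Bochner_Integration.integrable_bound)
  show "integrable lborel (\<lambda>u :: 'a. exp ((real p + k)\<^sup>2 / (2 * c)) * exp (- (c / 2) * (norm u)\<^sup>2))"
    using c by (intro integrable_mult_right integrable_exp_neg_norm_square) auto
  show "AE u :: 'a in lborel. norm ((1 + norm u) ^ p * exp (k * norm u) * exp (- c * (norm u)\<^sup>2))
       \<le> norm (exp ((real p + k)\<^sup>2 / (2 * c)) * exp (- (c / 2) * (norm u)\<^sup>2))"
    using polynomial_exponential_gaussian_bound[OF c norm_ge_zero] by (intro AE_I2) (simp add: abs_mult)
qed auto

lemma integral_odd_function:
  fixes f :: "'a::euclidean_space \<Rightarrow> 'b::{banach, second_countable_topology}"
  assumes "f \<in> borel_measurable borel" "\<And>u. f (- u) = - f u"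
  shows "(\<integral>u. f u \<partial>lborel) = 0"
proof -
  have "(\<integral>u. f u \<partial>lborel) = - (\<integral>u. f u \<partial>lborel)"
    using lborel_integral_affine_euclidean(1)[of "- 1" f 0] assms by simp
  then have "2 *\<^sub>R (\<integral>u. f u \<partial>lborel) = 0" by (metis add.right_inverse scaleR_2)
  then show ?thesis by simp
qed

locale gaussian =
  fixes A :: "real^'d^'d" and c :: real
  assumes c_pos: "c > 0" and sym: "\<And>u v. (A *v u) \<bullet> v = (A *v v) \<bullet> u"
    and coercive: "\<And>u. c * (norm u)\<^sup>2 \<le> (A *v u) \<bullet> u"
begin

definition "\<phi> u = exp (- ((A *v u) \<bullet> u) / 2)"

definition "Z0 = (\<integral>u. \<phi> u \<partial>lborel)"

lemma \<phi>_measurable[measurable]: "\<phi> \<in> borel_measurable borel"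
  unfolding \<phi>_def by (intro borel_measurable_continuous_onI continuous_intros
    linear_continuous_on matrix_vector_mul_bounded_linear) auto

lemma \<phi>_pos: "\<phi> u > 0" by (simp add: \<phi>_def)

lemma \<phi>_le: "\<phi> u \<le> exp (- (c / 2) * (norm u)\<^sup>2)"
  using coercive[of u] by (simp add: \<phi>_def)

lemma \<phi>_minus: "\<phi> (- u) = \<phi> u"
proof -
  have "- u = (- 1) *\<^sub>R u" by simp
  then have "A *v (- u) = - (A *v u)" by (metis matrix_vector_mult_scaleR scaleR_minus1_left)
  then show ?thesis by (simp add: \<phi>_def)
qed

lemma \<phi>_shift: "\<phi> (u + s *\<^sub>R w) = \<phi> u * exp (- s * ((A *v w) \<bullet> u)) * exp (- s\<^sup>2 * ((A *v w) \<bullet> w) / 2)"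
proof -
  have "(A *v (u + s *\<^sub>R w)) \<bullet> (u + s *\<^sub>R w) = (A *v u) \<bullet> u + 2 * s * ((A *v w) \<bullet> u) + s\<^sup>2 * ((A *v w) \<bullet> w)"
    using sym[of u w] by (simp add: matrix_vector_right_distrib matrix_vector_mult_scaleR inner_add_left inner_add_right power2_eq_square algebra_simps)
  then show ?thesis by (simp add: \<phi>_def exp_add[symmetric] field_simps)
qed

lemma integrable_dominated:
  fixes h :: "real^'d \<Rightarrow> 'b::{banach, second_countable_topology}"
  assumes [measurable]: "h \<in> borel_measurable borel"
    and le: "\<And>u. norm (h u) \<le> C * ((1 + norm u) ^ p * exp (k * norm u))"
  shows "integrable lborel (\<lambda>u. \<phi> u *\<^sub>R h u)"
proof (rule Bochner_Integration.integrable_bound)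
  show "integrable lborel (\<lambda>u :: real^'d. C * ((1 + norm u) ^ p * exp (k * norm u) * exp (- (c / 2) * (norm u)\<^sup>2)))"
    using c_pos by (intro integrable_mult_right integrable_polynomial_gaussian) auto
  show "AE u in lborel. norm (\<phi> u *\<^sub>R h u) \<le> norm (C * ((1 + norm u) ^ p * exp (k * norm u) * exp (- (c / 2) * (norm u)\<^sup>2)))"
  proof (rule AE_I2)
    fix u
    have "norm (\<phi> u *\<^sub>R h u) = norm (h u) * \<phi> u" using \<phi>_pos[of u] by simp
    also have "\<dots> \<le> (C * ((1 + norm u) ^ p * exp (k * norm u))) * exp (- (c / 2) * (norm u)\<^sup>2)"
      using \<phi>_pos[of u] by (intro mult_mono le \<phi>_le order_trans[OF norm_ge_zero le]) auto
    finally show "norm (\<phi> u *\<^sub>R h u) \<le> norm (C * ((1 + norm u) ^ p * exp (k * norm u) * exp (- (c / 2) * (norm u)\<^sup>2)))"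
      by (simp add: mult.assoc)
  qed
qed measurable

lemma integrable_\<phi>: "integrable lborel \<phi>"
  using integrable_dominated[of "\<lambda>_. 1::real" 1 0 0] by simp

lemma Z0_pos: "Z0 > 0"
proof -
  have "Z0 \<noteq> 0"
    unfolding Z0_def
    by (subst integral_nonneg_eq_0_iff_AE[OF integrable_\<phi>])
       (use \<phi>_pos in \<open>auto simp: less_imp_le less_imp_neq[THEN not_sym] AE_iff_measurable[of UNIV lborel]\<close>)
  moreover have "Z0 \<ge> 0" unfolding Z0_def using \<phi>_pos by (intro integral_nonneg_AE AE_I2) (simp add: less_imp_le)
  ultimately show ?thesis by simp
qed

lemma first_moment: "(\<integral>u. \<phi> u *\<^sub>R u \<partial>lborel) = 0"
  by (rule integral_odd_function) (auto simp: \<phi>_minus)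

lemma exp_quotient_bound: "\<bar>(exp (s * y) - 1) / s\<bar> \<le> \<bar>y\<bar> * exp \<bar>y\<bar>" if "0 < s" "s \<le> 1" for s y :: real
proof -
  have *: "\<bar>exp z - 1\<bar> \<le> \<bar>z\<bar> * exp \<bar>z\<bar>" for z :: real
  proof (cases "z \<ge> 0")
    case True
    have "exp z * (1 - z) \<le> exp z * exp (- z)" using exp_ge_add_one_self[of "- z"] by (intro mult_left_mono) auto
    then have "exp z - 1 \<le> z * exp z" by (simp add: exp_minus algebra_simps)
    then show ?thesis using True by simp
  next
    case False
    have "1 - exp z \<le> - z" using exp_ge_add_one_self[of z] by linarith
    also have "\<dots> \<le> - z * exp (- z)" using False by (simp add: mult_le_cancel_left1)
    finally show ?thesis using False by simp
  qed
  have "\<bar>(exp (s * y) - 1) / s\<bar> = \<bar>exp (s * y) - 1\<bar> / s" using that by simp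
  also have "\<dots> \<le> (\<bar>s * y\<bar> * exp \<bar>s * y\<bar>) / s" using that * by (intro divide_right_mono) auto
  also have "\<dots> = \<bar>y\<bar> * exp (s * \<bar>y\<bar>)" using that by (simp add: abs_mult)
  also have "\<dots> \<le> \<bar>y\<bar> * exp \<bar>y\<bar>" using that by (intro mult_left_mono) (auto intro: mult_left_le_one_le)
  finally show ?thesis .
qed

text \<open>
  The integral of \<open>(w' \<bullet> (u + s *\<^sub>R w)) * \<phi> (u + s *\<^sub>R w)\<close> over \<open>u\<close> does not
  depend on \<open>s\<close> and is zero by symmetry. Its derivative at \<open>s = 0\<close> is the difference of the
  two sides. This is Stein's identity for the Gaussian density; the derivative is taken along
  a sequence of difference quotients by dominated convergence.
\<close>

lemma second_moment_identity:
  "(\<integral>u. \<phi> u * ((w' \<bullet> u) * ((A *v w) \<bullet> u)) \<partial>lborel) = (w' \<bullet> w) * Z0"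
proof -
  define y where "y u = - ((A *v w) \<bullet> u)" for u
  define k where "k = norm (A *v w)"
  define s where "s n = inverse (real (Suc n))" for n
  have s: "0 < s n" "s n \<le> 1" for n by (auto simp: s_def inverse_le_1_iff)
  have slim: "s \<longlonglongrightarrow> 0" unfolding s_def by (rule LIMSEQ_inverse_real_of_nat)
  have yb: "\<bar>y u\<bar> \<le> k * norm u" for u unfolding y_def k_def by (simp add: Cauchy_Schwarz_ineq2)
  have k0: "k \<ge> 0" by (simp add: k_def)
  have ym[measurable]: "y \<in> borel_measurable borel" unfolding y_def by measurable
  have nu: "norm u \<le> 1 + norm u" for u :: "real^'d" by simp
  have expy: "exp (t * y u) \<le> exp (k * norm u)" if "0 \<le> t" "t \<le> 1" for t u
  proof -
    have "t * y u \<le> t * \<bar>y u\<bar>" using that by (intro mult_left_mono) auto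
    also have "\<dots> \<le> \<bar>y u\<bar>" using that by (intro mult_left_le_one_le) auto
    finally show ?thesis using yb[of u] by simp
  qed
  have iw': "integrable lborel (\<lambda>u. \<phi> u * (w' \<bullet> u))"
  proof -
    have "norm (w' \<bullet> u) \<le> norm w' * ((1 + norm u) ^ 1 * exp (0 * norm u))" for u
      using order_trans[OF Cauchy_Schwarz_ineq2[of w' u] mult_left_mono[OF nu norm_ge_zero]] by simp
    from integrable_dominated[OF _ this] show ?thesis by simp
  qed
  have m0: "(\<integral>u. \<phi> u * (w' \<bullet> u) \<partial>lborel) = 0"
    by (rule integral_odd_function) (auto simp: \<phi>_minus)
  have i1: "integrable lborel (\<lambda>u. \<phi> u * exp (s n * y u))" for n
  proof -
    have "norm (exp (s n * y u)) \<le> 1 * ((1 + norm u) ^ 0 * exp (k * norm u))" for u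
      using expy[OF less_imp_le[OF s(1)] s(2), of n u] by (simp only: real_norm_def abs_exp_cancel power_0 mult_1)
    from integrable_dominated[OF _ this] show ?thesis by simp
  qed
  have i2: "integrable lborel (\<lambda>u. \<phi> u * ((w' \<bullet> u) * exp (s n * y u)))" for n
  proof -
    have "\<bar>(w' \<bullet> u) * exp (s n * y u)\<bar> \<le> norm w' * ((1 + norm u) ^ 1 * exp (k * norm u))" for u
      using mult_mono[OF order_trans[OF Cauchy_Schwarz_ineq2[of w' u] mult_left_mono[OF nu norm_ge_zero]]
          expy[OF less_imp_le[OF s(1)] s(2), of n u]]
      by (simp add: abs_mult mult.assoc)
    then show ?thesis using integrable_dominated[of "\<lambda>u. (w' \<bullet> u) * exp (s n * y u)" "norm w'" 1 k] by simp
  qed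
  have zero: "(w' \<bullet> w) * (\<integral>u. \<phi> u * exp (s n * y u) \<partial>lborel)
      + (\<integral>u. \<phi> u * ((w' \<bullet> u) * ((exp (s n * y u) - 1) / s n)) \<partial>lborel) = 0" for n
  proof -
    have "(\<integral>u. \<phi> u * (w' \<bullet> u) \<partial>lborel) = (\<integral>u. \<phi> (s n *\<^sub>R w + u) * (w' \<bullet> (s n *\<^sub>R w + u)) \<partial>lborel)"
      using lborel_integral_affine_euclidean(1)[of 1 "\<lambda>u. \<phi> u * (w' \<bullet> u)" "s n *\<^sub>R w"] by simp
    also have "\<dots> = (\<integral>u. exp (- (s n)\<^sup>2 * ((A *v w) \<bullet> w) / 2) * (\<phi> u * exp (s n * y u) * (s n * (w' \<bullet> w) + w' \<bullet> u)) \<partial>lborel)"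
      by (rule Bochner_Integration.integral_cong[OF refl], subst add.commute, subst \<phi>_shift)
         (simp add: y_def inner_add_right mult_ac)
    finally have "(\<integral>u. \<phi> u * exp (s n * y u) * (s n * (w' \<bullet> w) + w' \<bullet> u) \<partial>lborel) = 0"
      using m0 by simp
    moreover have "(\<integral>u. \<phi> u * exp (s n * y u) * (s n * (w' \<bullet> w) + w' \<bullet> u) \<partial>lborel)
        = (\<integral>u. s n * (w' \<bullet> w) * (\<phi> u * exp (s n * y u)) + \<phi> u * ((w' \<bullet> u) * exp (s n * y u)) \<partial>lborel)"
      by (rule Bochner_Integration.integral_cong) (auto simp: algebra_simps)
    moreover have "\<dots> = s n * (w' \<bullet> w) * (\<integral>u. \<phi> u * exp (s n * y u) \<partial>lborel) + (\<integral>u. \<phi> u * ((w' \<bullet> u) * exp (s n * y u)) \<partial>lborel)"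
      using i1[of n] i2[of n] by simp
    moreover have "(\<integral>u. \<phi> u * ((w' \<bullet> u) * ((exp (s n * y u) - 1) / s n)) \<partial>lborel)
        = (\<integral>u. (1 / s n) * (\<phi> u * ((w' \<bullet> u) * exp (s n * y u)) - \<phi> u * (w' \<bullet> u)) \<partial>lborel)"
      by (rule Bochner_Integration.integral_cong) (auto simp: algebra_simps diff_divide_distrib)
    moreover have "\<dots> = (1 / s n) * (\<integral>u. \<phi> u * ((w' \<bullet> u) * exp (s n * y u)) \<partial>lborel)"
      using i2[of n] iw' m0 by simp
    ultimately have "s n * ((w' \<bullet> w) * (\<integral>u. \<phi> u * exp (s n * y u) \<partial>lborel)
      + (\<integral>u. \<phi> u * ((w' \<bullet> u) * ((exp (s n * y u) - 1) / s n)) \<partial>lborel)) = 0"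
      using s(1)[of n] by (simp add: distrib_left mult.assoc)
    then show ?thesis using s(1)[of n] by simp
  qed
  have lim1: "(\<lambda>n. \<integral>u. \<phi> u * exp (s n * y u) \<partial>lborel) \<longlonglongrightarrow> (\<integral>u. \<phi> u \<partial>lborel)"
  proof (rule integral_dominated_convergence[where w = "\<lambda>u. \<phi> u * exp (k * norm u)"])
    show "integrable lborel (\<lambda>u. \<phi> u * exp (k * norm u))"
      using integrable_dominated[of "\<lambda>u. exp (k * norm u)" 1 0 k] by simp
    show "AE u in lborel. (\<lambda>n. \<phi> u * exp (s n * y u)) \<longlonglongrightarrow> \<phi> u"
    proof (rule AE_I2)
      fix u
      have "(\<lambda>n. \<phi> u * exp (s n * y u)) \<longlonglongrightarrow> \<phi> u * exp (0 * y u)" by (intro tendsto_intros slim)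
      then show "(\<lambda>n. \<phi> u * exp (s n * y u)) \<longlonglongrightarrow> \<phi> u" by simp
    qed
    show "AE u in lborel. norm (\<phi> u * exp (s n * y u)) \<le> \<phi> u * exp (k * norm u)" for n
      using expy[OF less_imp_le[OF s(1)] s(2)] by (intro AE_I2) (auto simp: abs_mult abs_of_pos[OF \<phi>_pos] intro!: mult_left_mono less_imp_le[OF \<phi>_pos])
  qed measurable
  have lim2: "(\<lambda>n. \<integral>u. \<phi> u * ((w' \<bullet> u) * ((exp (s n * y u) - 1) / s n)) \<partial>lborel) \<longlonglongrightarrow> (\<integral>u. \<phi> u * ((w' \<bullet> u) * y u) \<partial>lborel)"
  proof (rule integral_dominated_convergence[where w = "\<lambda>u. \<phi> u * ((norm w' * norm u) * ((k * norm u) * exp (k * norm u)))"])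
    have "\<bar>(norm w' * norm u) * ((k * norm u) * exp (k * norm u))\<bar> \<le> (norm w' * k) * ((1 + norm u) ^ 2 * exp (k * norm u))" for u :: "real^'d"
    proof -
      have "norm u * norm u \<le> (1 + norm u) ^ 2" by (simp add: power2_eq_square algebra_simps)
      then have "(norm w' * k * exp (k * norm u)) * (norm u * norm u) \<le> (norm w' * k * exp (k * norm u)) * (1 + norm u) ^ 2"
        using k0 by (intro mult_left_mono) auto
      then show ?thesis using k0 by (simp add: abs_mult mult_ac)
    qed
    then show "integrable lborel (\<lambda>u. \<phi> u * ((norm w' * norm u) * ((k * norm u) * exp (k * norm u))))"
      using integrable_dominated[of "\<lambda>u. (norm w' * norm u) * ((k * norm u) * exp (k * norm u))" "norm w' * k" 2 k] by simp
    show "AE u in lborel. (\<lambda>n. \<phi> u * ((w' \<bullet> u) * ((exp (s n * y u) - 1) / s n))) \<longlonglongrightarrow> \<phi> u * ((w' \<bullet> u) * y u)"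
    proof (rule AE_I2)
      fix u
      have "((\<lambda>t. exp (t * y u)) has_field_derivative y u) (at 0)" by (auto intro!: derivative_eq_intros)
      then have "((\<lambda>t. (exp (t * y u) - 1) / t) \<longlongrightarrow> y u) (at 0)" by (simp add: DERIV_def)
      moreover have "filterlim s (at 0) sequentially"
        using slim s(1) by (auto simp: filterlim_at less_imp_neq[symmetric])
      ultimately have "(\<lambda>n. (exp (s n * y u) - 1) / s n) \<longlonglongrightarrow> y u" by (rule filterlim_compose)
      then show "(\<lambda>n. \<phi> u * ((w' \<bullet> u) * ((exp (s n * y u) - 1) / s n))) \<longlonglongrightarrow> \<phi> u * ((w' \<bullet> u) * y u)"
        by (intro tendsto_intros)
    qed
    show "AE u in lborel. norm (\<phi> u * ((w' \<bullet> u) * ((exp (s n * y u) - 1) / s n))) \<le> \<phi> u * ((norm w' * norm u) * ((k * norm u) * exp (k * norm u)))" for n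
    proof (rule AE_I2)
      fix u
      have "\<bar>(exp (s n * y u) - 1) / s n\<bar> \<le> (k * norm u) * exp (k * norm u)"
        using yb[of u] k0 by (intro order_trans[OF exp_quotient_bound[OF s] mult_mono]) auto
      then have "\<bar>w' \<bullet> u\<bar> * \<bar>(exp (s n * y u) - 1) / s n\<bar> \<le> (norm w' * norm u) * ((k * norm u) * exp (k * norm u))"
        by (intro mult_mono Cauchy_Schwarz_ineq2) auto
      then show "norm (\<phi> u * ((w' \<bullet> u) * ((exp (s n * y u) - 1) / s n))) \<le> \<phi> u * ((norm w' * norm u) * ((k * norm u) * exp (k * norm u)))"
        unfolding real_norm_def abs_mult[of "\<phi> u"] abs_mult[of "w' \<bullet> u"] abs_of_pos[OF \<phi>_pos]
        by (intro mult_left_mono less_imp_le[OF \<phi>_pos])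
    qed
  qed measurable
  have "(w' \<bullet> w) * Z0 + (\<integral>u. \<phi> u * ((w' \<bullet> u) * y u) \<partial>lborel) = 0"
    using LIMSEQ_unique[OF tendsto_add[OF tendsto_mult_left[OF lim1, of "w' \<bullet> w"] lim2]] zero by (simp add: Z0_def)
  then show ?thesis by (simp add: y_def)
qed

definition "V = (\<chi> i j. (\<integral>u. \<phi> u * (u $ i * u $ j) \<partial>lborel) / Z0)"

lemma integrable_second: "integrable lborel (\<lambda>u. \<phi> u * (u $ i * u $ j))"
proof -
  have "\<bar>u $ i * u $ j\<bar> \<le> 1 * ((1 + norm u) ^ 2 * exp (0 * norm u))" for u :: "real^'d"
  proof -
    have "\<bar>u $ i\<bar> * \<bar>u $ j\<bar> \<le> (1 + norm u) * (1 + norm u)"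
      using component_le_norm_cart[of u i] component_le_norm_cart[of u j] by (intro mult_mono) auto
    then show ?thesis by (simp add: abs_mult power2_eq_square)
  qed
  then show ?thesis using integrable_dominated[of "\<lambda>u. u $ i * u $ j" 1 2 0] by simp
qed

text \<open>
  The entries of \<open>V ** A\<close> are the second moment identity for two coordinate vectors.
\<close>

lemma V_inverse: "V ** A = mat 1" "A ** V = mat 1"
proof -
  have "(V ** A) $ i $ k = mat 1 $ i $ k" for i k
  proof -
    have "(V ** A) $ i $ k = (\<Sum>j\<in>UNIV. (\<integral>u. \<phi> u * (u $ i * u $ j) \<partial>lborel) / Z0 * A $ j $ k)"
      by (simp add: matrix_matrix_mult_def V_def)
    also have "\<dots> = (\<Sum>j\<in>UNIV. A $ j $ k * (\<integral>u. \<phi> u * (u $ i * u $ j) \<partial>lborel)) / Z0"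
      by (simp add: sum_divide_distrib mult.commute)
    also have "(\<Sum>j\<in>UNIV. A $ j $ k * (\<integral>u. \<phi> u * (u $ i * u $ j) \<partial>lborel))
        = (\<integral>u. (\<Sum>j\<in>UNIV. A $ j $ k * (\<phi> u * (u $ i * u $ j))) \<partial>lborel)"
      using integrable_second by simp
    also have "\<dots> = (\<integral>u. \<phi> u * ((axis i 1 \<bullet> u) * ((A *v axis k 1) \<bullet> u)) \<partial>lborel)"
    proof (rule Bochner_Integration.integral_cong[OF refl])
      fix u :: "real^'d"
      have "(A *v axis k 1) \<bullet> u = (\<Sum>j\<in>UNIV. A $ j $ k * u $ j)"
        by (simp add: inner_vec_def matrix_vector_mult_basis column_def)
      then show "(\<Sum>j\<in>UNIV. A $ j $ k * (\<phi> u * (u $ i * u $ j))) = \<phi> u * ((axis i 1 \<bullet> u) * ((A *v axis k 1) \<bullet> u))"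
        by (simp add: inner_axis' sum_distrib_left mult_ac)
    qed
    also have "\<dots> = ((axis i 1 :: real^'d) \<bullet> axis k 1) * Z0" by (rule second_moment_identity)
    finally show ?thesis using Z0_pos by (simp add: inner_axis_axis mat_def)
  qed
  then show "V ** A = mat 1" by (simp add: vec_eq_iff)
  then show "A ** V = mat 1" using matrix_left_right_inverse by blast
qed

end


section \<open>Perturbation of matrix inverses\<close>

lemma norm_matrix_mult_le:
  fixes A :: "real^'n^'m" and B :: "real^'k^'n"
  shows "norm (A ** B) \<le> norm A * norm B"
proof (rule norm_vec_le_mult)
  fix i
  have "(A ** B) $ i = (\<Sum>k\<in>UNIV. A $ i $ k *\<^sub>R B $ k)"
    by (simp add: vec_eq_iff matrix_matrix_mult_def)
  then have "norm ((A ** B) $ i) \<le> (\<Sum>k\<in>UNIV. \<bar>A $ i $ k\<bar> * \<bar>norm (B $ k)\<bar>)"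
    by (simp add: norm_sum[THEN order_trans])
  also have "\<dots> \<le> L2_set (\<lambda>k. A $ i $ k) UNIV * L2_set (\<lambda>k. norm (B $ k)) UNIV"
    by (rule L2_set_mult_ineq)
  also have "\<dots> = norm (A $ i) * norm B" by (simp add: norm_vec_def[of "A $ i"] norm_vec_def[of B] L2_set_def)
  finally show "norm ((A ** B) $ i) \<le> norm (A $ i) * norm B" .
qed simp

lemma norm_matrix_le_entries:
  fixes A :: "real^'n^'m"
  assumes "\<And>i j. \<bar>A $ i $ j\<bar> \<le> e"
  shows "norm A \<le> real (CARD('m)) * (real (CARD('n)) * e)"
proof -
  have row: "norm (A $ i) \<le> real (CARD('n)) * e" for i
  proof -
    have "norm (A $ i) \<le> (\<Sum>j\<in>UNIV. \<bar>A $ i $ j\<bar>)" by (rule norm_le_l1_cart)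
    also have "\<dots> \<le> (\<Sum>j\<in>(UNIV :: 'n set). e)" by (rule sum_mono) (rule assms)
    finally show ?thesis by simp
  qed
  have "norm A \<le> (\<Sum>i\<in>UNIV. norm (A $ i))" unfolding norm_vec_def by (rule L2_set_le_sum) simp
  also have "\<dots> \<le> (\<Sum>i\<in>(UNIV :: 'm set). real (CARD('n)) * e)" by (rule sum_mono) (rule row)
  finally show ?thesis by simp
qed

lemma matrix_mult_scaleR:
  fixes M N :: "real^'d^'d"
  shows "(a *\<^sub>R M) ** (b *\<^sub>R N) = (a * b) *\<^sub>R (M ** N)"
  by (simp add: vec_eq_iff matrix_matrix_mult_def sum_distrib_left mult_ac)

lemma matrix_mult_diff:
  fixes M N Q :: "real^'d^'d"
  shows "(M - N) ** Q = M ** Q - N ** Q" "Q ** (M - N) = Q ** M - Q ** N"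
  by (simp_all add: vec_eq_iff matrix_matrix_mult_def sum_subtractf algebra_simps)

text \<open>
  A matrix within \<open>1 / (2 * norm A)\<close> of the inverse of \<open>A\<close> has trivial kernel, and its inverse
  \<open>Y\<close> satisfies \<open>Y - A = Y ** ((V - W) ** A)\<close>, which first gives \<open>norm Y \<le> 2 * norm A\<close> and
  then the bound. For the posterior covariance \<open>C\<close> the scale \<open>s\<close> is the sample size.
\<close>

lemma matrix_inverse_perturbation:
  fixes A V W :: "real^'d^'d"
  assumes VA: "V ** A = mat 1" "A ** V = mat 1" and e: "norm (W - V) \<le> e" "e * norm A \<le> 1 / 2"
    and s: "s \<noteq> 0" and C: "W = s *\<^sub>R C"
  shows "norm (A - (1 / s) *\<^sub>R matrix_inv C) \<le> 2 * (norm A)\<^sup>2 * e"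
proof -
  have e0: "e \<ge> 0" using e(1) norm_ge_zero order_trans by blast
  have "x = 0" if "C *v x = 0" for x
  proof -
    have "W *v x = 0" using that by (simp add: C scaleR_matrix_vector_assoc[symmetric])
    then have "A *v ((V - W) *v x) = x"
      using VA(2) by (simp add: matrix_vector_mult_diff_rdistrib matrix_vector_mul_assoc)
    then have "norm x \<le> norm A * norm ((V - W) *v x)" by (metis norm_matrix_vector_le)
    also have "\<dots> \<le> norm A * (norm (V - W) * norm x)" by (intro mult_left_mono norm_matrix_vector_le) auto
    also have "\<dots> \<le> norm A * (e * norm x)"
      using e(1) by (intro mult_left_mono mult_right_mono) (auto simp: norm_minus_commute)
    also have "\<dots> \<le> 1 / 2 * norm x" using mult_right_mono[OF e(2), of "norm x"] by (simp add: mult_ac)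
    finally show "x = 0" by simp
  qed
  then have inv: "invertible C" using matrix_left_invertible_ker invertible_left_inverse by blast
  define Y where "Y = (1 / s) *\<^sub>R matrix_inv C"
  have "matrix_inv C ** C = mat 1"
    using inv someI_ex[of "\<lambda>D. C ** D = mat 1 \<and> D ** C = mat 1"]
    unfolding invertible_def matrix_inv_def by blast
  then have YW: "Y ** W = mat 1"
    using s by (simp add: Y_def C matrix_mult_scaleR)
  have "Y - A = Y ** ((V - W) ** A)"
  proof -
    have "Y ** ((V - W) ** A) = Y ** (V ** A) - (Y ** W) ** A"
      by (simp add: matrix_mult_diff matrix_mul_assoc)
    then show ?thesis using VA YW by simp
  qed
  then have "norm (Y - A) \<le> norm Y * (norm (V - W) * norm A)"
    using order_trans[OF norm_matrix_mult_le mult_left_mono[OF norm_matrix_mult_le norm_ge_zero]] by simp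
  also have "\<dots> \<le> norm Y * (e * norm A)"
    using e(1) by (intro mult_left_mono mult_right_mono) (auto simp: norm_minus_commute)
  finally have 1: "norm (Y - A) \<le> norm Y * (e * norm A)" .
  also have "\<dots> \<le> norm Y * (1 / 2)" using e(2) by (intro mult_left_mono) auto
  finally have "norm Y \<le> 2 * norm A" using norm_triangle_sub[of Y A] by simp
  then have "norm Y * (e * norm A) \<le> 2 * norm A * (e * norm A)" using e0 by (intro mult_right_mono) auto
  with 1 have "norm (Y - A) \<le> 2 * (norm A)\<^sup>2 * e" by (simp add: power2_eq_square mult_ac)
  then show ?thesis by (simp add: Y_def norm_minus_commute)
qed


section \<open>Laplace approximation of posterior moments\<close>

lemma exp_difference_bound: "\<bar>exp a - exp b\<bar> \<le> \<bar>a - b\<bar> * max (exp a) (exp b)" for a b :: real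
proof -
  have *: "exp a - exp b \<le> (a - b) * exp a" if "b \<le> a" for a b :: real
  proof -
    have "exp a * (1 - (a - b)) \<le> exp a * exp (- (a - b))"
      using exp_ge_add_one_self[of "- (a - b)"] by (intro mult_left_mono) (linarith, simp)
    also have "\<dots> = exp b" by (simp add: exp_add[symmetric])
    finally show ?thesis by (simp add: algebra_simps)
  qed
  show ?thesis
    using *[of a b] *[of b a] by (cases "b \<le> a") (auto simp: max_def)
qed

text \<open>
  The posterior mass outside a ball is exponentially small, which outweighs every power of
  \<open>n\<close>.
\<close>

lemma eventually_exponential_tail:
  fixes c E :: real
  assumes "c > 0"
  shows "\<forall>\<^sub>F n in sequentially. exp (- c * real n) * (1 + sqrt (real n) * E)\<^sup>2 \<le> (1 / sqrt (real n)) ^ p"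
proof -
  have pw: "((\<lambda>x. x ^ (p + 1) * exp (- c * x)) \<longlongrightarrow> 0) at_top"
  proof -
    have "((\<lambda>y. y ^ (p + 1) / exp y) \<longlongrightarrow> (0::real)) at_top" by (rule tendsto_power_div_exp_0)
    moreover have "filterlim (\<lambda>x. c * x) at_top at_top"
      using assms filterlim_ident by (intro filterlim_tendsto_pos_mult_at_top[OF tendsto_const])
    ultimately have "((\<lambda>x. (c * x) ^ (p + 1) / exp (c * x)) \<longlongrightarrow> 0) at_top" by (rule filterlim_compose)
    then have "((\<lambda>x. inverse (c ^ (p + 1)) * ((c * x) ^ (p + 1) / exp (c * x))) \<longlongrightarrow> inverse (c ^ (p + 1)) * 0) at_top"
      by (intro tendsto_mult tendsto_const)
    then show ?thesis using assms by (simp add: power_mult_distrib exp_minus field_simps)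
  qed
  have "((\<lambda>n. (1 + \<bar>E\<bar>)\<^sup>2 * (real n ^ (p + 1) * exp (- c * real n))) \<longlongrightarrow> (1 + \<bar>E\<bar>)\<^sup>2 * 0) sequentially"
    by (intro tendsto_mult tendsto_const filterlim_compose[OF pw filterlim_real_sequentially])
  from order_tendstoD(2)[OF this, of 1]
  have "\<forall>\<^sub>F n in sequentially. (1 + \<bar>E\<bar>)\<^sup>2 * (real n ^ (p + 1) * exp (- c * real n)) < 1" by simp
  then show ?thesis using eventually_ge_at_top[of 1]
  proof eventually_elim
    case (elim n)
    have n1: "sqrt (real n) \<ge> 1" "real n \<ge> 1" using elim by auto
    have "\<bar>1 + sqrt (real n) * E\<bar> \<le> sqrt (real n) * (1 + \<bar>E\<bar>)"
    proof -
      have "\<bar>1 + sqrt (real n) * E\<bar> \<le> 1 + \<bar>sqrt (real n) * E\<bar>" using abs_triangle_ineq[of 1 "sqrt (real n) * E"] by simp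
      also have "\<bar>sqrt (real n) * E\<bar> = sqrt (real n) * \<bar>E\<bar>" by (simp add: abs_mult)
      finally show ?thesis using n1(1) unfolding distrib_left mult_1_right by linarith
    qed
    then have "\<bar>1 + sqrt (real n) * E\<bar>\<^sup>2 \<le> (sqrt (real n) * (1 + \<bar>E\<bar>))\<^sup>2" by (rule power_mono) simp
    then have "(1 + sqrt (real n) * E)\<^sup>2 \<le> real n * (1 + \<bar>E\<bar>)\<^sup>2" by (simp add: power_mult_distrib)
    moreover have "sqrt (real n) ^ p \<le> real n ^ p"
      using n1 by (intro power_mono) (auto simp: real_sqrt_le_iff' power2_eq_square)
    ultimately have "(exp (- c * real n) * (1 + sqrt (real n) * E)\<^sup>2) * sqrt (real n) ^ p
        \<le> (exp (- c * real n) * (real n * (1 + \<bar>E\<bar>)\<^sup>2)) * real n ^ p"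
      using n1 by (intro mult_mono) auto
    also have "\<dots> = (1 + \<bar>E\<bar>)\<^sup>2 * (real n ^ (p + 1) * exp (- c * real n))" by simp
    also have "\<dots> \<le> 1" using elim by simp
    finally show ?case using n1 by (simp add: power_divide pos_le_divide_eq)
  qed
qed

text \<open>
  The log-likelihood \<open>L\<close> has a quadratic expansion at \<open>m\<close> with relative error \<open>\<kappa>\<close>, valid near
  \<open>m\<close>, a Gaussian majorant on a fixed ball, which controls the range between, and is smaller
  than at \<open>m\<close> by a multiple of \<open>n\<close> outside the ball. A single constant \<open>B\<close> serves for all
  bounds. The relation between \<open>1 / sqrt n\<close> and \<open>\<kappa>\<close> makes errors of the prior, which are of order
  \<open>1 / sqrt n\<close>, of order \<open>\<kappa>\<close>.
\<close>

locale laplace_setting = gaussian A c for A :: "real^'d^'d" and c +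
  fixes \<Theta> :: "(real^'d) set" and \<rho> :: "real^'d \<Rightarrow> real" and \<theta>0 :: "real^'d" and B \<delta> D cs :: real
    and n :: nat and \<kappa> :: real and L :: "real^'d \<Rightarrow> real" and m :: "real^'d"
  assumes compact: "compact \<Theta>" and \<delta>: "\<delta> > 0" and ball: "ball \<theta>0 \<delta> \<subseteq> \<Theta>" and B: "B \<ge> 1"
    and prior: "prior_density \<Theta> \<rho>" and \<rho>0: "\<rho> \<theta>0 > 0"
    and \<rho>_lipschitz: "\<And>\<theta>. \<theta> \<in> ball \<theta>0 \<delta> \<Longrightarrow> \<bar>\<rho> \<theta> - \<rho> \<theta>0\<bar> \<le> B * norm (\<theta> - \<theta>0)"
    and D: "\<And>\<theta>. \<theta> \<in> \<Theta> \<Longrightarrow> norm (\<theta> - \<theta>0) \<le> D" and cs: "cs > 0"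
    and n: "n > 0" and \<kappa>: "\<kappa> > 0" "\<kappa> \<le> 1" and n\<kappa>: "1 / sqrt (real n) \<le> B * \<kappa>"
    and m: "norm (m - \<theta>0) \<le> B / sqrt (real n)" and nB: "B / sqrt (real n) \<le> \<delta> / 2"
    and L_measurable: "L \<in> borel_measurable (lebesgue_on \<Theta>)"
    and expansion: "\<And>\<theta>. \<theta> \<in> ball \<theta>0 \<delta> \<Longrightarrow>
        \<bar>L \<theta> - L m + real n * ((A *v (\<theta> - m)) \<bullet> (\<theta> - m)) / 2\<bar> \<le> B * \<kappa> * (1 + sqrt (real n) * norm (\<theta> - m)) ^ 3"
    and majorant: "\<And>\<theta>. \<theta> \<in> ball \<theta>0 \<delta> \<Longrightarrow> L \<theta> - L m \<le> B - c / 4 * (sqrt (real n) * norm (\<theta> - m))\<^sup>2"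
    and outside: "\<And>\<theta>. \<theta> \<in> \<Theta> \<Longrightarrow> \<theta> \<notin> ball \<theta>0 \<delta> \<Longrightarrow> L \<theta> - L m \<le> - cs * real n"
    and tail: "exp (- cs * real n) * (1 + sqrt (real n) * (D + B))\<^sup>2 \<le> (1 / sqrt (real n)) ^ (CARD('d) + 1)"
begin

definition "rescaled \<theta> = sqrt (real n) *\<^sub>R (\<theta> - m)"

text \<open>
  The posterior density up to normalization, scaled so that it is close to \<open>\<phi> (rescaled \<theta>)\<close>.
\<close>

definition "weight \<theta> = (if \<theta> \<in> \<Theta> then \<rho> \<theta> / \<rho> \<theta>0 * exp (L \<theta> - L m) else 0)"

text \<open>
  The Jacobian determinant of the inverse of \<open>rescaled\<close>.
\<close>

definition "vol = (1 / sqrt (real n)) ^ CARD('d)"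

text \<open>
  Two of the six powers serve moments of order two, the other four the error of the density.
\<close>

definition "sixth_moment = (\<integral>u. (1 + norm (u :: real^'d)) ^ 6 * exp (- (c / 4) * (norm u)\<^sup>2) \<partial>lborel)"

definition "density_const = exp B * (B ^ 3 / \<rho> \<theta>0 + B) + 2 * B / \<delta>"

definition "moment_const = density_const * sixth_moment + B / \<rho> \<theta>0"

lemma root_n: "sqrt (real n) > 0" using n by simp

lemma vol_pos: "vol > 0" using n by (simp add: vol_def)

lemma norm_rescaled: "norm (rescaled \<theta>) = sqrt (real n) * norm (\<theta> - m)"
  by (simp add: rescaled_def)

lemma \<phi>_rescaled: "\<phi> (rescaled \<theta>) = exp (- (real n * ((A *v (\<theta> - m)) \<bullet> (\<theta> - m)) / 2))"
proof -
  have "(A *v rescaled \<theta>) \<bullet> rescaled \<theta> = (sqrt (real n) * sqrt (real n)) * ((A *v (\<theta> - m)) \<bullet> (\<theta> - m))"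
    by (simp add: rescaled_def matrix_vector_mult_scaleR del: real_sqrt_mult_self)
  then show ?thesis by (simp add: \<phi>_def)
qed

lemma prior_nonneg: "\<rho> \<theta> \<ge> 0" and prior_outside: "\<theta> \<notin> \<Theta> \<Longrightarrow> \<rho> \<theta> = 0"
  and prior_integral: "has_bochner_integral lebesgue \<rho> 1"
  using prior by (auto simp: prior_density_def)

lemma weight_nonneg: "weight \<theta> \<ge> 0" using prior_nonneg \<rho>0 by (simp add: weight_def)

lemma density_const_nonneg: "density_const \<ge> 0" using B \<rho>0 \<delta> by (simp add: density_const_def)

lemma moment_const_pos: "moment_const > 0"
proof -
  have "sixth_moment \<ge> 0" unfolding sixth_moment_def by (intro integral_nonneg_AE AE_I2) simp
  then have "density_const * sixth_moment \<ge> 0" using density_const_nonneg by simp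
  moreover have "B / \<rho> \<theta>0 > 0" using B \<rho>0 by simp
  ultimately show ?thesis unfolding moment_const_def by linarith
qed

text \<open>
  Within the ball the two exponentials differ by at most the difference of their exponents,
  which is \<open>O(\<kappa>)\<close> with cubic growth, times their common Gaussian majorant; the ratio of the
  prior densities differs from one by \<open>O(\<kappa>)\<close> with linear growth. Outside the ball the weight
  is exponentially small, and \<open>\<phi>\<close> is small because the rescaled distance exceeds a multiple of
  \<open>sqrt n\<close>, so that \<open>1\<close> is at most a multiple of \<open>\<kappa>\<close> times that distance.
\<close>

lemma density_approximation:
  "(1 + norm (rescaled \<theta>))\<^sup>2 * \<bar>weight \<theta> - \<phi> (rescaled \<theta>)\<bar>
    \<le> density_const * \<kappa> * ((1 + norm (rescaled \<theta>)) ^ 6 * exp (- (c / 4) * (norm (rescaled \<theta>))\<^sup>2))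
      + \<rho> \<theta> / \<rho> \<theta>0 * (1 / sqrt (real n)) ^ (CARD('d) + 1)"
proof (cases "\<theta> \<in> ball \<theta>0 \<delta>")
  case True
  define x where "x = norm (rescaled \<theta>)"
  define E where "E = exp (- (c / 4) * x\<^sup>2)"
  define a where "a = L \<theta> - L m"
  define b where "b = - (real n * ((A *v (\<theta> - m)) \<bullet> (\<theta> - m)) / 2)"
  define q where "q = \<rho> \<theta> / \<rho> \<theta>0"
  have x0: "x \<ge> 0" by (simp add: x_def)
  have eb: "exp b = \<phi> (rescaled \<theta>)" by (simp add: b_def \<phi>_rescaled)
  have weight: "weight \<theta> = q * exp a" using True ball by (auto simp: weight_def q_def a_def)
  have ea: "exp a \<le> exp B * E"
    using majorant[OF True] by (simp add: a_def E_def x_def norm_rescaled exp_add[symmetric])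
  have "exp b \<le> exp (- (c / 2) * x\<^sup>2)" unfolding eb x_def by (rule \<phi>_le)
  also have "\<dots> \<le> E" using c_pos by (auto simp: E_def intro!: mult_right_mono)
  also have "\<dots> \<le> exp B * E" using B by (simp add: E_def)
  finally have mx: "max (exp a) (exp b) \<le> exp B * E" using ea by simp
  have ab: "\<bar>a - b\<bar> \<le> B * \<kappa> * (1 + x) ^ 3"
    using expansion[OF True] by (simp add: a_def b_def x_def norm_rescaled)
  have d1: "\<bar>exp a - exp b\<bar> \<le> (B * \<kappa> * (1 + x) ^ 3) * (exp B * E)"
  proof -
    have "0 \<le> B * \<kappa> * (1 + x) ^ 3" using ab by (rule order_trans[OF abs_ge_zero])
    moreover have "0 \<le> max (exp a) (exp b)" by (rule order_trans[OF exp_ge_zero max.cobounded1])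
    ultimately show ?thesis by (rule order_trans[OF exp_difference_bound mult_mono[OF ab mx]])
  qed
  have q1: "\<bar>q - 1\<bar> \<le> B ^ 3 / \<rho> \<theta>0 * \<kappa> * (1 + x)"
  proof -
    have "norm (\<theta> - \<theta>0) \<le> norm (\<theta> - m) + norm (m - \<theta>0)" using norm_triangle_ineq[of "\<theta> - m" "m - \<theta>0"] by simp
    also have "norm (\<theta> - m) = x * (1 / sqrt (real n))" using root_n by (simp add: x_def norm_rescaled)
    also have "x * (1 / sqrt (real n)) + norm (m - \<theta>0) \<le> B * (1 + x) * (1 / sqrt (real n))"
    proof -
      have "x + B \<le> B * (1 + x)" using B x0 mult_right_mono[OF B x0] by (simp add: distrib_left)
      then have "(x + B) * (1 / sqrt (real n)) \<le> B * (1 + x) * (1 / sqrt (real n))"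
        using root_n by (intro mult_right_mono) auto
      then show ?thesis using m by (simp add: add_divide_distrib)
    qed
    also have "\<dots> \<le> B * (1 + x) * (B * \<kappa>)" using n\<kappa> B x0 by (intro mult_left_mono) auto
    finally have "norm (\<theta> - \<theta>0) \<le> B * (1 + x) * (B * \<kappa>)" .
    from order_trans[OF \<rho>_lipschitz[OF True] mult_left_mono[OF this]]
    have "\<bar>\<rho> \<theta> - \<rho> \<theta>0\<bar> \<le> B * (B * (1 + x) * (B * \<kappa>))" using B by simp
    then have "\<bar>\<rho> \<theta> - \<rho> \<theta>0\<bar> / \<rho> \<theta>0 \<le> B * (B * (1 + x) * (B * \<kappa>)) / \<rho> \<theta>0"
      using \<rho>0 by (intro divide_right_mono) auto
    moreover have "q - 1 = (\<rho> \<theta> - \<rho> \<theta>0) / \<rho> \<theta>0" using \<rho>0 by (simp add: q_def diff_divide_distrib)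
    then have "\<bar>q - 1\<bar> = \<bar>\<rho> \<theta> - \<rho> \<theta>0\<bar> / \<rho> \<theta>0" using \<rho>0 by (simp add: abs_divide)
    ultimately show ?thesis by (simp add: power3_eq_cube mult_ac)
  qed
  have "\<bar>weight \<theta> - \<phi> (rescaled \<theta>)\<bar> = \<bar>(q - 1) * exp a + (exp a - exp b)\<bar>"
    unfolding weight eb by (simp add: algebra_simps)
  also have "\<dots> \<le> \<bar>q - 1\<bar> * exp a + \<bar>exp a - exp b\<bar>"
    by (rule order_trans[OF abs_triangle_ineq]) (simp add: abs_mult)
  also have "\<dots> \<le> (B ^ 3 / \<rho> \<theta>0 * \<kappa> * (1 + x)) * (exp B * E) + (B * \<kappa> * (1 + x) ^ 3) * (exp B * E)"
    using q1 ea d1 B \<rho>0 \<kappa> x0 by (intro add_mono mult_mono) auto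
  also have "\<dots> \<le> (B ^ 3 / \<rho> \<theta>0 * \<kappa> * (1 + x) ^ 4) * (exp B * E) + (B * \<kappa> * (1 + x) ^ 4) * (exp B * E)"
    using B \<kappa> \<rho>0 x0 power_increasing[of 1 4 "1 + x"] power_increasing[of 3 4 "1 + x"]
    by (intro add_mono mult_right_mono mult_left_mono) (auto simp: E_def)
  also have "\<dots> = exp B * (B ^ 3 / \<rho> \<theta>0 + B) * \<kappa> * ((1 + x) ^ 4 * E)" by (simp add: algebra_simps)
  also have "\<dots> \<le> density_const * \<kappa> * ((1 + x) ^ 4 * E)"
    using B \<delta> \<kappa> x0 by (intro mult_right_mono) (auto simp: density_const_def E_def)
  finally have "(1 + x)\<^sup>2 * \<bar>weight \<theta> - \<phi> (rescaled \<theta>)\<bar> \<le> (1 + x)\<^sup>2 * (density_const * \<kappa> * ((1 + x) ^ 4 * E))"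
    by (intro mult_left_mono) auto
  also have "\<dots> = density_const * \<kappa> * ((1 + x) ^ 6 * E)"
    by (simp add: power2_eq_square power_numeral_reduce mult_ac)
  also have "\<dots> \<le> density_const * \<kappa> * ((1 + x) ^ 6 * E) + \<rho> \<theta> / \<rho> \<theta>0 * (1 / sqrt (real n)) ^ (CARD('d) + 1)"
    using prior_nonneg \<rho>0 by simp
  finally show ?thesis by (simp add: x_def E_def)
next
  case False
  define x where "x = norm (rescaled \<theta>)"
  define E where "E = exp (- (c / 4) * x\<^sup>2)"
  have x0: "x \<ge> 0" by (simp add: x_def)
  have far: "sqrt (real n) * \<delta> \<le> 2 * x"
  proof -
    have "\<delta> \<le> norm (\<theta> - \<theta>0)" using False by (simp add: dist_norm norm_minus_commute)
    also have "\<dots> \<le> norm (\<theta> - m) + norm (m - \<theta>0)" using norm_triangle_ineq[of "\<theta> - m" "m - \<theta>0"] by simp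
    finally have "\<delta> / 2 \<le> norm (\<theta> - m)" using m nB by linarith
    then have "sqrt (real n) * (\<delta> / 2) \<le> sqrt (real n) * norm (\<theta> - m)" using root_n by (intro mult_left_mono) auto
    then show ?thesis by (simp add: x_def norm_rescaled)
  qed
  have one: "1 \<le> 2 * B / \<delta> * \<kappa> * (1 + x)"
  proof -
    have "1 \<le> 2 * x / \<delta> * (1 / sqrt (real n))" using far root_n \<delta> by (simp add: field_simps)
    also have "\<dots> \<le> 2 * x / \<delta> * (B * \<kappa>)" using n\<kappa> x0 \<delta> by (intro mult_left_mono) auto
    also have "\<dots> \<le> 2 * (1 + x) / \<delta> * (B * \<kappa>)" using x0 \<delta> B \<kappa> by (intro mult_right_mono divide_right_mono) auto
    finally show ?thesis by (simp add: mult_ac)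
  qed
  have phi: "\<phi> (rescaled \<theta>) \<le> density_const * \<kappa> * ((1 + x) ^ 4 * E)"
  proof -
    have "\<phi> (rescaled \<theta>) \<le> exp (- (c / 2) * x\<^sup>2)" unfolding x_def by (rule \<phi>_le)
    also have "\<dots> \<le> 1 * E" using c_pos by (auto simp: E_def intro!: mult_right_mono)
    also have "\<dots> \<le> (2 * B / \<delta> * \<kappa> * (1 + x)) * E" using one by (intro mult_right_mono) (auto simp: E_def)
    also have "\<dots> \<le> (density_const * \<kappa> * (1 + x) ^ 4) * E"
    proof -
      have "exp B * (B ^ 3 / \<rho> \<theta>0 + B) \<ge> 0" using B \<rho>0 by simp
      then have "2 * B / \<delta> * \<kappa> * (1 + x) \<le> density_const * \<kappa> * (1 + x) ^ 4"
        using B \<kappa> \<delta> x0 power_increasing[of 1 4 "1 + x"] density_const_nonneg by (intro mult_mono) (auto simp: density_const_def)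
      then show ?thesis by (intro mult_right_mono) (auto simp: E_def)
    qed
    finally show ?thesis by (simp add: mult_ac)
  qed
  have w: "(1 + x)\<^sup>2 * weight \<theta> \<le> \<rho> \<theta> / \<rho> \<theta>0 * (1 / sqrt (real n)) ^ (CARD('d) + 1)"
  proof (cases "\<theta> \<in> \<Theta>")
    case True
    have "norm (\<theta> - m) \<le> norm (\<theta> - \<theta>0) + norm (m - \<theta>0)"
      using norm_triangle_ineq4[of "\<theta> - \<theta>0" "m - \<theta>0"] by simp
    also have "\<dots> \<le> D + B"
    proof -
      have "B / sqrt (real n) \<le> B / 1" using B n by (intro divide_left_mono) auto
      then show ?thesis using D[OF True] m by simp
    qed
    finally have "x \<le> sqrt (real n) * (D + B)" using root_n by (simp add: x_def norm_rescaled)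
    then have x2: "(1 + x)\<^sup>2 \<le> (1 + sqrt (real n) * (D + B))\<^sup>2" using x0 by (intro power_mono) auto
    have "(1 + x)\<^sup>2 * weight \<theta> = \<rho> \<theta> / \<rho> \<theta>0 * (exp (L \<theta> - L m) * (1 + x)\<^sup>2)" using True by (simp add: weight_def)
    also have "\<dots> \<le> \<rho> \<theta> / \<rho> \<theta>0 * (exp (- cs * real n) * (1 + sqrt (real n) * (D + B))\<^sup>2)"
      using outside[OF True False] x2 prior_nonneg \<rho>0 by (intro mult_left_mono mult_mono) auto
    also have "\<dots> \<le> \<rho> \<theta> / \<rho> \<theta>0 * (1 / sqrt (real n)) ^ (CARD('d) + 1)"
      using tail prior_nonneg \<rho>0 by (intro mult_left_mono) auto
    finally show ?thesis .
  qed (simp add: weight_def prior_outside)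
  have "(1 + x)\<^sup>2 * \<bar>weight \<theta> - \<phi> (rescaled \<theta>)\<bar> \<le> (1 + x)\<^sup>2 * \<phi> (rescaled \<theta>) + (1 + x)\<^sup>2 * weight \<theta>"
    using weight_nonneg[of \<theta>] \<phi>_pos[of "rescaled \<theta>"] by (simp add: distrib_left[symmetric] mult_left_mono)
  also have "\<dots> \<le> (1 + x)\<^sup>2 * (density_const * \<kappa> * ((1 + x) ^ 4 * E)) + \<rho> \<theta> / \<rho> \<theta>0 * (1 / sqrt (real n)) ^ (CARD('d) + 1)"
    using phi w by (intro add_mono mult_left_mono) auto
  also have "(1 + x)\<^sup>2 * (density_const * \<kappa> * ((1 + x) ^ 4 * E)) = density_const * \<kappa> * ((1 + x) ^ 6 * E)"
    by (simp add: power2_eq_square power_numeral_reduce mult_ac)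
  finally show ?thesis by (simp add: x_def E_def)
qed

lemma \<Theta>_sets: "\<Theta> \<in> sets lebesgue" using compact by (simp add: lmeasurable_compact fmeasurableD)

lemma weight_measurable[measurable]: "weight \<in> borel_measurable lebesgue"
proof -
  have [measurable]: "\<rho> \<in> borel_measurable lebesgue" using prior_integral by (auto simp: has_bochner_integral_iff)
  have "(\<lambda>\<theta>. \<rho> \<theta> / \<rho> \<theta>0 * exp (L \<theta> - L m)) \<in> borel_measurable (lebesgue_on \<Theta>)"
    using L_measurable by (intro borel_measurable_times borel_measurable_divide borel_measurable_exp borel_measurable_diff) (auto intro: measurable_restrict_space1)
  then have "(\<lambda>\<theta>. indicator \<Theta> \<theta> *\<^sub>R (\<rho> \<theta> / \<rho> \<theta>0 * exp (L \<theta> - L m))) \<in> borel_measurable lebesgue"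
    using \<Theta>_sets by (subst (asm) borel_measurable_restrict_space_iff) auto
  moreover have "weight = (\<lambda>\<theta>. indicator \<Theta> \<theta> *\<^sub>R (\<rho> \<theta> / \<rho> \<theta>0 * exp (L \<theta> - L m)))"
    by (auto simp: weight_def indicator_def)
  ultimately show ?thesis by simp
qed

lemma rescaled_integral:
  fixes H :: "real^'d \<Rightarrow> 'b::{banach, second_countable_topology}"
  assumes H[measurable]: "H \<in> borel_measurable borel"
  shows "(\<integral>\<theta>. H (rescaled \<theta>) \<partial>lebesgue) = vol *\<^sub>R (\<integral>u. H u \<partial>lborel)"
    "integrable lborel H \<Longrightarrow> integrable lebesgue (\<lambda>\<theta>. H (rescaled \<theta>))"
proof -
  have [measurable]: "rescaled \<in> borel_measurable borel" unfolding rescaled_def[abs_def] by measurable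
  have unscale: "rescaled (m + (1 / sqrt (real n)) *\<^sub>R u) = u" for u using root_n by (simp add: rescaled_def)
  have "(\<integral>\<theta>. H (rescaled \<theta>) \<partial>lebesgue) = (\<integral>\<theta>. H (rescaled \<theta>) \<partial>lborel)"
    by (rule integral_completion) measurable
  also have "\<dots> = vol *\<^sub>R (\<integral>u. H u \<partial>lborel)"
    using lborel_integral_affine_euclidean(1)[of "1 / sqrt (real n)" "\<lambda>\<theta>. H (rescaled \<theta>)" m] n
    by (simp add: unscale vol_def)
  finally show "(\<integral>\<theta>. H (rescaled \<theta>) \<partial>lebesgue) = vol *\<^sub>R (\<integral>u. H u \<partial>lborel)" .
  assume "integrable lborel H"
  then have "integrable lborel (\<lambda>\<theta>. H (rescaled \<theta>))"
    using lborel_integral_affine_euclidean(2)[of "1 / sqrt (real n)" "\<lambda>\<theta>. H (rescaled \<theta>)" m] n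
    by (simp add: unscale)
  then show "integrable lebesgue (\<lambda>\<theta>. H (rescaled \<theta>))"
    by (subst integrable_completion) auto
qed

text \<open>
  The pointwise bound of \<open>density_approximation\<close> is integrable, and its integral is \<open>vol\<close>
  times a multiple of \<open>\<kappa>\<close>: the Gaussian part by rescaling, the part with the prior since \<open>vol
  / sqrt n \<le> vol * (B * \<kappa>)\<close>.
\<close>

lemma moment_approximation:
  fixes H :: "real^'d \<Rightarrow> 'b::{banach, second_countable_topology}"
  assumes H[measurable]: "H \<in> borel_measurable borel" and le: "\<And>u. norm (H u) \<le> (1 + norm u)\<^sup>2"
  shows "integrable lebesgue (\<lambda>\<theta>. weight \<theta> *\<^sub>R H (rescaled \<theta>))"
    "norm ((\<integral>\<theta>. weight \<theta> *\<^sub>R H (rescaled \<theta>) \<partial>lebesgue) - vol *\<^sub>R (\<integral>u. \<phi> u *\<^sub>R H u \<partial>lborel)) \<le> moment_const * \<kappa> * vol"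
proof -
  have rm[measurable]: "rescaled \<in> measurable lebesgue borel"
    by (rule measurable_completion) (simp add: rescaled_def[abs_def])
  have Hm[measurable]: "(\<lambda>\<theta>. H (rescaled \<theta>)) \<in> borel_measurable lebesgue"
    by (rule measurable_compose[OF rm H])
  have pm[measurable]: "(\<lambda>\<theta>. \<phi> (rescaled \<theta>)) \<in> borel_measurable lebesgue"
    by (rule measurable_compose[OF rm \<phi>_measurable])
  let ?b = "\<lambda>\<theta>. density_const * \<kappa> * ((1 + norm (rescaled \<theta>)) ^ 6 * exp (- (c / 4) * (norm (rescaled \<theta>))\<^sup>2))
      + \<rho> \<theta> / \<rho> \<theta>0 * (1 / sqrt (real n)) ^ (CARD('d) + 1)"
  have i6: "integrable lborel (\<lambda>u :: real^'d. (1 + norm u) ^ 6 * exp (- (c / 4) * (norm u)\<^sup>2))"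
    using integrable_polynomial_gaussian[of "c / 4" 6 0] c_pos by simp
  have i\<rho>: "integrable lebesgue \<rho>" "(\<integral>\<theta>. \<rho> \<theta> \<partial>lebesgue) = 1"
    using prior_integral by (auto simp: has_bochner_integral_iff)
  have ib: "integrable lebesgue ?b"
    using rescaled_integral(2)[OF _ i6] i\<rho> by auto
  have Ib: "(\<integral>\<theta>. ?b \<theta> \<partial>lebesgue) \<le> moment_const * \<kappa> * vol"
  proof -
    have "(\<integral>\<theta>. ?b \<theta> \<partial>lebesgue) = density_const * \<kappa> * (vol * sixth_moment) + 1 / \<rho> \<theta>0 * (1 / sqrt (real n)) ^ (CARD('d) + 1)"
      using rescaled_integral[OF _, of "\<lambda>u. (1 + norm u) ^ 6 * exp (- (c / 4) * (norm u)\<^sup>2)"] i6 i\<rho> by (simp add: sixth_moment_def)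
    also have "(1 / sqrt (real n)) ^ (CARD('d) + 1) \<le> vol * (B * \<kappa>)"
      using mult_left_mono[OF n\<kappa> less_imp_le[OF vol_pos]] by (simp add: vol_def mult_ac)
    finally have "(\<integral>\<theta>. ?b \<theta> \<partial>lebesgue) \<le> density_const * \<kappa> * (vol * sixth_moment) + 1 / \<rho> \<theta>0 * (vol * (B * \<kappa>))"
      using \<rho>0 by (simp add: divide_right_mono)
    then show ?thesis by (simp add: moment_const_def algebra_simps)
  qed
  have dom: "norm ((weight \<theta> - \<phi> (rescaled \<theta>)) *\<^sub>R H (rescaled \<theta>)) \<le> ?b \<theta>" for \<theta>
  proof -
    have "norm ((weight \<theta> - \<phi> (rescaled \<theta>)) *\<^sub>R H (rescaled \<theta>)) \<le> \<bar>weight \<theta> - \<phi> (rescaled \<theta>)\<bar> * (1 + norm (rescaled \<theta>))\<^sup>2"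
      using le[of "rescaled \<theta>"] by (simp add: mult_left_mono)
    then show ?thesis using density_approximation[of \<theta>] by (simp add: mult.commute)
  qed
  have id: "integrable lebesgue (\<lambda>\<theta>. (weight \<theta> - \<phi> (rescaled \<theta>)) *\<^sub>R H (rescaled \<theta>))"
  proof (rule Bochner_Integration.integrable_bound[OF ib])
    show "AE \<theta> in lebesgue. norm ((weight \<theta> - \<phi> (rescaled \<theta>)) *\<^sub>R H (rescaled \<theta>)) \<le> norm (?b \<theta>)"
      unfolding real_norm_def[of "?b _"] by (intro AE_I2 order_trans[OF dom abs_ge_self])
  qed measurable
  have i\<phi>: "integrable lborel (\<lambda>u. \<phi> u *\<^sub>R H u)"
    using integrable_dominated[of H 1 2 0] le by simp
  have im: "integrable lebesgue (\<lambda>\<theta>. \<phi> (rescaled \<theta>) *\<^sub>R H (rescaled \<theta>))"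
    using rescaled_integral(2)[OF _ i\<phi>] by simp
  show iw: "integrable lebesgue (\<lambda>\<theta>. weight \<theta> *\<^sub>R H (rescaled \<theta>))"
    using Bochner_Integration.integrable_add[OF id im] by (simp add: scaleR_left_diff_distrib)
  have "(\<integral>\<theta>. weight \<theta> *\<^sub>R H (rescaled \<theta>) \<partial>lebesgue) - vol *\<^sub>R (\<integral>u. \<phi> u *\<^sub>R H u \<partial>lborel)
      = (\<integral>\<theta>. (weight \<theta> - \<phi> (rescaled \<theta>)) *\<^sub>R H (rescaled \<theta>) \<partial>lebesgue)"
    using iw im rescaled_integral(1)[of "\<lambda>u. \<phi> u *\<^sub>R H u"] by (simp add: scaleR_left_diff_distrib)
  also have "norm \<dots> \<le> (\<integral>\<theta>. norm ((weight \<theta> - \<phi> (rescaled \<theta>)) *\<^sub>R H (rescaled \<theta>)) \<partial>lebesgue)"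
    by (rule integral_norm_bound)
  also have "\<dots> \<le> (\<integral>\<theta>. ?b \<theta> \<partial>lebesgue)"
    by (rule integral_mono[OF integrable_norm[OF id] ib]) (rule dom)
  finally show "norm ((\<integral>\<theta>. weight \<theta> *\<^sub>R H (rescaled \<theta>) \<partial>lebesgue) - vol *\<^sub>R (\<integral>u. \<phi> u *\<^sub>R H u \<partial>lborel)) \<le> moment_const * \<kappa> * vol"
    using Ib by linarith
qed

definition "total_weight = (\<integral>\<theta>. weight \<theta> \<partial>lebesgue)"

definition "mean_const = 2 * moment_const / Z0"

lemma mean_const_pos: "mean_const > 0" using moment_const_pos Z0_pos by (simp add: mean_const_def)

lemma total_weight_approximation: "integrable lebesgue weight" "\<bar>total_weight - vol * Z0\<bar> \<le> moment_const * \<kappa> * vol"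
  using moment_approximation[of "\<lambda>_. 1 :: real"] by (auto simp: total_weight_def Z0_def)

lemma posterior_integral:
  fixes h :: "real^'d \<Rightarrow> 'b::{banach, second_countable_topology}"
  assumes h: "h \<in> borel_measurable borel"
  shows "(\<integral>\<theta>. h \<theta> \<partial>profile_posterior \<Theta> \<rho> L) = (1 / total_weight) *\<^sub>R (\<integral>\<theta>. weight \<theta> *\<^sub>R h \<theta> \<partial>lebesgue)"
proof -
  define k0 where "k0 = \<rho> \<theta>0 * exp (L m)"
  have k0: "k0 > 0" using \<rho>0 by (simp add: k0_def)
  have eq: "\<rho> \<theta> * exp (L \<theta>) = k0 * weight \<theta>" if "\<theta> \<in> \<Theta>" for \<theta>
    using that \<rho>0 by (simp add: k0_def weight_def exp_diff)
  have restr: "(\<integral>\<theta>. g \<theta> \<partial>lebesgue_on \<Theta>) = (\<integral>\<theta>. indicator \<Theta> \<theta> *\<^sub>R g \<theta> \<partial>lebesgue)" for g :: "real^'d \<Rightarrow> 'c::{banach, second_countable_topology}"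
    using \<Theta>_sets by (intro integral_restrict_space) auto
  have norm: "(\<integral>\<theta>'. \<rho> \<theta>' * exp (L \<theta>') \<partial>lebesgue_on \<Theta>) = k0 * total_weight"
  proof -
    have "(\<integral>\<theta>'. \<rho> \<theta>' * exp (L \<theta>') \<partial>lebesgue_on \<Theta>) = (\<integral>\<theta>'. k0 * weight \<theta>' \<partial>lebesgue_on \<Theta>)"
      by (rule Bochner_Integration.integral_cong) (use eq in auto)
    also have "\<dots> = k0 * (\<integral>\<theta>'. weight \<theta>' \<partial>lebesgue_on \<Theta>)" by simp
    also have "(\<integral>\<theta>'. weight \<theta>' \<partial>lebesgue_on \<Theta>) = total_weight"
      unfolding restr total_weight_def by (rule Bochner_Integration.integral_cong[OF refl]) (simp add: weight_def indicator_def)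
    finally show ?thesis .
  qed
  have W0: "total_weight \<ge> 0" unfolding total_weight_def by (intro integral_nonneg_AE AE_I2 weight_nonneg)
  have wtm: "weight \<in> borel_measurable (lebesgue_on \<Theta>)" using weight_measurable by (rule measurable_restrict_space1)
  have hm: "h \<in> borel_measurable (lebesgue_on \<Theta>)"
    using h by (intro measurable_restrict_space1 measurable_completion) simp
  have "profile_posterior \<Theta> \<rho> L = density (lebesgue_on \<Theta>) (\<lambda>\<theta>. ennreal (weight \<theta> / total_weight))"
    unfolding profile_posterior_def norm
  proof (rule density_cong)
    show "(\<lambda>\<theta>. ennreal (\<rho> \<theta> * exp (L \<theta>) / (k0 * total_weight))) \<in> borel_measurable (lebesgue_on \<Theta>)"
    proof (subst measurable_cong)
      show "ennreal (\<rho> \<theta> * exp (L \<theta>) / (k0 * total_weight)) = ennreal (weight \<theta> / total_weight)" if "\<theta> \<in> space (lebesgue_on \<Theta>)" for \<theta>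
        using eq that k0 by simp
    qed (use wtm in measurable)
    show "AE \<theta> in lebesgue_on \<Theta>. ennreal (\<rho> \<theta> * exp (L \<theta>) / (k0 * total_weight)) = ennreal (weight \<theta> / total_weight)"
      using eq k0 by (intro AE_I2) simp
  qed (use wtm in measurable)
  then have "(\<integral>\<theta>. h \<theta> \<partial>profile_posterior \<Theta> \<rho> L) = (\<integral>\<theta>. (weight \<theta> / total_weight) *\<^sub>R h \<theta> \<partial>lebesgue_on \<Theta>)"
    using wtm hm weight_nonneg W0 by (simp add: integral_density)
  also have "\<dots> = (\<integral>\<theta>. (1 / total_weight) *\<^sub>R (weight \<theta> *\<^sub>R h \<theta>) \<partial>lebesgue)"
    unfolding restr
  proof (rule Bochner_Integration.integral_cong[OF refl])
    fix \<theta>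
    show "indicator \<Theta> \<theta> *\<^sub>R ((weight \<theta> / total_weight) *\<^sub>R h \<theta>) = (1 / total_weight) *\<^sub>R (weight \<theta> *\<^sub>R h \<theta>)"
      by (simp add: weight_def indicator_def)
  qed
  also have "\<dots> = (1 / total_weight) *\<^sub>R (\<integral>\<theta>. weight \<theta> *\<^sub>R h \<theta> \<partial>lebesgue)" by (rule integral_scaleR_right)
  finally show ?thesis .
qed

context
  assumes small: "\<kappa> * moment_const \<le> Z0 / 2"
begin

lemma total_weight_lower: "total_weight \<ge> vol * Z0 / 2" "total_weight > 0"
proof -
  have "moment_const * \<kappa> * vol \<le> Z0 / 2 * vol" using small vol_pos by (intro mult_right_mono) (auto simp: mult.commute)
  then show "total_weight \<ge> vol * Z0 / 2" using total_weight_approximation(2) by (simp add: abs_le_iff mult.commute)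
  moreover have "vol * Z0 / 2 > 0" using vol_pos Z0_pos by simp
  ultimately show "total_weight > 0" by linarith
qed

text \<open>
  Numerator and normalizing constant of a posterior moment both have the error of
  \<open>moment_approximation\<close>, and the normalizing constant is at least half of its Gaussian value.
\<close>

lemma normalized_moment:
  fixes H :: "real^'d \<Rightarrow> 'b::{banach, second_countable_topology}"
  assumes H: "H \<in> borel_measurable borel" and le: "\<And>u. norm (H u) \<le> (1 + norm u)\<^sup>2"
  shows "norm ((\<integral>\<theta>. H (rescaled \<theta>) \<partial>profile_posterior \<Theta> \<rho> L) - (1 / Z0) *\<^sub>R (\<integral>u. \<phi> u *\<^sub>R H u \<partial>lborel))
     \<le> mean_const * \<kappa> * (1 + norm (\<integral>u. \<phi> u *\<^sub>R H u \<partial>lborel) / Z0)"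
proof -
  define I where "I = (\<integral>\<theta>. weight \<theta> *\<^sub>R H (rescaled \<theta>) \<partial>lebesgue)"
  define I0 where "I0 = (\<integral>u. \<phi> u *\<^sub>R H u \<partial>lborel)"
  have rm: "rescaled \<in> borel_measurable borel" unfolding rescaled_def[abs_def] by measurable
  have "(\<integral>\<theta>. H (rescaled \<theta>) \<partial>profile_posterior \<Theta> \<rho> L) = (1 / total_weight) *\<^sub>R I"
    unfolding I_def by (rule posterior_integral) (rule measurable_compose[OF rm H])
  moreover have "(1 / total_weight) *\<^sub>R I - (1 / Z0) *\<^sub>R I0 = (1 / total_weight) *\<^sub>R ((I - vol *\<^sub>R I0) + ((vol * Z0 - total_weight) / Z0) *\<^sub>R I0)"
    using total_weight_lower(2) Z0_pos by (simp add: scaleR_right_distrib scaleR_diff_right diff_divide_distrib scaleR_left_diff_distrib)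
  moreover have "norm ((I - vol *\<^sub>R I0) + ((vol * Z0 - total_weight) / Z0) *\<^sub>R I0) \<le> moment_const * \<kappa> * vol * (1 + norm I0 / Z0)"
  proof -
    have "norm (((vol * Z0 - total_weight) / Z0) *\<^sub>R I0) = \<bar>total_weight - vol * Z0\<bar> * (norm I0 / Z0)"
      using Z0_pos by (simp add: abs_minus_commute)
    also have "\<dots> \<le> moment_const * \<kappa> * vol * (norm I0 / Z0)"
      using total_weight_approximation(2) Z0_pos by (intro mult_right_mono) auto
    finally show ?thesis
      using moment_approximation(2)[OF H le, folded I_def I0_def] norm_triangle_ineq[of "I - vol *\<^sub>R I0" "((vol * Z0 - total_weight) / Z0) *\<^sub>R I0"]
      by (simp add: distrib_left)
  qed
  ultimately have "norm ((\<integral>\<theta>. H (rescaled \<theta>) \<partial>profile_posterior \<Theta> \<rho> L) - (1 / Z0) *\<^sub>R I0)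
      \<le> (1 / total_weight) * (moment_const * \<kappa> * vol * (1 + norm I0 / Z0))"
    using total_weight_lower(2) by (simp add: divide_right_mono)
  also have "\<dots> \<le> (2 / (vol * Z0)) * (moment_const * \<kappa> * vol * (1 + norm I0 / Z0))"
  proof (rule mult_right_mono)
    have "1 / total_weight \<le> 1 / (vol * Z0 / 2)" using total_weight_lower vol_pos Z0_pos by (intro divide_left_mono) auto
    then show "1 / total_weight \<le> 2 / (vol * Z0)" by simp
    show "0 \<le> moment_const * \<kappa> * vol * (1 + norm I0 / Z0)" using moment_const_pos \<kappa> vol_pos Z0_pos by simp
  qed
  also have "\<dots> = mean_const * \<kappa> * (1 + norm I0 / Z0)" using vol_pos by (simp add: mean_const_def)
  finally show ?thesis by (simp add: I0_def)
qed

abbreviation "post \<equiv> profile_posterior \<Theta> \<rho> L"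

definition "mean_rescaled = (\<integral>\<theta>. rescaled \<theta> \<partial>post)"

lemma posterior_mean_rescaled: "norm mean_rescaled \<le> mean_const * \<kappa>"
proof -
  have "norm (u :: real^'d) \<le> (1 + norm u)\<^sup>2" for u
    using norm_ge_zero[of u] by (simp add: power2_eq_square algebra_simps)
  from normalized_moment[of "\<lambda>u. u", OF _ this] show ?thesis
    by (simp add: first_moment mean_rescaled_def)
qed

lemma post_integrable:
  fixes H :: "real^'d \<Rightarrow> 'b::{banach, second_countable_topology}"
  assumes H: "H \<in> borel_measurable borel" and le: "\<And>u. norm (H u) \<le> (1 + norm u)\<^sup>2"
  shows "(\<integral>\<theta>. a *\<^sub>R H (rescaled \<theta>) + v \<partial>post) = a *\<^sub>R (\<integral>\<theta>. H (rescaled \<theta>) \<partial>post) + v"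
proof -
  have rm: "rescaled \<in> borel_measurable borel" unfolding rescaled_def[abs_def] by measurable
  note Hr[measurable] = measurable_compose[OF rm H]
  have "(\<integral>\<theta>. weight \<theta> *\<^sub>R (a *\<^sub>R H (rescaled \<theta>) + v) \<partial>lebesgue) = (\<integral>\<theta>. a *\<^sub>R (weight \<theta> *\<^sub>R H (rescaled \<theta>)) + weight \<theta> *\<^sub>R v \<partial>lebesgue)"
    by (rule Bochner_Integration.integral_cong) (auto simp: scaleR_right_distrib)
  also have "\<dots> = a *\<^sub>R (\<integral>\<theta>. weight \<theta> *\<^sub>R H (rescaled \<theta>) \<partial>lebesgue) + total_weight *\<^sub>R v"
    using moment_approximation(1)[OF H le] total_weight_approximation(1) by (simp add: total_weight_def del: scaleR_scaleR)
  finally show ?thesis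
    using posterior_integral[of "\<lambda>\<theta>. a *\<^sub>R H (rescaled \<theta>) + v"] posterior_integral[of "\<lambda>\<theta>. H (rescaled \<theta>)"] total_weight_lower(2)
    by (simp add: scaleR_right_distrib)
qed

lemma posterior_mean: "(\<integral>\<theta>. \<theta> \<partial>post) = m + (1 / sqrt (real n)) *\<^sub>R mean_rescaled"
proof -
  have le: "norm (u :: real^'d) \<le> (1 + norm u)\<^sup>2" for u
    using norm_ge_zero[of u] by (simp add: power2_eq_square algebra_simps)
  have eq: "\<theta> = (1 / sqrt (real n)) *\<^sub>R rescaled \<theta> + m" for \<theta> using root_n by (simp add: rescaled_def)
  have "(\<integral>\<theta>. \<theta> \<partial>post) = (\<integral>\<theta>. (1 / sqrt (real n)) *\<^sub>R rescaled \<theta> + m \<partial>post)"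
    by (rule Bochner_Integration.integral_cong[OF refl]) (rule eq)
  also have "\<dots> = (1 / sqrt (real n)) *\<^sub>R mean_rescaled + m"
    using post_integrable[of "\<lambda>u. u", OF _ le] by (simp add: mean_rescaled_def)
  finally show ?thesis by simp
qed

lemma posterior_mean_bound: "norm (m - (\<integral>\<theta>. \<theta> \<partial>post)) \<le> mean_const * (\<kappa> / sqrt (real n))"
  using posterior_mean_rescaled root_n by (simp add: posterior_mean divide_right_mono)

definition "cov_const = real CARD('d) * (real CARD('d) * (mean_const * (1 + norm V) + mean_const\<^sup>2))"

text \<open>
  Entrywise, \<open>n\<close> times the covariance is the second moment of the rescaled parameter, which is
  \<open>V + O(\<kappa>)\<close>, minus a product of two coordinates of its mean, which are both \<open>O(\<kappa>)\<close>.
\<close>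

lemma posterior_covariance_bound:
  "norm (real n *\<^sub>R cov_matrix post (\<lambda>\<theta>. \<theta>) - V) \<le> cov_const * \<kappa>"
proof -
  have le1: "norm (u :: real^'d) \<le> (1 + norm u)\<^sup>2" for u
    using norm_ge_zero[of u] by (simp add: power2_eq_square algebra_simps)
  have le2: "norm ((u :: real^'d) $ i) \<le> (1 + norm u)\<^sup>2" for u i
    using component_le_norm_cart[of u i] le1[of u] by simp
  have le3: "norm ((u :: real^'d) $ i * u $ j) \<le> (1 + norm u)\<^sup>2" for u i j
  proof -
    have "\<bar>u $ i\<bar> * \<bar>u $ j\<bar> \<le> (1 + norm u) * (1 + norm u)"
      using component_le_norm_cart[of u i] component_le_norm_cart[of u j] by (intro mult_mono) auto
    then show ?thesis by (simp add: abs_mult power2_eq_square)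
  qed
  have entry: "\<bar>(real n *\<^sub>R cov_matrix post (\<lambda>\<theta>. \<theta>) - V) $ i $ j\<bar> \<le> (mean_const * (1 + norm V) + mean_const\<^sup>2) * \<kappa>" for i j
  proof -
    have mean_i: "(\<integral>\<theta>. rescaled \<theta> $ i \<partial>post) = mean_rescaled $ i" for i
    proof -
      have bl: "bounded_linear (\<lambda>v :: real^'d. v $ i)" by (rule bounded_linear_vec_nth)
      have "(\<integral>\<theta>. weight \<theta> *\<^sub>R rescaled \<theta> $ i \<partial>lebesgue) = (\<integral>\<theta>. (weight \<theta> *\<^sub>R rescaled \<theta>) $ i \<partial>lebesgue)" by simp
      also have "\<dots> = (\<integral>\<theta>. weight \<theta> *\<^sub>R rescaled \<theta> \<partial>lebesgue) $ i"
        by (rule integral_bounded_linear[OF bl moment_approximation(1)[of "\<lambda>u. u", OF _ le1]]) simp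
      finally show ?thesis
        using posterior_integral[of "\<lambda>\<theta>. rescaled \<theta> $ i"] posterior_integral[of rescaled]
        by (simp add: mean_rescaled_def rescaled_def[abs_def])
    qed
    have th_i: "(\<integral>\<theta>. \<theta> $ i \<partial>post) = m $ i + mean_rescaled $ i / sqrt (real n)" for i
    proof -
      have eq: "\<theta> $ i = (1 / sqrt (real n)) *\<^sub>R rescaled \<theta> $ i + m $ i" for \<theta>
        using root_n by (simp add: rescaled_def)
      have "(\<integral>\<theta>. \<theta> $ i \<partial>post) = (\<integral>\<theta>. (1 / sqrt (real n)) *\<^sub>R rescaled \<theta> $ i + m $ i \<partial>post)"
        by (rule Bochner_Integration.integral_cong[OF refl]) (rule eq)
      also have "\<dots> = (1 / sqrt (real n)) *\<^sub>R (\<integral>\<theta>. rescaled \<theta> $ i \<partial>post) + m $ i"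
        by (rule post_integrable[of "\<lambda>u. u $ i", OF _ le2]) simp
      finally show ?thesis by (simp add: mean_i)
    qed
    define a b where "a = mean_rescaled $ i" "b = mean_rescaled $ j"
    let ?Q = "\<lambda>u :: real^'d. u $ i * u $ j"
    have split: "(\<integral>\<theta>. (rescaled \<theta> $ i - a) * (rescaled \<theta> $ j - b) \<partial>post) = (\<integral>\<theta>. ?Q (rescaled \<theta>) \<partial>post) - a * b"
    proof -
      have iQ: "integrable lebesgue (\<lambda>\<theta>. weight \<theta> * ?Q (rescaled \<theta>))"
        using moment_approximation(1)[of ?Q, OF _ le3] by simp
      have ii: "integrable lebesgue (\<lambda>\<theta>. weight \<theta> * rescaled \<theta> $ k)" for k
        using moment_approximation(1)[of "\<lambda>u. u $ k", OF _ le2] by simp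
      have k: "(\<integral>\<theta>. weight \<theta> * rescaled \<theta> $ k \<partial>lebesgue) = total_weight * mean_rescaled $ k" for k
        using posterior_integral[of "\<lambda>\<theta>. rescaled \<theta> $ k"] mean_i[of k] total_weight_lower(2) by (simp add: rescaled_def[abs_def] field_simps)
      have "(\<integral>\<theta>. weight \<theta> * ((rescaled \<theta> $ i - a) * (rescaled \<theta> $ j - b)) \<partial>lebesgue)
         = (\<integral>\<theta>. weight \<theta> * ?Q (rescaled \<theta>) - b * (weight \<theta> * rescaled \<theta> $ i) - a * (weight \<theta> * rescaled \<theta> $ j) + a * b * weight \<theta> \<partial>lebesgue)"
        by (rule Bochner_Integration.integral_cong) (auto simp: algebra_simps)
      also have "\<dots> = (\<integral>\<theta>. weight \<theta> * ?Q (rescaled \<theta>) \<partial>lebesgue) - b * (total_weight * a) - a * (total_weight * b) + a * b * total_weight"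
        using iQ ii total_weight_approximation(1) k by (simp add: total_weight_def[symmetric] a_b_def)
      finally have *: "(\<integral>\<theta>. weight \<theta> * ((rescaled \<theta> $ i - a) * (rescaled \<theta> $ j - b)) \<partial>lebesgue)
          = (\<integral>\<theta>. weight \<theta> * ?Q (rescaled \<theta>) \<partial>lebesgue) - total_weight * (a * b)" by (simp add: algebra_simps)
      have m1: "(\<lambda>\<theta>. (rescaled \<theta> $ i - a) * (rescaled \<theta> $ j - b)) \<in> borel_measurable borel"
         "(\<lambda>\<theta>. ?Q (rescaled \<theta>)) \<in> borel_measurable borel" by (simp_all add: rescaled_def[abs_def])
      show ?thesis
        using posterior_integral[OF m1(1)] posterior_integral[OF m1(2)] * total_weight_lower(2) by (simp add: right_diff_distrib diff_divide_distrib)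
    qed
    have "real n * cov_matrix post (\<lambda>\<theta>. \<theta>) $ i $ j = real n * (\<integral>\<theta>. (1 / real n) * ((rescaled \<theta> $ i - a) * (rescaled \<theta> $ j - b)) \<partial>post)"
    proof -
      have "(\<theta> $ i - (m $ i + a / sqrt (real n))) * (\<theta> $ j - (m $ j + b / sqrt (real n)))
          = (1 / real n) * ((rescaled \<theta> $ i - a) * (rescaled \<theta> $ j - b))" for \<theta>
      proof -
        have "\<theta> $ k - (m $ k + t / sqrt (real n)) = (1 / sqrt (real n)) * (rescaled \<theta> $ k - t)" for k t
          using root_n by (simp add: rescaled_def right_diff_distrib)
        then show ?thesis using n by simp
      qed
      then show ?thesis by (simp add: cov_matrix_def th_i a_b_def)
    qed
    also have "\<dots> = (\<integral>\<theta>. ?Q (rescaled \<theta>) \<partial>post) - a * b" using n split by simp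
    finally have cov: "real n * cov_matrix post (\<lambda>\<theta>. \<theta>) $ i $ j = (\<integral>\<theta>. ?Q (rescaled \<theta>) \<partial>post) - a * b" .
    have Vij: "(1 / Z0) *\<^sub>R (\<integral>u. \<phi> u *\<^sub>R ?Q u \<partial>lborel) = V $ i $ j" by (simp add: V_def)
    have nV: "norm (\<integral>u. \<phi> u *\<^sub>R ?Q u \<partial>lborel) / Z0 = \<bar>V $ i $ j\<bar>" using Z0_pos by (simp add: V_def)
    have Vi: "norm (V $ i) \<le> norm V" by (subst norm_vec_def[of V]) (rule member_le_L2_set; simp)
    have "\<bar>V $ i $ j\<bar> \<le> norm V" using component_le_norm_cart[of "V $ i" j] Vi by linarith
    then have "mean_const * \<kappa> * (1 + \<bar>V $ i $ j\<bar>) \<le> mean_const * \<kappa> * (1 + norm V)" using mean_const_pos \<kappa> by (intro mult_left_mono) auto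
    then have 1: "\<bar>(\<integral>\<theta>. ?Q (rescaled \<theta>) \<partial>post) - V $ i $ j\<bar> \<le> mean_const * \<kappa> * (1 + norm V)"
      using normalized_moment[of ?Q, OF _ le3] unfolding Vij nV by simp
    have "\<bar>a\<bar> \<le> mean_const * \<kappa>" "\<bar>b\<bar> \<le> mean_const * \<kappa>"
      using posterior_mean_rescaled component_le_norm_cart[of mean_rescaled i] component_le_norm_cart[of mean_rescaled j] by (auto simp: a_b_def)
    then have "\<bar>a * b\<bar> \<le> (mean_const * \<kappa>) * (mean_const * \<kappa>)" unfolding abs_mult by (intro mult_mono) auto
    also have "\<dots> = mean_const\<^sup>2 * \<kappa> * \<kappa>" by (simp add: power2_eq_square)
    also have "\<dots> \<le> mean_const\<^sup>2 * \<kappa> * 1" using \<kappa> by (intro mult_left_mono) auto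
    finally have 2: "\<bar>a * b\<bar> \<le> mean_const\<^sup>2 * \<kappa>" by simp
    define q where "q = (\<integral>\<theta>. ?Q (rescaled \<theta>) \<partial>post)"
    have "(real n *\<^sub>R cov_matrix post (\<lambda>\<theta>. \<theta>) - V) $ i $ j = (q - V $ i $ j) - a * b"
      using cov by (simp add: q_def)
    moreover have "\<bar>(q - V $ i $ j) - a * b\<bar> \<le> mean_const * \<kappa> * (1 + norm V) + mean_const\<^sup>2 * \<kappa>"
      using abs_triangle_ineq4[of "q - V $ i $ j" "a * b"] 1 2 unfolding q_def[symmetric] by linarith
    moreover have "mean_const * \<kappa> * (1 + norm V) + mean_const\<^sup>2 * \<kappa> = (mean_const * (1 + norm V) + mean_const\<^sup>2) * \<kappa>"
      by (simp add: algebra_simps)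
    ultimately show ?thesis by (simp only:)
  qed
  show ?thesis
    using norm_matrix_le_entries[OF entry] by (simp add: cov_const_def mult.assoc)
qed

lemma posterior_information_bound:
  assumes "cov_const * \<kappa> * norm A \<le> 1 / 2"
  shows "norm (A - (1 / real n) *\<^sub>R matrix_inv (cov_matrix post (\<lambda>\<theta>. \<theta>))) \<le> 2 * (norm A)\<^sup>2 * cov_const * \<kappa>"
  using matrix_inverse_perturbation[OF V_inverse posterior_covariance_bound assms _ refl] n by simp

end

end


section \<open>Regularity at the true value\<close>

lemma positive_definite_coercive:
  fixes A :: "real^'d^'d"
  assumes "\<And>v. v \<noteq> 0 \<Longrightarrow> v \<bullet> (A *v v) > 0"
  shows "\<exists>c>0. \<forall>v. c * (norm v)\<^sup>2 \<le> (A *v v) \<bullet> v"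
proof -
  have cont: "continuous_on (sphere 0 1) (\<lambda>v. v \<bullet> (A *v v))"
    by (intro continuous_intros linear_continuous_on matrix_vector_mul_bounded_linear)
  obtain w :: "real^'d" where w: "w \<in> sphere 0 1" "\<And>v. v \<in> sphere 0 1 \<Longrightarrow> w \<bullet> (A *v w) \<le> v \<bullet> (A *v v)"
    using continuous_attains_inf[OF compact_sphere _ cont] by auto
  define c where "c = w \<bullet> (A *v w)"
  have "w \<noteq> 0" using w(1) by auto
  then have "c > 0" unfolding c_def by (rule assms)
  moreover have "c * (norm v)\<^sup>2 \<le> (A *v v) \<bullet> v" for v
  proof (cases "v = 0")
    case False
    define u where "u = (1 / norm v) *\<^sub>R v"
    have v: "v = norm v *\<^sub>R u" using False by (simp add: u_def)
    have "u \<in> sphere 0 1" using False by (simp add: u_def)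
    then have "c \<le> u \<bullet> (A *v u)" using w(2) by (simp add: c_def)
    then have "(norm v)\<^sup>2 * c \<le> (norm v)\<^sup>2 * (u \<bullet> (A *v u))" by (rule mult_left_mono) simp
    also have "\<dots> = (A *v v) \<bullet> v"
    proof -
      have "(A *v (norm v *\<^sub>R u)) \<bullet> (norm v *\<^sub>R u) = (norm v)\<^sup>2 * (u \<bullet> (A *v u))"
        by (simp add: matrix_vector_mult_scaleR power2_eq_square inner_commute)
      then show ?thesis using v by simp
    qed
    finally show ?thesis by (simp add: mult.commute)
  qed simp
  ultimately show ?thesis by blast
qed

lemma cov_matrix_symmetric: "(cov_matrix P f *v u) \<bullet> v = (cov_matrix P f *v v) \<bullet> u"
proof -
  have s: "cov_matrix P f $ i $ j = cov_matrix P f $ j $ i" for i j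
    by (simp add: cov_matrix_def mult.commute)
  then have "transpose (cov_matrix P f) = cov_matrix P f" by (simp add: transpose_def vec_eq_iff)
  then show ?thesis by (metis dot_lmul_matrix inner_commute vector_transpose_matrix)
qed

text \<open>
  The prior density vanishes outside \<open>\<Theta>\<close> and is continuous and positive at \<open>\<theta>0\<close>. Therefore
  \<open>\<theta>0\<close> is an interior point of \<open>\<Theta>\<close>, as the expansion around \<open>\<theta>0\<close> needs.
\<close>

lemma prior_locally_lipschitz:
  fixes \<rho> :: "real^'d \<Rightarrow> real"
  assumes prior: "prior_density \<Theta> \<rho>" and pos: "\<rho> \<theta>0 > 0" and r: "r > 0"
    and deriv: "\<And>\<theta>. \<theta> \<in> ball \<theta>0 r \<Longrightarrow> (\<rho> has_derivative (\<lambda>h. \<rho>' \<theta> \<bullet> h)) (at \<theta>)"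
    and cont: "continuous_on (ball \<theta>0 r) \<rho>'"
  shows "\<exists>s>0. \<exists>B. ball \<theta>0 s \<subseteq> \<Theta> \<and> (\<forall>\<theta>\<in>ball \<theta>0 s. \<bar>\<rho> \<theta> - \<rho> \<theta>0\<bar> \<le> B * norm (\<theta> - \<theta>0))"
proof -
  have sub: "cball \<theta>0 (r / 2) \<subseteq> ball \<theta>0 r" using r by auto
  have "compact (\<rho>' ` cball \<theta>0 (r / 2))"
    using continuous_on_subset[OF cont sub] by (rule compact_continuous_image) simp
  then obtain B where B: "\<And>\<theta>. \<theta> \<in> cball \<theta>0 (r / 2) \<Longrightarrow> norm (\<rho>' \<theta>) \<le> B"
    by (meson compact_imp_bounded bounded_iff imageI)
  have lip: "\<bar>\<rho> \<theta> - \<rho> \<theta>0\<bar> \<le> B * norm (\<theta> - \<theta>0)" if "\<theta> \<in> cball \<theta>0 (r / 2)" for \<theta>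
  proof -
    have "norm (\<rho> \<theta> - \<rho> \<theta>0) \<le> B * norm (\<theta> - \<theta>0)"
    proof (rule lipschitz_of_derivative_bound[of "cball \<theta>0 (r / 2)" \<rho> "\<lambda>u h. \<rho>' u \<bullet> h"])
      show "norm (\<rho>' u \<bullet> h) \<le> B * norm h" if "u \<in> cball \<theta>0 (r / 2)" for u h
        using order_trans[OF Cauchy_Schwarz_ineq2 mult_right_mono[OF B[OF that] norm_ge_zero]] by simp
    qed (use deriv sub that r in auto)
    then show ?thesis by simp
  qed
  have "isCont \<rho> \<theta>0" using deriv[of \<theta>0] r by (intro has_derivative_continuous) auto
  then have "\<forall>\<^sub>F \<theta> in at \<theta>0. \<rho> \<theta> > 0" using pos by (simp add: isCont_def order_tendstoD(1))
  then obtain s where s: "s > 0" "\<And>\<theta>. \<theta> \<noteq> \<theta>0 \<Longrightarrow> dist \<theta> \<theta>0 < s \<Longrightarrow> \<rho> \<theta> > 0"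
    unfolding eventually_at by auto
  have in\<Theta>: "\<theta> \<in> \<Theta>" if "dist \<theta> \<theta>0 < s" for \<theta>
    using s(2)[OF _ that] pos prior unfolding prior_density_def by (cases "\<theta> = \<theta>0") force+
  show ?thesis
    using s(1) r in\<Theta> lip
    by (intro exI[of _ "min s (r / 2)"] exI[of _ B] conjI) (auto simp: dist_commute)
qed

lemma roughness_nonneg: "roughness k Z \<eta> \<ge> 0"
  unfolding roughness_def set_lebesgue_integral_def
  by (intro real_sqrt_ge_zero integral_nonneg_AE AE_I2) (auto simp: indicator_def)

lemma (in prob_space) random_seq_near_shift:
  assumes "random_seq_near M \<Theta> T (\<lambda>n \<omega>. \<theta>0)" "smallo_P M (\<lambda>n \<omega>. S n \<omega> - \<theta>0) (\<lambda>n \<omega>. 1)"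
  shows "random_seq_near M \<Theta> T S"
  unfolding random_seq_near_def smallo_P_iff
proof (intro conjI allI impI)
  show "\<forall>\<omega>\<in>space M. T n \<omega> \<in> \<Theta>" for n using assms(1) by (simp add: random_seq_near_def)
  fix c \<epsilon> :: real assume c: "c > 0" "\<epsilon> > 0"
  have "eventually_wp M (\<epsilon> / 2 + \<epsilon> / 2) (\<lambda>n \<omega>. norm (T n \<omega> - \<theta>0) \<le> c / 2 * \<bar>1\<bar> \<and> norm (S n \<omega> - \<theta>0) \<le> c / 2 * \<bar>1\<bar>)"
    using assms half_gt_zero[OF c(1)] half_gt_zero[OF c(2)] unfolding random_seq_near_def smallo_P_iff
    by (intro eventually_wp_conj) blast+
  then show "eventually_wp M \<epsilon> (\<lambda>n \<omega>. norm (T n \<omega> - S n \<omega>) \<le> c * \<bar>1\<bar>)"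
    unfolding field_sum_of_halves
  proof (rule eventually_wp_mono, intro always_eventually allI ballI impI)
    fix n \<omega> assume "norm (T n \<omega> - \<theta>0) \<le> c / 2 * \<bar>1\<bar> \<and> norm (S n \<omega> - \<theta>0) \<le> c / 2 * \<bar>1\<bar>"
    then show "norm (T n \<omega> - S n \<omega>) \<le> c * \<bar>1\<bar>"
      using norm_triangle_ineq4[of "T n \<omega> - \<theta>0" "S n \<omega> - \<theta>0"] by simp
  qed
qed

text \<open>
  A condition on two random sequences is a condition on one random sequence in \<open>\<Theta> \<times> \<Theta>\<close>, to
  which the selection of bad parameters applies.
\<close>

lemma (in prob_space) random_seq_near_pair:
  fixes \<Theta> :: "'v::real_normed_vector set"
  assumes "random_seq_near M (\<Theta> \<times> \<Theta>) T (\<lambda>n \<omega>. (\<theta>0, \<theta>0))"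
  shows "random_seq_near M \<Theta> (\<lambda>n \<omega>. fst (T n \<omega>)) (\<lambda>n \<omega>. \<theta>0)" "random_seq_near M \<Theta> (\<lambda>n \<omega>. snd (T n \<omega>)) (\<lambda>n \<omega>. \<theta>0)"
proof -
  have mem: "fst (T n \<omega>) \<in> \<Theta> \<and> snd (T n \<omega>) \<in> \<Theta>" if "\<omega> \<in> space M" for n \<omega>
    using assms that by (auto simp: random_seq_near_def mem_Times_iff)
  have E: "eventually_wp M \<epsilon> (\<lambda>n \<omega>. norm (T n \<omega> - (\<theta>0, \<theta>0)) \<le> c * \<bar>1\<bar>)" if "c > 0" "\<epsilon> > 0" for c \<epsilon>
    using assms that by (simp add: random_seq_near_def smallo_P_iff)
  have le: "norm (fst t - \<theta>0) \<le> norm (t - (\<theta>0, \<theta>0))" "norm (snd t - \<theta>0) \<le> norm (t - (\<theta>0, \<theta>0))" for t :: "'v \<times> 'v"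
    using norm_fst_le[of "fst t - \<theta>0" "snd t - \<theta>0"] norm_snd_le[of "snd t - \<theta>0" "fst t - \<theta>0"]
    by (simp_all add: minus_prod_def)
  have "eventually_wp M \<epsilon> (\<lambda>n \<omega>. norm (fst (T n \<omega>) - \<theta>0) \<le> c * \<bar>1\<bar>)"
    "eventually_wp M \<epsilon> (\<lambda>n \<omega>. norm (snd (T n \<omega>) - \<theta>0) \<le> c * \<bar>1\<bar>)" if "c > 0" "\<epsilon> > 0" for c \<epsilon>
    by (rule eventually_wp_mono[OF E[OF that]], intro always_eventually allI ballI impI, erule order_trans[OF le(1)],
        rule eventually_wp_mono[OF E[OF that]], intro always_eventually allI ballI impI, erule order_trans[OF le(2)])
  then show "random_seq_near M \<Theta> (\<lambda>n \<omega>. fst (T n \<omega>)) (\<lambda>n \<omega>. \<theta>0)" "random_seq_near M \<Theta> (\<lambda>n \<omega>. snd (T n \<omega>)) (\<lambda>n \<omega>. \<theta>0)"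
    using mem by (auto simp: random_seq_near_def smallo_P_iff)
qed


section \<open>Posterior mean and covariance\<close>

theorem corollary3:
  fixes M :: "'w measure" and \<mu> :: "'x measure" and X :: "nat \<Rightarrow> 'w \<Rightarrow> 'x"
    and k :: nat and Z :: "real set" and \<Theta> :: "(real^'d) set"
    and ll :: "real^'d \<Rightarrow> (real \<Rightarrow> real) \<Rightarrow> 'x \<Rightarrow> real"
    and d :: "(real \<Rightarrow> real) \<Rightarrow> (real \<Rightarrow> real) \<Rightarrow> real"
    and \<theta>0 :: "real^'d" and \<eta>0 :: "real \<Rightarrow> real"
    and lam :: "nat \<Rightarrow> 'w \<Rightarrow> real"
    and etahat :: "nat \<Rightarrow> 'w \<Rightarrow> real^'d \<Rightarrow> real \<Rightarrow> real"
    and thetahat :: "nat \<Rightarrow> 'w \<Rightarrow> real^'d" and etajoint :: "nat \<Rightarrow> 'w \<Rightarrow> real \<Rightarrow> real"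
    and sub :: "real^'d \<Rightarrow> real^'d \<Rightarrow> (real \<Rightarrow> real) \<Rightarrow> real \<Rightarrow> real"
    and D10 :: "real^'d \<Rightarrow> real^'d \<Rightarrow> (real \<Rightarrow> real) \<Rightarrow> 'x \<Rightarrow> real^'d"
    and D20 D11 :: "real^'d \<Rightarrow> real^'d \<Rightarrow> (real \<Rightarrow> real) \<Rightarrow> 'x \<Rightarrow> real^'d^'d"
    and D30 D12 D21 :: "real^'d \<Rightarrow> real^'d \<Rightarrow> (real \<Rightarrow> real) \<Rightarrow> 'x \<Rightarrow> real^'d^'d^'d"
    and ltilde :: "'x \<Rightarrow> real^'d"
    and \<rho> :: "real^'d \<Rightarrow> real" and \<rho>' :: "real^'d \<Rightarrow> real^'d" and r :: real
    and H :: "(real \<Rightarrow> real) set" and J :: "(real \<Rightarrow> real) \<Rightarrow> real" and P :: "'x measure"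
    and I0 :: "real^'d^'d" and lpl :: "nat \<Rightarrow> 'w \<Rightarrow> real^'d \<Rightarrow> real"
    and post :: "nat \<Rightarrow> 'w \<Rightarrow> (real^'d) measure"
  assumes H_eq: "H = sobolev_class k Z"
    and J_eq: "J = roughness k Z"
    and P_eq: "P = model_law \<mu> ll \<theta>0 \<eta>0"
    and I0_eq: "I0 = cov_matrix P ltilde"
    and lpl_eq: "lpl = log_pl ll J X lam etahat"
    and post_eq: "post = (\<lambda>n \<omega>. profile_posterior \<Theta> \<rho> (lpl n \<omega>))"
    and k: "k > 0" and Z: "compact Z" and Theta: "compact \<Theta>"
    and model: "semiparametric_model \<mu> \<Theta> H ll"
    and true_value: "\<theta>0 \<in> \<Theta>" "\<eta>0 \<in> H"
    and metric: "Metric_space H d"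
    and sample_space: "prob_space M"
    and independent: "prob_space.indep_vars M (\<lambda>i. P) X UNIV"
    and identically_distributed: "\<And>i. distr M P (X i) = P"
    and lambda_pos: "\<And>n \<omega>. n > 0 \<Longrightarrow> \<omega> \<in> space M \<Longrightarrow> lam n \<omega> > 0"
    and lambda_upper: "smallo_P M lam (\<lambda>n \<omega>. real n powr (- 1 / 4))"
    and lambda_lower: "bigO_P M (\<lambda>n \<omega>. inverse (lam n \<omega>)) (\<lambda>n \<omega>. real n powr (real k / (2 * real k + 1)))"
    and estimators: "penalized_estimators (space M) \<Theta> H ll J X lam etahat thetahat etajoint"
    and consistent: "smallo_P M (\<lambda>n \<omega>. thetahat n \<omega> - \<theta>0) (\<lambda>n \<omega>. 1)"
    and submodel: "smooth_submodel H d J \<theta>0 \<eta>0 sub"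
    and least_favorable: "least_favorable \<mu> \<Theta> H ll \<theta>0 \<eta>0 sub D10 ltilde"
    and information_pos_def: "\<And>v. v \<noteq> 0 \<Longrightarrow> v \<bullet> (I0 *v v) > 0"
    and R1: "condition_R1 M \<Theta> d J lam etahat \<theta>0 \<eta>0"
    and S1: "condition_S1 P H d \<theta>0 \<eta>0 (submodel_loglik ll sub) D10 D20 D30 D11 D12 D21"
    and S2: "condition_S2 P H d \<theta>0 \<eta>0 D10 D20 D11"
    and E1: "condition_E1 M P X k \<Theta> lam etahat thetahat \<theta>0 \<eta>0 D10 D20 D30 D11"
    and separation: "\<And>T. (\<forall>n. \<forall>\<omega>\<in>space M. T n \<omega> \<in> \<Theta>) \<Longrightarrow>
          smallo_P M (\<lambda>n \<omega>. (1 / real n) * (lpl n \<omega> (T n \<omega>) - lpl n \<omega> (thetahat n \<omega>))) (\<lambda>n \<omega>. 1) \<Longrightarrow>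
          smallo_P M (\<lambda>n \<omega>. T n \<omega> - \<theta>0) (\<lambda>n \<omega>. 1)"
    and prior: "prior_density \<Theta> \<rho>"
    and prior_pos: "\<rho> \<theta>0 > 0"
    and prior_C1: "r > 0" "\<And>\<theta>. \<theta> \<in> ball \<theta>0 r \<Longrightarrow> (\<rho> has_derivative (\<lambda>h. \<rho>' \<theta> \<bullet> h)) (at \<theta>)"
          "continuous_on (ball \<theta>0 r) \<rho>'"
    and second_moment: "integrable lebesgue (\<lambda>\<theta>. (norm \<theta>)\<^sup>2 * \<rho> \<theta>)"
    and posterior_defined: "\<And>n \<omega>. \<omega> \<in> space M \<Longrightarrow> lpl n \<omega> \<in> borel_measurable (lebesgue_on \<Theta>)"
  shows "bigO_P M (\<lambda>n \<omega>. thetahat n \<omega> - (\<integral>\<theta>. \<theta> \<partial>post n \<omega>)) (\<lambda>n \<omega>. (lam n \<omega>)\<^sup>2) \<and>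
    bigO_P M (\<lambda>n \<omega>. I0 - (1 / real n) *\<^sub>R matrix_inv (cov_matrix (post n \<omega>) (\<lambda>\<theta>. \<theta>)))
           (\<lambda>n \<omega>. sqrt (real n) * (lam n \<omega>)\<^sup>2)"
proof -
  interpret M: prob_space M by (rule sample_space)
  define f where "f = submodel_loglik ll sub"
  interpret P: prob_space P
    using model true_value unfolding P_eq semiparametric_model_def by blast
  have d0: "d \<eta>0 \<eta>0 = 0" using Metric_space.mdist_zero[OF metric true_value(2)] .
  have d_nonneg: "d \<eta> \<eta>' \<ge> 0" for \<eta> \<eta>' using Metric_space.nonneg[OF metric] .
  have J_nonneg: "J \<eta> \<ge> 0" for \<eta> unfolding J_eq by (rule roughness_nonneg)
  have X_meas: "X i \<in> measurable M P" for i
    using independent unfolding M.indep_vars_def by auto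
  obtain r1 Bp where r1: "r1 > 0" "ball \<theta>0 r1 \<subseteq> \<Theta>"
    and Bp: "\<And>\<theta>. \<theta> \<in> ball \<theta>0 r1 \<Longrightarrow> \<bar>\<rho> \<theta> - \<rho> \<theta>0\<bar> \<le> Bp * norm (\<theta> - \<theta>0)"
    using prior_locally_lipschitz[OF prior prior_pos prior_C1] by blast
  obtain \<delta>1 Cs where \<delta>1: "\<delta>1 > 0" and sm: "\<And>t \<theta> \<eta>. t \<in> ball \<theta>0 \<delta>1 \<Longrightarrow> \<theta> \<in> ball \<theta>0 \<delta>1 \<Longrightarrow> \<eta> \<in> H \<Longrightarrow> d \<eta> \<eta>0 < \<delta>1 \<Longrightarrow>
       sub t \<theta> \<eta> \<in> H \<and> sub \<theta> \<theta> \<eta> = \<eta> \<and> \<bar>J (sub t \<theta> \<eta>) - J \<eta>\<bar> \<le> Cs * (1 + J \<eta>) * norm (t - \<theta>)"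
    using submodel unfolding smooth_submodel_def by blast
  obtain \<delta>2 F where \<delta>2: "\<delta>2 > 0" and iF: "integrable P F"
    and S1': "\<And>t \<theta> \<eta> x. t \<in> ball \<theta>0 \<delta>2 \<Longrightarrow> \<theta> \<in> ball \<theta>0 \<delta>2 \<Longrightarrow> \<eta> \<in> H \<Longrightarrow> d \<eta> \<eta>0 < \<delta>2 \<Longrightarrow> x \<in> space P \<Longrightarrow>
        ((\<lambda>u. f u \<theta> \<eta> x) has_derivative (\<lambda>h. D10 t \<theta> \<eta> x \<bullet> h)) (at t) \<and>
        ((\<lambda>u. D10 u \<theta> \<eta> x) has_derivative (\<lambda>h. D20 t \<theta> \<eta> x *v h)) (at t) \<and>
        ((\<lambda>u. D20 u \<theta> \<eta> x) has_derivative (\<lambda>h. \<chi> i j. D30 t \<theta> \<eta> x $ i $ j \<bullet> h)) (at t) \<and>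
        ((\<lambda>u. D10 t u \<eta> x) has_derivative (\<lambda>h. D11 t \<theta> \<eta> x *v h)) (at \<theta>) \<and>
        ((\<lambda>u. D11 t u \<eta> x) has_derivative (\<lambda>h. \<chi> i j. D12 t \<theta> \<eta> x $ i $ j \<bullet> h)) (at \<theta>) \<and>
        ((\<lambda>u. D20 t u \<eta> x) has_derivative (\<lambda>h. \<chi> i j. D21 t \<theta> \<eta> x $ i $ j \<bullet> h)) (at \<theta>) \<and>
        \<bar>f t \<theta> \<eta> x\<bar> \<le> F x \<and> norm (D10 t \<theta> \<eta> x) \<le> F x \<and> norm (D20 t \<theta> \<eta> x) \<le> F x \<and>
        norm (D30 t \<theta> \<eta> x) \<le> F x \<and> norm (D11 t \<theta> \<eta> x) \<le> F x \<and>
        norm (D12 t \<theta> \<eta> x) \<le> F x \<and> norm (D21 t \<theta> \<eta> x) \<le> F x"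
    using S1 unfolding condition_S1_def f_def[symmetric] by blast
  obtain \<delta>3 C3 where \<delta>3: "\<delta>3 > 0" and S2': "\<And>\<eta>. \<eta> \<in> H \<Longrightarrow> d \<eta> \<eta>0 < \<delta>3 \<Longrightarrow>
       norm ((\<integral>x. D20 \<theta>0 \<theta>0 \<eta> x \<partial>P) - (\<integral>x. D20 \<theta>0 \<theta>0 \<eta>0 x \<partial>P)) \<le> C3 * d \<eta> \<eta>0 \<and>
       norm ((\<integral>x. D11 \<theta>0 \<theta>0 \<eta> x \<partial>P) - (\<integral>x. D11 \<theta>0 \<theta>0 \<eta>0 x \<partial>P)) \<le> C3 * d \<eta> \<eta>0 \<and>
       norm (\<integral>x. D10 \<theta>0 \<theta>0 \<eta> x \<partial>P) \<le> C3 * (d \<eta> \<eta>0)\<^sup>2"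
    using S2 unfolding condition_S2_def by blast
  define \<delta> where "\<delta> = min (min \<delta>1 \<delta>2) (min \<delta>3 r1)"
  have \<delta>: "\<delta> > 0" "\<delta> \<le> \<delta>1" "\<delta> \<le> \<delta>2" "\<delta> \<le> \<delta>3" "\<delta> \<le> r1" using r1 \<delta>1 \<delta>2 \<delta>3 by (auto simp: \<delta>_def)
  define N where "N = {\<eta>\<in>H. d \<eta> \<eta>0 < \<delta>}"
  have ball\<Theta>: "ball \<theta>0 \<delta> \<subseteq> \<Theta>" using r1(2) \<delta>(5) by (meson subset_ball subset_trans)
  have setsP: "sets P = sets \<mu>" unfolding P_eq model_law_def by simp
  interpret sl: smooth_loglik P N f D10 D20 D11 D30 D12 D21 \<theta>0 \<eta>0 \<delta> F
  proof
    fix t \<theta> \<eta> assume th: "t \<in> ball \<theta>0 \<delta>" "\<theta> \<in> ball \<theta>0 \<delta>" "\<eta> \<in> N"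
    have "sub t \<theta> \<eta> \<in> H" using sm[of t \<theta> \<eta>] th \<delta> by (auto simp: N_def)
    then have "f t \<theta> \<eta> \<in> borel_measurable \<mu>"
      using model th ball\<Theta> unfolding semiparametric_model_def f_def submodel_loglik_def by blast
    then show "f t \<theta> \<eta> \<in> borel_measurable P" by (simp add: measurable_cong_sets[OF setsP refl])
    fix x assume "x \<in> space P"
    with S1'[of t \<theta> \<eta> x] th \<delta>
    have S: "((\<lambda>u. f u \<theta> \<eta> x) has_derivative (\<lambda>h. D10 t \<theta> \<eta> x \<bullet> h)) (at t) \<and>
        ((\<lambda>u. D10 u \<theta> \<eta> x) has_derivative (\<lambda>h. D20 t \<theta> \<eta> x *v h)) (at t) \<and>
        ((\<lambda>u. D20 u \<theta> \<eta> x) has_derivative (\<lambda>h. \<chi> i j. D30 t \<theta> \<eta> x $ i $ j \<bullet> h)) (at t) \<and>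
        ((\<lambda>u. D10 t u \<eta> x) has_derivative (\<lambda>h. D11 t \<theta> \<eta> x *v h)) (at \<theta>) \<and>
        ((\<lambda>u. D11 t u \<eta> x) has_derivative (\<lambda>h. \<chi> i j. D12 t \<theta> \<eta> x $ i $ j \<bullet> h)) (at \<theta>) \<and>
        ((\<lambda>u. D20 t u \<eta> x) has_derivative (\<lambda>h. \<chi> i j. D21 t \<theta> \<eta> x $ i $ j \<bullet> h)) (at \<theta>) \<and>
        \<bar>f t \<theta> \<eta> x\<bar> \<le> F x \<and> norm (D10 t \<theta> \<eta> x) \<le> F x \<and> norm (D20 t \<theta> \<eta> x) \<le> F x \<and>
        norm (D30 t \<theta> \<eta> x) \<le> F x \<and> norm (D11 t \<theta> \<eta> x) \<le> F x \<and>
        norm (D12 t \<theta> \<eta> x) \<le> F x \<and> norm (D21 t \<theta> \<eta> x) \<le> F x"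
      by (auto simp: N_def)
    show "((\<lambda>u. f u \<theta> \<eta> x) has_derivative (\<lambda>h. D10 t \<theta> \<eta> x \<bullet> h)) (at t) \<and>
        ((\<lambda>u. D10 u \<theta> \<eta> x) has_derivative (\<lambda>h. D20 t \<theta> \<eta> x *v h)) (at t) \<and>
        ((\<lambda>u. D20 u \<theta> \<eta> x) has_derivative (\<lambda>h. \<chi> i j. D30 t \<theta> \<eta> x $ i $ j \<bullet> h)) (at t) \<and>
        ((\<lambda>u. D10 t u \<eta> x) has_derivative (\<lambda>h. D11 t \<theta> \<eta> x *v h)) (at \<theta>) \<and>
        ((\<lambda>u. D11 t u \<eta> x) has_derivative (\<lambda>h. \<chi> i j. D12 t \<theta> \<eta> x $ i $ j \<bullet> h)) (at \<theta>) \<and>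
        ((\<lambda>u. D20 t u \<eta> x) has_derivative (\<lambda>h. \<chi> i j. D21 t \<theta> \<eta> x $ i $ j \<bullet> h)) (at \<theta>)"
      using S by blast
    show "norm (D10 t \<theta> \<eta> x) \<le> F x \<and> norm (D20 t \<theta> \<eta> x) \<le> F x \<and>
        norm (D30 t \<theta> \<eta> x) \<le> F x \<and> norm (D11 t \<theta> \<eta> x) \<le> F x \<and>
        norm (D12 t \<theta> \<eta> x) \<le> F x \<and> norm (D21 t \<theta> \<eta> x) \<le> F x"
      using S by blast
  qed (use \<delta> iF true_value d0 in \<open>auto simp: N_def\<close>)
  have score_mean: "(\<integral>x. D10 \<theta>0 \<theta>0 \<eta>0 x \<partial>P) = 0"
    using S2'[of \<eta>0] true_value d0 \<delta>3 by simp
  have subN: "sub t \<theta> \<eta> \<in> H \<and> sub \<theta> \<theta> \<eta> = \<eta>" if "t \<in> ball \<theta>0 \<delta>" "\<theta> \<in> ball \<theta>0 \<delta>" "\<eta> \<in> N" for t \<theta> \<eta>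
    using sm[of t \<theta> \<eta>] that \<delta> by (auto simp: N_def)
  have NH: "N \<subseteq> H" by (auto simp: N_def)
  note info = sl.information_identities[OF P_eq f_def model ball\<Theta> NH subN least_favorable score_mean, folded I0_eq]
  have f_diag: "f \<theta> \<theta> \<eta> = ll \<theta> \<eta>" if "\<theta> \<in> ball \<theta>0 \<delta>" "\<eta> \<in> N" for \<theta> \<eta>
    using subN[OF that(1) that] by (simp add: f_def submodel_loglik_def)

  \<comment> \<open>the stochastic orders along random sequences, as bounds for all parameters within \<open>1 / K\<close> of the true value\<close>
  note near = M.random_seq_near_shift[OF _ consistent]
  have const_near: "random_seq_near M \<Theta> (\<lambda>n \<omega>. \<theta>0) (\<lambda>n \<omega>. \<theta>0)"
    using true_value by (auto simp: random_seq_near_def smallo_P_iff intro!: M.eventually_wp_always)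
  note E1' = E1[unfolded condition_E1_def, rule_format]
  define U1 where "U1 K n \<omega> \<longleftrightarrow> (\<forall>\<theta>\<in>\<Theta>. norm (\<theta> - \<theta>0) \<le> 1 / K \<longrightarrow> norm (d (etahat n \<omega> \<theta>) \<eta>0) \<le> K * \<bar>lam n \<omega> + norm (\<theta> - \<theta>0)\<bar>)" for K n \<omega>
  define U2 where "U2 K n \<omega> \<longleftrightarrow> (\<forall>\<theta>\<in>\<Theta>. norm (\<theta> - \<theta>0) \<le> 1 / K \<longrightarrow> norm (lam n \<omega> * J (etahat n \<omega> \<theta>)) \<le> K * \<bar>lam n \<omega> + norm (\<theta> - \<theta>0)\<bar>)" for K n \<omega>
  define U3 where "U3 K n \<omega> \<longleftrightarrow> (\<forall>\<theta>\<in>\<Theta>. norm (\<theta> - \<theta>0) \<le> 1 / K \<longrightarrow>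
      norm (emp_process P X n \<omega> (\<lambda>x. D10 \<theta>0 \<theta>0 (etahat n \<omega> \<theta>) x - D10 \<theta>0 \<theta>0 \<eta>0 x)) \<le> K * \<bar>real n powr (1 / (4 * real k + 2)) * (lam n \<omega> + norm (\<theta> - \<theta>0))\<bar>)" for K n \<omega>
  define U4 where "U4 K n \<omega> \<longleftrightarrow> (\<forall>\<theta>\<in>\<Theta>. norm (\<theta> - \<theta>0) \<le> 1 / K \<longrightarrow> norm (emp_process P X n \<omega> (D20 \<theta>0 \<theta> (etahat n \<omega> \<theta>))) \<le> K * \<bar>1\<bar>)" for K n \<omega>
  define U5 where "U5 K n \<omega> \<longleftrightarrow> (\<forall>t\<in>\<Theta> \<times> \<Theta>. norm (t - (\<theta>0, \<theta>0)) \<le> 1 / K \<longrightarrow> norm (emp_process P X n \<omega> (D11 \<theta>0 (snd t) (etahat n \<omega> (fst t)))) \<le> K * \<bar>1\<bar>)" for K n \<omega>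
  define U6 where "U6 K n \<omega> \<longleftrightarrow> (\<forall>t\<in>\<Theta> \<times> \<Theta>. norm (t - (\<theta>0, \<theta>0)) \<le> 1 / K \<longrightarrow>
      norm (emp X n \<omega> (D30 (snd t) (fst t) (etahat n \<omega> (fst t))) - (\<integral>x. D30 (snd t) (fst t) (etahat n \<omega> (fst t)) x \<partial>P)) \<le> K * \<bar>1\<bar>)" for K n \<omega>
  define U7 where "U7 K n \<omega> \<longleftrightarrow> norm (emp X n \<omega> (D10 \<theta>0 \<theta>0 \<eta>0)) \<le> K * \<bar>1 / sqrt (real n)\<bar>" for K n \<omega>
  define U8 where "U8 K n \<omega> \<longleftrightarrow> norm (inverse (lam n \<omega>)) \<le> K * \<bar>real n powr (real k / (2 * real k + 1))\<bar>" for K n \<omega>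
  have t1: "tight_event M U1" and t2: "tight_event M U2"
    unfolding U1_def U2_def
    by (rule M.uniform_bigO_P[OF true_value(1)]; use R1[unfolded condition_R1_def, rule_format] in blast)+
  have t3: "tight_event M U3" and t4: "tight_event M U4"
    unfolding U3_def U4_def
    by (rule M.uniform_bigO_P[OF true_value(1)]; use E1'[OF conjI[OF near const_near]] in blast)+
  have c2: "(\<theta>0, \<theta>0) \<in> \<Theta> \<times> \<Theta>" using true_value by simp
  have t5: "tight_event M U5"
    unfolding U5_def
    by (rule M.uniform_bigO_P[OF c2]; use E1'[OF conjI[OF near[OF M.random_seq_near_pair(1)] M.random_seq_near_pair(2)]] in blast)
  have t6: "tight_event M U6"
    unfolding U6_def
    by (rule M.uniform_bigO_P[OF c2]; use E1'[OF conjI[OF near[OF M.random_seq_near_pair(1)] M.random_seq_near_pair(2)]] smallo_P_imp_bigO_P in blast)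
  have t7: "tight_event M U7"
    unfolding U7_def
    by (rule bigO_P_tight, rule M.empirical_mean_bigO_P[OF independent identically_distributed _ info(3) score_mean],
        rule sl.integrable_D(1)[OF sl.centre sl.centre sl.eta0_N])
  have t8: "tight_event M U8" unfolding U8_def by (rule bigO_P_tight[OF lambda_lower])
  define U where "U K n \<omega> \<longleftrightarrow> (((U1 K n \<omega> \<and> U2 K n \<omega>) \<and> (U3 K n \<omega> \<and> U4 K n \<omega>)) \<and> ((U5 K n \<omega> \<and> U6 K n \<omega>) \<and> (U7 K n \<omega> \<and> U8 K n \<omega>)))" for K n \<omega>
  have tU: "tight_event M U"
    unfolding U_def by (intro M.tight_event_conj t1 t2 t3 t4 t5 t6 t7 t8)

  \<comment> \<open>the first component of a joint maximizer maximizes the profile likelihood\<close>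
  have est: "etahat n \<omega> \<theta> \<in> H" "\<And>\<eta>. \<eta> \<in> H \<Longrightarrow> pen_crit ll J X lam n \<omega> \<theta> \<eta> \<le> pen_crit ll J X lam n \<omega> \<theta> (etahat n \<omega> \<theta>)"
    if "n > 0" "\<omega> \<in> space M" "\<theta> \<in> \<Theta>" for n \<omega> \<theta>
    using estimators that unfolding penalized_estimators_def by blast+
  have that_in: "thetahat n \<omega> \<in> \<Theta>" if "n > 0" "\<omega> \<in> space M" for n \<omega>
    using estimators that unfolding penalized_estimators_def by blast
  have lpl_max: "lpl n \<omega> \<theta> \<le> lpl n \<omega> (thetahat n \<omega>)" if n: "n > 0" "\<omega> \<in> space M" and th: "\<theta> \<in> \<Theta>" for n \<omega> \<theta>
  proof -
    have "pen_crit ll J X lam n \<omega> \<theta> (etahat n \<omega> \<theta>) \<le> pen_crit ll J X lam n \<omega> (thetahat n \<omega>) (etajoint n \<omega>)"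
      "etajoint n \<omega> \<in> H"
      using estimators n th est(1)[OF n th] unfolding penalized_estimators_def by blast+
    then have "pen_crit ll J X lam n \<omega> \<theta> (etahat n \<omega> \<theta>) \<le> pen_crit ll J X lam n \<omega> (thetahat n \<omega>) (etahat n \<omega> (thetahat n \<omega>))"
      using est(2)[OF n that_in[OF n], of "etajoint n \<omega>"] by linarith
    then show ?thesis unfolding lpl_eq log_pl_def by (intro mult_left_mono) auto
  qed
  obtain Dm where Dm: "\<And>\<theta>. \<theta> \<in> \<Theta> \<Longrightarrow> norm (\<theta> - \<theta>0) \<le> Dm"
  proof -
    obtain b where b: "\<And>\<theta>. \<theta> \<in> \<Theta> \<Longrightarrow> norm \<theta> \<le> b" using compact_imp_bounded[OF Theta] by (auto simp: bounded_iff)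
    have "norm (\<theta> - \<theta>0) \<le> b + norm \<theta>0" if "\<theta> \<in> \<Theta>" for \<theta>
      using norm_triangle_ineq4[of \<theta> \<theta>0] b[OF that] by linarith
    then show ?thesis by (rule that)
  qed
  obtain c where c: "c > 0" "\<And>v. c * (norm v)\<^sup>2 \<le> (I0 *v v) \<bullet> v"
    using positive_definite_coercive[of I0] information_pos_def by blast
  have I0_sym: "(I0 *v u) \<bullet> v = (I0 *v v) \<bullet> u" for u v unfolding I0_eq by (rule cov_matrix_symmetric)
  interpret g: gaussian I0 c by standard (use c I0_sym in auto)

  \<comment> \<open>both bounds on a common event; a quarter of \<open>\<epsilon>\<close> each is spent on the uniform bounds, the size of \<open>lam\<close>, consistency and separation\<close>
  have main: "\<exists>A1 A2. eventually_wp M \<epsilon> (\<lambda>n \<omega>. norm (thetahat n \<omega> - (\<integral>\<theta>. \<theta> \<partial>post n \<omega>)) \<le> A1 * (lam n \<omega>)\<^sup>2 \<and>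
      norm (I0 - (1 / real n) *\<^sub>R matrix_inv (cov_matrix (post n \<omega>) (\<lambda>\<theta>. \<theta>))) \<le> A2 * (sqrt (real n) * (lam n \<omega>)\<^sup>2))"
    if \<epsilon>: "\<epsilon> > 0" for \<epsilon>
  proof -
    obtain K0 where K0: "K0 \<ge> 1" "eventually_wp M (\<epsilon> / 4) (U K0)"
      using tU \<epsilon> unfolding tight_event_def by (meson divide_pos_pos zero_less_numeral)
    \<comment> \<open>one constant for the stochastic bounds and for the constants of the model conditions\<close>
    define K where "K = K0 + \<bar>Cs\<bar> + \<bar>C3\<bar> + \<bar>\<integral>x. F x \<partial>P\<bar>"
    have K: "K \<ge> 1" "K0 \<le> K" "Cs \<le> K" "C3 \<le> K" "(\<integral>x. F x \<partial>P) \<le> K" using K0(1) by (auto simp: K_def)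
    have UKmono: "U K n \<omega>" if "U K0 n \<omega>" for n \<omega>
      using tU[unfolded tight_event_def, THEN conjunct1, rule_format, OF K0(1) K(2) that] .
    have UK: "eventually_wp M (\<epsilon> / 4) (U K)"
      by (rule eventually_wp_mono[OF K0(2)]) (intro always_eventually allI ballI impI UKmono)
    \<comment> \<open>so small that \<open>etahat\<close> stays in \<open>N\<close>, that both components of a pair are within reach of the uniform bounds, and that the quadratic terms are absorbed by the information\<close>
    define R where "R = min (min 1 (\<delta> / (4 * K))) (min (1 / (2 * K)) (c / (768 * K ^ 4)))"
    have R: "R > 0" "R \<le> 1" "R \<le> \<delta> / (4 * K)" "R \<le> 1 / (2 * K)" "R \<le> c / (768 * K ^ 4)"
      using \<delta> K c by (auto simp: R_def)
    have R\<delta>: "R \<le> \<delta>"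
    proof -
      have "\<delta> / (4 * K) \<le> \<delta> / 1" using \<delta> K by (intro divide_left_mono) auto
      then show ?thesis using R by simp
    qed
    have KR: "2 * K * R < \<delta>"
    proof -
      have "2 * K * R \<le> 2 * K * (\<delta> / (4 * K))" using R K by (intro mult_left_mono) auto
      also have "\<dots> = \<delta> / 2" using K by simp
      finally show ?thesis using \<delta> by simp
    qed
    have smallR: "768 * K ^ 4 * R \<le> c"
    proof -
      have "0 < 768 * K ^ 4" using K by simp
      then show ?thesis using R(5) by (simp add: pos_le_divide_eq mult.commute)
    qed
    have RK2: "2 * R \<le> 1 / K"
    proof -
      have "2 * (1 / (2 * K)) = 1 / K" by simp
      then show ?thesis using R(4) by linarith
    qed
    have ballR: "ball \<theta>0 R \<subseteq> ball \<theta>0 \<delta>" using R\<delta> by auto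
    define B where "B = max 1 (max (loc_const K c) Bp)"
    have B: "B \<ge> 1" "loc_const K c \<le> B" "Bp \<le> B" by (auto simp: B_def)
    have lc: "loc_radius K c \<le> loc_const K c" "K\<^sup>2 \<le> loc_const K c"
    proof -
      have a0: "loc_radius K c \<ge> 0" "loc_score K c \<ge> 0" using c K by (auto simp: loc_radius_def loc_score_def)
      have "0 \<le> (loc_score K c + 23 * K ^ 4 * ((1 + loc_radius K c) * (1 + K * (1 + loc_radius K c))\<^sup>2 + loc_radius K c * (1 + loc_radius K c * K)\<^sup>2))
        + (23 * K ^ 4 * (loc_radius K c * (1 + loc_radius K c * K)\<^sup>2 + 2 * loc_radius K c + 4 * (loc_radius K c)\<^sup>2) + 2 * (loc_score K c + 46 * K ^ 4)\<^sup>2 / c)"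
        using a0 c by (intro add_nonneg_nonneg) auto
      moreover have "K\<^sup>2 \<ge> 0" by simp
      ultimately show "loc_radius K c \<le> loc_const K c" "K\<^sup>2 \<le> loc_const K c"
        using a0(1) unfolding loc_const_def Let_def by linarith+
    qed
    define C2 where "C2 = laplace_setting.moment_const c \<rho> \<theta>0 B R"
    define C3' where "C3' = laplace_setting.mean_const I0 c \<rho> \<theta>0 B R"
    define C4 where "C4 = laplace_setting.cov_const I0 c \<rho> \<theta>0 B R"
    \<comment> \<open>below this value the normalizing constant is at least half of its limit and the posterior covariance is invertible\<close>
    define \<kappa>0 where "\<kappa>0 = min 1 (min (g.Z0 / (2 * (\<bar>C2\<bar> + 1))) (1 / (2 * (\<bar>C4\<bar> * norm I0 + 1))))"
    have den: "2 * (\<bar>C2\<bar> + 1) > 0" "2 * (\<bar>C4\<bar> * norm I0 + 1) > 0"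
      using mult_nonneg_nonneg[of "\<bar>C4\<bar>" "norm I0"] by (auto simp: add_nonneg_pos)
    have \<kappa>0: "\<kappa>0 > 0" using den g.Z0_pos by (simp add: \<kappa>0_def)
    \<comment> \<open>a bound on \<open>lam\<close> in units of \<open>n powr (- 1 / 4)\<close> that keeps \<open>sqrt n * lam\<^sup>2\<close> below \<open>\<kappa>0\<close> and \<open>lam\<close> below \<open>R\<close>\<close>
    define \<tau> where "\<tau> = min R (sqrt \<kappa>0)"
    have \<tau>: "\<tau> > 0" "\<tau> \<le> R" "\<tau>\<^sup>2 \<le> \<kappa>0"
    proof -
      show "\<tau> > 0" "\<tau> \<le> R" using R \<kappa>0 by (auto simp: \<tau>_def)
      then have "\<tau>\<^sup>2 \<le> (sqrt \<kappa>0)\<^sup>2" by (intro power_mono) (auto simp: \<tau>_def)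
      then show "\<tau>\<^sup>2 \<le> \<kappa>0" using \<kappa>0 by simp
    qed
    have lamE: "eventually_wp M (\<epsilon> / 4) (\<lambda>n \<omega>. norm (lam n \<omega>) \<le> \<tau> * \<bar>real n powr (- 1 / 4)\<bar>)"
      using lambda_upper \<tau> \<epsilon> unfolding smallo_P_iff by simp
    have conE: "eventually_wp M (\<epsilon> / 4) (\<lambda>n \<omega>. norm (thetahat n \<omega> - \<theta>0) \<le> R / 2 * \<bar>1\<bar>)"
      using consistent R(1) \<epsilon> unfolding smallo_P_iff by (meson divide_pos_pos half_gt_zero zero_less_numeral)
    have "\<epsilon> / 4 > 0" using \<epsilon> by simp
    from M.uniform_separation[where L = lpl and that = thetahat, OF separation true_value(1) lpl_max that_in this R(1)]
    obtain cs where cs: "cs > 0" and sepE: "eventually_wp M (\<epsilon> / 4) (\<lambda>n \<omega>. \<forall>\<theta>\<in>\<Theta>. norm (\<theta> - \<theta>0) \<ge> R \<longrightarrow>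
            lpl n \<omega> \<theta> - lpl n \<omega> (thetahat n \<omega>) \<le> - cs * real n)" by blast
    have all: "eventually_wp M ((\<epsilon> / 4 + \<epsilon> / 4) + (\<epsilon> / 4 + \<epsilon> / 4)) (\<lambda>n \<omega>. (U K n \<omega> \<and> norm (lam n \<omega>) \<le> \<tau> * \<bar>real n powr (- 1 / 4)\<bar>) \<and>
        (norm (thetahat n \<omega> - \<theta>0) \<le> R / 2 * \<bar>1\<bar> \<and> (\<forall>\<theta>\<in>\<Theta>. norm (\<theta> - \<theta>0) \<ge> R \<longrightarrow>
            lpl n \<omega> \<theta> - lpl n \<omega> (thetahat n \<omega>) \<le> - cs * real n)))"
      by (intro M.eventually_wp_conj UK lamE conE sepE)
    have big: "\<forall>\<^sub>F n in sequentially. n > 0 \<and> B / sqrt (real n) \<le> R / 2 \<and>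
        exp (- cs * real n) * (1 + sqrt (real n) * (Dm + B))\<^sup>2 \<le> (1 / sqrt (real n)) ^ (CARD('d) + 1)"
    proof (intro eventually_conj eventually_gt_at_top eventually_exponential_tail[OF cs])
      have "((\<lambda>n. B / sqrt (real n)) \<longlongrightarrow> 0) sequentially"
        by (intro tendsto_divide_0[OF tendsto_const] filterlim_at_top_imp_at_infinity
            filterlim_compose[OF sqrt_at_top filterlim_real_sequentially])
      from order_tendstoD(2)[OF this, of "R / 2"] R(1)
      show "\<forall>\<^sub>F n in sequentially. B / sqrt (real n) \<le> R / 2" by (auto elim: eventually_mono)
    qed
    show ?thesis
    proof (intro exI)
      show "eventually_wp M \<epsilon> (\<lambda>n \<omega>. norm (thetahat n \<omega> - (\<integral>\<theta>. \<theta> \<partial>post n \<omega>)) \<le> C3' * (lam n \<omega>)\<^sup>2 \<and>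
        norm (I0 - (1 / real n) *\<^sub>R matrix_inv (cov_matrix (post n \<omega>) (\<lambda>\<theta>. \<theta>))) \<le> (2 * (norm I0)\<^sup>2 * C4) * (sqrt (real n) * (lam n \<omega>)\<^sup>2))"
      proof (rule eventually_wp_mono[of _ "(\<epsilon> / 4 + \<epsilon> / 4) + (\<epsilon> / 4 + \<epsilon> / 4)", THEN eventually_wp_mono_eps, OF all])
        show "\<epsilon> / 4 + \<epsilon> / 4 + (\<epsilon> / 4 + \<epsilon> / 4) \<le> \<epsilon>" by simp
        show "\<forall>\<^sub>F n in sequentially. \<forall>\<omega>\<in>space M. (U K n \<omega> \<and> norm (lam n \<omega>) \<le> \<tau> * \<bar>real n powr (- 1 / 4)\<bar>) \<and>
            (norm (thetahat n \<omega> - \<theta>0) \<le> R / 2 * \<bar>1\<bar> \<and> (\<forall>\<theta>\<in>\<Theta>. norm (\<theta> - \<theta>0) \<ge> R \<longrightarrow>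
            lpl n \<omega> \<theta> - lpl n \<omega> (thetahat n \<omega>) \<le> - cs * real n)) \<longrightarrow>
            norm (thetahat n \<omega> - (\<integral>\<theta>. \<theta> \<partial>post n \<omega>)) \<le> C3' * (lam n \<omega>)\<^sup>2 \<and>
            norm (I0 - (1 / real n) *\<^sub>R matrix_inv (cov_matrix (post n \<omega>) (\<lambda>\<theta>. \<theta>))) \<le> (2 * (norm I0)\<^sup>2 * C4) * (sqrt (real n) * (lam n \<omega>)\<^sup>2)"
          using big
        proof (eventually_elim, intro ballI impI)
          fix n \<omega>
          assume n: "n > 0 \<and> B / sqrt (real n) \<le> R / 2 \<and>
             exp (- cs * real n) * (1 + sqrt (real n) * (Dm + B))\<^sup>2 \<le> (1 / sqrt (real n)) ^ (CARD('d) + 1)"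
            and w: "\<omega> \<in> space M"
            and good: "(U K n \<omega> \<and> norm (lam n \<omega>) \<le> \<tau> * \<bar>real n powr (- 1 / 4)\<bar>) \<and>
             (norm (thetahat n \<omega> - \<theta>0) \<le> R / 2 * \<bar>1\<bar> \<and> (\<forall>\<theta>\<in>\<Theta>. norm (\<theta> - \<theta>0) \<ge> R \<longrightarrow>
              lpl n \<omega> \<theta> - lpl n \<omega> (thetahat n \<omega>) \<le> - cs * real n))"
          define l where "l = lam n \<omega>"
          have n0: "n > 0" using n by simp
          have l0: "l > 0" using lambda_pos n0 w by (simp add: l_def)
          have "l \<le> \<tau> * real n powr (- 1 / 4)" using good l0 by (simp add: l_def)
          then have l2: "l\<^sup>2 \<le> \<tau>\<^sup>2 / sqrt (real n)" and lR: "l \<le> R"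
          proof -
            assume l: "l \<le> \<tau> * real n powr (- 1 / 4)"
            then have "l\<^sup>2 \<le> (\<tau> * real n powr (- 1 / 4))\<^sup>2" using l0 by (intro power_mono) auto
            also have "\<dots> = \<tau>\<^sup>2 * real n powr (- 1 / 2)" using n0 by (simp add: power_mult_distrib powr_power)
            also have "\<dots> = \<tau>\<^sup>2 / sqrt (real n)" by (simp add: powr_minus_divide powr_half_sqrt)
            finally show "l\<^sup>2 \<le> \<tau>\<^sup>2 / sqrt (real n)" .
            have "real n powr (- 1 / 4) \<le> real n powr 0" using n0 by (intro powr_mono) auto
            then have "\<tau> * real n powr (- 1 / 4) \<le> \<tau> * 1" using \<tau> n0 by (intro mult_left_mono) auto
            then show "l \<le> R" using l \<tau> by linarith
          qed
          have \<kappa>: "sqrt (real n) * l\<^sup>2 \<le> \<kappa>0"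
          proof -
            have "sqrt (real n) * l\<^sup>2 \<le> sqrt (real n) * (\<tau>\<^sup>2 / sqrt (real n))" using l2 by (intro mult_left_mono) auto
            also have "\<dots> = \<tau>\<^sup>2" using n0 by simp
            finally show ?thesis using \<tau> by simp
          qed
          have \<kappa>1: "sqrt (real n) * l\<^sup>2 \<le> 1" using \<kappa> by (simp add: \<kappa>0_def)
          have u: "U1 K n \<omega>" "U2 K n \<omega>" "U3 K n \<omega>" "U4 K n \<omega>" "U5 K n \<omega>" "U6 K n \<omega>" "U7 K n \<omega>" "U8 K n \<omega>"
            using good by (auto simp: U_def)
          have near1: "\<theta> \<in> \<Theta>" "norm (\<theta> - \<theta>0) \<le> 1 / K" if "\<theta> \<in> ball \<theta>0 R" for \<theta>
          proof -
            show "\<theta> \<in> \<Theta>" using that ballR ball\<Theta> by blast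
            have "norm (\<theta> - \<theta>0) < R" using that by (simp add: dist_norm norm_minus_commute)
            then show "norm (\<theta> - \<theta>0) \<le> 1 / K" using RK2 R by linarith
          qed
          have near2: "(\<theta>, \<theta>') \<in> \<Theta> \<times> \<Theta>" "norm ((\<theta>, \<theta>') - (\<theta>0, \<theta>0)) \<le> 1 / K" if "\<theta> \<in> ball \<theta>0 R" "\<theta>' \<in> ball \<theta>0 R" for \<theta> \<theta>'
          proof -
            show "(\<theta>, \<theta>') \<in> \<Theta> \<times> \<Theta>" using near1 that by blast
            have "norm (\<theta> - \<theta>0) < R" "norm (\<theta>' - \<theta>0) < R" using that by (auto simp: dist_norm norm_minus_commute)
            then show "norm ((\<theta>, \<theta>') - (\<theta>0, \<theta>0)) \<le> 1 / K"
              using norm_Pair_le[of "\<theta> - \<theta>0" "\<theta>' - \<theta>0"] RK2 by simp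
          qed
          have rate: "\<bar>lam n \<omega> + norm (\<theta> - \<theta>0)\<bar> = l + norm (\<theta> - \<theta>0)" for \<theta>
            using l0 by (simp add: l_def add_pos_nonneg abs_of_pos)
          have rd: "d (etahat n \<omega> \<theta>) \<eta>0 \<le> K * (l + norm (\<theta> - \<theta>0))" if "\<theta> \<in> ball \<theta>0 R" for \<theta>
            using u(1) near1[OF that] d_nonneg unfolding U1_def rate by force
          have eN: "etahat n \<omega> \<theta> \<in> N" if th: "\<theta> \<in> ball \<theta>0 R" for \<theta>
          proof -
            have "norm (\<theta> - \<theta>0) < R" using th by (simp add: dist_norm norm_minus_commute)
            then have "K * (l + norm (\<theta> - \<theta>0)) \<le> K * (R + R)" using lR K by (intro mult_left_mono) auto
            also have "\<dots> < \<delta>" using KR by simp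
            finally show ?thesis using rd[OF th] est(1)[OF n0 w near1(1)[OF th]] by (simp add: N_def)
          qed
          \<comment> \<open>from here on the sample is fixed and all estimates are deterministic\<close>
          interpret pr: profile_realization P N f D10 D20 D11 D30 D12 D21 \<theta>0 \<eta>0 \<delta> F
             X n \<omega> l J "etahat n \<omega>" "lpl n \<omega>" "thetahat n \<omega>" I0 R K k sub "\<lambda>\<eta>. d \<eta> \<eta>0"
          proof
            show "X i \<omega> \<in> space P" for i using measurable_space[OF X_meas w] .
            show "norm ((\<integral>x. D20 \<theta>0 \<theta>0 \<eta> x \<partial>P) + I0) \<le> K * d \<eta> \<eta>0"
              "norm (\<integral>x. D11 \<theta>0 \<theta>0 \<eta> x \<partial>P) \<le> K * d \<eta> \<eta>0"
              "norm (\<integral>x. D10 \<theta>0 \<theta>0 \<eta> x \<partial>P) \<le> K * (d \<eta> \<eta>0)\<^sup>2" if "\<eta> \<in> N" for \<eta>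
              using S2'[of \<eta>] that \<delta> info(1,2) mult_right_mono[OF K(4) d_nonneg[of \<eta> \<eta>0]] mult_right_mono[OF K(4), of "(d \<eta> \<eta>0)\<^sup>2"]
              by (auto simp: N_def)
            show "l * J (etahat n \<omega> \<theta>) \<le> K * (l + norm (\<theta> - \<theta>0))" if "\<theta> \<in> ball \<theta>0 R" for \<theta>
              using u(2)[unfolded U2_def, rule_format, OF near1[OF that]] unfolding rate by (simp add: l_def)
            show "norm (emp_process P X n \<omega> (\<lambda>x. D10 \<theta>0 \<theta>0 (etahat n \<omega> \<theta>) x - D10 \<theta>0 \<theta>0 \<eta>0 x)) \<le> K * (real n powr (1 / (4 * real k + 2)) * (l + norm (\<theta> - \<theta>0)))"
              if "\<theta> \<in> ball \<theta>0 R" for \<theta>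
              using u(3) near1[OF that] unfolding U3_def abs_mult rate by simp
            show "norm (emp_process P X n \<omega> (D20 \<theta>0 \<theta> (etahat n \<omega> \<theta>))) \<le> K" if "\<theta> \<in> ball \<theta>0 R" for \<theta>
              using u(4) near1[OF that] unfolding U4_def by simp
            show "norm (emp_process P X n \<omega> (D11 \<theta>0 \<theta>' (etahat n \<omega> \<theta>))) \<le> K" if "\<theta> \<in> ball \<theta>0 R" "\<theta>' \<in> ball \<theta>0 R" for \<theta> \<theta>'
              using u(5)[unfolded U5_def, rule_format, OF near2[OF that]] by simp
            show "norm (emp X n \<omega> (D30 \<theta>' \<theta> (etahat n \<omega> \<theta>)) - (\<integral>x. D30 \<theta>' \<theta> (etahat n \<omega> \<theta>) x \<partial>P)) \<le> K" if "\<theta> \<in> ball \<theta>0 R" "\<theta>' \<in> ball \<theta>0 R" for \<theta> \<theta>'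
              using u(6)[unfolded U6_def, rule_format, OF near2[OF that]] by simp
            show "inverse l \<le> K * real n powr (real k / (2 * real k + 1))" using u(8) l0 unfolding U8_def l_def by simp
            show "norm (emp X n \<omega> (D10 \<theta>0 \<theta>0 \<eta>0)) \<le> K / sqrt (real n)" using u(7) unfolding U7_def by simp
            show "lpl n \<omega> \<theta> = real n * (emp X n \<omega> (f \<theta> \<theta> (etahat n \<omega> \<theta>)) - l\<^sup>2 * (J (etahat n \<omega> \<theta>))\<^sup>2)" if th: "\<theta> \<in> ball \<theta>0 R" for \<theta>
              using f_diag[of \<theta> "etahat n \<omega> \<theta>"] th ballR eN[OF th] by (auto simp: lpl_eq log_pl_def pen_crit_def l_def)
            show "real n * (emp X n \<omega> (f t \<theta> (etahat n \<omega> \<theta>)) - l\<^sup>2 * (J (sub t \<theta> (etahat n \<omega> \<theta>)))\<^sup>2) \<le> lpl n \<omega> t"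
              if th: "\<theta> \<in> ball \<theta>0 R" "t \<in> ball \<theta>0 R" for \<theta> t
            proof -
              have "sub t \<theta> (etahat n \<omega> \<theta>) \<in> H" using subN[of t \<theta>] th ballR eN by blast
              from est(2)[OF n0 w near1(1)[OF th(2)] this] show ?thesis
                unfolding lpl_eq log_pl_def by (intro mult_left_mono) (auto simp: pen_crit_def f_def submodel_loglik_def l_def)
            qed
            show "\<bar>J (sub t \<theta> \<eta>) - J \<eta>\<bar> \<le> K * (1 + J \<eta>) * norm (t - \<theta>)"
              if th: "\<theta> \<in> ball \<theta>0 R" "t \<in> ball \<theta>0 R" "\<eta> \<in> N" for \<theta> t \<eta>
            proof -
              have "\<bar>J (sub t \<theta> \<eta>) - J \<eta>\<bar> \<le> Cs * (1 + J \<eta>) * norm (t - \<theta>)"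
                using sm[of t \<theta> \<eta>] th R\<delta> \<delta> by (auto simp: N_def)
              also have "\<dots> \<le> K * (1 + J \<eta>) * norm (t - \<theta>)"
                using K J_nonneg[of \<eta>] by (intro mult_right_mono) auto
              finally show ?thesis .
            qed
            show "thetahat n \<omega> \<in> ball \<theta>0 R" using good R(1) by (auto simp: dist_norm norm_minus_commute)
            show "lpl n \<omega> \<theta> \<le> lpl n \<omega> (thetahat n \<omega>)" if "\<theta> \<in> ball \<theta>0 R" for \<theta>
              by (rule lpl_max[OF n0 w near1(1)[OF that]])
          qed (use n0 K R R\<delta> l0 J_nonneg d_nonneg score_mean eN rd in auto)
          note loc = c(1) I0_sym c(2) smallR \<kappa>1
          define \<kappa> where "\<kappa> = sqrt (real n) * l\<^sup>2"
          have kap: "pr.slack = \<kappa>" using pr.slack_def[OF loc] by (simp add: \<kappa>_def)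
          interpret ls: laplace_setting I0 c \<Theta> \<rho> \<theta>0 B R Dm cs n \<kappa> "lpl n \<omega>" "thetahat n \<omega>"
          proof
            show "ball \<theta>0 R \<subseteq> \<Theta>" using ballR ball\<Theta> by blast
            show "\<bar>\<rho> \<theta> - \<rho> \<theta>0\<bar> \<le> B * norm (\<theta> - \<theta>0)" if "\<theta> \<in> ball \<theta>0 R" for \<theta>
            proof -
              have "\<theta> \<in> ball \<theta>0 r1" using that R\<delta> \<delta>(5) by auto
              then show ?thesis using Bp mult_right_mono[OF B(3), of "norm (\<theta> - \<theta>0)"] by force
            qed
            show "\<kappa> > 0" "\<kappa> \<le> 1" using pr.slack[OF loc] by (simp_all add: kap)
            show "1 / sqrt (real n) \<le> B * \<kappa>"
            proof -
              have "K\<^sup>2 * \<kappa> \<le> B * \<kappa>" using lc B pr.slack(1)[OF loc] by (intro mult_right_mono) (auto simp: kap)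
              then show ?thesis using pr.root_slack[OF loc] by (simp add: kap)
            qed
            show "norm (thetahat n \<omega> - \<theta>0) \<le> B / sqrt (real n)"
            proof -
              have "loc_radius K c / sqrt (real n) \<le> B / sqrt (real n)" using lc B by (intro divide_right_mono) auto
              then show ?thesis using pr.localisation[OF loc] by linarith
            qed
            show "lpl n \<omega> \<in> borel_measurable (lebesgue_on \<Theta>)" by (rule posterior_defined[OF w])
            show "\<bar>lpl n \<omega> \<theta> - lpl n \<omega> (thetahat n \<omega>) + real n * ((I0 *v (\<theta> - thetahat n \<omega>)) \<bullet> (\<theta> - thetahat n \<omega>)) / 2\<bar>
                \<le> B * \<kappa> * (1 + sqrt (real n) * norm (\<theta> - thetahat n \<omega>)) ^ 3" if "\<theta> \<in> ball \<theta>0 R" for \<theta>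
            proof -
              have "loc_const K c * \<kappa> * (1 + sqrt (real n) * norm (\<theta> - thetahat n \<omega>)) ^ 3 \<le> B * \<kappa> * (1 + sqrt (real n) * norm (\<theta> - thetahat n \<omega>)) ^ 3"
                using B pr.slack(1)[OF loc] by (intro mult_right_mono) (auto simp: kap)
              then show ?thesis using pr.localised_expansion[OF loc that] by (simp add: kap)
            qed
            show "lpl n \<omega> \<theta> - lpl n \<omega> (thetahat n \<omega>) \<le> B - c / 4 * (sqrt (real n) * norm (\<theta> - thetahat n \<omega>))\<^sup>2" if "\<theta> \<in> ball \<theta>0 R" for \<theta>
              using pr.localised_majorant[OF loc that] B(2) by linarith
            show "lpl n \<omega> \<theta> - lpl n \<omega> (thetahat n \<omega>) \<le> - cs * real n" if "\<theta> \<in> \<Theta>" "\<theta> \<notin> ball \<theta>0 R" for \<theta>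
              using good that by (auto simp: dist_norm norm_minus_commute)
          qed (use Theta R B prior prior_pos Dm cs n in auto)
          have kpos: "\<kappa> > 0" by (rule ls.\<kappa>)
          have k0: "\<kappa> \<le> g.Z0 / (2 * (\<bar>C2\<bar> + 1))" "\<kappa> \<le> 1 / (2 * (\<bar>C4\<bar> * norm I0 + 1))"
            using \<kappa> by (auto simp: \<kappa>_def \<kappa>0_def)
          have s1: "\<kappa> * ls.moment_const \<le> g.Z0 / 2"
          proof -
            have "\<kappa> * C2 \<le> \<kappa> * (\<bar>C2\<bar> + 1)" using kpos by (intro mult_left_mono) auto
            also have "\<dots> \<le> g.Z0 / 2"
              using k0(1) unfolding pos_le_divide_eq[OF den(1)] by (simp add: algebra_simps)
            finally show ?thesis by (simp add: C2_def)
          qed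
          have s2: "ls.cov_const * \<kappa> * norm I0 \<le> 1 / 2"
          proof -
            have "C4 * \<kappa> * norm I0 \<le> \<bar>C4\<bar> * \<kappa> * norm I0" using kpos by (intro mult_right_mono) auto
            also have "\<dots> \<le> \<kappa> * (\<bar>C4\<bar> * norm I0 + 1)" using kpos by (simp add: algebra_simps)
            also have "\<dots> \<le> 1 / 2"
              using k0(2) unfolding pos_le_divide_eq[OF den(2)] by (simp add: algebra_simps)
            finally show ?thesis by (simp add: C4_def)
          qed
          have "\<kappa> / sqrt (real n) = l\<^sup>2" using n0 by (simp add: \<kappa>_def)
          then show "norm (thetahat n \<omega> - (\<integral>\<theta>. \<theta> \<partial>post n \<omega>)) \<le> C3' * (lam n \<omega>)\<^sup>2 \<and>
            norm (I0 - (1 / real n) *\<^sub>R matrix_inv (cov_matrix (post n \<omega>) (\<lambda>\<theta>. \<theta>))) \<le> (2 * (norm I0)\<^sup>2 * C4) * (sqrt (real n) * (lam n \<omega>)\<^sup>2)"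
            using ls.posterior_mean_bound[OF s1] ls.posterior_information_bound[OF s1 s2]
            by (simp add: post_eq C3'_def C4_def \<kappa>_def l_def)
        qed
      qed
    qed
  qed
  show ?thesis
    unfolding bigO_P_iff
  proof (intro conjI allI impI)
    fix \<epsilon> :: real assume "\<epsilon> > 0"
    from main[OF this] obtain A1 A2 where A: "eventually_wp M \<epsilon> (\<lambda>n \<omega>. norm (thetahat n \<omega> - (\<integral>\<theta>. \<theta> \<partial>post n \<omega>)) \<le> A1 * (lam n \<omega>)\<^sup>2 \<and>
      norm (I0 - (1 / real n) *\<^sub>R matrix_inv (cov_matrix (post n \<omega>) (\<lambda>\<theta>. \<theta>))) \<le> A2 * (sqrt (real n) * (lam n \<omega>)\<^sup>2))" by blast
    show "\<exists>C. eventually_wp M \<epsilon> (\<lambda>n \<omega>. norm (thetahat n \<omega> - (\<integral>\<theta>. \<theta> \<partial>post n \<omega>)) \<le> C * \<bar>(lam n \<omega>)\<^sup>2\<bar>)"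
      by (intro exI[of _ A1] eventually_wp_mono[OF A] always_eventually) simp
    show "\<exists>C. eventually_wp M \<epsilon> (\<lambda>n \<omega>. norm (I0 - (1 / real n) *\<^sub>R matrix_inv (cov_matrix (post n \<omega>) (\<lambda>\<theta>. \<theta>))) \<le> C * \<bar>sqrt (real n) * (lam n \<omega>)\<^sup>2\<bar>)"
      by (intro exI[of _ A2] eventually_wp_mono[OF A] always_eventually) simp
  qed
qed

end
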